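(* Let $\alpha\in\mathbb{R}$. Suppose $\hat\rho$ satisfies $\sup_{x\in\mathcal{M}}\frac{|\hat\rho(x)-\bar\rho(x)|}{|\bar\rho(x)|}<\varepsilon_\rho<0.1$, and that as $N\to\infty$, $$\epsilon=o(1),\qquad \epsilon^{d/2}N=\Omega(\log N),\qquad \varepsilon_\rho=o(1).$$ Then for any $f\in C^\infty(\mathcal{M})$, when $N$ is sufficiently large, with probability $>1-2N^{-10}$, with $p_\alpha:=p^{1+2(\alpha-1)/d}$, $$E_N(f,f)=\mathcal{E}_{p_\alpha}(f,f)\big(1+O^{[\alpha]}(\varepsilon_\rho)\big)+O^{[f,p]}(\epsilon)+O^{[1]}\!\left(\sqrt{\frac{\log N}{N\epsilon^{d/2}}\int_{\mathcal{M}}|\nabla f|^4\,p^{1+\frac{4(\alpha-1)}{d}}\,dV}\right).$$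
   Context: $\mathcal{M}$ is a $d$-dimensional $C^\infty$ compact manifold without boundary, isometrically embedded in $\mathbb{R}^D$ ($\|\cdot\|$ is the Euclidean norm of $\mathbb{R}^D$), with Riemannian volume measure $dV$ and manifold gradient $\nabla$. $p\in C^\infty(\mathcal{M})$ is a probability density with respect to $dV$ with $0<p_{min}\le p\le p_{max}<\infty$; $\bar\rho:=p^{-1/d}$. Kernel: $k_0:[0,\infty)\to\mathbb{R}$ is continuous on $[0,\infty)$, $C^4$ on $(0,\infty)$, $k_0\ge0$, $\|k_0\|_\infty>0$, and there are $a,a_l>0$ with $|k_0^{(l)}(\xi)|\le a_le^{-a\xi}$ for all $\xi>0$, $l=0,\dots,4$. $m_2:=\frac1d\int_{\mathbb{R}^d}|u|^2k_0(|u|^2)\,du$. Data: $X=\{x_i\}_{i=1}^N$ are i.i.d. from $p$. $\hat\rho$ is the kNN bandwidth function computed from a separate dataset $Y=\{y_j\}_{j=1}^{N_y}$ independent of $X$: $\hat\rho(x)=\hat R(x)\big(\frac{1}{v_d}\frac{k}{N_y}\big)^{-1/d}$, where $v_d$ is the volume of the unit ball of $\mathbb{R}^d$ and $\hat R(x)=\inf\{r>0:\sum_j\mathbf 1_{\{\|y_j-x\|<r\}}\ge k\}$. One conditions on $Y$, so that $\hat\rho$ is a fixed (non-random) function and probability is over $X$. $\epsilon>0$, $\varepsilon_\rho$ and $\hat\rho$ may vary with $N$. Graph Dirichlet form: $$W^{(\alpha)}_{ij}=k_0\!\left(\frac{\|x_i-x_j\|^2}{\epsilon\hat\rho(x_i)\hat\rho(x_j)}\right)\frac{1}{\hat\rho(x_i)^\alpha\hat\rho(x_j)^\alpha},\qquad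 E_N(f,f)=\frac{1}{\epsilon m_2}\frac{1}{N^2}\sum_{i,j=1}^N\epsilon^{-d/2}W^{(\alpha)}_{ij}(f(x_i)-f(x_j))^2.$$ Differential Dirichlet form: for a positive density $q$ on $\mathcal M$, $\mathcal{E}_q(f,f)=\int_{\mathcal{M}}q|\nabla f|^2\,dV$. Asymptotic notation: $f=O(g)$ means $|f|\le C|g|$ in the limit; $f=o(g)$ means $|f|/g\to0$; $f=\Omega(g)$ (for $f,g>0$) means $f/g\to\infty$. Superscripts such as $^{[f,p]}$ list what the constant may depend on, $^{[1]}$ meaning an absolute constant; dependence on $\mathcal{M}$ (including $d$) and $k_0$ is always allowed, and dependence on $\alpha$ is allowed without being declared in constants with superscript $^{[f,p]}$. *)

theory Defs
  imports "HOL-Analysis.Analysis" "HOL-Probability.Probability"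
begin

text \<open>The class $C^k$ on an open set; only meaningful for open \<open>S\<close>.\<close>

primrec Ck_on :: "nat \<Rightarrow> ('a::euclidean_space \<Rightarrow> 'b::real_normed_vector) \<Rightarrow> 'a set \<Rightarrow> bool" where
  "Ck_on 0 f S \<longleftrightarrow> continuous_on S f"
| "Ck_on (Suc k) f S \<longleftrightarrow>
     (\<forall>x\<in>S. f differentiable (at x)) \<and>
     (\<forall>v. Ck_on k (\<lambda>x. frechet_derivative f (at x) v) S)"

definition smooth_on :: "('a::euclidean_space) set \<Rightarrow> ('a \<Rightarrow> 'b::real_normed_vector) \<Rightarrow> bool" where
  "smooth_on S f \<longleftrightarrow> (\<forall>k. Ck_on k f S)"


text \<open>
  An isometrically embedded manifold is rendered as an embedded submanifold \<open>M\<close> of the Euclidean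
  space \<open>'a\<close> carrying the metric induced by the inner product of \<open>'a\<close>. The intrinsic dimension
  is that of \<open>real ^ 'd\<close>; it is passed as a type argument where it is not determined by the
  other arguments. Since parametrizations have open domains, there is no boundary.
\<close>

definition local_param :: "('a::euclidean_space) set \<Rightarrow> (real ^ 'd) set \<Rightarrow> (real ^ 'd \<Rightarrow> 'a) \<Rightarrow> bool" where
  "local_param M V \<phi> \<longleftrightarrow>
     open V \<and> smooth_on V \<phi> \<and>
     (\<forall>u\<in>V. inj (frechet_derivative \<phi> (at u))) \<and>
     openin (top_of_set M) (\<phi> ` V) \<and>
     (\<exists>\<psi>. homeomorphism V (\<phi> ` V) \<phi> \<psi>)"

definition smooth_submanifold :: "'d::finite itself \<Rightarrow> ('a::euclidean_space) set \<Rightarrow> bool" where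
  "smooth_submanifold _ M \<longleftrightarrow>
     (\<forall>x\<in>M. \<exists>(V :: (real ^ 'd) set) \<phi>. local_param M V \<phi> \<and> x \<in> \<phi> ` V)"

text \<open>Functions on \<open>M\<close> are functions on the ambient space whose values off \<open>M\<close> are irrelevant.\<close>

definition smooth_fun :: "'d::finite itself \<Rightarrow> ('a::euclidean_space) set \<Rightarrow> ('a \<Rightarrow> real) \<Rightarrow> bool" where
  "smooth_fun _ M f \<longleftrightarrow>
     (\<forall>(V :: (real ^ 'd) set) \<phi>. local_param M V \<phi> \<longrightarrow> smooth_on V (f \<circ> \<phi>))"

definition metric_matrix :: "(real ^ 'd \<Rightarrow> 'a::euclidean_space) \<Rightarrow> real ^ 'd \<Rightarrow> real ^ 'd ^ 'd" where
  "metric_matrix \<phi> u =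
     (\<chi> i j. frechet_derivative \<phi> (at u) (axis i 1) \<bullet> frechet_derivative \<phi> (at u) (axis j 1))"

text \<open>
  \<open>riemannian_volume TYPE('d) M dV\<close>: \<open>dV\<close> is the (unique) Borel measure on \<open>M\<close> given in all local
  coordinates by $\sqrt{\det g}\,du$.
\<close>

definition riemannian_volume :: "'d::finite itself \<Rightarrow> ('a::euclidean_space) set \<Rightarrow> 'a measure \<Rightarrow> bool" where
  "riemannian_volume _ M dV \<longleftrightarrow>
     sets dV = sets (restrict_space borel M) \<and>
     (\<forall>(V :: (real ^ 'd) set) \<phi> A. local_param M V \<phi> \<and> A \<in> sets dV \<and> A \<subseteq> \<phi> ` V \<longrightarrow>
        emeasure dV A =
          (\<integral>\<^sup>+ u \<in> V. indicator A (\<phi> u) * ennreal (sqrt (det (metric_matrix \<phi> u))) \<partial>lborel))"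

text \<open>
  The gradient at \<open>x\<close>: the tangent vector that represents the differential of \<open>f\<close>, both read off in
  any local parametrization around \<open>x\<close>.
\<close>

definition manifold_grad :: "'d::finite itself \<Rightarrow> ('a::euclidean_space) set \<Rightarrow> ('a \<Rightarrow> real) \<Rightarrow> 'a \<Rightarrow> 'a" where
  "manifold_grad _ M f x =
     (THE v. \<exists>(V :: (real ^ 'd) set) \<phi> u. local_param M V \<phi> \<and> u \<in> V \<and> \<phi> u = x \<and>
        v \<in> range (frechet_derivative \<phi> (at u)) \<and>
        (\<forall>w. v \<bullet> frechet_derivative \<phi> (at u) w = frechet_derivative (f \<circ> \<phi>) (at u) w))"

definition dirichlet_form ::
    "'d::finite itself \<Rightarrow> ('a::euclidean_space) set \<Rightarrow> 'a measure \<Rightarrow> ('a \<Rightarrow> real) \<Rightarrow> ('a \<Rightarrow> real) \<Rightarrow> real" where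
  "dirichlet_form T M dV q f = (\<integral>x. q x * (norm (manifold_grad T M f x))\<^sup>2 \<partial>dV)"

definition smooth_density ::
    "'d::finite itself \<Rightarrow> ('a::euclidean_space) set \<Rightarrow> 'a measure \<Rightarrow> ('a \<Rightarrow> real) \<Rightarrow> bool" where
  "smooth_density T M dV p \<longleftrightarrow>
     smooth_fun T M p \<and>
     (\<exists>p_min p_max. 0 < p_min \<and> (\<forall>x\<in>M. p_min \<le> p x \<and> p x \<le> p_max)) \<and>
     (\<integral>x. p x \<partial>dV) = 1"


text \<open>Only the values of \<open>k0\<close> on $[0,\infty)$ matter.\<close>

definition admissible_kernel :: "(real \<Rightarrow> real) \<Rightarrow> bool" where
  "admissible_kernel k0 \<longleftrightarrow>
     continuous_on {0..} k0 \<and> Ck_on 4 k0 {0<..} \<and>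
     (\<forall>\<xi>\<ge>0. k0 \<xi> \<ge> 0) \<and> (SUP \<xi>\<in>{0..}. \<bar>k0 \<xi>\<bar>) > 0 \<and>
     (\<exists>a>0. \<exists>b :: nat \<Rightarrow> real. \<forall>l\<le>4. b l > 0 \<and>
        (\<forall>\<xi>>0. \<bar>(deriv ^^ l) k0 \<xi>\<bar> \<le> b l * exp (- a * \<xi>)))"

definition kernel_m2 :: "'d::finite itself \<Rightarrow> (real \<Rightarrow> real) \<Rightarrow> real" where
  "kernel_m2 _ k0 =
     1 / real CARD('d) * (\<integral>u. (norm (u :: real ^ 'd))\<^sup>2 * k0 ((norm u)\<^sup>2) \<partial>lborel)"


text \<open>k-nearest-neighbour bandwidth of a dataset \<open>y 0, \<dots>, y (Ny - 1)\<close>.\<close>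

definition knn_radius :: "nat \<Rightarrow> (nat \<Rightarrow> 'a::euclidean_space) \<Rightarrow> nat \<Rightarrow> 'a \<Rightarrow> real" where
  "knn_radius Ny y k x = Inf {r. r > 0 \<and> k \<le> card {j. j < Ny \<and> norm (y j - x) < r}}"

definition knn_bandwidth ::
    "'d::finite itself \<Rightarrow> nat \<Rightarrow> (nat \<Rightarrow> 'a::euclidean_space) \<Rightarrow> nat \<Rightarrow> 'a \<Rightarrow> real" where
  "knn_bandwidth _ Ny y k x =
     knn_radius Ny y k x *
     (1 / measure lborel (ball (0 :: real ^ 'd) 1) * (real k / real Ny)) powr (- 1 / real CARD('d))"

definition graph_weight ::
    "(real \<Rightarrow> real) \<Rightarrow> real \<Rightarrow> real \<Rightarrow> ('a::euclidean_space \<Rightarrow> real) \<Rightarrow> 'a \<Rightarrow> 'a \<Rightarrow> real" where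
  "graph_weight k0 \<alpha> \<epsilon> \<rho> x x' =
     k0 ((norm (x - x'))\<^sup>2 / (\<epsilon> * \<rho> x * \<rho> x')) * (1 / (\<rho> x powr \<alpha> * \<rho> x' powr \<alpha>))"

definition graph_dirichlet_form ::
    "'d::finite itself \<Rightarrow> (real \<Rightarrow> real) \<Rightarrow> real \<Rightarrow> real \<Rightarrow> ('a::euclidean_space \<Rightarrow> real) \<Rightarrow>
     nat \<Rightarrow> (nat \<Rightarrow> 'a) \<Rightarrow> ('a \<Rightarrow> real) \<Rightarrow> real" where
  "graph_dirichlet_form T k0 \<alpha> \<epsilon> \<rho> N x f =
     1 / (\<epsilon> * kernel_m2 T k0) * (1 / (real N)\<^sup>2) *
     (\<Sum>i<N. \<Sum>j<N. \<epsilon> powr (- real CARD('d) / 2) *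
        graph_weight k0 \<alpha> \<epsilon> \<rho> (x i) (x j) * (f (x i) - f (x j))\<^sup>2)"

definition iid_sample ::
    "'w measure \<Rightarrow> 'a measure \<Rightarrow> nat \<Rightarrow> (nat \<Rightarrow> 'w \<Rightarrow> 'a) \<Rightarrow> bool" where
  "iid_sample \<Omega> \<mu> N X \<longleftrightarrow>
     prob_space \<Omega> \<and> prob_space.indep_vars \<Omega> (\<lambda>_. \<mu>) X {..<N} \<and>
     (\<forall>i<N. distr \<Omega> \<mu> (X i) = \<mu>)"

text \<open>
  The standing assumptions on the parameters, all of which vary with the sample size \<open>N\<close>:
  \<open>\<epsilon> N\<close>, the bound \<open>e\<rho> N\<close> on the relative error of the bandwidth, and the dataset
  \<open>y N 0, \<dots>, y N (Ny N - 1)\<close> with neighbour number \<open>k N\<close>. Conditioning on the auxiliary dataset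
  means that it is an arbitrary deterministic family of points of \<open>M\<close>. The supremum is taken in
  the extended reals so that it is meaningful without a boundedness assumption.
\<close>

definition bandwidth_regime ::
    "'d::finite itself \<Rightarrow> ('a::euclidean_space) set \<Rightarrow> ('a \<Rightarrow> real) \<Rightarrow> (nat \<Rightarrow> real) \<Rightarrow> (nat \<Rightarrow> real) \<Rightarrow>
     (nat \<Rightarrow> nat) \<Rightarrow> (nat \<Rightarrow> nat) \<Rightarrow> (nat \<Rightarrow> nat \<Rightarrow> 'a) \<Rightarrow> bool" where
  "bandwidth_regime T M p \<epsilon> e\<rho> Ny k y \<longleftrightarrow>
     (\<forall>N>0. \<epsilon> N > 0 \<and> 1 \<le> k N \<and> k N \<le> Ny N \<and> (\<forall>j<Ny N. y N j \<in> M) \<and>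
        (let \<rho>bar = (\<lambda>x. p x powr (- 1 / real CARD('d))) in
           (SUP x\<in>M. ereal (\<bar>knn_bandwidth T (Ny N) (y N) (k N) x - \<rho>bar x\<bar> / \<bar>\<rho>bar x\<bar>)) < ereal (e\<rho> N)) \<and>
        e\<rho> N < 0.1) \<and>
     \<epsilon> \<longlonglongrightarrow> 0 \<and>
     filterlim (\<lambda>N. \<epsilon> N powr (real CARD('d) / 2) * real N / ln (real N)) at_top sequentially \<and>
     e\<rho> \<longlonglongrightarrow> 0"

end

theory Submission
  imports Defs
begin

text \<open>
  In a chart, scaling by \<open>sqrt \<epsilon>\<close> turns a kernel energy \<open>\<integral>\<integral> k(|x - y|\<^sup>2 q(x) q(y) / \<epsilon>) (f x - f y)^n \<tau>(x) \<tau>(y)\<close>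
  into a Gaussian-type integral whose first-order corrections cancel by the symmetry of exchanging
  \<open>x\<close> and \<open>y\<close>, so its error is of relative order \<open>\<epsilon>\<close>. The bandwidth error is absorbed by comparing the weights
  with an exponential kernel. The graph form is a V-statistic; splitting the pairs of distinct indices into
  classes of disjoint pairs reduces its deviation to Bernstein's inequality for independent summands,
  whose variance is the kernel energy with \<open>n = 4\<close>. If the fourth-moment integral vanishes, then
  \<open>f\<close> is locally constant and the form is exponentially small.
\<close>

text \<open>Two features shape the argument. The estimated bandwidth is merely continuous, so
  nothing can be expanded in \<epsilon> with it; it is first exchanged pointwise for the exact one,
  at a price that must be relative to the Dirichlet form. A comparison kernel
  \<open>exp (- (a / 2) * s)\<close> achieves this, because its energy has the same limit up to a
  ratio of moments. Secondly, the constants have different scopes: that of the fluctuation precedes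
  \<alpha>, \<open>f\<close> and \<open>p\<close>. Their influence is pushed into the threshold for
  \<open>N\<close>: the \<alpha>-dependent factor of the variance tends to 1 with the bandwidth
  error, and the \<epsilon>-correction of the fourth-moment energy is eventually below its limit,
  provided that this limit is not 0. If it is 0 there is nothing to absorb it, hence the separate
  case. The cancellation of first-order terms rests on bounds for values, increments and symmetric
  second differences. The class \<open>lip2_on\<close> so defined is closed under products,
  composition and powers of functions bounded away from 0, and contains squared positive parts, so a
  partition of unity can be written down explicitly.\<close>

section \<open>Functions with quadratic symmetric second differences\<close>

definition lip2_on :: "'a::euclidean_space set \<Rightarrow> ('a \<Rightarrow> 'b::real_normed_vector) \<Rightarrow> bool" where
  "lip2_on S F \<longleftrightarrow> (\<exists>C. \<forall>u\<in>S. \<forall>v\<in>S. norm (F u) \<le> C \<and> norm (F u - F v) \<le> C * norm (u - v) \<and>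
     norm (F u + F v - 2 *\<^sub>R F (midpoint u v)) \<le> C * (norm (u - v))\<^sup>2)"

lemma lip2_onI:
  assumes "\<And>u. u \<in> S \<Longrightarrow> norm (F u) \<le> A"
    and "\<And>u v. u \<in> S \<Longrightarrow> v \<in> S \<Longrightarrow> norm (F u - F v) \<le> B * norm (u - v)"
    and "\<And>u v. u \<in> S \<Longrightarrow> v \<in> S \<Longrightarrow> norm (F u + F v - 2 *\<^sub>R F (midpoint u v)) \<le> C * (norm (u - v))\<^sup>2"
  shows "lip2_on S F"
proof -
  define D where "D = max A (max B C)"
  have "A \<le> D" "B \<le> D" "C \<le> D" by (auto simp: D_def)
  then have D: "x * A \<le> x * D" "x * B \<le> x * D" "x * C \<le> x * D" if "x \<ge> 0" for x
    using that by (auto intro: mult_left_mono)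
  have "norm (F u) \<le> D \<and> norm (F u - F v) \<le> D * norm (u - v) \<and>
     norm (F u + F v - 2 *\<^sub>R F (midpoint u v)) \<le> D * (norm (u - v))\<^sup>2" if uv: "u \<in> S" "v \<in> S" for u v
    using assms(1)[OF uv(1)] assms(2,3)[OF uv] D(1)[of 1] D(2)[of "norm (u - v)"] D(3)[of "(norm (u - v))\<^sup>2"]
    by (auto simp: mult.commute)
  then show ?thesis unfolding lip2_on_def by blast
qed

lemma lip2_onE:
  assumes "lip2_on S F"
  obtains C where "C > 0" "\<And>u. u \<in> S \<Longrightarrow> norm (F u) \<le> C"
    "\<And>u v. u \<in> S \<Longrightarrow> v \<in> S \<Longrightarrow> norm (F u - F v) \<le> C * norm (u - v)"
    "\<And>u v. u \<in> S \<Longrightarrow> v \<in> S \<Longrightarrow> norm (F u + F v - 2 *\<^sub>R F (midpoint u v)) \<le> C * (norm (u - v))\<^sup>2"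
proof -
  obtain C where C: "\<forall>u\<in>S. \<forall>v\<in>S. norm (F u) \<le> C \<and> norm (F u - F v) \<le> C * norm (u - v) \<and>
     norm (F u + F v - 2 *\<^sub>R F (midpoint u v)) \<le> C * (norm (u - v))\<^sup>2"
    using assms unfolding lip2_on_def by blast
  define D where "D = max C 1"
  have "C \<le> D" "D > 0" by (auto simp: D_def)
  have D: "C * x \<le> D * x" if "x \<ge> 0" for x
    using that \<open>C \<le> D\<close> by (auto intro: mult_right_mono)
  show thesis
  proof (rule that[of D])
    fix u v assume "u \<in> S" "v \<in> S"
    then show "norm (F u) \<le> D" "norm (F u - F v) \<le> D * norm (u - v)"
      "norm (F u + F v - 2 *\<^sub>R F (midpoint u v)) \<le> D * (norm (u - v))\<^sup>2"
      using C D[of "norm (u - v)"] D[of "(norm (u - v))\<^sup>2"] \<open>C \<le> D\<close> by fastforce+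
  qed (use C \<open>D > 0\<close> \<open>C \<le> D\<close> in force)+
qed

text \<open>Convexity puts the midpoint into \<open>S\<close>, where the two functions
  agree.\<close>

lemma lip2_on_cong:
  assumes "lip2_on S F" "convex S" "\<And>x. x \<in> S \<Longrightarrow> F x = G x"
  shows "lip2_on S G"
proof -
  have "midpoint u v \<in> S" if "u \<in> S" "v \<in> S" for u v
    using assms(2) that by (metis closed_segment_subset midpoint_in_closed_segment subsetD)
  then show ?thesis using assms(1,3) unfolding lip2_on_def by metis
qed

lemma lip2_on_continuous_on:
  assumes "lip2_on S F" shows "continuous_on S F"
proof -
  obtain C where "C > 0" and C: "\<And>u v. u \<in> S \<Longrightarrow> v \<in> S \<Longrightarrow> norm (F u - F v) \<le> C * norm (u - v)"
    using lip2_onE[OF assms] by metis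
  have "C-lipschitz_on S F"
    using C \<open>C > 0\<close> by (auto simp: lipschitz_on_def dist_norm)
  then show ?thesis by (rule lipschitz_on_continuous_on)
qed

lemma lip2_on_const: "lip2_on S (\<lambda>_. c)"
  by (rule lip2_onI[of _ _ "norm c" 0 0]) (auto simp: scaleR_2)

lemma lip2_on_add:
  assumes "lip2_on S F" "lip2_on S G" shows "lip2_on S (\<lambda>x. F x + G x)"
proof -
  obtain A where A: "A > 0" "\<And>u. u \<in> S \<Longrightarrow> norm (F u) \<le> A"
    "\<And>u v. u \<in> S \<Longrightarrow> v \<in> S \<Longrightarrow> norm (F u - F v) \<le> A * norm (u - v)"
    "\<And>u v. u \<in> S \<Longrightarrow> v \<in> S \<Longrightarrow> norm (F u + F v - 2 *\<^sub>R F (midpoint u v)) \<le> A * (norm (u - v))\<^sup>2"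
    using lip2_onE[OF assms(1)] by metis
  obtain B where B: "B > 0" "\<And>u. u \<in> S \<Longrightarrow> norm (G u) \<le> B"
    "\<And>u v. u \<in> S \<Longrightarrow> v \<in> S \<Longrightarrow> norm (G u - G v) \<le> B * norm (u - v)"
    "\<And>u v. u \<in> S \<Longrightarrow> v \<in> S \<Longrightarrow> norm (G u + G v - 2 *\<^sub>R G (midpoint u v)) \<le> B * (norm (u - v))\<^sup>2"
    using lip2_onE[OF assms(2)] by metis
  show ?thesis
  proof (rule lip2_onI[of _ _ "A + B" "A + B" "A + B"])
    fix u v assume uv: "u \<in> S" "v \<in> S"
    show "norm (F u + G u) \<le> A + B"
      using norm_triangle_mono A(2)[OF uv(1)] B(2)[OF uv(1)] by blast
    have "F u + G u - (F v + G v) = (F u - F v) + (G u - G v)" by simp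
    then show "norm (F u + G u - (F v + G v)) \<le> (A + B) * norm (u - v)"
      using norm_triangle_mono[OF A(3)[OF uv] B(3)[OF uv]] by (simp add: algebra_simps)
    have "F u + G u + (F v + G v) - 2 *\<^sub>R (F (midpoint u v) + G (midpoint u v))
       = (F u + F v - 2 *\<^sub>R F (midpoint u v)) + (G u + G v - 2 *\<^sub>R G (midpoint u v))"
      by (simp add: algebra_simps)
    then show "norm (F u + G u + (F v + G v) - 2 *\<^sub>R (F (midpoint u v) + G (midpoint u v)))
       \<le> (A + B) * (norm (u - v))\<^sup>2"
      using norm_triangle_mono[OF A(4)[OF uv] B(4)[OF uv]] by (simp add: algebra_simps)
  qed
qed

text \<open>A Leibniz rule for second differences. Stating it for a bounded bilinear map covers
  products of scalars as well as the inner products in the metric matrix.\<close>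

lemma lip2_on_bilinear:
  assumes bil: "bounded_bilinear (pr :: 'b::real_normed_vector \<Rightarrow> 'c::real_normed_vector \<Rightarrow> 'd::real_normed_vector)"
    and "convex S" and "lip2_on S F" "lip2_on S G"
  shows "lip2_on S (\<lambda>x. pr (F x) (G x))"
proof -
  interpret bounded_bilinear pr by fact
  obtain A where A: "A > 0" "\<And>u. u \<in> S \<Longrightarrow> norm (F u) \<le> A"
    "\<And>u v. u \<in> S \<Longrightarrow> v \<in> S \<Longrightarrow> norm (F u - F v) \<le> A * norm (u - v)"
    "\<And>u v. u \<in> S \<Longrightarrow> v \<in> S \<Longrightarrow> norm (F u + F v - 2 *\<^sub>R F (midpoint u v)) \<le> A * (norm (u - v))\<^sup>2"
    using lip2_onE[OF assms(3)] by metis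
  obtain B where B: "B > 0" "\<And>u. u \<in> S \<Longrightarrow> norm (G u) \<le> B"
    "\<And>u v. u \<in> S \<Longrightarrow> v \<in> S \<Longrightarrow> norm (G u - G v) \<le> B * norm (u - v)"
    "\<And>u v. u \<in> S \<Longrightarrow> v \<in> S \<Longrightarrow> norm (G u + G v - 2 *\<^sub>R G (midpoint u v)) \<le> B * (norm (u - v))\<^sup>2"
    using lip2_onE[OF assms(4)] by metis
  obtain K where K: "K > 0" "\<And>a b. norm (pr a b) \<le> norm a * norm b * K"
    using pos_bounded by blast
  have N: "norm (pr a b) \<le> x * y * K" if "norm a \<le> x" "norm b \<le> y" for a b x y
  proof -
    have "norm a * norm b \<le> x * y" using that by (intro mult_mono) (auto intro: order_trans[OF norm_ge_zero])
    then show ?thesis using K by (meson mult_right_mono order_trans less_imp_le)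
  qed
  show ?thesis
  proof (rule lip2_onI[of _ _ "A*B*K" "2*A*B*K" "3*A*B*K"])
    fix u v assume uv: "u \<in> S" "v \<in> S"
    let ?m = "midpoint u v"
    have m: "?m \<in> S" using assms(2) uv by (metis closed_segment_subset midpoint_in_closed_segment subsetD)
    show "norm (pr (F u) (G u)) \<le> A*B*K" by (rule N) (use A B uv in auto)
    have "pr (F u) (G u) - pr (F v) (G v) = pr (F u - F v) (G u) + pr (F v) (G u - G v)"
      by (simp add: diff_left diff_right)
    also have "norm \<dots> \<le> (A * norm (u - v)) * B * K + A * (B * norm (u - v)) * K"
      by (intro norm_triangle_mono N) (use A B uv in auto)
    finally show "norm (pr (F u) (G u) - pr (F v) (G v)) \<le> 2*A*B*K * norm (u - v)"
      by (simp add: algebra_simps)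
    define X where "X = pr (F u) (G u) + pr (F v) (G v) - 2 *\<^sub>R pr (F ?m) (G ?m)"
    \<comment> \<open>Twice the second difference of the product, so that all coefficients are
      integers. Each summand contains a second difference or two first differences, hence is
      quadratic in \<open>norm (u - v)\<close>.\<close>
    have eq: "X + X = pr (F u + F v - 2 *\<^sub>R F ?m) (G u + G v) + pr (F u - F v) (G u - G v)
          + 2 *\<^sub>R pr (F ?m) (G u + G v - 2 *\<^sub>R G ?m)"
      unfolding X_def scaleR_2 by (simp add: diff_left diff_right add_left add_right)
    have "norm (X + X) \<le> (A * (norm (u-v))\<^sup>2) * (B + B) * K + (A * norm (u-v)) * (B * norm (u-v)) * K
          + 2 * (A * (B * (norm (u-v))\<^sup>2) * K)"
      unfolding eq
    proof (intro norm_triangle_mono)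
      show "norm (pr (F u + F v - 2 *\<^sub>R F ?m) (G u + G v)) \<le> (A * (norm (u-v))\<^sup>2) * (B + B) * K"
        by (intro N A(4) uv norm_triangle_mono B(2))
      show "norm (pr (F u - F v) (G u - G v)) \<le> (A * norm (u-v)) * (B * norm (u-v)) * K"
        by (intro N A(3) B(3) uv)
      show "norm (2 *\<^sub>R pr (F ?m) (G u + G v - 2 *\<^sub>R G ?m)) \<le> 2 * (A * (B * (norm (u-v))\<^sup>2) * K)"
        using N[OF A(2)[OF m] B(4)[OF uv]] by simp
    qed
    moreover have "norm (X + X) = 2 * norm X" by (simp flip: scaleR_2)
    ultimately have "norm X \<le> (1/2) * ((A * (norm (u-v))\<^sup>2) * (B + B) * K + (A * norm (u-v)) * (B * norm (u-v)) * K
          + 2 * (A * (B * (norm (u-v))\<^sup>2) * K))" by simp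
    also have "\<dots> = (5/2) * (A * B * K * (norm (u-v))\<^sup>2)"
      by (simp add: algebra_simps power2_eq_square)
    also have "\<dots> \<le> 3 * (A * B * K * (norm (u-v))\<^sup>2)"
      using A(1) B(1) K(1) by (intro mult_right_mono) auto
    finally show "norm (pr (F u) (G u) + pr (F v) (G v) - 2 *\<^sub>R pr (F ?m) (G ?m)) \<le> 3*A*B*K * (norm (u-v))\<^sup>2"
      by (simp add: X_def mult.assoc)
  qed
qed

lemma lip2_on_mult:
  fixes F G :: "'a::euclidean_space \<Rightarrow> real"
  assumes "convex S" "lip2_on S F" "lip2_on S G"
  shows "lip2_on S (\<lambda>x. F x * G x)"
  by (rule lip2_on_bilinear[OF bounded_bilinear_mult assms])

lemma lip2_on_sum:
  assumes "\<And>i. i \<in> I \<Longrightarrow> lip2_on S (F i)" shows "lip2_on S (\<lambda>x. \<Sum>i\<in>I. F i x)"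
  using assms by (induction I rule: infinite_finite_induct) (auto intro: lip2_on_add lip2_on_const)

lemma lip2_on_prod:
  fixes F :: "'i \<Rightarrow> 'a::euclidean_space \<Rightarrow> real"
  assumes "convex S" "\<And>i. i \<in> I \<Longrightarrow> lip2_on S (F i)" shows "lip2_on S (\<lambda>x. \<Prod>i\<in>I. F i x)"
  using assms(2) by (induction I rule: infinite_finite_induct) (auto intro: lip2_on_mult lip2_on_const assms(1))

text \<open>The second difference of \<open>G\<close> is available at the midpoint of the values
  \<open>F u\<close> and \<open>F v\<close>, not at the value of \<open>F\<close> at the midpoint.
  These two points differ by half a second difference of \<open>F\<close>, and \<open>G\<close> is
  Lipschitz. Convexity of \<open>T\<close> keeps the inserted point in the domain.\<close>

lemma lip2_on_compose:
  assumes "lip2_on T G" "convex T" "lip2_on S F" "convex S" "\<And>x. x \<in> S \<Longrightarrow> F x \<in> T"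
  shows "lip2_on S (\<lambda>x. G (F x))"
proof -
  obtain A where A: "A > 0" "\<And>u. u \<in> S \<Longrightarrow> norm (F u) \<le> A"
    "\<And>u v. u \<in> S \<Longrightarrow> v \<in> S \<Longrightarrow> norm (F u - F v) \<le> A * norm (u - v)"
    "\<And>u v. u \<in> S \<Longrightarrow> v \<in> S \<Longrightarrow> norm (F u + F v - 2 *\<^sub>R F (midpoint u v)) \<le> A * (norm (u - v))\<^sup>2"
    using lip2_onE[OF assms(3)] by metis
  obtain B where B: "B > 0" "\<And>u. u \<in> T \<Longrightarrow> norm (G u) \<le> B"
    "\<And>u v. u \<in> T \<Longrightarrow> v \<in> T \<Longrightarrow> norm (G u - G v) \<le> B * norm (u - v)"
    "\<And>u v. u \<in> T \<Longrightarrow> v \<in> T \<Longrightarrow> norm (G u + G v - 2 *\<^sub>R G (midpoint u v)) \<le> B * (norm (u - v))\<^sup>2"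
    using lip2_onE[OF assms(1)] by metis
  show ?thesis
  proof (rule lip2_onI[of _ _ B "B*A" "B * A\<^sup>2 + B * A"])
    fix u v assume uv: "u \<in> S" "v \<in> S"
    let ?m = "midpoint u v" and ?k = "midpoint (F u) (F v)"
    have m: "?m \<in> S" using assms(4) uv by (metis closed_segment_subset midpoint_in_closed_segment subsetD)
    have T: "F u \<in> T" "F v \<in> T" "F ?m \<in> T" using assms(5) uv m by auto
    have k: "?k \<in> T" using assms(2) T by (metis closed_segment_subset midpoint_in_closed_segment subsetD)
    show "norm (G (F u)) \<le> B" using B(2) T by blast
    have "norm (G (F u) - G (F v)) \<le> B * norm (F u - F v)" using B(3) T by blast
    also have "\<dots> \<le> B * (A * norm (u - v))" using A(3)[OF uv] B(1) by simp
    finally show "norm (G (F u) - G (F v)) \<le> B * A * norm (u - v)" by simp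
    have "norm (?k - F ?m) = norm ((1/2) *\<^sub>R (F u + F v - 2 *\<^sub>R F ?m))"
      by (simp add: midpoint_def scaleR_diff_right)
    also have "\<dots> \<le> (1/2) * (A * (norm (u-v))\<^sup>2)" using A(4)[OF uv] by simp
    finally have km: "norm (?k - F ?m) \<le> (1/2) * (A * (norm (u-v))\<^sup>2)" .
    have "G (F u) + G (F v) - 2 *\<^sub>R G (F ?m) = (G (F u) + G (F v) - 2 *\<^sub>R G ?k) + 2 *\<^sub>R (G ?k - G (F ?m))"
      by (simp add: scaleR_diff_right)
    also have "norm \<dots> \<le> B * (norm (F u - F v))\<^sup>2 + 2 * (B * norm (?k - F ?m))"
      using B(4)[OF T(1,2)] B(3)[OF k T(3)] by (intro norm_triangle_mono) auto
    also have "\<dots> \<le> B * (A * norm (u-v))\<^sup>2 + 2 * (B * ((1/2) * (A * (norm (u-v))\<^sup>2)))"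
      using A(3)[OF uv] B(1) km by (intro add_mono mult_left_mono power_mono) auto
    finally show "norm (G (F u) + G (F v) - 2 *\<^sub>R G (F ?m)) \<le> (B * A\<^sup>2 + B * A) * (norm (u-v))\<^sup>2"
      by (simp add: algebra_simps power_mult_distrib)
  qed
qed

text \<open>The parameter \<open>t\<close> traverses the segment from \<open>v\<close> at -1 to
  \<open>u\<close> at 1.\<close>

lemma midpoint_add_mem:
  fixes u v :: "'a::euclidean_space"
  assumes "convex S" "u \<in> S" "v \<in> S" "-1 \<le> t" "t \<le> 1"
  shows "midpoint u v + t *\<^sub>R ((1/2) *\<^sub>R (u - v)) \<in> S"
proof -
  have "midpoint u v + t *\<^sub>R ((1/2) *\<^sub>R (u - v)) = (1 - (1-t)/2) *\<^sub>R u + ((1-t)/2) *\<^sub>R v"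
    by (rule euclidean_eqI) (simp add: midpoint_def inner_simps field_simps)
  then show ?thesis using convexD_alt[OF assms(1-3), of "(1-t)/2"] assms(4,5) by simp
qed

text \<open>A bounded Lipschitz derivative suffices: \<open>F (m + t w) + F (m - t w)\<close> has as
  derivative in \<open>t\<close> a difference of two values of \<open>F'\<close>, to which the
  Lipschitz bound applies.\<close>

lemma lip2_on_derivI:
  fixes F :: "'a::euclidean_space \<Rightarrow> 'b::real_inner"
  assumes S: "convex S"
    and der: "\<And>x. x \<in> S \<Longrightarrow> (F has_derivative F' x) (at x)"
    and bF: "\<And>x. x \<in> S \<Longrightarrow> norm (F x) \<le> C0"
    and b: "\<And>x h. x \<in> S \<Longrightarrow> norm (F' x h) \<le> C1 * norm h"
    and l: "\<And>x y h. x \<in> S \<Longrightarrow> y \<in> S \<Longrightarrow> norm (F' x h - F' y h) \<le> C2 * norm (x - y) * norm h"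
  shows "lip2_on S F"
proof (rule lip2_onI[of _ _ C0 C1 "C2 / 2"])
  fix u v assume uv: "u \<in> S" "v \<in> S"
  show "norm (F u) \<le> C0" using bF uv by blast
  show "norm (F u - F v) \<le> C1 * norm (u - v)"
  proof (rule differentiable_bound[OF S])
    show "(F has_derivative F' x) (at x within S)" if "x \<in> S" for x
      using der[OF that] has_derivative_at_withinI by blast
    show "onorm (F' x) \<le> C1" if "x \<in> S" for x
      using b[OF that] by (rule onorm_le)
  qed (use uv in auto)
  let ?m = "midpoint u v"
  define w where "w = (1/2) *\<^sub>R (u - v)"
  have mw: "?m + w = u" "?m - w = v"
    by (rule euclidean_eqI, simp add: midpoint_def w_def inner_simps field_simps)+
  have inS: "?m + t *\<^sub>R w \<in> S" "?m - t *\<^sub>R w \<in> S" if "0 \<le> t" "t \<le> 1" for t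
    using midpoint_add_mem[OF S uv, of t] midpoint_add_mem[OF S uv, of "-t"] that
    by (auto simp: w_def)
  \<comment> \<open>\<open>G 1 - G 0\<close> is exactly the second difference, because
    \<open>?m + w = u\<close> and \<open>?m - w = v\<close>.\<close>
  define G where "G = (\<lambda>t. F (?m + t *\<^sub>R w) + F (?m - t *\<^sub>R w))"
  have dG: "(G has_derivative (\<lambda>s. F' (?m + t *\<^sub>R w) (s *\<^sub>R w) + F' (?m - t *\<^sub>R w) (- (s *\<^sub>R w)))) (at t)"
    if "0 \<le> t" "t \<le> 1" for t
    unfolding G_def
    by (rule has_derivative_add;
        rule has_derivative_compose[where f = "\<lambda>t. ?m + t *\<^sub>R w" and g = F] 
             has_derivative_compose[where f = "\<lambda>t. ?m - t *\<^sub>R w" and g = F])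
       (auto intro!: derivative_eq_intros der inS that)
  have cont: "continuous_on {0..1} G"
    by (meson atLeastAtMost_iff continuous_at_imp_continuous_on dG has_derivative_continuous)
  obtain t where t: "t \<in> {0<..<1}" and
    le: "norm (G 1 - G 0) \<le> norm (F' (?m + t *\<^sub>R w) ((1 - 0) *\<^sub>R w) + F' (?m - t *\<^sub>R w) (- ((1 - 0) *\<^sub>R w)))"
    using mvt_general[OF zero_less_one cont, where f' = "\<lambda>t s. F' (?m + t *\<^sub>R w) (s *\<^sub>R w) + F' (?m - t *\<^sub>R w) (- (s *\<^sub>R w))"]
      dG by auto
  have t1: "0 \<le> t" "t \<le> 1" using t by auto
  have lin: "F' (?m - t *\<^sub>R w) (- w) = - F' (?m - t *\<^sub>R w) w"
    using der[OF inS(2)[OF t1]] has_derivative_linear linear_neg by blast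
  have "norm (G 1 - G 0) \<le> norm (F' (?m + t *\<^sub>R w) w - F' (?m - t *\<^sub>R w) w)" using le lin by simp
  also have "\<dots> \<le> C2 * norm ((?m + t *\<^sub>R w) - (?m - t *\<^sub>R w)) * norm w" using l inS[OF t1] by blast
  also have "norm ((?m + t *\<^sub>R w) - (?m - t *\<^sub>R w)) = t * norm (u - v)"
  proof -
    have "(?m + t *\<^sub>R w) - (?m - t *\<^sub>R w) = t *\<^sub>R (u - v)" 
      by (rule euclidean_eqI, simp add: w_def inner_simps field_simps)
    then show ?thesis using t1 by simp
  qed
  also have "C2 * (t * norm (u - v)) * norm w = C2 * t * norm (u - v) * (norm (u - v) / 2)"
    by (simp add: w_def)
  also have "\<dots> \<le> C2 / 2 * (norm (u - v))\<^sup>2"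
  proof -
    have "C2 * norm (u - v) * norm w \<ge> 0"
      using l[OF uv, of w] norm_ge_zero order_trans by blast
    then have "t * (C2 * norm (u - v) * norm w) \<le> 1 * (C2 * norm (u - v) * norm w)"
      using t1 by (intro mult_right_mono) auto
    moreover have "norm w = norm (u - v) / 2" by (simp add: w_def)
    ultimately show ?thesis by (simp add: power2_eq_square algebra_simps)
  qed
  finally show "norm (F u + F v - 2 *\<^sub>R F ?m) \<le> C2 / 2 * (norm (u - v))\<^sup>2"
    by (simp add: G_def mw scaleR_2)
qed


section \<open>Estimates for smooth maps on compact convex sets\<close>

lemma Ck_on_continuous_on: "Ck_on k F V \<Longrightarrow> continuous_on V F"
  by (cases k) (auto intro!: differentiable_imp_continuous_on simp: differentiable_on_def differentiable_at_withinI)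

lemma smooth_on_frechet_derivative: "smooth_on V F \<Longrightarrow> smooth_on V (\<lambda>x. frechet_derivative F (at x) v)"
  unfolding smooth_on_def by (metis Ck_on.simps(2))

lemma smooth_on_Ck_on: "smooth_on V F \<Longrightarrow> Ck_on k F V"
  by (auto simp: smooth_on_def)

lemma smooth_on_has_derivative:
  "smooth_on V F \<Longrightarrow> x \<in> V \<Longrightarrow> (F has_derivative frechet_derivative F (at x)) (at x)"
  using smooth_on_Ck_on[of V F 1] by (simp add: frechet_derivative_works)

lemma smooth_on_linear:
  "smooth_on V F \<Longrightarrow> x \<in> V \<Longrightarrow> linear (frechet_derivative F (at x))"
  using smooth_on_has_derivative has_derivative_linear by blast

lemma linear_eq_sum_Basis:
  fixes f :: "'a::euclidean_space \<Rightarrow> 'b::real_vector"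
  assumes "linear f" shows "f h = (\<Sum>b\<in>Basis. (h \<bullet> b) *\<^sub>R f b)"
proof -
  have "f h = f (\<Sum>b\<in>Basis. (h \<bullet> b) *\<^sub>R b)" by (simp add: euclidean_representation)
  also have "\<dots> = (\<Sum>b\<in>Basis. (h \<bullet> b) *\<^sub>R f b)" by (simp add: linear_sum[OF assms] linear_cmul[OF assms])
  finally show ?thesis .
qed

lemma linear_norm_le_sum_Basis:
  fixes f :: "'a::euclidean_space \<Rightarrow> 'b::real_normed_vector"
  assumes "linear f" "\<And>b. b \<in> Basis \<Longrightarrow> norm (f b) \<le> C b"
  shows "norm (f h) \<le> (\<Sum>b\<in>Basis. C b) * norm h"
proof -
  have "norm (f h) \<le> (\<Sum>b\<in>Basis. norm ((h \<bullet> b) *\<^sub>R f b))"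
    unfolding linear_eq_sum_Basis[OF assms(1), of h] by (rule norm_sum)
  also have "\<dots> \<le> (\<Sum>b\<in>Basis. C b * norm h)"
  proof (rule sum_mono)
    fix b :: 'a assume b: "b \<in> Basis"
    have "\<bar>h \<bullet> b\<bar> * norm (f b) \<le> norm h * C b"
      by (intro mult_mono assms b Basis_le_norm) auto
    then show "norm ((h \<bullet> b) *\<^sub>R f b) \<le> C b * norm h" by (simp add: mult.commute)
  qed
  finally show ?thesis by (simp add: sum_distrib_right)
qed

lemma linear_diff_fun: "linear f \<Longrightarrow> linear g \<Longrightarrow> linear (\<lambda>x. f x - g x)"
  by (rule linear_compose_sub)

lemma continuous_on_compact_bound_family:
  assumes "compact K" "finite I" "\<And>i. i \<in> I \<Longrightarrow> continuous_on K (F i)"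
  obtains C :: real where "C > 0" "\<And>i x. i \<in> I \<Longrightarrow> x \<in> K \<Longrightarrow> norm (F i x) \<le> C"
proof -
  have "\<forall>i\<in>I. \<exists>B. \<forall>x\<in>K. norm (F i x) \<le> B"
    by (metis assms(1,3) bounded_iff compact_continuous_image compact_imp_bounded imageI)
  then obtain B where B: "\<And>i x. i \<in> I \<Longrightarrow> x \<in> K \<Longrightarrow> norm (F i x) \<le> B i" by metis
  have "norm (F i x) \<le> (\<Sum>i\<in>I. \<bar>B i\<bar>) + 1" if "i \<in> I" "x \<in> K" for i x
  proof -
    have "\<bar>B i\<bar> \<le> (\<Sum>i\<in>I. \<bar>B i\<bar>)" using that assms(2) by (intro member_le_sum) auto
    then show ?thesis using B[OF that] by linarith
  qed
  moreover have "(\<Sum>i\<in>I. \<bar>B i\<bar>) + 1 > 0" by (simp add: add_nonneg_pos sum_nonneg)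
  ultimately show thesis using that by blast
qed

context
  fixes F :: "'a::euclidean_space \<Rightarrow> 'b::euclidean_space" and V K :: "'a set"
  assumes K: "compact K" "convex K" "K \<subseteq> V"
begin

lemma Ck_on_frechet_bounded:
  assumes "Ck_on 1 F V"
  obtains C where "C > 0" "\<And>x h. x \<in> K \<Longrightarrow> norm (frechet_derivative F (at x) h) \<le> C * norm h"
proof -
  have "continuous_on K (\<lambda>x. frechet_derivative F (at x) b)" for b
    using assms K(3) by (auto intro: continuous_on_subset)
  then obtain B where B: "B > 0" "\<And>b x. b \<in> Basis \<Longrightarrow> x \<in> K \<Longrightarrow> norm (frechet_derivative F (at x) b) \<le> B"
    using continuous_on_compact_bound_family[OF K(1) finite_Basis, of "\<lambda>b x. frechet_derivative F (at x) b"] by blast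
  have "norm (frechet_derivative F (at x) h) \<le> (\<Sum>b\<in>(Basis::'a set). B) * norm h" if "x \<in> K" for x h
  proof (rule linear_norm_le_sum_Basis)
    have "F differentiable (at x)" using assms that K(3) by auto
    then show "linear (frechet_derivative F (at x))" by (rule linear_frechet_derivative)
  qed (use B that in auto)
  moreover have "(\<Sum>b\<in>(Basis::'a set). B) > 0" using B(1) by simp
  ultimately show thesis using that by blast
qed

lemma Ck_on_lipschitz:
  assumes "Ck_on 1 F V"
  obtains C where "C > 0" "\<And>u v. u \<in> K \<Longrightarrow> v \<in> K \<Longrightarrow> norm (F u - F v) \<le> C * norm (u - v)"
proof -
  obtain C where C: "C > 0" "\<And>x h. x \<in> K \<Longrightarrow> norm (frechet_derivative F (at x) h) \<le> C * norm h"
    using Ck_on_frechet_bounded[OF assms] by blast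
  have "norm (F u - F v) \<le> C * norm (u - v)" if "u \<in> K" "v \<in> K" for u v
  proof (rule differentiable_bound[OF K(2)])
    show "(F has_derivative frechet_derivative F (at x)) (at x within K)" if "x \<in> K" for x
      using assms that K(3) frechet_derivative_works has_derivative_at_withinI by fastforce
    show "onorm (frechet_derivative F (at x)) \<le> C" if "x \<in> K" for x
      using C(2)[OF that] by (rule onorm_le)
  qed (use that in auto)
  then show thesis using that C(1) by blast
qed

end

text \<open>By linearity in \<open>h\<close> it suffices to treat the directional derivatives along
  basis vectors, and each of these is again smooth.\<close>

lemma smooth_on_frechet_lipschitz:
  fixes F :: "'a::euclidean_space \<Rightarrow> 'b::euclidean_space"
  assumes K: "compact K" "convex K" "K \<subseteq> V" and F: "smooth_on V F"
  obtains C where "C > 0" "\<And>x y h. x \<in> K \<Longrightarrow> y \<in> K \<Longrightarrow>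
     norm (frechet_derivative F (at x) h - frechet_derivative F (at y) h) \<le> C * norm (x - y) * norm h"
proof -
  have "\<forall>b. \<exists>C>0. \<forall>u\<in>K. \<forall>v\<in>K. norm (frechet_derivative F (at u) b - frechet_derivative F (at v) b) \<le> C * norm (u - v)"
    using Ck_on_lipschitz[OF K smooth_on_Ck_on[OF smooth_on_frechet_derivative[OF F]]] by metis
  then obtain C where C: "\<And>b. C b > 0" "\<And>b u v. u \<in> K \<Longrightarrow> v \<in> K \<Longrightarrow> 
      norm (frechet_derivative F (at u) b - frechet_derivative F (at v) b) \<le> C b * norm (u - v)"
    by metis
  have "norm (frechet_derivative F (at x) h - frechet_derivative F (at y) h) 
      \<le> (\<Sum>b\<in>Basis. C b * norm (x - y)) * norm h" if "x \<in> K" "y \<in> K" for x y h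
    using that C K(3) by (intro linear_norm_le_sum_Basis linear_diff_fun smooth_on_linear[OF F]) auto
  then show thesis using C(1) 
    by (intro that[of "\<Sum>b\<in>Basis. C b"]) (auto simp: sum_distrib_right intro!: sum_pos)
qed

lemma smooth_on_lip2_on:
  fixes F :: "'a::euclidean_space \<Rightarrow> 'b::euclidean_space"
  assumes K: "compact K" "convex K" "K \<subseteq> V" and F: "smooth_on V F"
  shows "lip2_on K F"
proof -
  obtain C1 where C1: "\<And>x h. x \<in> K \<Longrightarrow> norm (frechet_derivative F (at x) h) \<le> C1 * norm h"
    using Ck_on_frechet_bounded[OF K smooth_on_Ck_on[OF F]] by metis
  obtain C2 where C2: "\<And>x y h. x \<in> K \<Longrightarrow> y \<in> K \<Longrightarrow>
     norm (frechet_derivative F (at x) h - frechet_derivative F (at y) h) \<le> C2 * norm (x - y) * norm h"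
    using smooth_on_frechet_lipschitz[OF K F] by metis
  have "continuous_on K F" using Ck_on_continuous_on smooth_on_Ck_on[OF F] continuous_on_subset K(3) by metis
  then obtain C0 where C0: "\<And>x. x \<in> K \<Longrightarrow> norm (F x) \<le> C0"
    by (metis K(1) bounded_iff compact_continuous_image compact_imp_bounded imageI)
  show ?thesis
    by (rule lip2_on_derivI[OF K(2) smooth_on_has_derivative[OF F] C0 C1 C2]) (use K(3) in auto)
qed

text \<open>About the midpoint the even Taylor terms cancel, so the linear approximation is accurate
  to third order. The input is the second-difference bound for directional derivatives, which are
  smooth and hence in the class.\<close>

lemma smooth_on_symmetric_difference:
  fixes F :: "'a::euclidean_space \<Rightarrow> 'b::euclidean_space"
  assumes K: "compact K" "convex K" "K \<subseteq> V" and F: "smooth_on V F"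
  obtains C where "C > 0" "\<And>u v. u \<in> K \<Longrightarrow> v \<in> K \<Longrightarrow>
     norm (F u - F v - frechet_derivative F (at (midpoint u v)) (u - v)) \<le> C * norm (u - v) ^ 3"
proof -
  let ?D = "\<lambda>x. frechet_derivative F (at x)"
  have "\<forall>b. \<exists>C>0. \<forall>u\<in>K. \<forall>v\<in>K. norm (?D u b + ?D v b - 2 *\<^sub>R ?D (midpoint u v) b) \<le> C * (norm (u - v))\<^sup>2"
    using lip2_onE[OF smooth_on_lip2_on[OF K smooth_on_frechet_derivative[OF F]]] by metis
  then obtain C where C: "\<And>b. C b > 0" "\<And>b u v. u \<in> K \<Longrightarrow> v \<in> K \<Longrightarrow> 
      norm (?D u b + ?D v b - 2 *\<^sub>R ?D (midpoint u v) b) \<le> C b * (norm (u - v))\<^sup>2"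
    by metis
  define B where "B = (\<Sum>b\<in>Basis. C b)"
  have B0: "B > 0" unfolding B_def using C(1) by (intro sum_pos) auto
  have mid: "midpoint u v \<in> K" if "u \<in> K" "v \<in> K" for u v
    using K(2) that by (metis closed_segment_subset midpoint_in_closed_segment subsetD)
  have B: "norm (?D u h + ?D v h - 2 *\<^sub>R ?D (midpoint u v) h) \<le> B * (norm (u - v))\<^sup>2 * norm h"
    if "u \<in> K" "v \<in> K" for u v h
  proof -
    have "norm (?D u h + ?D v h - 2 *\<^sub>R ?D (midpoint u v) h) \<le> (\<Sum>b\<in>Basis. C b * (norm (u - v))\<^sup>2) * norm h"
      using that C mid[OF that] K(3)
      by (intro linear_norm_le_sum_Basis linear_diff_fun linear_compose_add linear_compose_scale_right 
           smooth_on_linear[OF F]) auto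
    then show ?thesis by (simp add: B_def sum_distrib_right)
  qed
  have "norm (F u - F v - ?D (midpoint u v) (u - v)) \<le> B * norm (u - v) ^ 3" if uv: "u \<in> K" "v \<in> K" for u v
  proof -
    let ?m = "midpoint u v"
    define w where "w = (1/2) *\<^sub>R (u - v)"
    have mw: "?m + w = u" "?m - w = v"
      by (rule euclidean_eqI, simp add: midpoint_def w_def inner_simps field_simps)+
    have inS: "?m + t *\<^sub>R w \<in> K" "?m - t *\<^sub>R w \<in> K" if "0 \<le> t" "t \<le> 1" for t
      using midpoint_add_mem[OF K(2) uv, of t] midpoint_add_mem[OF K(2) uv, of "-t"] that
      by (auto simp: w_def)
    \<comment> \<open>The linear term is subtracted inside \<open>G\<close>, so that the derivative
      at \<open>t\<close> is a second difference of the derivative of \<open>F\<close> about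
      \<open>?m\<close>, over a segment of length \<open>t * norm (u - v)\<close>.\<close>
    define G where "G = (\<lambda>t. F (?m + t *\<^sub>R w) - F (?m - t *\<^sub>R w) - t *\<^sub>R (2 *\<^sub>R ?D ?m w))"
    define G' where "G' = (\<lambda>t s. ?D (?m + t *\<^sub>R w) (s *\<^sub>R w) - ?D (?m - t *\<^sub>R w) (- (s *\<^sub>R w)) - s *\<^sub>R (2 *\<^sub>R ?D ?m w))"
    have dG: "(G has_derivative G' t) (at t)" if "0 \<le> t" "t \<le> 1" for t
    proof -
      have d: "(F has_derivative ?D (?m + t *\<^sub>R w)) (at (?m + t *\<^sub>R w))" "(F has_derivative ?D (?m - t *\<^sub>R w)) (at (?m - t *\<^sub>R w))"
        using inS[OF that] K(3) smooth_on_has_derivative[OF F] by blast+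
      have d1: "((\<lambda>t. F (?m + t *\<^sub>R w)) has_derivative (\<lambda>s. ?D (?m + t *\<^sub>R w) (s *\<^sub>R w))) (at t)"
        by (rule has_derivative_compose[where f = "\<lambda>t. ?m + t *\<^sub>R w" and g = F]) (auto intro!: d(1) derivative_eq_intros)
      have d2: "((\<lambda>t. F (?m - t *\<^sub>R w)) has_derivative (\<lambda>s. ?D (?m - t *\<^sub>R w) (- (s *\<^sub>R w)))) (at t)"
        by (rule has_derivative_compose[where f = "\<lambda>t. ?m - t *\<^sub>R w" and g = F]) (auto intro!: d(2) derivative_eq_intros)
      show ?thesis unfolding G_def G'_def
        by (intro has_derivative_diff d1 d2 has_derivative_scaleR_left has_derivative_ident)
    qed
    have cont: "continuous_on {0..1} G"
      by (meson atLeastAtMost_iff continuous_at_imp_continuous_on dG has_derivative_continuous)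
    obtain t where t: "t \<in> {0<..<1}" and le: "norm (G 1 - G 0) \<le> norm (G' t (1 - 0))"
      using mvt_general[OF zero_less_one cont, where f' = G'] dG by auto
    have t1: "0 \<le> t" "t \<le> 1" using t by auto
    have lin: "?D (?m - t *\<^sub>R w) (- w) = - ?D (?m - t *\<^sub>R w) w"
      using smooth_on_linear[OF F] inS(2)[OF t1] K(3) linear_neg by blast
    have mm: "midpoint (?m + t *\<^sub>R w) (?m - t *\<^sub>R w) = ?m"
      by (rule euclidean_eqI, simp add: midpoint_def inner_simps field_simps)
    have wn: "norm w = norm (u - v) / 2" by (simp add: w_def)
    have "norm (G 1 - G 0) \<le> norm (?D (?m + t *\<^sub>R w) w + ?D (?m - t *\<^sub>R w) w - 2 *\<^sub>R ?D ?m w)"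
      using le lin by (simp add: G'_def)
    also have "\<dots> \<le> B * (norm ((?m + t *\<^sub>R w) - (?m - t *\<^sub>R w)))\<^sup>2 * norm w" 
      using B[OF inS[OF t1], of w] by (simp only: mm)
    also have "norm ((?m + t *\<^sub>R w) - (?m - t *\<^sub>R w)) = t * norm (u - v)"
    proof -
      have "(?m + t *\<^sub>R w) - (?m - t *\<^sub>R w) = t *\<^sub>R (u - v)" 
        by (rule euclidean_eqI, simp add: w_def inner_simps field_simps)
      then show ?thesis using t1 by simp
    qed
    also have "B * (t * norm (u - v))\<^sup>2 * norm w \<le> B * (1 * norm (u - v))\<^sup>2 * norm (u - v)"
      unfolding wn using t1 B0 by (intro mult_mono power_mono) auto
    also have "\<dots> = B * norm (u - v) ^ 3" by (simp add: power2_eq_square power3_eq_cube)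
    finally have "norm (G 1 - G 0) \<le> B * norm (u - v) ^ 3" .
    moreover have "G 1 - G 0 = F u - F v - ?D ?m (2 *\<^sub>R w)"
      using linear_cmul[OF smooth_on_linear[OF F], of ?m 2 w] mid[OF uv] K(3)
      by (auto simp: G_def mw)
    ultimately show ?thesis by (simp add: w_def)
  qed
  then show thesis using that B0 by blast
qed

section \<open>Linear changes of variables for Lebesgue measure\<close>

text \<open>With the other coordinates fixed, the shear translates the coordinate along
  \<open>b\<close> by \<open>x \<bullet> c\<close>, an amount that does not involve this coordinate
  as \<open>b \<noteq> c\<close>. Fubini reduces the claim to translation invariance on the
  line.\<close>

lemma lborel_distr_shear:
  fixes b c :: "'a::euclidean_space"
  assumes bc: "b \<in> Basis" "c \<in> Basis" "b \<noteq> c"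
  shows "distr lborel borel (\<lambda>x. x + (x \<bullet> c) *\<^sub>R b) = lborel"
proof (rule measure_eqI)
  fix A assume "A \<in> sets (distr lborel borel (\<lambda>x. x + (x \<bullet> c) *\<^sub>R b))"
  then have A[measurable]: "A \<in> sets borel" by simp
  interpret product_sigma_finite "\<lambda>_::'a. lborel :: real measure" ..
  \<comment> \<open>\<open>J\<close> assembles a vector from its coordinates; \<open>lborel\<close>
    is the image of the product measure under it.\<close>
  define J where "J = (\<lambda>w::'a\<Rightarrow>real. \<Sum>b\<in>Basis. w b *\<^sub>R b)"
  have J[measurable]: "J \<in> (\<Pi>\<^sub>M b\<in>Basis. lborel) \<rightarrow>\<^sub>M borel" unfolding J_def by measurable
  have Basis: "insert b (Basis - {b}) = Basis" using bc by auto
  have key: "J (w(b := y)) + (J (w(b := y)) \<bullet> c) *\<^sub>R b = J (w(b := y + w c))" for w y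
  proof (rule euclidean_eqI)
    fix i :: 'a assume i: "i \<in> Basis"
    have Ji: "J v \<bullet> i = v i" if "i \<in> Basis" for v i unfolding J_def using that by simp
    show "(J (w(b := y)) + (J (w(b := y)) \<bullet> c) *\<^sub>R b) \<bullet> i = J (w(b := y + w c)) \<bullet> i"
      using bc i by (auto simp: inner_add_left Ji inner_Basis)
  qed
  have "emeasure (distr lborel borel (\<lambda>x. x + (x \<bullet> c) *\<^sub>R b)) A 
      = (\<integral>\<^sup>+x. indicator A (x + (x \<bullet> c) *\<^sub>R b) \<partial>lborel)"
    by (subst nn_integral_indicator[symmetric], simp, subst nn_integral_distr) auto
  also have "\<dots> = (\<integral>\<^sup>+w. indicator A (J w + (J w \<bullet> c) *\<^sub>R b) \<partial>(\<Pi>\<^sub>M b\<in>Basis. lborel))"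
    by (subst lborel_eq, subst nn_integral_distr) (auto simp: J_def)
  also have "\<dots> = (\<integral>\<^sup>+w. (\<integral>\<^sup>+y. indicator A (J (w(b := y)) + (J (w(b := y)) \<bullet> c) *\<^sub>R b) \<partial>lborel) \<partial>(\<Pi>\<^sub>M b\<in>Basis - {b}. lborel))"
    by (subst Basis[symmetric], rule product_nn_integral_insert) (auto simp: Basis insert_absorb[OF bc(1)])
  also have "\<dots> = (\<integral>\<^sup>+w. (\<integral>\<^sup>+y. indicator A (J (w(b := y + w c))) \<partial>lborel) \<partial>(\<Pi>\<^sub>M b\<in>Basis - {b}. lborel))"
    by (simp only: key)
  also have "\<dots> = (\<integral>\<^sup>+w. (\<integral>\<^sup>+y. indicator A (J (w(b := y))) \<partial>lborel) \<partial>(\<Pi>\<^sub>M b\<in>Basis - {b}. lborel))"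
  proof (rule nn_integral_cong)
    fix w assume ww: "w \<in> space (\<Pi>\<^sub>M b\<in>Basis - {b}. lborel :: real measure)"
    have m: "(\<lambda>y. w(b := y)) \<in> borel \<rightarrow>\<^sub>M (\<Pi>\<^sub>M b\<in>Basis. lborel :: real measure)"
      using measurable_component_update[OF ww, of b] Basis by (simp add: measurable_lborel1 cong: measurable_cong_sets)
    have [measurable]: "(\<lambda>y. indicator A (J (w(b := y))) :: ennreal) \<in> borel_measurable borel"
      using measurable_compose[OF m, of "\<lambda>w. indicator A (J w) :: ennreal"] by simp
    have "(\<integral>\<^sup>+y. indicator A (J (w(b := y))) \<partial>lborel) = (\<integral>\<^sup>+y. indicator A (J (w(b := w c + y))) \<partial>lborel)"
      by (subst lborel_distr_plus[of "w c", symmetric], subst nn_integral_distr) auto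
    then show "(\<integral>\<^sup>+y. indicator A (J (w(b := y + w c))) \<partial>lborel) = (\<integral>\<^sup>+y. indicator A (J (w(b := y))) \<partial>lborel)"
      by (simp add: add.commute)
  qed
  also have "\<dots> = (\<integral>\<^sup>+w. indicator A (J w) \<partial>(\<Pi>\<^sub>M b\<in>Basis. lborel))"
    by (subst (2) Basis[symmetric], rule product_nn_integral_insert[symmetric]) (auto simp: Basis insert_absorb[OF bc(1)])
  also have "\<dots> = (\<integral>\<^sup>+x. indicator A x \<partial>lborel)"
    by (subst (2) lborel_eq, subst nn_integral_distr) (auto simp: J_def)
  finally show "emeasure (distr lborel borel (\<lambda>x. x + (x \<bullet> c) *\<^sub>R b)) A = emeasure lborel A" by simp
qed simp

lemma linear_lambda_transpose: "linear (\<lambda>x::real^'n. \<chi> i. x $ Transposition.transpose m n i)"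
  by (rule linearI) (auto simp: vec_eq_iff)

lemma borel_measurable_linear:
  fixes f :: "'a::euclidean_space \<Rightarrow> 'b::euclidean_space"
  shows "linear f \<Longrightarrow> f \<in> borel_measurable borel"
  by (simp add: borel_measurable_continuous_onI linear_continuous_on linear_conv_bounded_linear)

text \<open>A permutation of coordinates sends boxes to boxes with the same side lengths, and boxes
  determine the measure.\<close>

lemma lborel_distr_transpose:
  fixes m n :: "'n::finite"
  shows "distr lborel borel (\<lambda>x::real^'n. \<chi> i. x $ Transposition.transpose m n i) = lborel"
    (is "distr lborel borel ?h = _")
proof (rule lborel_eqI[symmetric])
  fix l u :: "real^'n" assume le: "\<And>b. b \<in> Basis \<Longrightarrow> l \<bullet> b \<le> u \<bullet> b"
  have le': "l $ i \<le> u $ i" for i using le[of "axis i 1"] by (simp add: inner_axis axis_in_Basis_iff)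
  have hh: "?h (?h x) = x" for x by (simp add: vec_eq_iff)
  have eq: "?h -` box l u = box (?h l) (?h u)"
    by (auto simp: mem_box_cart) (metis transpose_involutory)+
  have [measurable]: "?h \<in> borel_measurable borel" by (rule borel_measurable_linear[OF linear_lambda_transpose])
  have P: "(\<Prod>b\<in>Basis. f b) = (\<Prod>i\<in>UNIV. f (axis i 1))" for f :: "real^'n \<Rightarrow> real"
  proof -
    have B: "Basis = (\<lambda>i. axis i (1::real)) ` (UNIV::'n set)" by (auto simp: Basis_vec_def)
    show ?thesis unfolding B by (subst prod.reindex) (auto simp: inj_on_def axis_eq_axis)
  qed
  have "emeasure (distr lborel borel ?h) (box l u) = emeasure lborel (box (?h l) (?h u))"
    by (subst emeasure_distr) (auto simp: eq)
  also have "\<dots> = ennreal (\<Prod>b\<in>Basis. (?h u - ?h l) \<bullet> b)"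
    by (rule emeasure_lborel_box) (auto simp: Basis_vec_def inner_axis le')
  also have "(\<Prod>b\<in>Basis. (?h u - ?h l) \<bullet> b) = (\<Prod>i\<in>UNIV. (u - l) $ (Transposition.transpose m n i))"
    by (simp add: P inner_axis)
  also have "\<dots> = (\<Prod>i\<in>UNIV. (u - l) $ i)"
    using prod.permute[OF permutes_swap_id[of m UNIV n], where g="\<lambda>i. (u - l)$i", symmetric] by (simp add: o_def)
  also have "\<dots> = (\<Prod>b\<in>Basis. (u - l) \<bullet> b)" by (simp add: P inner_axis)
  finally show "emeasure (distr lborel borel ?h) (box l u) = ennreal (\<Prod>b\<in>Basis. (u - l) \<bullet> b)" .
qed simp

text \<open>Every linear map is composed of elementary ones, and the formula is multiplicative under
  composition. An identity of measures, rather than of integrals, yields the integral formula and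
  the equivalence of integrability together.\<close>

lemma lborel_density_distr_linear:
  fixes f :: "real^'n \<Rightarrow> real^'n"
  assumes "linear f" "det (matrix f) \<noteq> 0"
  shows "lborel = density (distr lborel borel f) (\<lambda>_. ennreal \<bar>det (matrix f)\<bar>)"
proof -
  \<comment> \<open>The determinant condition moves inside the claim: the induction also visits maps
    with a vanishing coordinate, where the claim holds vacuously.\<close>
  have "linear f \<and> (det (matrix f) \<noteq> 0 \<longrightarrow> lborel = density (distr lborel borel f) (\<lambda>_. ennreal \<bar>det (matrix f)\<bar>))"
  proof (rule induct_linear_elementary[OF assms(1)])
    fix f g :: "real^'n \<Rightarrow> real^'n"
    assume fg: "linear f" "linear g"
      and f: "linear f \<and> (det (matrix f) \<noteq> 0 \<longrightarrow> lborel = density (distr lborel borel f) (\<lambda>_. ennreal \<bar>det (matrix f)\<bar>))"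
      and g: "linear g \<and> (det (matrix g) \<noteq> 0 \<longrightarrow> lborel = density (distr lborel borel g) (\<lambda>_. ennreal \<bar>det (matrix g)\<bar>))"
    have [measurable]: "f \<in> borel_measurable borel" "g \<in> borel_measurable borel"
      using fg by (auto intro: borel_measurable_linear)
    have d: "det (matrix (f \<circ> g)) = det (matrix f) * det (matrix g)"
      by (simp add: matrix_compose fg det_mul)
    have "lborel = density (distr lborel borel (f \<circ> g)) (\<lambda>_. ennreal \<bar>det (matrix (f \<circ> g))\<bar>)"
      if nz: "det (matrix (f \<circ> g)) \<noteq> 0"
    proof -
      have "density (distr lborel borel (f \<circ> g)) (\<lambda>_. ennreal \<bar>det (matrix (f \<circ> g))\<bar>)
         = density (density (distr (distr lborel borel g) borel f) (\<lambda>_. ennreal \<bar>det (matrix g)\<bar>)) (\<lambda>_. ennreal \<bar>det (matrix f)\<bar>)"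
        by (subst density_density_eq) (auto simp: distr_distr d abs_mult ennreal_mult mult.commute)
      also have "density (distr (distr lborel borel g) borel f) (\<lambda>_. ennreal \<bar>det (matrix g)\<bar>)
         = distr (density (distr lborel borel g) (\<lambda>_. ennreal \<bar>det (matrix g)\<bar>)) borel f"
        by (subst density_distr[symmetric]) auto
      also have "density (distr lborel borel g) (\<lambda>_. ennreal \<bar>det (matrix g)\<bar>) = lborel" using g nz d by auto
      finally have "density (distr lborel borel (f \<circ> g)) (\<lambda>_. ennreal \<bar>det (matrix (f \<circ> g))\<bar>)
         = density (distr lborel borel f) (\<lambda>_. ennreal \<bar>det (matrix f)\<bar>)" .
      moreover have "det (matrix f) \<noteq> 0" using nz d by auto
      ultimately show ?thesis using f by metis
    qed
    then show "linear (f \<circ> g) \<and> (det (matrix (f \<circ> g)) \<noteq> 0 \<longrightarrow> lborel = density (distr lborel borel (f \<circ> g)) (\<lambda>_. ennreal \<bar>det (matrix (f \<circ> g))\<bar>))"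
      using fg linear_compose by blast
  next
    fix f :: "real^'n \<Rightarrow> real^'n" and i assume "linear f" and 0: "\<And>x. f x $ i = 0"
    have "row i (matrix f) = 0" by (simp add: row_def matrix_def 0 vec_eq_iff)
    then have "det (matrix f) = 0" by (rule det_zero_row)
    then show "linear f \<and> (det (matrix f) \<noteq> 0 \<longrightarrow> lborel = density (distr lborel borel f) (\<lambda>_. ennreal \<bar>det (matrix f)\<bar>))"
      using \<open>linear f\<close> by simp
  next
    fix c :: "'n \<Rightarrow> real"
    let ?h = "\<lambda>x::real^'n. \<chi> i. c i * x $ i"
    have lin: "linear ?h" by (rule linearI) (auto simp: vec_eq_iff algebra_simps)
    have det: "det (matrix ?h) = (\<Prod>i\<in>UNIV. c i)"
      by (subst det_diagonal) (auto simp: matrix_def axis_def)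
    have B: "Basis = (\<lambda>i. axis i (1::real)) ` (UNIV::'n set)" by (auto simp: Basis_vec_def)
    have "lborel = density (distr lborel borel ?h) (\<lambda>_. ennreal \<bar>det (matrix ?h)\<bar>)" if nz: "det (matrix ?h) \<noteq> 0"
    proof -
      \<comment> \<open>The diagonal entries, reindexed by basis vectors.\<close>
      define C where "C = (\<lambda>b::real^'n. \<Sum>i\<in>UNIV. b $ i * c i)"
      have C: "C (axis i 1) = c i" for i by (simp add: C_def axis_def if_distrib if_distribR cong: if_cong)
      have cn: "c i \<noteq> 0" for i using nz by (simp add: det)
      have "?h = (\<lambda>x. 0 + (\<Sum>j\<in>Basis. (C j * (x \<bullet> j)) *\<^sub>R j))"
      proof
        fix x :: "real^'n"
        have "(\<Sum>j\<in>Basis. (C j * (x \<bullet> j)) *\<^sub>R j) = (\<Sum>i\<in>UNIV. (c i * x $ i) *\<^sub>R axis i 1)"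
          unfolding B by (subst sum.reindex) (auto simp: inj_on_def axis_eq_axis C inner_axis)
        then show "?h x = 0 + (\<Sum>j\<in>Basis. (C j * (x \<bullet> j)) *\<^sub>R j)"
          by (simp add: vec_eq_iff axis_def if_distrib cong: if_cong)
      qed
      moreover have "(\<Prod>j\<in>Basis. \<bar>C j\<bar>) = \<bar>det (matrix ?h)\<bar>"
        unfolding B det by (subst prod.reindex) (auto simp: inj_on_def axis_eq_axis C abs_prod)
      moreover have "C j \<noteq> 0" if "j \<in> Basis" for j using that cn C by (auto simp: B)
      ultimately show ?thesis using lborel_affine_euclidean[of C 0] by simp
    qed
    then show "linear ?h \<and> (det (matrix ?h) \<noteq> 0 \<longrightarrow> lborel = density (distr lborel borel ?h) (\<lambda>_. ennreal \<bar>det (matrix ?h)\<bar>))"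
      using lin by simp
  next
    fix m n :: 'n assume "m \<noteq> n"
    let ?h = "\<lambda>v::real^'n. \<chi> i. v $ Transposition.transpose m n i"
    have "matrix ?h = transpose (\<chi> i j. mat 1 $ i $ Transposition.transpose m n j)"
      by (auto simp: vec_eq_iff transpose_def axis_def mat_def matrix_def)
    then have "\<bar>det (matrix ?h)\<bar> = 1"
      by (simp add: det_permute_columns permutes_swap_id sign_swap_id abs_mult)
    then show "linear ?h \<and> (det (matrix ?h) \<noteq> 0 \<longrightarrow> lborel = density (distr lborel borel ?h) (\<lambda>_. ennreal \<bar>det (matrix ?h)\<bar>))"
      by (simp add: lborel_distr_transpose linear_lambda_transpose density_1)
  next
    fix m n :: 'n assume mn: "m \<noteq> n"
    let ?h = "\<lambda>v::real^'n. \<chi> i. if i = m then v $ m + v $ n else v $ i"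
    have lin: "linear ?h" by (rule linearI) (auto simp: vec_eq_iff algebra_simps)
    have "matrix ?h = (\<chi> k. if k = m then row m (mat 1) + 1 *s row n (mat 1) else row k (mat 1))"
      by (auto simp: vec_eq_iff matrix_def row_def mat_def axis_def)
    then have "det (matrix ?h) = 1" by (simp only: det_row_operation[OF mn] det_I)
    moreover have "?h = (\<lambda>x. x + (x \<bullet> axis n 1) *\<^sub>R axis m 1)"
      by (simp add: fun_eq_iff vec_eq_iff inner_axis) (auto simp: axis_def)
    then have "distr lborel borel ?h = lborel"
      using lborel_distr_shear[of "axis m 1" "axis n (1::real)"] mn by (simp add: axis_eq_axis)
    ultimately show "linear ?h \<and> (det (matrix ?h) \<noteq> 0 \<longrightarrow> lborel = density (distr lborel borel ?h) (\<lambda>_. ennreal \<bar>det (matrix ?h)\<bar>))"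
      using lin by (simp add: density_1)
  qed
  then show ?thesis using assms(2) by simp
qed

lemma
  fixes f :: "real^'n \<Rightarrow> real^'n" and H :: "real^'n \<Rightarrow> real"
  assumes f: "linear f" "det (matrix f) \<noteq> 0" and [measurable]: "H \<in> borel_measurable borel"
  shows lborel_integral_linear: "(\<integral>x. H (f x) \<partial>lborel) = (\<integral>x. H x \<partial>lborel) / \<bar>det (matrix f)\<bar>"
    and lborel_integrable_linear_iff: "integrable lborel (\<lambda>x. H (f x)) \<longleftrightarrow> integrable lborel H"
proof -
  have [measurable]: "f \<in> borel_measurable borel" using f(1) by (rule borel_measurable_linear)
  have "(\<integral>x. H x \<partial>lborel) = (\<integral>x. \<bar>det (matrix f)\<bar> * H (f x) \<partial>lborel)"
    by (subst lborel_density_distr_linear[OF f]) (simp add: integral_density integral_distr)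
  also have "\<dots> = \<bar>det (matrix f)\<bar> * (\<integral>x. H (f x) \<partial>lborel)" by simp
  finally show "(\<integral>x. H (f x) \<partial>lborel) = (\<integral>x. H x \<partial>lborel) / \<bar>det (matrix f)\<bar>" using f(2) by simp
  have "integrable lborel H \<longleftrightarrow> integrable lborel (\<lambda>x. \<bar>det (matrix f)\<bar> * H (f x))"
    by (subst lborel_density_distr_linear[OF f]) (simp add: integrable_density integrable_distr_eq)
  then show "integrable lborel (\<lambda>x. H (f x)) \<longleftrightarrow> integrable lborel H" using f(2) by simp
qed

lemma integrable_exp_norm_square:
  assumes "b > 0" shows "integrable lborel (\<lambda>x::'a::euclidean_space. exp (- b * (norm x)\<^sup>2))"
proof -
  have "(\<integral>\<^sup>+x. ennreal (exp (- b * (norm (x::'a))\<^sup>2)) \<partial>lborel) = (\<integral>\<^sup>+x. (\<Prod>i\<in>(Basis::'a set). ennreal (exp (- b * (x \<bullet> i)\<^sup>2))) \<partial>lborel)"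
  proof (rule nn_integral_cong)
    fix x :: 'a
    have "(norm x)\<^sup>2 = (\<Sum>i\<in>Basis. (x \<bullet> i)\<^sup>2)"
      unfolding power2_norm_eq_inner by (subst euclidean_inner) (simp add: power2_eq_square)
    then show "ennreal (exp (- b * (norm x)\<^sup>2)) = (\<Prod>i\<in>Basis. ennreal (exp (- b * (x \<bullet> i)\<^sup>2)))"
      by (simp add: sum_distrib_left exp_sum prod_ennreal flip: sum_negf)
  qed
  also have "\<dots> = (\<Prod>i\<in>(Basis::'a set). \<integral>\<^sup>+t. ennreal (exp (- b * t\<^sup>2)) \<partial>lborel)"
    by (rule nn_integral_lborel_prod) auto
  also have "\<dots> < \<infinity>"
  proof -
    \<comment> \<open>The standard deviation with \<open>1 / (2 * s^2) = b\<close>, which turns the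
      integrand into a multiple of a normal density.\<close>
    define s where "s = 1 / sqrt (2 * b)"
    have s: "s > 0" "s\<^sup>2 = 1 / (2 * b)" using assms by (auto simp: s_def power_divide)
    have "integrable lborel (\<lambda>t. sqrt (2 * pi * s\<^sup>2) * normal_density 0 s t)"
      using s by (intro integrable_mult_right integrable_normal_density) auto
    also have "(\<lambda>t. sqrt (2 * pi * s\<^sup>2) * normal_density 0 s t) = (\<lambda>t. exp (- b * t\<^sup>2))"
      using s assms by (auto simp: normal_density_def fun_eq_iff)
    finally have "(\<integral>\<^sup>+t. ennreal (exp (- b * t\<^sup>2)) \<partial>lborel) < \<infinity>"
      by (subst nn_integral_eq_integral) auto
    then show ?thesis by (simp add: power_less_top_ennreal)
  qed
  finally show ?thesis by (intro integrableI_bounded) auto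
qed

text \<open>One term of the exponential series at \<open>c * t\<close> is at most the sum, all terms
  being nonnegative.\<close>

lemma power_times_exp_le:
  assumes "c > 0" "(t::real) \<ge> 0"
  shows "t ^ n * exp (- c * t) \<le> fact n / c ^ n"
proof -
  have "(c * t) ^ n / fact n \<le> exp (c * t)" 
  proof -
    have "(\<Sum>k\<le>n. (c * t) ^ k / fact k) \<le> exp (c * t)"
      using exp_lower_Taylor_quadratic assms sum_le_suminf[OF summable_exp[of "c*t"], of "{..n}"]
      by (auto simp: exp_def field_simps)
    moreover have "(c * t) ^ n / fact n \<le> (\<Sum>k\<le>n. (c * t) ^ k / fact k)"
      using assms by (intro member_le_sum) auto
    ultimately show ?thesis by linarith
  qed
  then show ?thesis using assms by (simp add: exp_minus field_simps power_mult_distrib)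
qed

lemma integrable_power_exp_norm_square:
  assumes "b > 0" shows "integrable lborel (\<lambda>x::'a::euclidean_space. norm x ^ n * exp (- b * (norm x)\<^sup>2))"
proof (rule Bochner_Integration.integrable_bound)
  show "integrable lborel (\<lambda>x::'a. (1 + fact n / (b/2) ^ n) * exp (- (b/2) * (norm x)\<^sup>2))"
    using assms by (intro integrable_mult_right integrable_exp_norm_square) auto
  have "norm x ^ n * exp (- b * (norm x)\<^sup>2) \<le> (1 + fact n / (b/2) ^ n) * exp (- (b/2) * (norm x)\<^sup>2)" for x :: 'a
  proof -
    \<comment> \<open>Powers of the squared norm are absorbed by half of the Gaussian through
      \<open>power_times_exp_le\<close>; the other half remains integrable.\<close>
    have "norm x ^ n \<le> 1 + ((norm x)\<^sup>2) ^ n"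
    proof (cases "norm x \<le> 1")
      case True then have "norm x ^ n \<le> 1" by (simp add: power_le_one)
      then show ?thesis by (simp add: add_increasing2)
    next
      case False
      then have "norm x ^ n \<le> norm x ^ (2 * n)" by (intro power_increasing) auto
      then show ?thesis by (simp add: power_mult)
    qed
    then have "norm x ^ n * exp (- (b/2) * (norm x)\<^sup>2) \<le> (1 + ((norm x)\<^sup>2) ^ n) * exp (- (b/2) * (norm x)\<^sup>2)"
      by (intro mult_right_mono) auto
    also have "\<dots> \<le> 1 + fact n / (b/2) ^ n"
    proof -
      have "exp (- (b/2) * (norm x)\<^sup>2) \<le> 1" using assms by simp
      moreover have "((norm x)\<^sup>2) ^ n * exp (- (b/2) * (norm x)\<^sup>2) \<le> fact n / (b/2) ^ n"
        by (rule power_times_exp_le) (use assms in auto)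
      ultimately show ?thesis by (simp only: distrib_right mult_1 add_mono)
    qed
    finally have "norm x ^ n * exp (- (b/2) * (norm x)\<^sup>2) * exp (- (b/2) * (norm x)\<^sup>2)
        \<le> (1 + fact n / (b/2) ^ n) * exp (- (b/2) * (norm x)\<^sup>2)"
      by (intro mult_right_mono) auto
    moreover have "exp (- b * (norm x)\<^sup>2) = exp (- (b/2) * (norm x)\<^sup>2) * exp (- (b/2) * (norm x)\<^sup>2)"
      by (simp flip: exp_add)
    ultimately show ?thesis by (simp add: mult.assoc)
  qed
  then show "AE x::'a in lborel. norm (norm x ^ n * exp (- b * (norm x)\<^sup>2)) 
      \<le> norm ((1 + fact n / (b/2) ^ n) * exp (- (b/2) * (norm x)\<^sup>2))"
    using assms by (intro AE_I2) (auto simp: abs_mult)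
qed simp

section \<open>Powers, positive parts and determinants within the class\<close>

lemma lip2_on_powr_interval:
  fixes lo hi \<beta> :: real
  assumes "0 < lo" shows "lip2_on {lo..hi} (\<lambda>x. x powr \<beta>)"
proof -
  have c: "continuous_on {lo..hi} (\<lambda>x. c * x powr e)" for c e
    using assms by (auto intro!: continuous_intros)
  have B: "\<exists>B. \<forall>x\<in>{lo..hi}. \<bar>c * x powr e\<bar> \<le> B" for c e
  proof -
    have "bounded ((\<lambda>x. c * x powr e) ` {lo..hi})"
      by (intro compact_imp_bounded compact_continuous_image c compact_Icc)
    then obtain B where "\<And>y. y \<in> (\<lambda>x. c * x powr e) ` {lo..hi} \<Longrightarrow> norm y \<le> B" unfolding bounded_iff by blast
    then have "\<forall>x\<in>{lo..hi}. \<bar>c * x powr e\<bar> \<le> B" by (metis imageI real_norm_def)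
    then show ?thesis by blast
  qed
  obtain B0 where B0: "\<And>x. x \<in> {lo..hi} \<Longrightarrow> \<bar>1 * x powr \<beta>\<bar> \<le> B0" using B[of 1 \<beta>] by blast
  obtain B1 where B1: "\<And>x. x \<in> {lo..hi} \<Longrightarrow> \<bar>\<beta> * x powr (\<beta> - 1)\<bar> \<le> B1" using B[of \<beta> "\<beta> - 1"] by blast
  obtain B2 where B2: "\<And>x. x \<in> {lo..hi} \<Longrightarrow> \<bar>\<beta> * (\<beta> - 1) * x powr (\<beta> - 2)\<bar> \<le> B2" using B[of "\<beta> * (\<beta> - 1)" "\<beta> - 2"] by blast
  have d: "((\<lambda>x. \<beta> * x powr (\<beta> - 1)) has_real_derivative \<beta> * (\<beta> - 1) * x powr (\<beta> - 2)) (at x)" if "x \<in> {lo..hi}" for x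
    using assms that by (auto intro!: derivative_eq_intros)
  have L: "\<bar>\<beta> * x powr (\<beta> - 1) - \<beta> * y powr (\<beta> - 1)\<bar> \<le> B2 * \<bar>x - y\<bar>" if "x \<in> {lo..hi}" "y \<in> {lo..hi}" for x y
    using field_differentiable_bound[of "{lo..hi}" "\<lambda>x. \<beta> * x powr (\<beta> - 1)" "\<lambda>x. \<beta> * (\<beta> - 1) * x powr (\<beta> - 2)" B2 x y]
      B2 d that by (auto intro: has_field_derivative_at_within simp: norm_minus_commute)
  show ?thesis
  proof (rule lip2_on_derivI[where F' = "\<lambda>x h. \<beta> * x powr (\<beta> - 1) * h" and ?C0.0 = B0 and ?C1.0 = B1 and ?C2.0 = B2])
    show "((\<lambda>x. x powr \<beta>) has_derivative (*) (\<beta> * x powr (\<beta> - 1))) (at x)" if "x \<in> {lo..hi}" for x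
      unfolding has_field_derivative_def[symmetric] using that assms by (auto intro!: derivative_eq_intros)
    show "norm (\<beta> * x powr (\<beta> - 1) * h - \<beta> * y powr (\<beta> - 1) * h) \<le> B2 * norm (x - y) * norm h"
      if "x \<in> {lo..hi}" "y \<in> {lo..hi}" for x y h
      using mult_right_mono[OF L[OF that] abs_ge_zero[of h]] by (simp flip: abs_mult left_diff_distrib)
    show "norm (\<beta> * x powr (\<beta> - 1) * h) \<le> B1 * norm h" if "x \<in> {lo..hi}" for x h
      using mult_right_mono[OF B1[OF that] abs_ge_zero[of h]] by (simp flip: abs_mult)
  qed (use B0 in auto)
qed

lemma lip2_on_powr:
  fixes F :: "'a::euclidean_space \<Rightarrow> real"
  assumes "convex S" "lip2_on S F" "lo > 0" "\<And>x. x \<in> S \<Longrightarrow> lo \<le> F x"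
  shows "lip2_on S (\<lambda>x. F x powr \<beta>)"
proof -
  obtain C where "C > 0" and C: "\<And>u. u \<in> S \<Longrightarrow> norm (F u) \<le> C" using lip2_onE[OF assms(2)] by metis
  have "F x \<in> {lo..C}" if "x \<in> S" for x using C[OF that] assms(4)[OF that] by auto
  then show ?thesis
    by (intro lip2_on_compose[OF lip2_on_powr_interval[OF assms(3), of C] _ assms(2,1)]) auto
qed

text \<open>The square of a positive part has a Lipschitz derivative but no second derivative at 0.
  It supplies cut-offs of bounded support without recourse to smooth bump functions.\<close>

lemma lip2_on_pos_part_square:
  fixes F :: "'a::euclidean_space \<Rightarrow> real"
  assumes "convex S" "lip2_on S F"
  shows "lip2_on S (\<lambda>x. (max 0 (F x))\<^sup>2)"
proof -
  obtain C where "C > 0" and C: "\<And>u. u \<in> S \<Longrightarrow> norm (F u) \<le> C" using lip2_onE[OF assms(2)] by metis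
  have d: "((\<lambda>t::real. (max 0 t)\<^sup>2) has_real_derivative 2 * max 0 t) (at t)" for t
  proof -
    consider "t > 0" | "t < 0" | "t = 0" by linarith
    then show ?thesis
    proof cases
      case 1
      have "((\<lambda>t::real. t\<^sup>2) has_real_derivative 2 * max 0 t) (at t)" using 1 by (auto intro!: derivative_eq_intros)
      then show ?thesis
        by (rule has_field_derivative_transform_within_open[where S = "{0<..}"]) (use 1 in auto)
    next
      case 2
      have "((\<lambda>t::real. 0) has_real_derivative 2 * max 0 t) (at t)" using 2 by (auto intro!: derivative_eq_intros)
      then show ?thesis
        by (rule has_field_derivative_transform_within_open[where S = "{..<0}"]) (use 2 in auto)
    next
      case 3
      have "((\<lambda>h::real. (max 0 h)\<^sup>2 / h) \<longlongrightarrow> 0) (at 0)"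
      proof (rule Lim_null_comparison[where g = "\<lambda>h. \<bar>h\<bar>"])
        have "norm ((max 0 h)\<^sup>2 / h) \<le> \<bar>h\<bar>" for h :: real by (cases "h \<le> 0") (auto simp: power2_eq_square)
        then show "\<forall>\<^sub>F h in at 0. norm ((max 0 h)\<^sup>2 / h) \<le> \<bar>h\<bar>" by (intro always_eventually) blast
      qed (auto intro!: tendsto_eq_intros)
      then show ?thesis using 3 by (simp add: DERIV_def)
    qed
  qed
  have "lip2_on {-C..C} (\<lambda>t::real. (max 0 t)\<^sup>2)"
  proof (rule lip2_on_derivI[where F' = "\<lambda>x h. 2 * max 0 x * h" and ?C0.0 = "C\<^sup>2" and ?C1.0 = "2 * C" and ?C2.0 = 2])
    show "((\<lambda>t. (max 0 t)\<^sup>2) has_derivative (*) (2 * max 0 x)) (at x)" for x :: real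
      using d unfolding has_field_derivative_def .
    show "norm ((max 0 x)\<^sup>2) \<le> C\<^sup>2" if "x \<in> {-C..C}" for x
    proof -
      have "max 0 x \<le> C" using that \<open>C > 0\<close> by simp
      then show ?thesis by (simp add: power_mono)
    qed
    show "norm (2 * max 0 x * h) \<le> 2 * C * norm h" if "x \<in> {-C..C}" for x h
    proof -
      have "\<bar>2 * max 0 x\<bar> \<le> 2 * C" using that \<open>C > 0\<close> by simp
      from mult_right_mono[OF this abs_ge_zero[of h]] show ?thesis by (simp add: abs_mult)
    qed
    show "norm (2 * max 0 x * h - 2 * max 0 y * h) \<le> 2 * norm (x - y) * norm h" for x y h :: real
    proof -
      have "\<bar>2 * max 0 x - 2 * max 0 y\<bar> \<le> 2 * \<bar>x - y\<bar>" unfolding max_def by (smt (verit))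
      from mult_right_mono[OF this abs_ge_zero[of h]] show ?thesis
        unfolding real_norm_def left_diff_distrib[symmetric] abs_mult[symmetric] .
    qed
  qed auto
  from lip2_on_compose[OF this _ assms(2,1)] show ?thesis using C by (auto simp: abs_le_iff minus_le_iff)
qed

lemma lip2_on_det:
  fixes A :: "'a::euclidean_space \<Rightarrow> real^'d^'d"
  assumes "convex S" "\<And>i j. lip2_on S (\<lambda>x. A x $ i $ j)"
  shows "lip2_on S (\<lambda>x. det (A x))"
  unfolding det_def
  by (intro lip2_on_sum lip2_on_mult lip2_on_prod lip2_on_const assms)

section \<open>Gram determinants and radial moments\<close>

text \<open>Determinants belong to square matrices. A linear map \<open>g\<close> that is isometric
  on the range of \<open>T\<close>, with values in coordinate space, turns \<open>T\<close> into the
  endomorphism \<open>L\<close>; since \<open>g\<close> preserves inner products on that range, the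
  Gram matrix of \<open>T\<close> is the transpose of \<open>matrix L\<close> times
  \<open>matrix L\<close>.\<close>

lemma gram_factorization:
  fixes T :: "real^'d \<Rightarrow> 'a::euclidean_space"
  assumes T: "linear T" "inj T"
  shows "\<exists>(L :: real^'d \<Rightarrow> real^'d) g. linear L \<and> det (matrix L) \<noteq> 0 \<and> linear g \<and> (\<forall>h. L h = g (T h)) \<and>
    (\<forall>v\<in>range T. norm (g v) = norm v) \<and> (\<forall>v\<in>range T. \<forall>w\<in>range T. g v \<bullet> g w = v \<bullet> w) \<and>
    det (\<chi> i j. T (axis i 1) \<bullet> T (axis j 1)) = (det (matrix L))\<^sup>2"
proof -
  have sub: "subspace (range T)" using T(1) by (simp add: linear_subspace_image)
  have dim: "dim (range T) = dim (UNIV :: (real^'d) set)" using dim_image_eq[OF T(1), of UNIV] T(2) by (simp del: dim_UNIV)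
  have "\<exists>g :: 'a \<Rightarrow> real^'d. linear g \<and> (\<forall>x\<in>range T. norm (g x) = norm x)"
  proof (rule isometries_subspaces[OF sub subspace_UNIV dim])
    fix g :: "'a \<Rightarrow> real^'d" assume "linear g" "\<And>x. x \<in> range T \<Longrightarrow> norm (g x) = norm x"
    then show ?thesis by blast
  qed
  then obtain g :: "'a \<Rightarrow> real^'d" where g: "linear g" "\<forall>x\<in>range T. norm (g x) = norm x" by blast
  have gn: "norm (g (T x)) = norm (T x)" for x using g(2) by blast
  have ip: "g (T x) \<bullet> g (T y) = T x \<bullet> T y" for x y
  proof -
    have "norm (g (T x) + g (T y)) = norm (T x + T y)"
      using gn[of "x + y"] by (simp add: linear_add[OF T(1)] linear_add[OF g(1)])
    then show ?thesis by (simp add: dot_norm gn)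
  qed
  define L where "L = (\<lambda>x. g (T x))"
  have L: "linear L" unfolding L_def using linear_compose[OF T(1) g(1)] by (simp add: o_def)
  have "inj L"
    unfolding linear_injective_0[OF L]
  proof (intro allI impI)
    fix x assume "L x = 0"
    then have "T x = 0" using gn[of x] by (simp add: L_def)
    then show "x = 0" using T(2) linear_injective_0[OF T(1)] by blast
  qed
  then have d: "det (matrix L) \<noteq> 0" using det_nz_iff_inj[OF L] by blast
  have "(\<chi> i j. T (axis i 1) \<bullet> T (axis j 1)) = transpose (matrix L) ** matrix L"
  proof -
    have "T (axis i 1) \<bullet> T (axis j 1) = (\<Sum>k\<in>UNIV. L (axis i 1) $ k * L (axis j 1) $ k)" for i j
      unfolding L_def ip[symmetric] inner_vec_def[of "g (T (axis i 1))"] by simp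
    then show ?thesis
      by (simp add: vec_eq_iff matrix_matrix_mult_def transpose_def matrix_def)
  qed
  then have "det (\<chi> i j. T (axis i 1) \<bullet> T (axis j 1)) = (det (matrix L))\<^sup>2"
    by (simp add: det_mul power2_eq_square)
  moreover have "\<forall>v\<in>range T. \<forall>w\<in>range T. g v \<bullet> g w = v \<bullet> w" using ip by blast
  ultimately show ?thesis using L d g by (intro exI[of _ L] exI[of _ g]) (simp add: L_def)
qed

lemma det_gram_pos:
  fixes T :: "real^'d \<Rightarrow> 'a::euclidean_space"
  assumes "linear T" "inj T" shows "det (\<chi> i j. T (axis i 1) \<bullet> T (axis j 1)) > 0"
proof -
  obtain L :: "real^'d \<Rightarrow> real^'d" where "det (matrix L) \<noteq> 0" "det (\<chi> i j. T (axis i 1) \<bullet> T (axis j 1)) = (det (matrix L))\<^sup>2"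
    using gram_factorization[OF assms] by blast
  then show ?thesis by simp
qed

text \<open>The index \<open>undefined\<close> stands for an arbitrary coordinate; for positive
  \<open>n\<close>, rotation invariance as in \<open>integral_radial_inner_power\<close> makes the
  choice immaterial.\<close>

definition radial_moment :: "'d::finite itself \<Rightarrow> (real \<Rightarrow> real) \<Rightarrow> nat \<Rightarrow> real" where
  "radial_moment _ k n = (\<integral>z. k ((norm (z::real^'d))\<^sup>2) * (z $ undefined) ^ n \<partial>lborel)"

context
  fixes k :: "real \<Rightarrow> real" and A a :: real
  assumes k[measurable]: "k \<in> borel_measurable borel"
    and a: "a > 0" and bound: "\<And>s. s \<ge> 0 \<Longrightarrow> \<bar>k s\<bar> \<le> A * exp (- a * s)"
begin

lemma A_nonneg: "A \<ge> 0" using bound[of 0] by simp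

lemma integrable_radial:
  fixes f :: "'a::euclidean_space \<Rightarrow> real"
  assumes [measurable]: "f \<in> borel_measurable borel" and f: "\<And>z. \<bar>f z\<bar> \<le> B * norm z ^ n"
  shows "integrable lborel (\<lambda>z. k ((norm z)\<^sup>2) * f z)"
proof (rule Bochner_Integration.integrable_bound)
  show "integrable lborel (\<lambda>z::'a. (A * B) * (norm z ^ n * exp (- a * (norm z)\<^sup>2)))"
    using a by (intro integrable_mult_right integrable_power_exp_norm_square) auto
  have le: "\<bar>k ((norm z)\<^sup>2) * f z\<bar> \<le> A * exp (- a * (norm z)\<^sup>2) * (B * norm z ^ n)" for z
    unfolding abs_mult using f[of z] bound[of "(norm z)\<^sup>2"] A_nonneg by (intro mult_mono) auto
  then show "AE z in lborel. norm (k ((norm z)\<^sup>2) * f z) \<le> norm ((A * B) * (norm z ^ n * exp (- a * (norm z)\<^sup>2)))"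
  proof (intro AE_I2)
    fix z :: 'a
    have "A * exp (- a * (norm z)\<^sup>2) * (B * norm z ^ n) = (A * B) * (norm z ^ n * exp (- a * (norm z)\<^sup>2))" by simp
    then show "norm (k ((norm z)\<^sup>2) * f z) \<le> norm ((A * B) * (norm z ^ n * exp (- a * (norm z)\<^sup>2)))"
      using le[of z] by (metis abs_ge_self order_trans real_norm_def)
  qed
qed simp

text \<open>A rotation carrying a multiple of the distinguished axis to \<open>c\<close> preserves
  both the measure and the radial factor.\<close>

lemma integral_radial_inner_power:
  fixes c :: "real^'d"
  assumes "n > 0"
  shows "(\<integral>z. k ((norm z)\<^sup>2) * (c \<bullet> z) ^ n \<partial>lborel) = norm c ^ n * radial_moment TYPE('d) k n"
proof -
  let ?e = "axis (undefined::'d) (1::real)"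
  have "norm (norm c *\<^sub>R ?e) = norm c" by (simp add: norm_axis_1)
  then obtain f where f: "orthogonal_transformation f" "f (norm c *\<^sub>R ?e) = c"
    by (rule orthogonal_transformation_exists)
  have lin: "linear f" using f(1) by (rule orthogonal_transformation_linear)
  have "orthogonal_matrix (matrix f)" using f(1) orthogonal_transformation_matrix by blast
  then have det: "\<bar>det (matrix f)\<bar> = 1" using det_orthogonal_matrix by fastforce
  have "c \<bullet> f z = norm c * z $ undefined" for z
  proof -
    have "c \<bullet> f z = f (norm c *\<^sub>R ?e) \<bullet> f z" using f(2) by simp
    also have "\<dots> = (norm c *\<^sub>R ?e) \<bullet> z" using f(1) unfolding orthogonal_transformation_def by blast
    finally show ?thesis by (simp add: inner_axis')
  qed
  then have "(\<integral>z. k ((norm (f z))\<^sup>2) * (c \<bullet> f z) ^ n \<partial>lborel) = norm c ^ n * radial_moment TYPE('d) k n"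
    unfolding radial_moment_def using orthogonal_transformation_norm[OF f(1)]
    by (simp add: power_mult_distrib mult.left_commute)
  moreover have "(\<integral>z. k ((norm (f z))\<^sup>2) * (c \<bullet> f z) ^ n \<partial>lborel) = (\<integral>z. k ((norm z)\<^sup>2) * (c \<bullet> z) ^ n \<partial>lborel)"
    using lborel_integral_linear[OF lin, of "\<lambda>z. k ((norm z)\<^sup>2) * (c \<bullet> z) ^ n"] det by force
  ultimately show ?thesis by simp
qed

text \<open>The squared norm is a sum over \<open>CARD('d)\<close> coordinates with equal moments,
  and the division in \<open>kernel_m2\<close> undoes this sum. This is why the limiting Dirichlet
  form carries no numerical factor.\<close>

lemma kernel_m2_eq_radial_moment: "kernel_m2 TYPE('d::finite) k = radial_moment TYPE('d) k 2"
proof -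
  have "(\<integral>z. (norm (z::real^'d))\<^sup>2 * k ((norm z)\<^sup>2) \<partial>lborel) = (\<integral>z. (\<Sum>i\<in>UNIV. k ((norm z)\<^sup>2) * (axis (i::'d) (1::real) \<bullet> z)\<^sup>2) \<partial>lborel)"
  proof (rule Bochner_Integration.integral_cong)
    fix z :: "real^'d"
    have n: "(norm z)\<^sup>2 = (\<Sum>i\<in>UNIV. (axis i 1 \<bullet> z)\<^sup>2)"
      unfolding power2_norm_eq_inner inner_vec_def[of z z] by (simp add: inner_axis' power2_eq_square)
    have "(\<Sum>i\<in>UNIV. k ((norm z)\<^sup>2) * (axis i 1 \<bullet> z)\<^sup>2) = k ((norm z)\<^sup>2) * (\<Sum>i\<in>UNIV. (axis i 1 \<bullet> z)\<^sup>2)"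
      by (rule sum_distrib_left[symmetric])
    then show "(norm z)\<^sup>2 * k ((norm z)\<^sup>2) = (\<Sum>i\<in>UNIV. k ((norm z)\<^sup>2) * (axis i 1 \<bullet> z)\<^sup>2)"
      by (simp only: n[symmetric] mult.commute)
  qed simp
  also have "\<dots> = (\<Sum>i\<in>UNIV. \<integral>z. k ((norm z)\<^sup>2) * (axis (i::'d) (1::real) \<bullet> z)\<^sup>2 \<partial>lborel)"
  proof (rule Bochner_Integration.integral_sum)
    fix i :: 'd
    show "integrable lborel (\<lambda>z. k ((norm z)\<^sup>2) * (axis i (1::real) \<bullet> z)\<^sup>2)"
      by (rule integrable_radial[where B = 1 and n = 2])
         (auto simp: inner_axis' power2_le_iff_abs_le component_le_norm_cart)
  qed
  also have "\<dots> = real CARD('d) * radial_moment TYPE('d) k 2"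
    by (simp add: integral_radial_inner_power norm_axis_1)
  finally show ?thesis by (simp add: kernel_m2_def)
qed

lemma integral_kernel_linear:
  fixes T :: "real^'d \<Rightarrow> 'a::euclidean_space"
  assumes T: "linear T" "inj T" and v: "v \<in> range T" and "n > 0" "s > 0"
  shows "(\<integral>h. k ((norm (T h))\<^sup>2 / s\<^sup>2) * (v \<bullet> T h) ^ n \<partial>lborel)
    = s ^ (CARD('d) + n) * norm v ^ n * radial_moment TYPE('d) k n / sqrt (det (\<chi> i j. T (axis i 1) \<bullet> T (axis j 1)))"
proof -
  obtain L g where L: "linear L" "det (matrix L) \<noteq> 0" "linear (g :: 'a \<Rightarrow> real^'d)" "\<forall>h. L h = g (T h)"
    "\<forall>v\<in>range T. norm (g v) = norm v" "\<forall>v\<in>range T. \<forall>w\<in>range T. g v \<bullet> g w = v \<bullet> w"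
    "det (\<chi> i j. T (axis i 1) \<bullet> T (axis j 1)) = (det (matrix L))\<^sup>2"
    using gram_factorization[OF T] by blast
  let ?H = "\<lambda>y. k ((norm y)\<^sup>2 / s\<^sup>2) * (g v \<bullet> y) ^ n"
  have "(\<integral>h. k ((norm (T h))\<^sup>2 / s\<^sup>2) * (v \<bullet> T h) ^ n \<partial>lborel) = (\<integral>h. ?H (L h) \<partial>lborel)"
  proof (rule Bochner_Integration.integral_cong)
    fix h
    have "norm (L h) = norm (T h)" "g v \<bullet> L h = v \<bullet> T h" using v L(4,5,6) by auto
    then show "k ((norm (T h))\<^sup>2 / s\<^sup>2) * (v \<bullet> T h) ^ n = ?H (L h)" by simp
  qed simp
  also have "\<dots> = (\<integral>h. ?H h \<partial>lborel) / \<bar>det (matrix L)\<bar>"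
    by (rule lborel_integral_linear[OF L(1,2)]) simp
  also have "(\<integral>h. ?H h \<partial>lborel) = s ^ CARD('d) * (\<integral>z. ?H (s *\<^sub>R z) \<partial>lborel)"
    using lborel_integral_linear[of "(*\<^sub>R) s" ?H] \<open>s > 0\<close>
    by (simp add: linear_scaleR det_matrix_scaleR)
  also have "(\<integral>z. ?H (s *\<^sub>R z) \<partial>lborel) = (\<integral>z. s ^ n * (k ((norm z)\<^sup>2) * (g v \<bullet> z) ^ n) \<partial>lborel)"
  proof (rule Bochner_Integration.integral_cong)
    fix z :: "real^'d"
    have "(norm (s *\<^sub>R z))\<^sup>2 / s\<^sup>2 = (norm z)\<^sup>2" using \<open>s > 0\<close> by (simp add: power_mult_distrib)
    moreover have "(g v \<bullet> (s *\<^sub>R z)) ^ n = s ^ n * (g v \<bullet> z) ^ n" by (simp add: power_mult_distrib)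
    ultimately show "?H (s *\<^sub>R z) = s ^ n * (k ((norm z)\<^sup>2) * (g v \<bullet> z) ^ n)" by simp
  qed simp
  also have "\<dots> = s ^ n * (\<integral>z. k ((norm z)\<^sup>2) * (g v \<bullet> z) ^ n \<partial>lborel)" by simp
  also have "(\<integral>z. k ((norm z)\<^sup>2) * (g v \<bullet> z) ^ n \<partial>lborel) = norm v ^ n * radial_moment TYPE('d) k n"
  proof -
    have "norm (g v) = norm v" using L(5) v by blast
    then show ?thesis by (simp add: integral_radial_inner_power[OF \<open>n > 0\<close>])
  qed
  finally show ?thesis by (simp add: L(7) power_add)
qed

end

lemma integral_power_exp_scaled:
  assumes "\<epsilon> > 0"
  shows "(\<integral>h. norm (h::real^'d) ^ n * exp (- b * (norm h)\<^sup>2 / \<epsilon>) \<partial>lborel)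
     = sqrt \<epsilon> ^ (CARD('d) + n) * (\<integral>z. norm (z::real^'d) ^ n * exp (- b * (norm z)\<^sup>2) \<partial>lborel)"
    and "b > 0 \<Longrightarrow> integrable lborel (\<lambda>h::real^'d. norm h ^ n * exp (- b * (norm h)\<^sup>2 / \<epsilon>))"
proof -
  let ?H = "\<lambda>h::real^'d. norm h ^ n * exp (- b * (norm h)\<^sup>2 / \<epsilon>)"
  have s: "sqrt \<epsilon> > 0" using assms by simp
  have "(\<integral>z. ?H (sqrt \<epsilon> *\<^sub>R z) \<partial>lborel) = (\<integral>h. ?H h \<partial>lborel) / sqrt \<epsilon> ^ CARD('d)"
    using lborel_integral_linear[of "(*\<^sub>R) (sqrt \<epsilon>)" ?H] s by (simp add: linear_scaleR det_matrix_scaleR)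
  moreover have "?H (sqrt \<epsilon> *\<^sub>R z) = sqrt \<epsilon> ^ n * (norm z ^ n * exp (- b * (norm z)\<^sup>2))" for z
  proof -
    have "norm (sqrt \<epsilon> *\<^sub>R z) = sqrt \<epsilon> * norm z" using s by simp
    moreover have "- b * (sqrt \<epsilon> * norm z)\<^sup>2 / \<epsilon> = - b * (norm z)\<^sup>2"
      using assms by (simp add: power_mult_distrib)
    ultimately show ?thesis by (simp only: power_mult_distrib mult.assoc)
  qed
  ultimately show "(\<integral>h. norm (h::real^'d) ^ n * exp (- b * (norm h)\<^sup>2 / \<epsilon>) \<partial>lborel)
     = sqrt \<epsilon> ^ (CARD('d) + n) * (\<integral>z. norm (z::real^'d) ^ n * exp (- b * (norm z)\<^sup>2) \<partial>lborel)"
    using s by (simp add: field_simps power_add)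
  show "integrable lborel ?H" if "b > 0"
    using integrable_power_exp_norm_square[of "b / \<epsilon>" n, where 'a = "real^'d"] assms that by simp
qed

section \<open>Local parametrizations and the gradient\<close>

lemma local_paramD:
  assumes "local_param M V \<phi>"
  shows "open V" "smooth_on V \<phi>" "\<And>u. u \<in> V \<Longrightarrow> inj (frechet_derivative \<phi> (at u))"
    "openin (top_of_set M) (\<phi> ` V)" "\<phi> ` V \<subseteq> M" "continuous_on V \<phi>" "inj_on \<phi> V"
    "\<And>u. u \<in> V \<Longrightarrow> linear (frechet_derivative \<phi> (at u))"
    "\<And>u. u \<in> V \<Longrightarrow> (\<phi> has_derivative frechet_derivative \<phi> (at u)) (at u)"
proof -
  show *: "open V" "smooth_on V \<phi>" "\<And>u. u \<in> V \<Longrightarrow> inj (frechet_derivative \<phi> (at u))"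
    "openin (top_of_set M) (\<phi> ` V)"
    using assms by (simp_all add: local_param_def)
  show "\<phi> ` V \<subseteq> M" using openin_imp_subset[OF *(4)] .
  show "continuous_on V \<phi>" using Ck_on_continuous_on[OF smooth_on_Ck_on[OF *(2)]] .
  obtain \<psi> where "homeomorphism V (\<phi> ` V) \<phi> \<psi>" using assms unfolding local_param_def by blast
  then show "inj_on \<phi> V" by (intro inj_on_inverseI[where g = \<psi>]) (rule homeomorphism_apply1)
  show "\<And>u. u \<in> V \<Longrightarrow> linear (frechet_derivative \<phi> (at u))"
    by (rule smooth_on_linear[OF *(2)])
  show "\<And>u. u \<in> V \<Longrightarrow> (\<phi> has_derivative frechet_derivative \<phi> (at u)) (at u)"
    by (rule smooth_on_has_derivative[OF *(2)])
qed

text \<open>The transition map is continuous because parametrizations are homeomorphisms onto their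
  images. Its differentiability at the single point \<open>u1\<close> is deduced from a left inverse
  of the derivative of \<open>\<phi>2\<close>; this is enough to compare gradients in two
  charts.\<close>

lemma local_param_transition:
  fixes \<phi>1 \<phi>2 :: "real^'d \<Rightarrow> 'a::euclidean_space"
  assumes 1: "local_param M V1 \<phi>1" "u1 \<in> V1" and 2: "local_param M V2 \<phi>2" "u2 \<in> V2"
    and eq: "\<phi>1 u1 = \<phi>2 u2"
  shows "\<exists>\<theta> B. (\<theta> has_derivative B) (at u1) \<and> \<theta> u1 = u2 \<and> (\<forall>\<^sub>F u in nhds u1. \<phi>2 (\<theta> u) = \<phi>1 u)"
proof -
  let ?D1 = "frechet_derivative \<phi>1 (at u1)" and ?D2 = "frechet_derivative \<phi>2 (at u2)"
  note P1 = local_paramD[OF 1(1)] and P2 = local_paramD[OF 2(1)]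
  obtain \<psi> where \<psi>: "homeomorphism V2 (\<phi>2 ` V2) \<phi>2 \<psi>" using 2(1) unfolding local_param_def by blast
  obtain Q where Q: "open Q" "\<phi>2 ` V2 = M \<inter> Q" using P2(4) by (auto simp: openin_open)
  define W where "W = V1 \<inter> \<phi>1 -` Q"
  have W: "open W" unfolding W_def using continuous_open_preimage[OF P1(6,1) Q(1)] .
  have u1W: "u1 \<in> W" using 1(2) eq 2(2) Q(2) by (auto simp: W_def)
  have \<phi>1W: "\<phi>1 ` W \<subseteq> \<phi>2 ` V2" using P1(5) Q(2) by (auto simp: W_def)
  define \<theta> where "\<theta> = (\<lambda>u. \<psi> (\<phi>1 u))"
  have \<theta>: "\<phi>2 (\<theta> u) = \<phi>1 u" if "u \<in> W" for u
    using \<phi>1W that homeomorphism_apply2[OF \<psi>] unfolding \<theta>_def by blast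
  have \<theta>1: "\<theta> u1 = u2" using \<psi> 2(2) eq by (simp add: \<theta>_def homeomorphism_apply1)
  have "continuous_on W \<phi>1" using P1(6) by (rule continuous_on_subset) (auto simp: W_def)
  then have "continuous_on W \<theta>"
    unfolding \<theta>_def by (rule continuous_on_compose2[OF homeomorphism_cont2[OF \<psi>] _ \<phi>1W])
  then have cont\<theta>: "isCont \<theta> u1" using W u1W by (simp add: continuous_on_eq_continuous_at)
  obtain \<pi> where \<pi>: "linear \<pi>" "\<pi> \<circ> ?D2 = id"
    using linear_injective_left_inverse[OF P2(8)[OF 2(2)] P2(3)[OF 2(2)]] by blast
  have \<pi>D: "\<pi> (?D2 h) = h" for h using \<pi>(2) by (metis comp_apply id_apply)
  obtain P where P: "P > 0" "\<And>x. norm (\<pi> x) \<le> P * norm x"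
    using linear_bounded_pos[OF \<pi>(1)] by blast
  \<comment> \<open>The only possible derivative: differentiate
    \<open>\<phi>2 (\<theta> u) = \<phi>1 u\<close> and apply \<open>\<pi>\<close>.\<close>
  define B where "B = (\<lambda>h. \<pi> (?D1 h))"
  have lB: "linear B" unfolding B_def
    using linear_compose[OF P1(8)[OF 1(2)] \<pi>(1)] by (simp add: o_def)
  obtain K where K: "K > 0" "\<And>x. norm (B x) \<le> K * norm x"
    using linear_bounded_pos[OF lB] by blast
  have der1: "\<forall>e>0. \<exists>d>0. \<forall>y. norm (y - u1) < d \<longrightarrow> norm (\<phi>1 y - \<phi>1 u1 - ?D1 (y - u1)) \<le> e * norm (y - u1)"
    using P1(9)[OF 1(2)] unfolding has_derivative_at_alt by blast
  have der2: "\<forall>e>0. \<exists>d>0. \<forall>y. norm (y - u2) < d \<longrightarrow> norm (\<phi>2 y - \<phi>2 u2 - ?D2 (y - u2)) \<le> e * norm (y - u2)"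
    using P2(9)[OF 2(2)] unfolding has_derivative_at_alt by blast
  have main: "\<exists>d>0. \<forall>u. norm (u - u1) < d \<longrightarrow> norm (\<theta> u - \<theta> u1 - B (u - u1)) \<le> e * norm (u - u1)" if "e > 0" for e
  proof -
    \<comment> \<open>The first bound makes \<open>P * e2 \<le> 1/2\<close>, so that the term in
      \<open>norm (\<theta> u - u2)\<close> is absorbed on the left; the second makes its final
      contribution at most half of \<open>e\<close>.\<close>
    define e2 where "e2 = min (1 / (2 * P)) (e / (4 * P * (K + P)))"
    have e20: "e2 > 0" using P(1) K(1) \<open>e > 0\<close> by (simp add: e2_def)
    have "P * e2 \<le> P * (1 / (2 * P))" using P(1) by (intro mult_left_mono) (auto simp: e2_def)
    then have e21: "P * e2 \<le> 1/2" using P(1) by simp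
    have "P * e2 * (2 * (K + P)) \<le> P * (e / (4 * P * (K + P))) * (2 * (K + P))" 
      using P(1) K(1) by (intro mult_left_mono mult_right_mono) (auto simp: e2_def)
    also have "\<dots> = e / 2"
    proof -
      define R where "R = K + P"
      have "R \<noteq> 0" "P \<noteq> 0" using P(1) K(1) by (auto simp: R_def)
      then show ?thesis unfolding R_def[symmetric] by (simp add: field_simps)
    qed
    finally have e22: "P * e2 * (2 * (K + P)) \<le> e / 2" .
    define e1 where "e1 = min 1 (e / (2 * P))"
    have e10: "e1 > 0" "e1 \<le> 1" using P(1) \<open>e > 0\<close> by (auto simp: e1_def)
    have "P * e1 \<le> P * (e / (2 * P))" using P(1) by (intro mult_left_mono) (auto simp: e1_def)
    then have e11: "P * e1 \<le> e / 2" using P(1) by simp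
    obtain d1 where d1: "d1 > 0" "\<And>y. norm (y - u1) < d1 \<Longrightarrow> norm (\<phi>1 y - \<phi>1 u1 - ?D1 (y - u1)) \<le> e1 * norm (y - u1)"
      using der1 e10(1) by blast
    obtain d2 where d2: "d2 > 0" "\<And>y. norm (y - u2) < d2 \<Longrightarrow> norm (\<phi>2 y - \<phi>2 u2 - ?D2 (y - u2)) \<le> e2 * norm (y - u2)"
      using der2 e20 by blast
    obtain d3 where d3: "d3 > 0" "\<And>u. norm (u - u1) < d3 \<Longrightarrow> norm (\<theta> u - u2) < d2"
      using cont\<theta> d2(1) unfolding continuous_at_eps_delta dist_norm \<theta>1 by blast
    obtain d4 where d4: "d4 > 0" "ball u1 d4 \<subseteq> W" using W u1W open_contains_ball by blast
    define d where "d = min d1 (min d3 d4)"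
    have "norm (\<theta> u - \<theta> u1 - B (u - u1)) \<le> e * norm (u - u1)" if u: "norm (u - u1) < d" for u
    proof -
      have "u \<in> ball u1 d4" using u by (simp add: d_def dist_norm norm_minus_commute)
      then have uW: "u \<in> W" using d4 by blast
      let ?s = "\<phi>1 u - \<phi>1 u1 - ?D1 (u - u1)" and ?r = "\<phi>2 (\<theta> u) - \<phi>2 u2 - ?D2 (\<theta> u - u2)"
      have s: "norm ?s \<le> e1 * norm (u - u1)" using d1(2) u by (simp add: d_def)
      have r: "norm ?r \<le> e2 * norm (\<theta> u - u2)" using d2(2) d3(2) u by (simp add: d_def)
      have "?D2 (\<theta> u - u2) = ?D1 (u - u1) + ?s - ?r" using \<theta>[OF uW] eq by simp
      then have "\<pi> (?D2 (\<theta> u - u2)) = \<pi> (?D1 (u - u1) + ?s - ?r)" by (rule arg_cong)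
      then have id: "\<theta> u - u2 = B (u - u1) + \<pi> ?s - \<pi> ?r"
        unfolding B_def \<pi>D by (simp only: linear_add[OF \<pi>(1)] linear_diff[OF \<pi>(1)])
      have ns: "norm (\<pi> ?s) \<le> P * (e1 * norm (u - u1))" 
        by (rule order_trans[OF P(2) mult_left_mono[OF s]]) (use P(1) in simp)
      have nr: "norm (\<pi> ?r) \<le> P * (e2 * norm (\<theta> u - u2))" 
        by (rule order_trans[OF P(2) mult_left_mono[OF r]]) (use P(1) in simp)
      have "norm (\<theta> u - u2) = norm (B (u - u1) + \<pi> ?s - \<pi> ?r)" by (rule arg_cong[OF id])
      also have "\<dots> \<le> norm (B (u - u1)) + norm (\<pi> ?s) + norm (\<pi> ?r)"
        by (rule order_trans[OF norm_triangle_ineq4 add_right_mono[OF norm_triangle_ineq]])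
      also have "\<dots> \<le> K * norm (u - u1) + P * norm (u - u1) + (1/2) * norm (\<theta> u - u2)"
      proof (intro add_mono)
        show "norm (B (u - u1)) \<le> K * norm (u - u1)" by (rule K(2))
        have "P * (e1 * norm (u - u1)) \<le> P * (1 * norm (u - u1))" 
          using P(1) e10 by (intro mult_left_mono mult_right_mono) auto
        then show "norm (\<pi> ?s) \<le> P * norm (u - u1)" using ns by simp
        have "P * e2 * norm (\<theta> u - u2) \<le> (1/2) * norm (\<theta> u - u2)" using e21 by (rule mult_right_mono) simp
        then show "norm (\<pi> ?r) \<le> (1/2) * norm (\<theta> u - u2)" using nr by simp
      qed
      \<comment> \<open>Linear growth of \<open>\<theta>\<close>, which converts an error relative
        to \<open>norm (\<theta> u - u2)\<close> into one relative to
        \<open>norm (u - u1)\<close>.\<close>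
      finally have n: "norm (\<theta> u - u2) \<le> 2 * (K + P) * norm (u - u1)" by (simp add: algebra_simps)
      have "\<theta> u - \<theta> u1 - B (u - u1) = \<pi> ?s - \<pi> ?r" unfolding \<theta>1 by (subst id) simp
      then have "norm (\<theta> u - \<theta> u1 - B (u - u1)) \<le> norm (\<pi> ?s) + norm (\<pi> ?r)" 
        by (metis norm_triangle_ineq4)
      also have "\<dots> \<le> P * (e1 * norm (u - u1)) + P * (e2 * (2 * (K + P) * norm (u - u1)))"
      proof (rule add_mono[OF ns order_trans[OF nr]])
        show "P * (e2 * norm (\<theta> u - u2)) \<le> P * (e2 * (2 * (K + P) * norm (u - u1)))"
          using n P(1) e20 by (intro mult_left_mono) auto
      qed
      also have "\<dots> = (P * e1 + P * e2 * (2 * (K + P))) * norm (u - u1)" by (simp add: algebra_simps)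
      also have "\<dots> \<le> e * norm (u - u1)" using e11 e22 by (intro mult_right_mono) auto
      finally show ?thesis .
    qed
    moreover have "d > 0" using d1(1) d3(1) d4(1) by (simp add: d_def)
    ultimately show ?thesis by blast
  qed
  have "(\<theta> has_derivative B) (at u1)"
    unfolding has_derivative_at_alt using main lB linear_conv_bounded_linear by blast
  moreover have "\<forall>\<^sub>F u in nhds u1. \<phi>2 (\<theta> u) = \<phi>1 u"
    using eventually_nhds_in_open[OF W u1W] by (rule eventually_mono) (rule \<theta>)
  ultimately show ?thesis using \<theta>1 by blast
qed

lemma frechet_derivative_transition:
  fixes g :: "'a::euclidean_space \<Rightarrow> 'b::real_normed_vector" and \<phi>1 \<phi>2 :: "real^'d \<Rightarrow> 'a"
  assumes \<theta>: "(\<theta> has_derivative B) (at u1)" "\<theta> u1 = u2" "\<forall>\<^sub>F u in nhds u1. \<phi>2 (\<theta> u) = \<phi>1 u"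
    and g: "(\<lambda>u. g (\<phi>2 u)) differentiable (at u2)"
  shows "frechet_derivative (\<lambda>u. g (\<phi>1 u)) (at u1) h = frechet_derivative (\<lambda>u. g (\<phi>2 u)) (at u2) (B h)"
proof -
  have "((\<lambda>u. g (\<phi>2 u)) has_derivative frechet_derivative (\<lambda>u. g (\<phi>2 u)) (at u2)) (at (\<theta> u1))"
    using g by (simp add: \<theta>(2) frechet_derivative_works)
  from has_derivative_compose[OF \<theta>(1) this]
  have *: "((\<lambda>u. g (\<phi>2 (\<theta> u))) has_derivative (\<lambda>h. frechet_derivative (\<lambda>u. g (\<phi>2 u)) (at u2) (B h))) (at u1)" .
  obtain S where S: "open S" "u1 \<in> S" "\<And>u. u \<in> S \<Longrightarrow> \<phi>2 (\<theta> u) = \<phi>1 u"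
    using \<theta>(3) unfolding eventually_nhds by blast
  have "((\<lambda>u. g (\<phi>1 u)) has_derivative (\<lambda>h. frechet_derivative (\<lambda>u. g (\<phi>2 u)) (at u2) (B h))) (at u1)"
    by (rule has_derivative_transform_within_open[OF * S(1,2)]) (simp add: S(3))
  from frechet_derivative_at[OF this] show ?thesis by metis
qed

text \<open>Compose \<open>l\<close> with a left inverse of \<open>T\<close>, represent the
  resulting functional on the ambient space by a vector, and project this vector orthogonally onto
  the range.\<close>

lemma riesz_on_range:
  fixes T :: "real^'d \<Rightarrow> 'a::euclidean_space" and l :: "real^'d \<Rightarrow> real"
  assumes T: "linear T" "inj T" and l: "linear l"
  shows "\<exists>v\<in>range T. \<forall>w. v \<bullet> T w = l w"
proof -
  obtain T' where T': "linear T'" "T' \<circ> T = id" using linear_injective_left_inverse[OF T] by blast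
  have lin: "linear (\<lambda>y. l (T' y))" using linear_compose[OF T'(1) l] by (simp add: o_def)
  define c where "c = (\<Sum>b\<in>Basis. l (T' b) *\<^sub>R b)"
  have c: "c \<bullet> y = l (T' y)" for y
  proof -
    have "l (T' y) = (\<Sum>b\<in>Basis. (y \<bullet> b) *\<^sub>R l (T' b))" by (rule linear_eq_sum_Basis[OF lin])
    then show ?thesis by (simp add: c_def inner_sum_left mult.commute inner_commute[of y])
  qed
  have span: "span (range T) = range T" using T(1) by (simp add: linear_subspace_image span_eq_iff)
  have "\<exists>v z. v \<in> range T \<and> (\<forall>w\<in>range T. orthogonal z w) \<and> c = v + z"
  proof (rule orthogonal_subspace_decomp_exists[of "range T" c])
    fix v z assume "v \<in> span (range T)" "\<And>w. w \<in> span (range T) \<Longrightarrow> orthogonal z w" "c = v + z"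
    then show ?thesis unfolding span by blast
  qed
  then obtain v z where vz: "v \<in> range T" "\<forall>w\<in>range T. orthogonal z w" "c = v + z" by blast
  have "v \<bullet> T w = l w" for w
  proof -
    have "z \<bullet> T w = 0" using vz(2) by (auto simp: orthogonal_def)
    then have "v \<bullet> T w = c \<bullet> T w" by (simp add: vz(3) inner_add_left)
    also have "\<dots> = l w" unfolding c using T'(2) by (metis comp_apply id_apply)
    finally show ?thesis .
  qed
  then show ?thesis using vz(1) by blast
qed

text \<open>Discharges the definite description. Existence is Riesz representation on the tangent
  space. For uniqueness, a change of chart transforms the differentials of \<open>\<phi>\<close> and
  of \<open>f \<circ> \<phi>\<close> by the same \<open>B\<close>, so two candidates lie in one
  tangent space and have equal products with it; their difference is orthogonal to itself.\<close>

lemma manifold_grad_local_param: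
  fixes \<phi> :: "real^'d \<Rightarrow> 'a::euclidean_space"
  assumes f: "smooth_fun TYPE('d) M f" and lp: "local_param M V \<phi>" "u \<in> V"
  shows "manifold_grad TYPE('d) M f (\<phi> u) \<in> range (frechet_derivative \<phi> (at u)) \<and>
    (\<forall>w. manifold_grad TYPE('d) M f (\<phi> u) \<bullet> frechet_derivative \<phi> (at u) w = frechet_derivative (f \<circ> \<phi>) (at u) w)"
proof -
  have diff: "(f \<circ> \<phi>) differentiable (at u)" if "local_param M V \<phi>" "u \<in> V" for V and \<phi> :: "real^'d \<Rightarrow> 'a" and u
  proof -
    have "smooth_on V (f \<circ> \<phi>)" using f that unfolding smooth_fun_def by blast
    then show ?thesis using smooth_on_has_derivative that(2) differentiable_def by blast
  qed
  have chg: "\<exists>B. \<forall>h. frechet_derivative \<phi>1 (at u1) h = frechet_derivative \<phi>2 (at u2) (B h) \<and>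
      frechet_derivative (f \<circ> \<phi>1) (at u1) h = frechet_derivative (f \<circ> \<phi>2) (at u2) (B h)"
    if 1: "local_param M V1 \<phi>1" "u1 \<in> V1" and 2: "local_param M V2 \<phi>2" "u2 \<in> V2" and eq: "\<phi>1 u1 = \<phi>2 u2"
    for V1 V2 and \<phi>1 \<phi>2 :: "real^'d \<Rightarrow> 'a" and u1 u2
  proof -
    obtain \<theta> B where \<theta>: "(\<theta> has_derivative B) (at u1)" "\<theta> u1 = u2" "\<forall>\<^sub>F u in nhds u1. \<phi>2 (\<theta> u) = \<phi>1 u"
      using local_param_transition[OF 1 2 eq] by blast
    \<comment> \<open>With \<open>id\<close> the transition rule applies to the parametrization
      itself, with the same \<open>B\<close> as for \<open>f\<close>.\<close>
    have d1: "(\<lambda>u. id (\<phi>2 u)) differentiable (at u2)"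
      using local_paramD(9)[OF 2] by (auto simp: differentiable_def)
    have d2: "(\<lambda>u. f (\<phi>2 u)) differentiable (at u2)" using diff[OF 2] by (simp add: o_def)
    show ?thesis
      using frechet_derivative_transition[OF \<theta> d1] frechet_derivative_transition[OF \<theta> d2]
      by (intro exI[of _ B]) (simp add: o_def)
  qed
  have lin: "linear (frechet_derivative (f \<circ> \<phi>) (at u))"
    by (rule linear_frechet_derivative[OF diff[OF lp]])
  obtain v where v: "v \<in> range (frechet_derivative \<phi> (at u))" 
    "\<And>w. v \<bullet> frechet_derivative \<phi> (at u) w = frechet_derivative (f \<circ> \<phi>) (at u) w"
    using riesz_on_range[OF local_paramD(8)[OF lp] local_paramD(3)[OF lp] lin] by blast
  have "manifold_grad TYPE('d) M f (\<phi> u) = v"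
    unfolding manifold_grad_def
  proof (rule the_equality)
    show "\<exists>(V :: (real ^ 'd) set) \<phi>' u'. local_param M V \<phi>' \<and> u' \<in> V \<and> \<phi>' u' = \<phi> u \<and>
        v \<in> range (frechet_derivative \<phi>' (at u')) \<and>
        (\<forall>w. v \<bullet> frechet_derivative \<phi>' (at u') w = frechet_derivative (f \<circ> \<phi>') (at u') w)"
      using lp v by blast
  next
    fix v' assume "\<exists>(V :: (real ^ 'd) set) \<phi>' u'. local_param M V \<phi>' \<and> u' \<in> V \<and> \<phi>' u' = \<phi> u \<and>
        v' \<in> range (frechet_derivative \<phi>' (at u')) \<and>
        (\<forall>w. v' \<bullet> frechet_derivative \<phi>' (at u') w = frechet_derivative (f \<circ> \<phi>') (at u') w)"
    then obtain V' :: "(real ^ 'd) set" and \<phi>' u' where lp': "local_param M V' \<phi>'" "u' \<in> V'" and eq: "\<phi>' u' = \<phi> u"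
      and v': "v' \<in> range (frechet_derivative \<phi>' (at u'))"
        "\<And>w. v' \<bullet> frechet_derivative \<phi>' (at u') w = frechet_derivative (f \<circ> \<phi>') (at u') w" by blast
    obtain B where B: "\<And>h. frechet_derivative \<phi> (at u) h = frechet_derivative \<phi>' (at u') (B h)"
      "\<And>h. frechet_derivative (f \<circ> \<phi>) (at u) h = frechet_derivative (f \<circ> \<phi>') (at u') (B h)"
      using chg[OF lp lp' eq[symmetric]] by blast
    obtain B' where B': "\<And>h. frechet_derivative \<phi>' (at u') h = frechet_derivative \<phi> (at u) (B' h)"
      using chg[OF lp' lp eq] by blast
    have r: "v' \<in> range (frechet_derivative \<phi> (at u))" using v'(1) B' by auto
    have 0: "(v' - v) \<bullet> frechet_derivative \<phi> (at u) w = 0" for w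
    proof -
      have "v' \<bullet> frechet_derivative \<phi> (at u) w = frechet_derivative (f \<circ> \<phi>) (at u) w"
        by (simp only: B v'(2))
      then show ?thesis by (simp add: inner_diff_left v(2))
    qed
    have "subspace (range (frechet_derivative \<phi> (at u)))"
      by (rule linear_subspace_image[OF local_paramD(8)[OF lp] subspace_UNIV])
    then have "v' - v \<in> range (frechet_derivative \<phi> (at u))" by (rule subspace_diff[OF _ r v(1)])
    then obtain w where "v' - v = frechet_derivative \<phi> (at u) w" by blast
    then have "(v' - v) \<bullet> (v' - v) = 0" using 0[of w] by simp
    then show "v' = v" by simp
  qed
  then show ?thesis using v by auto
qed

text \<open>Smoothness speaks of compositions with parametrizations only; continuity on
  \<open>M\<close> is recovered through the inverse homeomorphism of a chart.\<close>

lemma smooth_fun_continuous_on: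
  fixes M :: "'a::euclidean_space set"
  assumes M: "smooth_submanifold TYPE('d::finite) M" and f: "smooth_fun TYPE('d) M f"
  shows "continuous_on M f"
  unfolding continuous_on_eq_continuous_within
proof
  fix x assume "x \<in> M"
  then obtain V :: "(real^'d) set" and \<phi> where lp: "local_param M V \<phi>" "x \<in> \<phi> ` V"
    using M unfolding smooth_submanifold_def by blast
  obtain \<psi> where \<psi>: "homeomorphism V (\<phi> ` V) \<phi> \<psi>" using lp unfolding local_param_def by blast
  obtain Q where Q: "open Q" "\<phi> ` V = M \<inter> Q" using local_paramD(4)[OF lp(1)] by (auto simp: openin_open)
  have "smooth_on V (f \<circ> \<phi>)" using f lp(1) unfolding smooth_fun_def by blast
  then have "continuous_on V (f \<circ> \<phi>)" using Ck_on_continuous_on smooth_on_Ck_on by blast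
  then have "continuous_on (\<phi> ` V) (\<lambda>y. (f \<circ> \<phi>) (\<psi> y))"
    by (rule continuous_on_compose2[OF _ homeomorphism_cont2[OF \<psi>]]) (simp add: homeomorphism_image2[OF \<psi>])
  then have "continuous_on (\<phi> ` V) f"
    by (rule continuous_on_eq) (simp add: homeomorphism_apply2[OF \<psi>])
  then have "continuous (at x within \<phi> ` V) f" using lp(2) continuous_on_eq_continuous_within by blast
  moreover have "at x within \<phi> ` V = at x within M"
    by (rule at_within_nhd[of x Q]) (use Q lp(2) in auto)
  ultimately show "continuous (at x within M) f" by simp
qed

section \<open>Charts with quantitative control\<close>

text \<open>The margins serve two truncations. A cut-off supported in \<open>ball x0 \<rho>\<close>
  lives over the half ball, so if the midpoint of two coordinates is in its support and one of them
  leaves the full ball, they differ by at least \<delta>. And points of \<open>M\<close> outside the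
  chart image are at distance at least \<rho> from the support.\<close>

definition nice_chart ::
  "'a::euclidean_space set \<Rightarrow> 'a \<Rightarrow> (real^'d) set \<Rightarrow> (real^'d \<Rightarrow> 'a) \<Rightarrow> real^'d \<Rightarrow> real \<Rightarrow> real \<Rightarrow> real \<Rightarrow> bool" where
  "nice_chart M x0 V \<phi> u0 \<delta> l \<rho> \<longleftrightarrow> local_param M V \<phi> \<and> u0 \<in> V \<and> \<phi> u0 = x0 \<and> \<delta> > 0 \<and> cball u0 \<delta> \<subseteq> V \<and> l > 0 \<and>
     (\<forall>u\<in>cball u0 \<delta>. \<forall>v\<in>cball u0 \<delta>. l * norm (u - v) \<le> norm (\<phi> u - \<phi> v)) \<and>
     (\<forall>u\<in>cball u0 \<delta>. \<forall>h. l * norm h \<le> norm (frechet_derivative \<phi> (at u) h)) \<and>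
     \<rho> > 0 \<and> M \<inter> ball x0 (2 * \<rho>) \<subseteq> \<phi> ` ball u0 (\<delta> / 2)"

lemma openin_local_param_image:
  assumes "local_param M V \<phi>" "open W" "W \<subseteq> V"
  shows "openin (top_of_set M) (\<phi> ` W)"
proof -
  obtain \<psi> where \<psi>: "homeomorphism V (\<phi> ` V) \<phi> \<psi>" using assms(1) unfolding local_param_def by blast
  have "openin (top_of_set V) W" using assms(2,3) by (simp add: open_subset)
  then have "openin (top_of_set (\<phi> ` V)) (\<phi> ` W)" by (rule homeomorphism_imp_open_map[OF \<psi>])
  then show ?thesis using local_paramD(4)[OF assms(1)] openin_trans by blast
qed

text \<open>Injectivity bounds the derivative at \<open>u0\<close> below by some \<open>l0\<close>.
  On a ball where the derivative moves by at most \<open>l0 / 2\<close>, the map minus its linear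
  part is \<open>l0 / 2\<close>-Lipschitz, so both the derivative and the increments of
  \<open>\<phi>\<close> are bounded below with constant \<open>l0 / 2\<close>.\<close>

lemma nice_chart_exists:
  fixes M :: "'a::euclidean_space set"
  assumes M: "smooth_submanifold TYPE('d::finite) M" and x0: "x0 \<in> M"
  shows "\<exists>(V :: (real^'d) set) \<phi> u0 \<delta> l \<rho>. nice_chart M x0 V \<phi> u0 \<delta> l \<rho>"
proof -
  obtain V :: "(real^'d) set" and \<phi> where lp: "local_param M V \<phi>" "x0 \<in> \<phi> ` V"
    using M x0 unfolding smooth_submanifold_def by blast
  note P = local_paramD[OF lp(1)]
  obtain u0 where u0: "u0 \<in> V" "\<phi> u0 = x0" using lp(2) by blast
  let ?D = "\<lambda>u. frechet_derivative \<phi> (at u)"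
  obtain l0 where l0: "l0 > 0" "\<And>h. l0 * norm h \<le> norm (?D u0 h)"
    using linear_inj_bounded_below_pos[OF P(8)[OF u0(1)] P(3)[OF u0(1)]] by metis
  obtain r where r: "r > 0" "cball u0 r \<subseteq> V" using P(1) u0(1) open_contains_cball by blast
  obtain C where C: "C > 0" "\<And>x y h. x \<in> cball u0 r \<Longrightarrow> y \<in> cball u0 r \<Longrightarrow>
     norm (?D x h - ?D y h) \<le> C * norm (x - y) * norm h"
    using smooth_on_frechet_lipschitz[OF compact_cball convex_cball r(2) P(2)] by blast
  define \<delta> where "\<delta> = min r (l0 / (2 * C))"
  have \<delta>: "\<delta> > 0" "\<delta> \<le> r" "C * \<delta> \<le> l0 / 2"
  proof -
    have "C * \<delta> \<le> C * (l0 / (2 * C))" using C(1) by (intro mult_left_mono) (auto simp: \<delta>_def)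
    then show "C * \<delta> \<le> l0 / 2" using C(1) by simp
  qed (use r(1) l0(1) C(1) in \<open>auto simp: \<delta>_def\<close>)
  have sub: "cball u0 \<delta> \<subseteq> cball u0 r" using \<delta>(2) by auto
  have Dd: "norm (?D u h - ?D u0 h) \<le> l0 / 2 * norm h" if "u \<in> cball u0 \<delta>" for u h
  proof -
    have "norm (?D u h - ?D u0 h) \<le> C * norm (u - u0) * norm h"
      using that sub r(1) by (intro C(2)) auto
    also have "\<dots> \<le> C * \<delta> * norm h"
      using that C(1) by (intro mult_right_mono mult_left_mono) (auto simp: dist_norm norm_minus_commute)
    also have "\<dots> \<le> l0 / 2 * norm h" using \<delta>(3) by (rule mult_right_mono) simp
    finally show ?thesis .
  qed
  have lower: "l0 / 2 * norm h \<le> norm (?D u h)" if "u \<in> cball u0 \<delta>" for u h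
    using Dd[OF that, of h] l0(2)[of h] norm_triangle_ineq2[of "?D u0 h" "?D u h"]
    by (simp add: norm_minus_commute)
  have bil: "l0 / 2 * norm (u - v) \<le> norm (\<phi> u - \<phi> v)" if uv: "u \<in> cball u0 \<delta>" "v \<in> cball u0 \<delta>" for u v
  proof -
    have "norm ((\<phi> u - ?D u0 u) - (\<phi> v - ?D u0 v)) \<le> l0 / 2 * norm (u - v)"
    proof (rule differentiable_bound[OF convex_cball])
      show "((\<lambda>u. \<phi> u - ?D u0 u) has_derivative (\<lambda>h. ?D u h - ?D u0 h)) (at u within cball u0 \<delta>)" if "u \<in> cball u0 \<delta>" for u
      proof -
        have "u \<in> V" using that sub r(2) by blast
        then have "((\<lambda>u. \<phi> u - ?D u0 u) has_derivative (\<lambda>h. ?D u h - ?D u0 h)) (at u)"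
          using P(8)[OF u0(1)] by (intro has_derivative_diff P(9) linear_imp_has_derivative) auto
        then show ?thesis by (rule has_derivative_at_withinI)
      qed
      show "onorm (\<lambda>h. ?D u h - ?D u0 h) \<le> l0 / 2" if "u \<in> cball u0 \<delta>" for u
        using Dd[OF that] by (rule onorm_le)
    qed (use uv in auto)
    moreover have "(\<phi> u - ?D u0 u) - (\<phi> v - ?D u0 v) = (\<phi> u - \<phi> v) - ?D u0 (u - v)"
      using linear_diff[OF P(8)[OF u0(1)], of u v] by simp
    ultimately have "norm ((\<phi> u - \<phi> v) - ?D u0 (u - v)) \<le> l0 / 2 * norm (u - v)" by simp
    then show ?thesis using l0(2)[of "u - v"] norm_triangle_ineq2[of "?D u0 (u - v)" "\<phi> u - \<phi> v"]
      by (simp add: norm_minus_commute)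
  qed
  \<comment> \<open>That all nearby points of \<open>M\<close> come from the half ball uses the
    embedding: an immersed sheet could return close to \<open>x0\<close>.\<close>
  have "ball u0 (\<delta>/2) \<subseteq> V" using sub r(2) \<delta>(1) by (force simp: subset_iff)
  then have "openin (top_of_set M) (\<phi> ` ball u0 (\<delta>/2))"
    by (intro openin_local_param_image[OF lp(1)]) auto
  moreover have "x0 \<in> \<phi> ` ball u0 (\<delta>/2)" using u0 \<delta>(1) by auto
  ultimately obtain e where e: "e > 0" "ball x0 e \<inter> M \<subseteq> \<phi> ` ball u0 (\<delta>/2)"
    unfolding openin_contains_ball by blast
  have "M \<inter> ball x0 (2 * (e/2)) \<subseteq> \<phi> ` ball u0 (\<delta> / 2)" using e(2) by auto
  then have "nice_chart M x0 V \<phi> u0 \<delta> (l0/2) (e/2)"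
    unfolding nice_chart_def using lp(1) u0 \<delta>(1) sub r(2) l0(1) bil lower e(1) by simp
  then show ?thesis by blast
qed

lemma nice_chart_cover:
  fixes M :: "'a::euclidean_space set"
  assumes "compact M" and M: "smooth_submanifold TYPE('d::finite) M"
  obtains X V \<phi> u \<delta> l \<rho> where "finite X" "X \<subseteq> M" 
    "\<And>x. x \<in> X \<Longrightarrow> nice_chart M x (V x :: (real^'d) set) (\<phi> x) (u x) (\<delta> x) (l x) (\<rho> x)"
    "M \<subseteq> (\<Union>x\<in>X. ball x (\<rho> x))"
proof -
  \<comment> \<open>The six chart data are packed into one tuple so that a single choice function
    suffices.\<close>
  have "\<forall>x. \<exists>c :: (real^'d) set \<times> (real^'d \<Rightarrow> 'a) \<times> (real^'d) \<times> real \<times> real \<times> real. x \<in> M \<longrightarrow>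
    (case c of (V, \<phi>, u, \<delta>, l, \<rho>) \<Rightarrow> nice_chart M x V \<phi> u \<delta> l \<rho>)"
    using nice_chart_exists[OF M] by fastforce
  then obtain c :: "'a \<Rightarrow> (real^'d) set \<times> (real^'d \<Rightarrow> 'a) \<times> (real^'d) \<times> real \<times> real \<times> real" 
    where c: "\<And>x. x \<in> M \<Longrightarrow> (case c x of (V, \<phi>, u, \<delta>, l, \<rho>) \<Rightarrow> nice_chart M x V \<phi> u \<delta> l \<rho>)" by metis
  define V \<phi> u \<delta> l \<rho> where defs: "V = (\<lambda>x. fst (c x))" "\<phi> = (\<lambda>x. fst (snd (c x)))" "u = (\<lambda>x. fst (snd (snd (c x))))"
    "\<delta> = (\<lambda>x. fst (snd (snd (snd (c x)))))" "l = (\<lambda>x. fst (snd (snd (snd (snd (c x))))))"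
    "\<rho> = (\<lambda>x. snd (snd (snd (snd (snd (c x))))))"
  have n: "nice_chart M x (V x) (\<phi> x) (u x) (\<delta> x) (l x) (\<rho> x)" if "x \<in> M" for x
    using c[OF that] by (simp add: defs split_beta)
  have "0 < \<rho> x" if "x \<in> M" for x using n[OF that] unfolding nice_chart_def by blast
  then have cov: "M \<subseteq> (\<Union>x\<in>M. ball x (\<rho> x))" by auto
  obtain X where X: "X \<subseteq> M" "finite X" "M \<subseteq> (\<Union>x\<in>X. ball x (\<rho> x))"
    by (rule compactE_image[OF assms(1) _ cov]) auto
  show thesis by (rule that[OF X(2,1) n X(3)]) (use X(1) in blast)
qed

section \<open>The volume measure in coordinates\<close>

definition sqrt_det_metric :: "(real^'d \<Rightarrow> 'a::euclidean_space) \<Rightarrow> real^'d \<Rightarrow> real" where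
  "sqrt_det_metric \<phi> u = sqrt (det (metric_matrix \<phi> u))"

lemma det_metric_matrix_pos:
  assumes "local_param M V \<phi>" "u \<in> V" shows "det (metric_matrix \<phi> u) > 0"
  unfolding metric_matrix_def using det_gram_pos local_paramD(3,8)[OF assms] by blast

lemma lip2_on_metric_matrix:
  assumes lp: "local_param M V \<phi>" and K: "compact K" "convex K" "K \<subseteq> V"
  shows "lip2_on K (\<lambda>u. det (metric_matrix \<phi> u))"
proof (rule lip2_on_det[OF K(2)])
  fix i j
  show "lip2_on K (\<lambda>x. metric_matrix \<phi> x $ i $ j)"
    unfolding metric_matrix_def vec_lambda_beta
    by (intro lip2_on_bilinear[OF bounded_bilinear_inner K(2)] smooth_on_lip2_on[OF K]
        smooth_on_frechet_derivative local_paramD(2)[OF lp])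
qed

lemma continuous_on_det_metric_matrix:
  assumes lp: "local_param M V \<phi>" shows "continuous_on V (\<lambda>u. det (metric_matrix \<phi> u))"
proof -
  have "continuous_on V (\<lambda>u. frechet_derivative \<phi> (at u) b)" for b
    using Ck_on_continuous_on[OF smooth_on_Ck_on[OF smooth_on_frechet_derivative[OF local_paramD(2)[OF lp]]]] .
  then show ?thesis unfolding det_def metric_matrix_def vec_lambda_beta
    by (intro continuous_intros)
qed

text \<open>The determinant has a positive minimum on a nonempty compact set, so its square root is
  an admissible power.\<close>

lemma lip2_on_sqrt_det_metric:
  assumes lp: "local_param M V \<phi>" and K: "compact K" "convex K" "K \<subseteq> V"
  shows "lip2_on K (sqrt_det_metric \<phi>)"
proof (cases "K = {}")
  case False
  have c: "continuous_on K (\<lambda>u. det (metric_matrix \<phi> u))"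
    using lip2_on_continuous_on[OF lip2_on_metric_matrix[OF lp K]] .
  obtain u where u: "u \<in> K" "\<And>v. v \<in> K \<Longrightarrow> det (metric_matrix \<phi> u) \<le> det (metric_matrix \<phi> v)"
    using continuous_attains_inf[OF K(1) False c] by blast
  have pos: "det (metric_matrix \<phi> u) > 0" using u(1) K(3) det_metric_matrix_pos[OF lp] by blast
  have "lip2_on K (\<lambda>u. det (metric_matrix \<phi> u) powr (1/2))"
    by (rule lip2_on_powr[OF K(2) lip2_on_metric_matrix[OF lp K] pos u(2)])
  then show ?thesis
  proof (rule lip2_on_cong[OF _ K(2)])
    fix v assume "v \<in> K"
    then have "det (metric_matrix \<phi> v) > 0" using K(3) det_metric_matrix_pos[OF lp] by blast
    then show "det (metric_matrix \<phi> v) powr (1/2) = sqrt_det_metric \<phi> v"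
      by (simp add: sqrt_det_metric_def powr_half_sqrt)
  qed
qed (simp add: lip2_on_def)

lemma continuous_on_sqrt_det_metric:
  assumes lp: "local_param M V \<phi>" shows "continuous_on V (sqrt_det_metric \<phi>)"
  using continuous_on_real_sqrt[OF continuous_on_det_metric_matrix[OF lp]]
  by (simp add: sqrt_det_metric_def[abs_def])

context
  fixes M :: "'a::euclidean_space set" and dV :: "'a measure"
  assumes vol: "riemannian_volume TYPE('d::finite) M dV"
begin

lemma sets_volume: "sets dV = sets (restrict_space borel M)"
  using vol by (simp add: riemannian_volume_def)

lemma space_volume: "space dV = M"
  using sets_eq_imp_space_eq[OF sets_volume] by (simp add: space_restrict_space)

lemma measurable_ident_volume: "(\<lambda>x. x) \<in> borel_measurable dV"
  using measurable_restrict_space1[of "\<lambda>x. x" borel borel M] 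
  by (simp add: measurable_cong_sets[OF sets_volume refl])

lemma borel_measurable_volume_continuous_on:
  fixes f :: "'a \<Rightarrow> 'b::topological_space"
  shows "continuous_on M f \<Longrightarrow> f \<in> borel_measurable dV"
  using borel_measurable_continuous_on_restrict measurable_cong_sets[OF sets_volume refl] by blast

lemma openin_sets_volume: "openin (top_of_set M) U \<Longrightarrow> U \<in> sets dV"
  unfolding sets_volume by (auto simp: openin_open sets_restrict_space)

lemma local_param_sets: "local_param M (V :: (real^'d) set) \<phi> \<Longrightarrow> \<phi> ` V \<in> sets dV"
  using local_paramD(4) openin_sets_volume by blast

context
  fixes V :: "(real^'d) set" and \<phi>
  assumes lp: "local_param M V \<phi>"
begin

text \<open>The value \<open>x0\<close> off \<open>V\<close> makes the parametrization a total
  measurable map, to which image measures apply.\<close>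

lemma measurable_local_param_extended:
  assumes "x0 \<in> M" shows "(\<lambda>u. if u \<in> V then \<phi> u else x0) \<in> borel \<rightarrow>\<^sub>M dV"
proof -
  have "(\<lambda>u. if u \<in> V then \<phi> u else x0) \<in> borel \<rightarrow>\<^sub>M restrict_space borel M"
  proof (rule measurable_restrict_space2)
    show "(\<lambda>u. if u \<in> V then \<phi> u else x0) \<in> space borel \<rightarrow> M" using assms image_subset_iff[THEN iffD1, OF local_paramD(5)[OF lp]] by auto
    show "(\<lambda>u. if u \<in> V then \<phi> u else x0) \<in> borel_measurable borel"
      using local_paramD(1,6)[OF lp] by (intro borel_measurable_continuous_on_if) auto
  qed
  then show ?thesis using measurable_cong_sets[OF refl sets_volume] by blast
qed

lemma measurable_sqrt_det_metric:
  "(\<lambda>u. indicator V u * sqrt_det_metric \<phi> u) \<in> borel_measurable borel"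
  using borel_measurable_continuous_on_indicator[OF _ continuous_on_sqrt_det_metric[OF lp]] local_paramD(1)[OF lp] by simp

text \<open>\<open>riemannian_volume\<close> prescribes measures of sets; as an equality of measures
  it transports integrals and integrability at once.\<close>

lemma density_volume_local_param:
  assumes x0: "x0 \<in> M"
  shows "density dV (indicator (\<phi> ` V)) =
    distr (density lborel (\<lambda>u. ennreal (indicator V u * sqrt_det_metric \<phi> u))) dV (\<lambda>u. if u \<in> V then \<phi> u else x0)"
    (is "_ = distr ?L dV ?\<phi>")
proof (rule measure_eqI)
  fix A assume "A \<in> sets (density dV (indicator (\<phi> ` V)))"
  then have A[measurable]: "A \<in> sets dV" by simp
  note [measurable] = measurable_local_param_extended[OF x0] measurable_sqrt_det_metric local_param_sets[OF lp]
  have AM: "A \<subseteq> M" using sets.sets_into_space[OF A] by (simp add: space_volume)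
  have "emeasure (density dV (indicator (\<phi> ` V))) A = emeasure dV (A \<inter> \<phi> ` V)"
    by (simp add: emeasure_density Int_commute flip: indicator_inter_arith)
  also have "\<dots> = (\<integral>\<^sup>+ u \<in> V. indicator (A \<inter> \<phi> ` V) (\<phi> u) * ennreal (sqrt (det (metric_matrix \<phi> u))) \<partial>lborel)"
    by (rule vol[unfolded riemannian_volume_def, THEN conjunct2, rule_format])
       (use lp sets.Int[OF A local_param_sets[OF lp]] in auto)
  also have "\<dots> = (\<integral>\<^sup>+ u. ennreal (indicator V u * sqrt_det_metric \<phi> u) * indicator (?\<phi> -` A) u \<partial>lborel)"
    by (intro nn_integral_cong) (auto simp: indicator_def sqrt_det_metric_def)
  also have "\<dots> = emeasure ?L (?\<phi> -` A)"
    using measurable_sets[OF measurable_local_param_extended[OF x0] A] by (simp add: emeasure_density)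
  also have "\<dots> = emeasure (distr ?L dV ?\<phi>) A"
    by (simp add: emeasure_distr)
  finally show "emeasure (density dV (indicator (\<phi> ` V))) A = emeasure (distr ?L dV ?\<phi>) A" .
qed simp

lemma sqrt_det_metric_nonneg: "u \<in> V \<Longrightarrow> 0 \<le> sqrt_det_metric \<phi> u"
  using det_metric_matrix_pos[OF lp] by (simp add: sqrt_det_metric_def less_imp_le)

lemma
  assumes g[measurable]: "g \<in> borel_measurable dV" and gV: "\<And>x. x \<in> M - \<phi> ` V \<Longrightarrow> g x = (0::real)"
  shows integral_volume_local_param: "(\<integral>x. g x \<partial>dV) = (\<integral>u. indicator V u * (sqrt_det_metric \<phi> u * g (\<phi> u)) \<partial>lborel)"
    and integrable_volume_local_param: "integrable dV g \<longleftrightarrow> integrable lborel (\<lambda>u. indicator V u * (sqrt_det_metric \<phi> u * g (\<phi> u)))"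
proof -
  have "(\<integral>x. g x \<partial>dV) = (\<integral>u. indicator V u * (sqrt_det_metric \<phi> u * g (\<phi> u)) \<partial>lborel) \<and>
     (integrable dV g \<longleftrightarrow> integrable lborel (\<lambda>u. indicator V u * (sqrt_det_metric \<phi> u * g (\<phi> u))))"
  proof (cases "M = {}")
    \<comment> \<open>An empty manifold offers no value \<open>x0\<close> for the extension.\<close>
    case True
    have "V = {}" using local_paramD(5)[OF lp] True by auto
    moreover have "space dV = {}" using True space_volume by simp
    moreover from this have "(\<integral>x. g x \<partial>dV) = (\<integral>x. 0 \<partial>dV)" 
      by (intro Bochner_Integration.integral_cong) auto
    ultimately show ?thesis by (simp add: integrable_iff_bounded nn_integral_empty)
  next
    case False
    then obtain x0 where x0: "x0 \<in> M" by blast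
    note [measurable] = measurable_local_param_extended[OF x0] measurable_sqrt_det_metric local_param_sets[OF lp]
    let ?\<phi> = "\<lambda>u. if u \<in> V then \<phi> u else x0"
    let ?L = "density lborel (\<lambda>u. ennreal (indicator V u * sqrt_det_metric \<phi> u))"
    have nn: "0 \<le> indicator V u * sqrt_det_metric \<phi> u" for u
      using sqrt_det_metric_nonneg by (simp add: indicator_def)
    have i1: "(\<integral>x. g x \<partial>density dV (indicator (\<phi> ` V))) = (\<integral>x. indicator (\<phi> ` V) x * g x \<partial>dV)"
      and i2: "integrable (density dV (indicator (\<phi> ` V))) g \<longleftrightarrow> integrable dV (\<lambda>x. indicator (\<phi> ` V) x * g x)"
      using integral_density[of g dV "indicator (\<phi> ` V)"] integrable_density[of g dV "indicator (\<phi> ` V)"]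
      by (simp_all add: ennreal_indicator)
    have eq: "(\<integral>x. indicator (\<phi> ` V) x * g x \<partial>dV) = (\<integral>x. g x \<partial>dV)" 
      "integrable dV (\<lambda>x. indicator (\<phi> ` V) x * g x) \<longleftrightarrow> integrable dV g"
      using gV by (auto intro!: Bochner_Integration.integral_cong Bochner_Integration.integrable_cong simp: space_volume indicator_def)
    have j1: "(\<integral>x. g x \<partial>distr ?L dV ?\<phi>) = (\<integral>u. (indicator V u * sqrt_det_metric \<phi> u) * g (?\<phi> u) \<partial>lborel)"
      by (subst integral_distr, measurable, subst integral_density) (use nn in auto)
    have j2: "integrable (distr ?L dV ?\<phi>) g \<longleftrightarrow> integrable lborel (\<lambda>u. (indicator V u * sqrt_det_metric \<phi> u) * g (?\<phi> u))"
      by (subst integrable_distr_eq, measurable, subst integrable_density) (use nn in auto)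
    have k: "(\<lambda>u. (indicator V u * sqrt_det_metric \<phi> u) * g (?\<phi> u)) = (\<lambda>u. indicator V u * (sqrt_det_metric \<phi> u * g (\<phi> u)))"
      by (auto simp: fun_eq_iff indicator_def)
    show ?thesis using i1 i2 eq j1 j2 k density_volume_local_param[OF x0] by metis
  qed
  then show "(\<integral>x. g x \<partial>dV) = (\<integral>u. indicator V u * (sqrt_det_metric \<phi> u * g (\<phi> u)) \<partial>lborel)"
    "integrable dV g \<longleftrightarrow> integrable lborel (\<lambda>u. indicator V u * (sqrt_det_metric \<phi> u * g (\<phi> u)))" by auto
qed

end

end

section \<open>From charts to the whole manifold\<close>

lemma nice_chartD:
  assumes "nice_chart M x0 V \<phi> u0 \<delta> l \<rho>"
  shows "local_param M V \<phi>" "u0 \<in> V" "\<phi> u0 = x0" "\<delta> > 0" "cball u0 \<delta> \<subseteq> V" "l > 0"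
    "\<And>u v. u \<in> cball u0 \<delta> \<Longrightarrow> v \<in> cball u0 \<delta> \<Longrightarrow> l * norm (u - v) \<le> norm (\<phi> u - \<phi> v)"
    "\<And>u h. u \<in> cball u0 \<delta> \<Longrightarrow> l * norm h \<le> norm (frechet_derivative \<phi> (at u) h)"
    "\<rho> > 0" "M \<inter> ball x0 (2 * \<rho>) \<subseteq> \<phi> ` ball u0 (\<delta> / 2)"
  using assms unfolding nice_chart_def by blast+

text \<open>A Lebesgue number argument: finitely many balls of radius \<open>\<rho> x\<close> cover
  \<open>M\<close>, and a pair closer than the smallest radius lies in one doubled ball, hence in
  one chart. Monotonicity in the constant merges the finitely many constants.\<close>

lemma uniform_local:
  fixes M :: "'a::euclidean_space set" and Q :: "real \<Rightarrow> 'a \<Rightarrow> 'a \<Rightarrow> bool"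
  assumes "compact M" and "smooth_submanifold TYPE('d::finite) M"
    and chart: "\<And>x (V :: (real^'d) set) \<phi> u \<delta> l \<rho>. nice_chart M x V \<phi> u \<delta> l \<rho> \<Longrightarrow>
      \<exists>C. \<forall>a\<in>ball u \<delta>. \<forall>b\<in>ball u \<delta>. Q C (\<phi> a) (\<phi> b)"
    and mono: "\<And>C C' y z. C \<le> C' \<Longrightarrow> Q C y z \<Longrightarrow> Q C' y z"
  shows "\<exists>C. \<exists>r>0. \<forall>y\<in>M. \<forall>z\<in>M. norm (y - z) < r \<longrightarrow> Q C y z"
proof -
  obtain X V \<phi> u \<delta> l \<rho> where X: "finite X" "X \<subseteq> M" 
    and n: "\<And>x. x \<in> X \<Longrightarrow> nice_chart M x (V x :: (real^'d) set) (\<phi> x) (u x) (\<delta> x) (l x) (\<rho> x)"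
    and cov: "M \<subseteq> (\<Union>x\<in>X. ball x (\<rho> x))"
    by (rule nice_chart_cover[OF assms(1,2)]) (rule that)
  have "\<forall>x. \<exists>C. x \<in> X \<longrightarrow> (\<forall>a\<in>ball (u x) (\<delta> x). \<forall>b\<in>ball (u x) (\<delta> x). Q C (\<phi> x a) (\<phi> x b))"
    using chart[OF n] by blast
  from choice[OF this] obtain C where C: "\<And>x a b. x \<in> X \<Longrightarrow> a \<in> ball (u x) (\<delta> x) \<Longrightarrow> b \<in> ball (u x) (\<delta> x) \<Longrightarrow> Q (C x) (\<phi> x a) (\<phi> x b)"
    by blast
  define r where "r = Min (insert 1 (\<rho> ` X))"
  define D where "D = (\<Sum>x\<in>X. \<bar>C x\<bar>)"
  have r: "r > 0" unfolding r_def using X(1) nice_chartD(9)[OF n] by (subst Min_gr_iff) auto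
  have rle: "r \<le> \<rho> x" if "x \<in> X" for x unfolding r_def using X(1) that by (intro Min_le) auto
  have D: "C x \<le> D" if "x \<in> X" for x
  proof -
    have "\<bar>C x\<bar> \<le> D" unfolding D_def using X(1) that by (intro member_le_sum) auto
    then show ?thesis by linarith
  qed
  have "Q D y z" if yz: "y \<in> M" "z \<in> M" "norm (y - z) < r" for y z
  proof -
    obtain x where x: "x \<in> X" "y \<in> ball x (\<rho> x)" using cov yz(1) by blast
    note N = nice_chartD[OF n[OF x(1)]]
    have "y \<in> ball x (2 * \<rho> x)" using x(2) N(9) by simp
    moreover have "dist x z < 2 * \<rho> x"
      using dist_triangle[of x z y] x(2) yz(3) rle[OF x(1)] by (simp add: dist_norm)
    ultimately have "y \<in> \<phi> x ` ball (u x) (\<delta> x / 2)" "z \<in> \<phi> x ` ball (u x) (\<delta> x / 2)"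
      using N(10) yz(1,2) by auto
    then obtain a b where "a \<in> ball (u x) (\<delta> x / 2)" "b \<in> ball (u x) (\<delta> x / 2)" "y = \<phi> x a" "z = \<phi> x b" by blast
    moreover from this have "a \<in> ball (u x) (\<delta> x)" "b \<in> ball (u x) (\<delta> x)" using N(4) by auto
    ultimately show ?thesis using C[OF x(1)] mono[OF D[OF x(1)]] by blast
  qed
  then show ?thesis using r by blast
qed

lemma smooth_fun_smooth_on:
  "smooth_fun TYPE('d::finite) M f \<Longrightarrow> local_param M (V :: (real^'d) set) \<phi> \<Longrightarrow> smooth_on V (f \<circ> \<phi>)"
  unfolding smooth_fun_def by blast

context
  fixes M :: "'a::euclidean_space set" and f :: "'a \<Rightarrow> real"
  assumes M: "compact M" "smooth_submanifold TYPE('d::finite) M"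
    and f: "smooth_fun TYPE('d) M f"
begin

text \<open>Distances are those of the ambient space. Close pairs are compared within a chart, where
  \<open>l\<close> converts coordinate distance into ambient distance; for the others the
  oscillation of \<open>f\<close>, at most \<open>2 * B\<close>, is divided by the radius
  \<open>r\<close>.\<close>

lemma smooth_fun_lipschitz: "\<exists>C>0. \<forall>x\<in>M. \<forall>y\<in>M. \<bar>f x - f y\<bar> \<le> C * norm (x - y)"
proof -
  have "\<exists>C. \<exists>r>0. \<forall>y\<in>M. \<forall>z\<in>M. norm (y - z) < r \<longrightarrow> \<bar>f y - f z\<bar> \<le> C * norm (y - z)"
  proof (rule uniform_local[OF M])
    fix x and V :: "(real^'d) set" and \<phi> u \<delta> l \<rho> assume n: "nice_chart M x V \<phi> u \<delta> l \<rho>"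
    note N = nice_chartD[OF n]
    obtain C where C: "C > 0" "\<And>a b. a \<in> cball u \<delta> \<Longrightarrow> b \<in> cball u \<delta> \<Longrightarrow> norm ((f \<circ> \<phi>) a - (f \<circ> \<phi>) b) \<le> C * norm (a - b)"
      using Ck_on_lipschitz[OF compact_cball convex_cball N(5) smooth_on_Ck_on[OF smooth_fun_smooth_on[OF f N(1)]]] by blast
    have "\<bar>f (\<phi> a) - f (\<phi> b)\<bar> \<le> C / l * norm (\<phi> a - \<phi> b)" if "a \<in> ball u \<delta>" "b \<in> ball u \<delta>" for a b
    proof -
      have ab: "a \<in> cball u \<delta>" "b \<in> cball u \<delta>" using that by auto
      have "\<bar>f (\<phi> a) - f (\<phi> b)\<bar> \<le> C * norm (a - b)" using C(2)[OF ab] by simp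
      also have "\<dots> = C / l * (l * norm (a - b))" using N(6) by simp
      also have "\<dots> \<le> C / l * norm (\<phi> a - \<phi> b)" using N(6,7) C(1) ab by (intro mult_left_mono) auto
      finally show ?thesis .
    qed
    then show "\<exists>C. \<forall>a\<in>ball u \<delta>. \<forall>b\<in>ball u \<delta>. \<bar>f (\<phi> a) - f (\<phi> b)\<bar> \<le> C * norm (\<phi> a - \<phi> b)" by blast
  next
    fix C C' :: real and y z :: 'a assume "C \<le> C'" "\<bar>f y - f z\<bar> \<le> C * norm (y - z)"
    then show "\<bar>f y - f z\<bar> \<le> C' * norm (y - z)" using mult_right_mono[of C C' "norm (y - z)"] by simp
  qed
  then obtain C r where Cr: "r > 0" "\<And>y z. y \<in> M \<Longrightarrow> z \<in> M \<Longrightarrow> norm (y - z) < r \<Longrightarrow> \<bar>f y - f z\<bar> \<le> C * norm (y - z)"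
    by blast
  have "bounded (f ` M)"
    by (rule compact_imp_bounded[OF compact_continuous_image[OF smooth_fun_continuous_on[OF M(2) f] M(1)]])
  then obtain B where B: "\<And>x. x \<in> M \<Longrightarrow> \<bar>f x\<bar> \<le> B" unfolding bounded_iff by auto
  define D where "D = max 1 (max C (2 * B / r))"
  have "\<bar>f x - f y\<bar> \<le> D * norm (x - y)" if xy: "x \<in> M" "y \<in> M" for x y
  proof (cases "norm (x - y) < r")
    case True
    have "C * norm (x - y) \<le> D * norm (x - y)" by (intro mult_right_mono) (auto simp: D_def)
    then show ?thesis using Cr(2)[OF xy True] by linarith
  next
    case False
    have "B \<ge> 0" using B[OF xy(1)] by linarith
    have "\<bar>f x - f y\<bar> \<le> 2 * B" using B[OF xy(1)] B[OF xy(2)] by linarith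
    also have "\<dots> = 2 * B / r * r" using Cr(1) by simp
    also have "\<dots> \<le> 2 * B / r * norm (x - y)" using False Cr(1) \<open>B \<ge> 0\<close> by (intro mult_left_mono) auto
    also have "\<dots> \<le> D * norm (x - y)" by (intro mult_right_mono) (auto simp: D_def)
    finally show ?thesis .
  qed
  moreover have "D > 0" by (simp add: D_def)
  ultimately show ?thesis by blast
qed

text \<open>The gradient is the image of some \<open>h\<close> under the derivative of
  \<open>\<phi>\<close>, so its squared norm is the differential of \<open>f \<circ> \<phi>\<close>
  at \<open>h\<close>, at most \<open>C * norm h\<close>, and \<open>norm h\<close> is at most the
  norm of the gradient over \<open>l\<close>. One factor cancels.\<close>

lemma manifold_grad_bounded: "\<exists>G. \<forall>x\<in>M. norm (manifold_grad TYPE('d) M f x) \<le> G"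
proof -
  \<comment> \<open>The second point is a dummy for \<open>uniform_local\<close>; at the end it is
    set equal to the first.\<close>
  have "\<exists>C. \<exists>r>0. \<forall>y\<in>M. \<forall>z\<in>M. norm (y - z) < r \<longrightarrow> norm (manifold_grad TYPE('d) M f y) \<le> C"
  proof (rule uniform_local[OF M])
    fix x and V :: "(real^'d) set" and \<phi> u \<delta> l \<rho> assume n: "nice_chart M x V \<phi> u \<delta> l \<rho>"
    note N = nice_chartD[OF n]
    obtain C where C: "C > 0" "\<And>a h. a \<in> cball u \<delta> \<Longrightarrow> norm (frechet_derivative (f \<circ> \<phi>) (at a) h) \<le> C * norm h"
      using Ck_on_frechet_bounded[OF compact_cball convex_cball N(5) smooth_on_Ck_on[OF smooth_fun_smooth_on[OF f N(1)]]] by blast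
    have "norm (manifold_grad TYPE('d) M f (\<phi> a)) \<le> C / l" if "a \<in> ball u \<delta>" for a
    proof -
      have a: "a \<in> cball u \<delta>" using that by auto
      then have aV: "a \<in> V" using N(5) by blast
      note g = manifold_grad_local_param[OF f N(1) aV]
      obtain h where h: "manifold_grad TYPE('d) M f (\<phi> a) = frechet_derivative \<phi> (at a) h" using g by blast
      have "(norm (manifold_grad TYPE('d) M f (\<phi> a)))\<^sup>2 = manifold_grad TYPE('d) M f (\<phi> a) \<bullet> frechet_derivative \<phi> (at a) h" 
        using h by (simp add: power2_norm_eq_inner)
      also have "\<dots> = frechet_derivative (f \<circ> \<phi>) (at a) h" using g by blast
      also have "\<dots> \<le> C * norm h" using C(2)[OF a, of h] by simp
      also have "\<dots> \<le> C * (norm (manifold_grad TYPE('d) M f (\<phi> a)) / l)"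
        using N(6) N(8)[OF a, of h] C(1) h by (intro mult_left_mono) (auto simp: field_simps)
      finally have "norm (manifold_grad TYPE('d) M f (\<phi> a)) * norm (manifold_grad TYPE('d) M f (\<phi> a)) \<le> (C / l) * norm (manifold_grad TYPE('d) M f (\<phi> a))"
        by (simp add: power2_eq_square)
      moreover have "n \<le> K" if "n * n \<le> K * n" "n \<ge> 0" "K \<ge> 0" for n K :: real
      proof (cases "n = 0")
        case True then show ?thesis using that(3) by (simp only:)
      next
        case False
        then have "0 < n" using that(2) by linarith
        with that(1) show ?thesis by (rule mult_right_le_imp_le)
      qed
      moreover have "0 \<le> C / l" using C(1) N(6) by simp
      ultimately show ?thesis by (metis norm_ge_zero)
    qed
    then show "\<exists>C. \<forall>a\<in>ball u \<delta>. \<forall>b\<in>ball u \<delta>. norm (manifold_grad TYPE('d) M f (\<phi> a)) \<le> C" by blast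
  qed linarith
  then show ?thesis by (metis diff_self norm_zero)
qed

text \<open>In a chart the derivative vanishes on a ball, and compactness makes the radius uniform.
  Different components of \<open>M\<close> may carry different values, so only close points are
  compared.\<close>

lemma locally_constant_of_manifold_grad_zero:
  assumes "\<And>x. x \<in> M \<Longrightarrow> manifold_grad TYPE('d) M f x = 0"
  shows "\<exists>r>0. \<forall>x\<in>M. \<forall>y\<in>M. norm (x - y) < r \<longrightarrow> f x = f y"
proof -
  have "\<exists>C::real. \<exists>r>0. \<forall>y\<in>M. \<forall>z\<in>M. norm (y - z) < r \<longrightarrow> f y = f z"
  proof (rule uniform_local[OF M])
    fix x and V :: "(real^'d) set" and \<phi> u \<delta> l \<rho> assume n: "nice_chart M x V \<phi> u \<delta> l \<rho>"
    note N = nice_chartD[OF n]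
    have d: "((f \<circ> \<phi>) has_derivative (\<lambda>h. 0)) (at a within ball u \<delta>)" if "a \<in> ball u \<delta>" for a
    proof -
      have aV: "a \<in> V" using that N(5) by auto
      have "frechet_derivative (f \<circ> \<phi>) (at a) h = 0" for h
      proof -
        have "\<phi> a \<in> M" using local_paramD(5)[OF N(1)] aV by blast
        then show ?thesis using manifold_grad_local_param[OF f N(1) aV] assms by (metis inner_zero_left)
      qed
      then have "frechet_derivative (f \<circ> \<phi>) (at a) = (\<lambda>h. 0)" by blast
      then show ?thesis 
        using smooth_on_has_derivative[OF smooth_fun_smooth_on[OF f N(1)] aV] has_derivative_at_withinI by metis
    qed
    have "\<exists>c. \<forall>a\<in>ball u \<delta>. (f \<circ> \<phi>) a = c"
      using has_derivative_zero_constant[OF convex_ball d] by blast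
    then show "\<exists>C. \<forall>a\<in>ball u \<delta>. \<forall>b\<in>ball u \<delta>. f (\<phi> a) = f (\<phi> b)" by auto
  qed
  then show ?thesis by blast
qed

text \<open>For every \<open>h\<close> the squared norm of the gradient is at least twice the
  differential of \<open>f\<close> at \<open>h\<close> minus the squared norm of the tangent vector
  of \<open>h\<close>, with equality when this vector is the gradient. The optimal \<open>h\<close>
  of one point thus gives a continuous minorant near it, and the squared norm is lower
  semicontinuous. Measurability and openness of the set of nonzero gradients both come from
  this.\<close>

lemma openin_manifold_grad_greater:
  "openin (top_of_set M) {x\<in>M. t < (norm (manifold_grad TYPE('d) M f x))\<^sup>2}"
proof (subst openin_subopen, intro ballI)
  fix x assume "x \<in> {x\<in>M. t < (norm (manifold_grad TYPE('d) M f x))\<^sup>2}"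
  then have x: "x \<in> M" "t < (norm (manifold_grad TYPE('d) M f x))\<^sup>2" by auto
  obtain V :: "(real^'d) set" and \<phi> where lp: "local_param M V \<phi>" "x \<in> \<phi> ` V"
    using M(2) x(1) unfolding smooth_submanifold_def by blast
  obtain u where u: "u \<in> V" "\<phi> u = x" using lp(2) by blast
  let ?D = "\<lambda>u h. frechet_derivative \<phi> (at u) h" and ?F = "\<lambda>u h. frechet_derivative (f \<circ> \<phi>) (at u) h"
  note g = manifold_grad_local_param[OF f lp(1)]
  obtain h where h: "manifold_grad TYPE('d) M f x = ?D u h" using g[OF u(1)] u(2) by blast
  define W where "W = V \<inter> (\<lambda>u. 2 * ?F u h - (norm (?D u h))\<^sup>2) -` {t<..}"
  have "continuous_on V (\<lambda>u. ?F u h)" "continuous_on V (\<lambda>u. ?D u h)"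
    using Ck_on_continuous_on smooth_on_Ck_on smooth_on_frechet_derivative smooth_fun_smooth_on[OF f lp(1)] local_paramD(2)[OF lp(1)]
    by blast+
  then have "continuous_on V (\<lambda>u. 2 * ?F u h - (norm (?D u h))\<^sup>2)" by (intro continuous_intros)
  then have W: "open W" unfolding W_def
    using local_paramD(1)[OF lp(1)] by (intro continuous_open_preimage) auto
  have id: "?F v h = manifold_grad TYPE('d) M f (\<phi> v) \<bullet> ?D v h" if "v \<in> V" for v using g[OF that] by metis
  have "?F u h = (norm (manifold_grad TYPE('d) M f x))\<^sup>2" using id[OF u(1)] u(2) h by (simp add: power2_norm_eq_inner)
  then have uW: "u \<in> W" using u(1) x(2) h by (simp add: W_def)
  have "\<phi> v \<in> {x\<in>M. t < (norm (manifold_grad TYPE('d) M f x))\<^sup>2}" if "v \<in> W" for v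
  proof -
    have vV: "v \<in> V" and gt: "t < 2 * ?F v h - (norm (?D v h))\<^sup>2" using that by (auto simp: W_def)
    \<comment> \<open>Expanding this square gives the minorant.\<close>
    have "0 \<le> (norm (manifold_grad TYPE('d) M f (\<phi> v) - ?D v h))\<^sup>2" by simp
    then have "2 * (manifold_grad TYPE('d) M f (\<phi> v) \<bullet> ?D v h) - (norm (?D v h))\<^sup>2 \<le> (norm (manifold_grad TYPE('d) M f (\<phi> v)))\<^sup>2"
      by (simp add: power2_norm_eq_inner inner_diff_left inner_diff_right inner_commute)
    then have "t < (norm (manifold_grad TYPE('d) M f (\<phi> v)))\<^sup>2" using gt id[OF vV] by simp
    moreover have "\<phi> v \<in> M" using local_paramD(5)[OF lp(1)] vV by blast
    ultimately show ?thesis by simp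
  qed
  then have "\<phi> ` W \<subseteq> {x\<in>M. t < (norm (manifold_grad TYPE('d) M f x))\<^sup>2}" by blast
  moreover have "openin (top_of_set M) (\<phi> ` W)"
    by (rule openin_local_param_image[OF lp(1) W]) (auto simp: W_def)
  moreover have "x \<in> \<phi> ` W" using uW u(2) by blast
  ultimately show "\<exists>T. openin (top_of_set M) T \<and> x \<in> T \<and> T \<subseteq> {x\<in>M. t < (norm (manifold_grad TYPE('d) M f x))\<^sup>2}" by blast
qed

context
  fixes dV :: "'a measure"
  assumes vol: "riemannian_volume TYPE('d) M dV"
begin

lemma measurable_norm_manifold_grad: "(\<lambda>x. norm (manifold_grad TYPE('d) M f x)) \<in> borel_measurable dV"
proof -
  have "(\<lambda>x. (norm (manifold_grad TYPE('d) M f x))\<^sup>2) \<in> borel_measurable dV"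
    unfolding borel_measurable_iff_greater space_volume[OF vol]
    using openin_sets_volume[OF vol openin_manifold_grad_greater] by blast
  then have "(\<lambda>x. sqrt ((norm (manifold_grad TYPE('d) M f x))\<^sup>2)) \<in> borel_measurable dV" by measurable
  then show ?thesis by simp
qed

text \<open>In a chart the volume density is positive, and a nonempty open set of coordinates is not
  negligible.\<close>

lemma emeasure_volume_open_pos:
  assumes U: "openin (top_of_set M) U" "x \<in> U"
  shows "emeasure dV U > 0"
proof -
  have "x \<in> M" using U openin_imp_subset by blast
  then obtain V :: "(real^'d) set" and \<phi> where lp: "local_param M V \<phi>" "x \<in> \<phi> ` V"
    using M(2) unfolding smooth_submanifold_def by blast
  obtain u where u: "u \<in> V" "\<phi> u = x" using lp(2) by blast
  obtain Q where Q: "open Q" "U = M \<inter> Q" using U(1) by (auto simp: openin_open)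
  define W where "W = V \<inter> \<phi> -` Q"
  have W: "open W" unfolding W_def using continuous_open_preimage local_paramD(1,6)[OF lp(1)] Q(1) by blast
  have uW: "u \<in> W" using u U(2) Q(2) by (auto simp: W_def)
  have opW: "openin (top_of_set M) (\<phi> ` W)"
    by (rule openin_local_param_image[OF lp(1) W]) (auto simp: W_def)
  have WU: "\<phi> ` W \<subseteq> U" using openin_imp_subset[OF opW] Q(2) by (auto simp: W_def)
  have Wm[measurable]: "W \<in> sets borel" using W by simp
  have Jm: "(\<lambda>u. indicator V u * sqrt_det_metric \<phi> u) \<in> borel_measurable borel"
    by (rule measurable_sqrt_det_metric[OF vol lp(1)])
  have "emeasure dV (\<phi> ` W) = (\<integral>\<^sup>+ u \<in> V. indicator (\<phi> ` W) (\<phi> u) * ennreal (sqrt (det (metric_matrix \<phi> u))) \<partial>lborel)"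
    by (rule vol[unfolded riemannian_volume_def, THEN conjunct2, rule_format])
       (use lp openin_sets_volume[OF vol opW] in \<open>auto simp: W_def\<close>)
  also have "\<dots> = (\<integral>\<^sup>+ u. ennreal (indicator W u * (indicator V u * sqrt_det_metric \<phi> u)) \<partial>lborel)"
  proof (rule nn_integral_cong)
    fix u
    have "u \<in> V \<Longrightarrow> \<phi> u \<in> \<phi> ` W \<longleftrightarrow> u \<in> W"
      using local_paramD(7)[OF lp(1)] by (auto simp: W_def inj_on_def)
    then show "indicator (\<phi> ` W) (\<phi> u) * ennreal (sqrt (det (metric_matrix \<phi> u))) * indicator V u =
      ennreal (indicator W u * (indicator V u * sqrt_det_metric \<phi> u))"
      by (auto simp: indicator_def sqrt_det_metric_def)
  qed
  finally have eq: "emeasure dV (\<phi> ` W) = (\<integral>\<^sup>+ u. ennreal (indicator W u * (indicator V u * sqrt_det_metric \<phi> u)) \<partial>lborel)" .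
  have "emeasure dV (\<phi> ` W) \<noteq> 0"
  proof
    assume "emeasure dV (\<phi> ` W) = 0"
    then have "AE u in lborel. ennreal (indicator W u * (indicator V u * sqrt_det_metric \<phi> u)) = 0"
      unfolding eq using Jm by (subst (asm) nn_integral_0_iff_AE) auto
    then have "AE u in lborel. u \<notin> W"
    proof eventually_elim
      case (elim u)
      show ?case
      proof
        assume "u \<in> W"
        then have "u \<in> V" by (simp add: W_def)
        then have "sqrt_det_metric \<phi> u > 0" 
          using det_metric_matrix_pos[OF lp(1)] by (simp add: sqrt_det_metric_def)
        then show False using elim \<open>u \<in> W\<close> \<open>u \<in> V\<close> by simp
      qed
    qed
    then have "W \<in> null_sets lborel" by (subst (asm) AE_iff_null_sets[symmetric]) auto
    then have "negligible W" by (simp add: negligible_iff_null_sets null_sets_completionI)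
    then show False using open_not_negligible[OF W] uW by blast
  qed
  moreover have "emeasure dV (\<phi> ` W) \<le> emeasure dV U"
    by (rule emeasure_mono[OF WU openin_sets_volume[OF vol U(1)]])
  ultimately show ?thesis by (metis le_zero_eq not_gr_zero)
qed

text \<open>The set of nonzero gradients is relatively open, so being null it must be empty.\<close>

lemma manifold_grad_zero_of_AE:
  assumes "AE x in dV. manifold_grad TYPE('d) M f x = 0" "x \<in> M" shows "manifold_grad TYPE('d) M f x = 0"
proof (rule ccontr)
  assume "manifold_grad TYPE('d) M f x \<noteq> 0"
  let ?U = "{x\<in>M. 0 < (norm (manifold_grad TYPE('d) M f x))\<^sup>2}"
  have "x \<in> ?U" using \<open>manifold_grad TYPE('d) M f x \<noteq> 0\<close> assms(2) by simp
  then have "emeasure dV ?U > 0" by (rule emeasure_volume_open_pos[OF openin_manifold_grad_greater])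
  moreover have "?U \<in> null_sets dV"
  proof -
    have "AE x in dV. x \<notin> ?U" using assms(1) by eventually_elim simp
    then show ?thesis
      using openin_sets_volume[OF vol openin_manifold_grad_greater[of 0]] AE_iff_null_sets by blast
  qed
  ultimately show False by (simp add: null_sets_def)
qed

end

end

section \<open>Midpoint and difference coordinates\<close>

text \<open>The map has determinant of modulus 1. By Fubini it is a translation of the midpoint for
  fixed \<open>h\<close>, followed by the reflection \<open>v = u - h\<close> for fixed
  \<open>u\<close>.\<close>

lemma lborel_distr_midpoint_diff:
  "distr lborel borel (\<lambda>z::'a\<times>'a. (fst z + (1/2) *\<^sub>R snd z, fst z - (1/2) *\<^sub>R snd z)) = (lborel :: ('a::euclidean_space \<times> 'a) measure)"
    (is "distr lborel borel ?T = _")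
proof (rule measure_eqI)
  fix A assume "A \<in> sets (distr lborel borel ?T)"
  then have A[measurable]: "A \<in> sets (borel :: ('a\<times>'a) measure)" by simp
  have A'[measurable]: "A \<in> sets (borel \<Otimes>\<^sub>M borel)" using A unfolding borel_prod .
  have T[measurable]: "?T \<in> borel \<rightarrow>\<^sub>M borel" by (intro borel_measurable_continuous_onI continuous_intros)
  have T'[measurable]: "?T \<in> lborel \<Otimes>\<^sub>M lborel \<rightarrow>\<^sub>M borel" using T by (simp add: lborel_prod)
  have tr: "(\<integral>\<^sup>+x. g x \<partial>lborel) = (\<integral>\<^sup>+x. g (c + x) \<partial>lborel)" if [measurable]: "g \<in> borel_measurable borel" 
    for g :: "'a \<Rightarrow> ennreal" and c
    by (subst lborel_distr_plus[of c, symmetric], subst nn_integral_distr) auto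
  have neg: "(\<integral>\<^sup>+x. g x \<partial>lborel) = (\<integral>\<^sup>+x. g (c - x) \<partial>lborel)" if [measurable]: "g \<in> borel_measurable borel" 
    for g :: "'a \<Rightarrow> ennreal" and c
    by (subst lborel_affine[of "-1" c], simp, subst nn_integral_density, simp_all add: nn_integral_distr)
  have "emeasure (distr lborel borel ?T) A = (\<integral>\<^sup>+z. indicator A z \<partial>distr lborel borel ?T)" by simp
  also have "\<dots> = (\<integral>\<^sup>+z. indicator A (?T z) \<partial>lborel)" by (subst nn_integral_distr) auto
  also have "\<dots> = (\<integral>\<^sup>+z. indicator A (?T z) \<partial>(lborel \<Otimes>\<^sub>M lborel))" by (simp add: lborel_prod)
  also have "\<dots> = (\<integral>\<^sup>+h. (\<integral>\<^sup>+c. indicator A (?T (c, h)) \<partial>lborel) \<partial>lborel)"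
    by (subst lborel_pair.nn_integral_snd[symmetric]) auto
  also have "\<dots> = (\<integral>\<^sup>+h. (\<integral>\<^sup>+u. indicator A (u, u - h) \<partial>lborel) \<partial>lborel)"
  proof (rule nn_integral_cong)
    fix h :: 'a
    show "(\<integral>\<^sup>+c. indicator A (?T (c, h)) \<partial>lborel) = (\<integral>\<^sup>+u. indicator A (u, u - h) \<partial>lborel)"
    proof -
      have "(\<integral>\<^sup>+u. indicator A (u, u - h) \<partial>lborel) = (\<integral>\<^sup>+c. indicator A ((1/2) *\<^sub>R h + c, ((1/2) *\<^sub>R h + c) - h) \<partial>lborel)"
        by (rule tr) measurable
      moreover have "?T (c, h) = ((1/2) *\<^sub>R h + c, ((1/2) *\<^sub>R h + c) - h)" for c
      proof -
        have "c - (1/2) *\<^sub>R h = ((1/2) *\<^sub>R h + c) - h"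
          by (rule euclidean_eqI) (simp add: inner_simps field_simps)
        then show ?thesis unfolding fst_conv snd_conv by (simp only: add.commute[of c "(1/2) *\<^sub>R h"])
      qed
      ultimately show ?thesis by (simp only:)
    qed
  qed
  also have "\<dots> = (\<integral>\<^sup>+z. indicator A (fst z, fst z - snd z) \<partial>(lborel \<Otimes>\<^sub>M lborel))"
    by (subst lborel_pair.nn_integral_snd[symmetric]) auto
  also have "\<dots> = (\<integral>\<^sup>+u. (\<integral>\<^sup>+h. indicator A (u, u - h) \<partial>lborel) \<partial>lborel)"
    by (subst lborel.nn_integral_fst[symmetric]) auto
  also have "\<dots> = (\<integral>\<^sup>+u. (\<integral>\<^sup>+v. indicator A (u, v) \<partial>lborel) \<partial>lborel)"
  proof (rule nn_integral_cong)
    fix u :: 'a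
    show "(\<integral>\<^sup>+h. indicator A (u, u - h) \<partial>lborel) = (\<integral>\<^sup>+v. indicator A (u, v) \<partial>lborel)"
      by (rule neg[symmetric]) measurable
  qed
  also have "\<dots> = (\<integral>\<^sup>+z. indicator A z \<partial>(lborel \<Otimes>\<^sub>M lborel))"
    by (subst lborel.nn_integral_fst[symmetric]) auto
  also have "\<dots> = emeasure lborel A" by (simp add: lborel_prod)
  finally show "emeasure (distr lborel borel ?T) A = emeasure lborel A" .
qed simp

lemma integral_midpoint_diff:
  fixes G :: "'a::euclidean_space \<times> 'a \<Rightarrow> real"
  assumes G: "integrable (lborel \<Otimes>\<^sub>M lborel) G"
  defines "H \<equiv> (\<lambda>z. G (fst z + (1/2) *\<^sub>R snd z, fst z - (1/2) *\<^sub>R snd z))"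
  shows "integrable (lborel \<Otimes>\<^sub>M lborel) H"
    and "(\<integral>u. \<integral>v. G (u, v) \<partial>lborel \<partial>lborel) = (\<integral>c. \<integral>h. G (c + (1/2) *\<^sub>R h, c - (1/2) *\<^sub>R h) \<partial>lborel \<partial>lborel)"
proof -
  let ?T = "\<lambda>z::'a\<times>'a. (fst z + (1/2) *\<^sub>R snd z, fst z - (1/2) *\<^sub>R snd z)"
  have [measurable]: "?T \<in> borel \<rightarrow>\<^sub>M borel" by (intro borel_measurable_continuous_onI continuous_intros)
  have Gl: "integrable lborel G" using G by (simp add: lborel_prod)
  have [measurable]: "G \<in> borel_measurable borel" using borel_measurable_integrable[OF Gl] by simp
  have "integrable (distr lborel borel ?T) G" using Gl by (simp only: lborel_distr_midpoint_diff)
  then have H: "integrable lborel H" unfolding H_def by (subst (asm) integrable_distr_eq) auto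
  then show HH: "integrable (lborel \<Otimes>\<^sub>M lborel) H" by (simp add: lborel_prod)
  have "(\<integral>u. \<integral>v. G (u, v) \<partial>lborel \<partial>lborel) = (\<integral>z. G z \<partial>(lborel \<Otimes>\<^sub>M lborel))"
    using lborel_pair.integral_fst'[OF G] by simp
  also have "\<dots> = (\<integral>z. G z \<partial>distr lborel borel ?T)" by (simp add: lborel_prod lborel_distr_midpoint_diff)
  also have "\<dots> = (\<integral>z. H z \<partial>(lborel \<Otimes>\<^sub>M lborel))" unfolding H_def lborel_prod by (subst integral_distr) auto
  also have "\<dots> = (\<integral>c. \<integral>h. H (c, h) \<partial>lborel \<partial>lborel)" using lborel_pair.integral_fst'[OF HH] by simp
  finally show "(\<integral>u. \<integral>v. G (u, v) \<partial>lborel \<partial>lborel) = (\<integral>c. \<integral>h. G (c + (1/2) *\<^sub>R h, c - (1/2) *\<^sub>R h) \<partial>lborel \<partial>lborel)"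
    by (simp add: H_def)
qed

lemma abs_power_diff_le:
  fixes x y B :: real
  assumes "\<bar>x\<bar> \<le> B" "\<bar>y\<bar> \<le> B"
  shows "\<bar>x ^ n - y ^ n\<bar> \<le> real n * B ^ (n - 1) * \<bar>x - y\<bar>"
proof (induction n)
  case (Suc n)
  have B: "B \<ge> 0" using assms(1) by linarith
  have "x ^ Suc n - y ^ Suc n = x * (x ^ n - y ^ n) + (x - y) * y ^ n" by (simp add: algebra_simps)
  then have "\<bar>x ^ Suc n - y ^ Suc n\<bar> \<le> \<bar>x\<bar> * \<bar>x ^ n - y ^ n\<bar> + \<bar>x - y\<bar> * \<bar>y\<bar> ^ n"
    by (metis abs_mult abs_triangle_ineq power_abs)
  also have "\<dots> \<le> B * (real n * B ^ (n - 1) * \<bar>x - y\<bar>) + \<bar>x - y\<bar> * B ^ n"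
    using Suc assms B by (intro add_mono mult_mono power_mono) auto
  also have "\<dots> = real (Suc n) * B ^ (Suc n - 1) * \<bar>x - y\<bar>"
    by (cases n) (auto simp: algebra_simps)
  finally show ?case .
qed simp

text \<open>Telescoping over four factors, the shape of \<open>chart_integrand\<close>.\<close>

lemma abs_prod4_diff_le:
  fixes a a0 b b0 c c0 d d0 :: real
  assumes "\<bar>a\<bar> \<le> A" "\<bar>a0\<bar> \<le> A" "\<bar>a - a0\<bar> \<le> A'" "\<bar>b\<bar> \<le> B" "\<bar>b0\<bar> \<le> B" "\<bar>b - b0\<bar> \<le> B'"
    and "\<bar>c\<bar> \<le> C" "\<bar>c0\<bar> \<le> C" "\<bar>c - c0\<bar> \<le> C'" "\<bar>d\<bar> \<le> D" "\<bar>d0\<bar> \<le> D" "\<bar>d - d0\<bar> \<le> D'"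
  shows "\<bar>a * b * c * d - a0 * b0 * c0 * d0\<bar> \<le> A' * B * C * D + A * B' * C * D + A * B * C' * D + A * B * C * D'"
proof -
  have nn: "0 \<le> A" "0 \<le> B" "0 \<le> C" "0 \<le> D" "0 \<le> A'" "0 \<le> B'" "0 \<le> C'" "0 \<le> D'"
    using assms by (auto intro: order_trans[OF abs_ge_zero])
  have "a * b * c * d - a0 * b0 * c0 * d0 = (a - a0) * b * c * d + a0 * (b - b0) * c * d + a0 * b0 * (c - c0) * d + a0 * b0 * c0 * (d - d0)"
    by (simp add: algebra_simps)
  also have "\<bar>\<dots>\<bar> \<le> \<bar>(a - a0) * b * c * d\<bar> + \<bar>a0 * (b - b0) * c * d\<bar> + \<bar>a0 * b0 * (c - c0) * d\<bar> + \<bar>a0 * b0 * c0 * (d - d0)\<bar>"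
    by (intro order_trans[OF abs_triangle_ineq] add_mono order_refl)
  also have "\<dots> \<le> A' * B * C * D + A * B' * C * D + A * B * C' * D + A * B * C * D'"
    unfolding abs_mult by (intro add_mono mult_mono assms nn mult_nonneg_nonneg abs_ge_zero)
  finally show ?thesis .
qed

lemma midpoint_mem: "convex S \<Longrightarrow> u \<in> S \<Longrightarrow> v \<in> S \<Longrightarrow> midpoint u v \<in> S" for u v :: "'a::euclidean_space"
  using midpoint_add_mem[of S u v 0] by simp

text \<open>With \<open>m\<close> the midpoint, \<open>w u * w v - (w m)^2\<close> equals
  \<open>w m * (w u + w v - 2 * w m) + (w u - w m) * (w v - w m)\<close>. The product at the
  endpoints thus agrees with the square at the midpoint to second order, which the square at one
  endpoint would not do in general.\<close>

lemma lip2_on_product_midpoint: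
  fixes w :: "'a::euclidean_space \<Rightarrow> real"
  assumes "lip2_on S w" "convex S"
  obtains C where "C > 0" "\<And>u. u \<in> S \<Longrightarrow> \<bar>w u\<bar> \<le> C"
    "\<And>u v. u \<in> S \<Longrightarrow> v \<in> S \<Longrightarrow> \<bar>(w u + w v) / 2 - w (midpoint u v)\<bar> \<le> C * (norm (u - v))\<^sup>2"
    "\<And>u v. u \<in> S \<Longrightarrow> v \<in> S \<Longrightarrow> \<bar>w u * w v - (w (midpoint u v))\<^sup>2\<bar> \<le> C * (norm (u - v))\<^sup>2"
proof -
  obtain C where C: "C > 0" "\<And>u. u \<in> S \<Longrightarrow> norm (w u) \<le> C"
    "\<And>u v. u \<in> S \<Longrightarrow> v \<in> S \<Longrightarrow> norm (w u - w v) \<le> C * norm (u - v)"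
    "\<And>u v. u \<in> S \<Longrightarrow> v \<in> S \<Longrightarrow> norm (w u + w v - 2 *\<^sub>R w (midpoint u v)) \<le> C * (norm (u - v))\<^sup>2"
    using lip2_onE[OF assms(1)] by metis
  define D where "D = C + C * C + C * C"
  have CD: "C \<le> D" "0 < D" using C(1) by (auto simp: D_def intro: add_pos_pos)
  have "\<bar>w u * w v - (w (midpoint u v))\<^sup>2\<bar> \<le> D * (norm (u - v))\<^sup>2" if uv: "u \<in> S" "v \<in> S" for u v
  proof -
    let ?m = "midpoint u v"
    have m: "?m \<in> S" by (rule midpoint_mem[OF assms(2) uv])
    have nm: "norm (u - ?m) = norm (u - v) / 2" "norm (v - ?m) = norm (u - v) / 2"
    proof -
      have "u - ?m = (1/2) *\<^sub>R (u - v)" "v - ?m = (1/2) *\<^sub>R (v - u)"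
        by (rule euclidean_eqI, simp add: midpoint_def inner_simps field_simps)+
      then show "norm (u - ?m) = norm (u - v) / 2" "norm (v - ?m) = norm (u - v) / 2"
        by (simp_all add: norm_minus_commute)
    qed
    have "C * norm (u - ?m) \<le> C * norm (u - v)" "C * norm (v - ?m) \<le> C * norm (u - v)"
      unfolding nm using C(1) by (auto intro!: mult_left_mono)
    then have am: "\<bar>w u - w ?m\<bar> \<le> C * norm (u - v)" "\<bar>w v - w ?m\<bar> \<le> C * norm (u - v)"
      using C(3)[OF uv(1) m] C(3)[OF uv(2) m] unfolding real_norm_def by linarith+
    have "w u * w v - (w ?m)\<^sup>2 = w ?m * (w u + w v - 2 * w ?m) + (w u - w ?m) * (w v - w ?m)"
      by (simp add: algebra_simps power2_eq_square)
    then have "\<bar>w u * w v - (w ?m)\<^sup>2\<bar> \<le> \<bar>w ?m\<bar> * \<bar>w u + w v - 2 * w ?m\<bar> + \<bar>w u - w ?m\<bar> * \<bar>w v - w ?m\<bar>"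
      by (metis abs_mult abs_triangle_ineq)
    also have "\<dots> \<le> C * (C * (norm (u - v))\<^sup>2) + (C * norm (u - v)) * (C * norm (u - v))"
      using C(1) C(2)[OF m] C(4)[OF uv] am by (intro add_mono mult_mono) auto
    also have "\<dots> = (C * C + C * C) * (norm (u - v))\<^sup>2" by (simp add: algebra_simps power2_eq_square)
    also have "\<dots> \<le> D * (norm (u - v))\<^sup>2" using C(1) by (intro mult_right_mono) (auto simp: D_def)
    finally show ?thesis .
  qed
  moreover have "\<bar>(w u + w v) / 2 - w (midpoint u v)\<bar> \<le> D * (norm (u - v))\<^sup>2" if uv: "u \<in> S" "v \<in> S" for u v
  proof -
    have "\<bar>(w u + w v) / 2 - w (midpoint u v)\<bar> \<le> \<bar>w u + w v - 2 * w (midpoint u v)\<bar>" by argo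
    also have "\<dots> \<le> C * (norm (u - v))\<^sup>2" using C(4)[OF uv] by simp
    also have "\<dots> \<le> D * (norm (u - v))\<^sup>2" using CD(1) by (rule mult_right_mono) simp
    finally show ?thesis .
  qed
  moreover have "\<bar>w u\<bar> \<le> D" if "u \<in> S" for u using C(2)[OF that] CD(1) by simp
  ultimately show thesis using that CD(2) by blast
qed

section \<open>The kernel energy in one chart\<close>

text \<open>The cut-off \<open>\<beta>\<close> enters through its average at the two points, so that
  it too is approximated by its midpoint value to second order. In the application \<open>w\<close>
  is the weight times the volume density.\<close>

definition chart_integrand ::
  "('b::real_normed_vector \<Rightarrow> 'a::real_normed_vector) \<Rightarrow> ('b \<Rightarrow> real) \<Rightarrow> ('b \<Rightarrow> real) \<Rightarrow> ('b \<Rightarrow> real) \<Rightarrow> ('b \<Rightarrow> real) \<Rightarrow>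
    (real \<Rightarrow> real) \<Rightarrow> nat \<Rightarrow> real \<Rightarrow> 'b \<Rightarrow> 'b \<Rightarrow> real" where
  "chart_integrand \<phi> F q \<beta> w k n \<epsilon> u v =
     (\<beta> u + \<beta> v) / 2 * k ((norm (\<phi> u - \<phi> v))\<^sup>2 * (q u * q v) / \<epsilon>) * (F u - F v) ^ n * (w u * w v)"

definition model_integrand ::
  "('b::real_normed_vector \<Rightarrow> 'a::real_normed_vector) \<Rightarrow> ('b \<Rightarrow> real) \<Rightarrow> ('b \<Rightarrow> real) \<Rightarrow> ('b \<Rightarrow> real) \<Rightarrow> ('b \<Rightarrow> real) \<Rightarrow>
    (real \<Rightarrow> real) \<Rightarrow> nat \<Rightarrow> real \<Rightarrow> 'b \<Rightarrow> 'b \<Rightarrow> real" where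
  "model_integrand \<phi> F q \<beta> w k n \<epsilon> c h =
     \<beta> c * k ((norm (frechet_derivative \<phi> (at c) h))\<^sup>2 * (q c)\<^sup>2 / \<epsilon>) * (frechet_derivative F (at c) h) ^ n * (w c)\<^sup>2"

context
  fixes \<phi> :: "real^'d \<Rightarrow> 'a::euclidean_space" and F q \<beta> w :: "real^'d \<Rightarrow> real" and V K :: "(real^'d) set"
    and k :: "real \<Rightarrow> real" and A a l q0 :: real and n :: nat
  assumes K: "compact K" "convex K" "K \<subseteq> V"
    and sm: "smooth_on V \<phi>" "smooth_on V F"
    and l: "l > 0" "\<And>u v. u \<in> K \<Longrightarrow> v \<in> K \<Longrightarrow> l * norm (u - v) \<le> norm (\<phi> u - \<phi> v)"
      "\<And>u h. u \<in> K \<Longrightarrow> l * norm h \<le> norm (frechet_derivative \<phi> (at u) h)"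
    and lip: "lip2_on K q" "lip2_on K \<beta>" "lip2_on K w"
    and q0: "q0 > 0" "\<And>u. u \<in> K \<Longrightarrow> q0 \<le> q u"
    and k: "continuous_on UNIV k" and a: "a > 0" 
    and kb: "\<And>s. s \<ge> 0 \<Longrightarrow> \<bar>k s\<bar> \<le> A * exp (- a * s)"
    and kl: "\<And>s t. s \<ge> 0 \<Longrightarrow> t \<ge> 0 \<Longrightarrow> \<bar>k s - k t\<bar> \<le> A * exp (- a * min s t) * \<bar>s - t\<bar>"
    and n: "n > 0"
begin

private abbreviation "ci \<equiv> chart_integrand \<phi> F q \<beta> w k n"
private abbreviation "mi \<equiv> model_integrand \<phi> F q \<beta> w k n"

text \<open>Write \<open>t\<close> for \<open>norm (u - v)\<close>. Freezing the cut-off and the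
  weights at the midpoint costs a factor \<open>t^2\<close>; the \<open>n\<close>-th power of the
  increment changes by order \<open>t^(n + 2)\<close>, by
  \<open>smooth_on_symmetric_difference\<close>; the squared distance changes by order
  \<open>t^4\<close>, hence the kernel argument by \<open>t^4 / \<epsilon>\<close>. Gaussian decay
  survives because both arguments are at least a multiple of
  \<open>t^2 / \<epsilon>\<close>.\<close>

lemma chart_integrand_estimate:
  "\<exists>C>0. \<exists>b>0. (\<forall>\<epsilon>>0. \<forall>u\<in>K. \<forall>v\<in>K. \<bar>ci \<epsilon> u v - mi \<epsilon> (midpoint u v) (u - v)\<bar>
      \<le> C * (norm (u - v) ^ (n + 2) + norm (u - v) ^ (n + 4) / \<epsilon>) * exp (- b * (norm (u - v))\<^sup>2 / \<epsilon>)) \<and>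
    (\<forall>\<epsilon>>0. \<forall>c\<in>K. \<forall>h. \<bar>mi \<epsilon> c h\<bar> \<le> C * norm h ^ n * exp (- b * (norm h)\<^sup>2 / \<epsilon>))"
proof -
  let ?D = "\<lambda>c. frechet_derivative \<phi> (at c)" and ?DF = "\<lambda>c. frechet_derivative F (at c)"
  obtain K1 where K1: "K1 > 0" "\<And>u v. u \<in> K \<Longrightarrow> v \<in> K \<Longrightarrow> norm (\<phi> u - \<phi> v) \<le> K1 * norm (u - v)"
    using Ck_on_lipschitz[OF K smooth_on_Ck_on[OF sm(1)]] by blast
  obtain K2 where K2: "K2 > 0" "\<And>u h. u \<in> K \<Longrightarrow> norm (?D u h) \<le> K2 * norm h"
    using Ck_on_frechet_bounded[OF K smooth_on_Ck_on[OF sm(1)]] by blast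
  obtain C3 where C3: "C3 > 0" "\<And>u v. u \<in> K \<Longrightarrow> v \<in> K \<Longrightarrow>
     norm (\<phi> u - \<phi> v - ?D (midpoint u v) (u - v)) \<le> C3 * norm (u - v) ^ 3"
    using smooth_on_symmetric_difference[OF K sm(1)] by blast
  obtain K3 where K3: "K3 > 0" "\<And>u v. u \<in> K \<Longrightarrow> v \<in> K \<Longrightarrow> norm (F u - F v) \<le> K3 * norm (u - v)"
    using Ck_on_lipschitz[OF K smooth_on_Ck_on[OF sm(2)]] by blast
  obtain K4 where K4: "K4 > 0" "\<And>u h. u \<in> K \<Longrightarrow> norm (?DF u h) \<le> K4 * norm h"
    using Ck_on_frechet_bounded[OF K smooth_on_Ck_on[OF sm(2)]] by blast
  obtain C4 where C4: "C4 > 0" "\<And>u v. u \<in> K \<Longrightarrow> v \<in> K \<Longrightarrow>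
     norm (F u - F v - ?DF (midpoint u v) (u - v)) \<le> C4 * norm (u - v) ^ 3"
    using smooth_on_symmetric_difference[OF K sm(2)] by blast
  obtain Cq where Cq: "Cq > 0" "\<And>u. u \<in> K \<Longrightarrow> \<bar>q u\<bar> \<le> Cq"
    "\<And>u v. u \<in> K \<Longrightarrow> v \<in> K \<Longrightarrow> \<bar>q u * q v - (q (midpoint u v))\<^sup>2\<bar> \<le> Cq * (norm (u - v))\<^sup>2"
    using lip2_on_product_midpoint[OF lip(1) K(2)] by metis
  obtain Cx where Cx: "Cx > 0" "\<And>u. u \<in> K \<Longrightarrow> \<bar>\<beta> u\<bar> \<le> Cx"
    "\<And>u v. u \<in> K \<Longrightarrow> v \<in> K \<Longrightarrow> \<bar>(\<beta> u + \<beta> v) / 2 - \<beta> (midpoint u v)\<bar> \<le> Cx * (norm (u - v))\<^sup>2"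
    using lip2_on_product_midpoint[OF lip(2) K(2)] by metis
  obtain Cw where Cw: "Cw > 0" "\<And>u. u \<in> K \<Longrightarrow> \<bar>w u\<bar> \<le> Cw"
    "\<And>u v. u \<in> K \<Longrightarrow> v \<in> K \<Longrightarrow> \<bar>w u * w v - (w (midpoint u v))\<^sup>2\<bar> \<le> Cw * (norm (u - v))\<^sup>2"
    using lip2_on_product_midpoint[OF lip(3) K(2)] by metis
  have A0: "A \<ge> 0" using kb[of 0] by simp
  define KP where "KP = max K1 K2"
  have KP: "KP > 0" "K1 \<le> KP" "K2 \<le> KP" using K1(1) by (auto simp: KP_def)
  define B where "B = max K3 K4"
  have B: "B > 0" "K3 \<le> B" "K4 \<le> B" using K3(1) by (auto simp: B_def)
  \<comment> \<open>Collects the two errors of the scaled squared distance: difference of squared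
    norms, and product against square for \<open>q\<close>.\<close>
  define CQ where "CQ = 2 * C3 * KP * Cq\<^sup>2 + KP\<^sup>2 * Cq"
  have CQ: "CQ > 0" unfolding CQ_def using C3(1) KP(1) Cq(1) by (intro add_pos_pos mult_pos_pos) auto
  \<comment> \<open>\<open>l\<close> and \<open>q0\<close> bound the true and the model argument of
    the kernel below by \<open>l^2 * q0^2 * t^2 / \<epsilon>\<close>.\<close>
  define b where "b = a * (l\<^sup>2 * q0\<^sup>2)"
  have b: "b > 0" using a l(1) q0(1) by (simp add: b_def)
  have DFb: "\<bar>?DF c h\<bar> \<le> B * norm h" if "c \<in> K" for c h
    using K4(2)[OF that, of h] mult_right_mono[OF B(3) norm_ge_zero[of h]] by simp
  have low0: "l\<^sup>2 * q0\<^sup>2 * (norm h)\<^sup>2 \<le> (norm (?D c h))\<^sup>2 * (q c)\<^sup>2" if "c \<in> K" for c h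
  proof -
    have "(l * norm h)\<^sup>2 * q0\<^sup>2 \<le> (norm (?D c h))\<^sup>2 * (q c)\<^sup>2"
      using l q0 that by (intro mult_mono power_mono) auto
    then show ?thesis by (simp add: power_mult_distrib mult_ac)
  qed
  have expb: "exp (- a * (Q / \<epsilon>)) \<le> exp (- b * t\<^sup>2 / \<epsilon>)" if "l\<^sup>2 * q0\<^sup>2 * t\<^sup>2 \<le> Q" "\<epsilon> > 0" for Q t \<epsilon>
  proof -
    have "b * t\<^sup>2 / \<epsilon> \<le> a * (Q / \<epsilon>)"
      using that a mult_left_mono[OF that(1), of a] by (simp add: b_def divide_right_mono mult.assoc)
    then show ?thesis by simp
  qed
  have kk: "\<bar>k (Q / \<epsilon>)\<bar> \<le> A * exp (- b * t\<^sup>2 / \<epsilon>)" if "l\<^sup>2 * q0\<^sup>2 * t\<^sup>2 \<le> Q" "\<epsilon> > 0" for Q t \<epsilon>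
  proof -
    have "0 \<le> l\<^sup>2 * q0\<^sup>2 * t\<^sup>2" by simp
    from order_trans[OF this that(1)] have "0 \<le> Q / \<epsilon>" using that(2) by simp
    then have "\<bar>k (Q / \<epsilon>)\<bar> \<le> A * exp (- a * (Q / \<epsilon>))" by (rule kb)
    also have "\<dots> \<le> A * exp (- b * t\<^sup>2 / \<epsilon>)" using expb[OF that] A0 by (rule mult_left_mono)
    finally show ?thesis .
  qed
  \<comment> \<open>One constant per source of error: \<open>X2\<close> for the kernel,
    \<open>X3\<close> for the increment of \<open>F\<close>, \<open>X4\<close> for the weights;
    \<open>X1\<close> serves the cut-off and the bound on the model itself.\<close>
  define X1 where "X1 = Cx * A * B ^ n * Cw\<^sup>2"
  define X2 where "X2 = Cx * A * CQ * B ^ n * Cw\<^sup>2"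
  define X3 where "X3 = Cx * A * (real n * B ^ (n - 1) * C4) * Cw\<^sup>2"
  define X4 where "X4 = Cx * A * B ^ n * Cw"
  have X: "X1 \<ge> 0" "X2 \<ge> 0" "X3 \<ge> 0" "X4 \<ge> 0"
    unfolding X1_def X2_def X3_def X4_def using Cx(1) A0 B(1) Cw(1) CQ C4(1) by auto
  define C where "C = 1 + X1 + X2 + X3 + X4"
  have C: "C > 0" "X1 \<le> C" using X by (auto simp: C_def)
  have est1: "\<bar>ci \<epsilon> u v - mi \<epsilon> (midpoint u v) (u - v)\<bar>
      \<le> C * (norm (u - v) ^ (n + 2) + norm (u - v) ^ (n + 4) / \<epsilon>) * exp (- b * (norm (u - v))\<^sup>2 / \<epsilon>)"
    if e: "\<epsilon> > 0" and uv: "u \<in> K" "v \<in> K" for \<epsilon> u v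
  proof -
    define t where "t = norm (u - v)"
    define c where "c = midpoint u v"
    have c: "c \<in> K" unfolding c_def by (rule midpoint_mem[OF K(2) uv])
    have t: "t \<ge> 0" by (simp add: t_def)
    define e where "e = exp (- b * t\<^sup>2 / \<epsilon>)"
    have e0: "e > 0" by (simp add: e_def)
    define Q where "Q = (norm (\<phi> u - \<phi> v))\<^sup>2 * (q u * q v)"
    define Q0 where "Q0 = (norm (?D c (u - v)))\<^sup>2 * (q c)\<^sup>2"
    have P: "norm (\<phi> u - \<phi> v) \<le> KP * t" 
      using K1(2)[OF uv] mult_right_mono[OF KP(2) t] by (simp add: t_def)
    have L: "norm (?D c (u - v)) \<le> KP * t" 
      using K2(2)[OF c, of "u - v"] mult_right_mono[OF KP(3) t] by (simp add: t_def)
    have PL: "\<bar>norm (\<phi> u - \<phi> v) - norm (?D c (u - v))\<bar> \<le> C3 * t ^ 3"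
      using norm_triangle_ineq3[of "\<phi> u - \<phi> v" "?D c (u - v)"] C3(2)[OF uv] by (simp add: t_def c_def)
    have QQ: "\<bar>Q - Q0\<bar> \<le> CQ * t ^ 4"
    proof -
      let ?x = "norm (\<phi> u - \<phi> v)" and ?y = "norm (?D c (u - v))"
      have "Q - Q0 = (?x - ?y) * (?x + ?y) * (q u * q v) + ?y\<^sup>2 * (q u * q v - (q c)\<^sup>2)"
        unfolding Q_def Q0_def by (simp add: algebra_simps power2_eq_square)
      then have "\<bar>Q - Q0\<bar> \<le> \<bar>(?x - ?y) * (?x + ?y) * (q u * q v)\<bar> + \<bar>?y\<^sup>2 * (q u * q v - (q c)\<^sup>2)\<bar>"
        by (metis abs_triangle_ineq)
      also have "\<dots> = \<bar>?x - ?y\<bar> * (?x + ?y) * (\<bar>q u\<bar> * \<bar>q v\<bar>) + ?y\<^sup>2 * \<bar>q u * q v - (q c)\<^sup>2\<bar>"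
        by (simp add: abs_mult)
      also have "\<dots> \<le> C3 * t ^ 3 * (KP * t + KP * t) * (Cq * Cq) + (KP * t)\<^sup>2 * (Cq * t\<^sup>2)"
        using PL P L Cq(2)[OF uv(1)] Cq(2)[OF uv(2)] Cq(3)[OF uv] Cq(1) C3(1) KP(1) t
        by (intro add_mono mult_mono power_mono mult_nonneg_nonneg) (auto simp: t_def c_def)
      also have "\<dots> = CQ * t ^ 4"
        by (simp add: CQ_def algebra_simps power2_eq_square power3_eq_cube power4_eq_xxxx)
      finally show ?thesis .
    qed
    have lowQ: "l\<^sup>2 * q0\<^sup>2 * t\<^sup>2 \<le> Q"
    proof -
      have "(l * t)\<^sup>2 * (q0 * q0) \<le> (norm (\<phi> u - \<phi> v))\<^sup>2 * (q u * q v)"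
        using l(1) l(2)[OF uv] q0(1) q0(2)[OF uv(1)] q0(2)[OF uv(2)] t
        by (intro mult_mono power_mono) (auto simp: t_def)
      then show ?thesis by (simp add: Q_def power_mult_distrib power2_eq_square mult_ac)
    qed
    have lowQ0: "l\<^sup>2 * q0\<^sup>2 * t\<^sup>2 \<le> Q0" using low0[OF c, of "u - v"] by (simp add: Q0_def t_def)
    have nnt: "0 \<le> l\<^sup>2 * q0\<^sup>2 * t\<^sup>2" by simp
    have Qp: "0 \<le> Q / \<epsilon>" "0 \<le> Q0 / \<epsilon>"
      using order_trans[OF nnt lowQ] order_trans[OF nnt lowQ0] \<open>\<epsilon> > 0\<close> by simp_all
    have kd: "\<bar>k (Q / \<epsilon>) - k (Q0 / \<epsilon>)\<bar> \<le> A * e * (CQ * t ^ 4 / \<epsilon>)"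
    proof -
      have "exp (- a * min (Q / \<epsilon>) (Q0 / \<epsilon>)) \<le> e"
        using expb[OF lowQ \<open>\<epsilon> > 0\<close>] expb[OF lowQ0 \<open>\<epsilon> > 0\<close>] by (auto simp: e_def min_def)
      moreover have "\<bar>Q / \<epsilon> - Q0 / \<epsilon>\<bar> \<le> CQ * t ^ 4 / \<epsilon>"
        using QQ \<open>\<epsilon> > 0\<close> by (simp add: divide_right_mono abs_divide flip: diff_divide_distrib)
      ultimately have "A * exp (- a * min (Q / \<epsilon>) (Q0 / \<epsilon>)) * \<bar>Q / \<epsilon> - Q0 / \<epsilon>\<bar> \<le> A * e * (CQ * t ^ 4 / \<epsilon>)"
        using A0 e0 by (intro mult_mono) auto
      then show ?thesis using kl[OF Qp] by linarith
    qed
    have Fb: "\<bar>F u - F v\<bar> \<le> B * t" 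
      using K3(2)[OF uv] mult_right_mono[OF B(2) t] by (simp add: t_def)
    have Fc: "\<bar>?DF c (u - v)\<bar> \<le> B * t" using DFb[OF c] by (simp add: t_def)
    have Bt: "0 \<le> B * t" using B(1) t by simp
    have Fn: "\<bar>(F u - F v) ^ n\<bar> \<le> B ^ n * t ^ n" "\<bar>(?DF c (u - v)) ^ n\<bar> \<le> B ^ n * t ^ n"
      unfolding power_abs power_mult_distrib[symmetric] using Fb Fc by (auto intro: power_mono)
    have Fd: "\<bar>(F u - F v) ^ n - (?DF c (u - v)) ^ n\<bar> \<le> real n * B ^ (n - 1) * C4 * t ^ (n + 2)"
    proof -
      have "\<bar>(F u - F v) ^ n - (?DF c (u - v)) ^ n\<bar> \<le> real n * (B * t) ^ (n - 1) * \<bar>(F u - F v) - ?DF c (u - v)\<bar>"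
        by (rule abs_power_diff_le[OF Fb Fc])
      also have "\<dots> \<le> real n * (B * t) ^ (n - 1) * (C4 * t ^ 3)"
        using C4(2)[OF uv] Bt by (intro mult_left_mono) (auto simp: c_def t_def)
      also have "\<dots> = real n * B ^ (n - 1) * C4 * (t ^ (n - 1) * t ^ 3)" by (simp add: power_mult_distrib)
      also have "t ^ (n - 1) * t ^ 3 = t ^ (n + 2)" using n by (simp flip: power_add)
      finally show ?thesis .
    qed
    have xav: "\<bar>(\<beta> u + \<beta> v) / 2\<bar> \<le> Cx" using Cx(2)[OF uv(1)] Cx(2)[OF uv(2)] unfolding abs_le_iff by argo
    have ww: "\<bar>w u * w v\<bar> \<le> Cw\<^sup>2" "\<bar>(w c)\<^sup>2\<bar> \<le> Cw\<^sup>2"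
      unfolding power2_eq_square abs_mult
      by (rule mult_mono[OF Cw(2)[OF uv(1)] Cw(2)[OF uv(2)] less_imp_le[OF Cw(1)] abs_ge_zero],
          rule mult_mono[OF Cw(2)[OF c] Cw(2)[OF c] less_imp_le[OF Cw(1)] abs_ge_zero])
    have "\<bar>ci \<epsilon> u v - mi \<epsilon> c (u - v)\<bar>
      \<le> (Cx * t\<^sup>2) * (A * e) * (B ^ n * t ^ n) * Cw\<^sup>2 + Cx * (A * e * (CQ * t ^ 4 / \<epsilon>)) * (B ^ n * t ^ n) * Cw\<^sup>2
        + Cx * (A * e) * (real n * B ^ (n - 1) * C4 * t ^ (n + 2)) * Cw\<^sup>2 + Cx * (A * e) * (B ^ n * t ^ n) * (Cw * t\<^sup>2)"
      unfolding chart_integrand_def model_integrand_def Q_def[symmetric] Q0_def[symmetric]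
      by (rule abs_prod4_diff_le[OF xav Cx(2)[OF c] Cx(3)[OF uv, folded c_def t_def]
           kk[OF lowQ \<open>\<epsilon> > 0\<close>, folded e_def] kk[OF lowQ0 \<open>\<epsilon> > 0\<close>, folded e_def] kd Fn Fd ww Cw(3)[OF uv, folded c_def t_def]])
    also have "\<dots> = (X1 + X3 + X4) * t ^ (n + 2) * e + X2 * (t ^ (n + 4) / \<epsilon>) * e"
      by (simp add: X1_def X2_def X3_def X4_def algebra_simps power_add add_divide_distrib power2_eq_square)
    also have "\<dots> \<le> C * t ^ (n + 2) * e + C * (t ^ (n + 4) / \<epsilon>) * e"
      using X t e0 \<open>\<epsilon> > 0\<close> by (intro add_mono mult_right_mono) (auto simp: C_def)
    also have "\<dots> = C * (t ^ (n + 2) + t ^ (n + 4) / \<epsilon>) * e" by (simp add: algebra_simps)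
    finally show ?thesis by (simp add: e_def t_def c_def)
  qed
  have est2: "\<bar>mi \<epsilon> c h\<bar> \<le> C * norm h ^ n * exp (- b * (norm h)\<^sup>2 / \<epsilon>)" if "\<epsilon> > 0" "c \<in> K" for \<epsilon> c h
  proof -
    have "\<bar>mi \<epsilon> c h\<bar> \<le> Cx * (A * exp (- b * (norm h)\<^sup>2 / \<epsilon>)) * (B * norm h) ^ n * Cw\<^sup>2"
      unfolding model_integrand_def abs_mult power_abs
      using Cx(1) Cx(2)[OF that(2)] kk[OF low0[OF that(2)] that(1), of h] DFb[OF that(2), of h] Cw(1) Cw(2)[OF that(2)] A0 B(1)
      by (intro mult_mono power_mono) (auto intro!: mult_nonneg_nonneg)
    also have "\<dots> = X1 * (norm h ^ n * exp (- b * (norm h)\<^sup>2 / \<epsilon>))" by (simp add: X1_def power_mult_distrib)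
    also have "\<dots> \<le> C * (norm h ^ n * exp (- b * (norm h)\<^sup>2 / \<epsilon>))" using C(2) by (rule mult_right_mono) simp
    finally show ?thesis by (simp add: mult.assoc)
  qed
  show ?thesis
    by (rule exI[of _ C], rule conjI[OF C(1)], rule exI[of _ b], rule conjI[OF b], intro conjI allI impI ballI est1 est2)
qed

text \<open>In midpoint and displacement coordinates the pointwise error is integrated over
  \<open>h\<close>; scaling by \<open>sqrt \<epsilon>\<close> yields two orders of
  \<open>sqrt \<epsilon>\<close> beyond the main term. The chart restricts \<open>h\<close>, whereas
  the model integrates over all of space; on the support of \<open>\<beta>\<close> the displacements
  so added satisfy \<open>norm h \<ge> \<delta>\<close> and fit into the same error.\<close>

lemma chart_integral_estimate:
  fixes u0 :: "real^'d" and \<delta> :: real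
  assumes Kb: "K = cball u0 \<delta>" and \<delta>: "\<delta> > 0"
    and supp: "\<And>c. c \<in> K \<Longrightarrow> c \<notin> ball u0 (\<delta>/2) \<Longrightarrow> \<beta> c = 0"
    and Gm: "\<And>\<epsilon>. \<epsilon> > 0 \<Longrightarrow> (\<lambda>z. indicator (ball u0 \<delta>) (fst z) * indicator (ball u0 \<delta>) (snd z) * ci \<epsilon> (fst z) (snd z))
       \<in> borel_measurable (lborel \<Otimes>\<^sub>M lborel)"
    and Zm: "\<And>\<epsilon>. \<epsilon> > 0 \<Longrightarrow> (\<lambda>c. indicator (ball u0 \<delta>) c * (\<integral>h. mi \<epsilon> c h \<partial>lborel)) \<in> borel_measurable lborel"
  shows "\<exists>C>0. \<forall>\<epsilon>>0. integrable lborel (\<lambda>c. indicator (ball u0 \<delta>) c * (\<integral>h. mi \<epsilon> c h \<partial>lborel)) \<and>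
     \<bar>(\<integral>u. \<integral>v. indicator (ball u0 \<delta>) u * indicator (ball u0 \<delta>) v * ci \<epsilon> u v \<partial>lborel \<partial>lborel)
       - (\<integral>c. indicator (ball u0 \<delta>) c * (\<integral>h. mi \<epsilon> c h \<partial>lborel) \<partial>lborel)\<bar> \<le> C * sqrt \<epsilon> ^ (CARD('d) + n) * \<epsilon>"
proof -
  obtain C b where C: "C > 0" and b: "b > 0"
    and est1: "\<And>\<epsilon> u v. \<epsilon> > 0 \<Longrightarrow> u \<in> K \<Longrightarrow> v \<in> K \<Longrightarrow> \<bar>ci \<epsilon> u v - mi \<epsilon> (midpoint u v) (u - v)\<bar>
      \<le> C * (norm (u - v) ^ (n + 2) + norm (u - v) ^ (n + 4) / \<epsilon>) * exp (- b * (norm (u - v))\<^sup>2 / \<epsilon>)"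
    and est2: "\<And>\<epsilon> c h. \<epsilon> > 0 \<Longrightarrow> c \<in> K \<Longrightarrow> \<bar>mi \<epsilon> c h\<bar> \<le> C * norm h ^ n * exp (- b * (norm h)\<^sup>2 / \<epsilon>)"
    using chart_integrand_estimate by (elim exE conjE) (erule that; blast)
  let ?U = "ball u0 \<delta>"
  have UK: "?U \<subseteq> K" using Kb by auto
  define m where "m j = (\<integral>z. norm (z::real^'d) ^ j * exp (- b * (norm z)\<^sup>2) \<partial>lborel)" for j
  have m0: "m j \<ge> 0" for j unfolding m_def by (intro Bochner_Integration.integral_nonneg) auto
  \<comment> \<open>The term \<open>1 / \<delta>^2\<close> pays for displacements that leave the
    chart: there \<open>norm h ^ n\<close> is at most
    \<open>norm h ^ (n + 2) / \<delta>^2\<close>.\<close>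
  define C' where "C' = C * (1 + 1 / \<delta>\<^sup>2)"
  have C': "C' > 0" "C \<le> C'" "C / \<delta>\<^sup>2 \<le> C'" using C \<delta> by (auto simp: C'_def algebra_simps add_pos_nonneg)
  define C2 where "C2 = C' * (m (n + 2) + m (n + 4))"
  have C2: "C2 \<ge> 0" using C' m0 by (simp add: C2_def)
  define vol where "vol = measure lborel ?U"
  have volU: "emeasure lborel ?U < \<infinity>" using emeasure_lborel_ball_finite[of u0 \<delta>] by simp
  have main: "integrable lborel (\<lambda>c. indicator ?U c * (\<integral>h. mi \<epsilon> c h \<partial>lborel)) \<and>
     \<bar>(\<integral>u. \<integral>v. indicator ?U u * indicator ?U v * ci \<epsilon> u v \<partial>lborel \<partial>lborel)
       - (\<integral>c. indicator ?U c * (\<integral>h. mi \<epsilon> c h \<partial>lborel) \<partial>lborel)\<bar> \<le> C2 * vol * (sqrt \<epsilon> ^ (CARD('d) + n) * \<epsilon>)"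
    if e: "\<epsilon> > 0" for \<epsilon>
  proof -
    define G where "G = (\<lambda>z. indicator ?U (fst z) * indicator ?U (snd z) * ci \<epsilon> (fst z) (snd z))"
    have Gm': "G \<in> borel_measurable (lborel \<Otimes>\<^sub>M lborel)" unfolding G_def by (rule Gm[OF e])
    define R where "R = (\<lambda>h::real^'d. (norm h ^ (n + 2) + norm h ^ (n + 4) / \<epsilon>) * exp (- b * (norm h)\<^sup>2 / \<epsilon>))"
    have R0: "R h \<ge> 0" for h using e by (simp add: R_def)
    have Ri: "integrable lborel R" "(\<integral>h. R h \<partial>lborel) = (m (n + 2) + m (n + 4)) * (sqrt \<epsilon> ^ (CARD('d) + n) * \<epsilon>)"
    proof -
      have R: "R = (\<lambda>h. norm h ^ (n + 2) * exp (- b * (norm h)\<^sup>2 / \<epsilon>) + (1/\<epsilon>) * (norm h ^ (n + 4) * exp (- b * (norm h)\<^sup>2 / \<epsilon>)))"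
        by (simp add: R_def fun_eq_iff algebra_simps)
      note I = integral_power_exp_scaled[OF e, where 'd = 'd and b = b]
      show "integrable lborel R" unfolding R using I(2)[OF b] by (intro Bochner_Integration.integrable_add integrable_mult_right)
      have "(\<integral>h. R h \<partial>lborel) = sqrt \<epsilon> ^ (CARD('d) + (n + 2)) * m (n + 2) + (1/\<epsilon>) * (sqrt \<epsilon> ^ (CARD('d) + (n + 4)) * m (n + 4))"
        unfolding R Bochner_Integration.integral_add[OF I(2)[OF b] integrable_mult_right[OF I(2)[OF b]]]
        by (simp only: integral_mult_right_zero I(1) m_def)
      also have "sqrt \<epsilon> ^ (CARD('d) + (n + 2)) = sqrt \<epsilon> ^ (CARD('d) + n) * \<epsilon>"
        using e by (simp add: power_add power2_eq_square)
      also have "sqrt \<epsilon> ^ (CARD('d) + (n + 4)) = sqrt \<epsilon> ^ (CARD('d) + n) * (\<epsilon> * \<epsilon>)"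
      proof -
        have "sqrt \<epsilon> ^ 4 = (sqrt \<epsilon> ^ 2) ^ 2" by (simp flip: power_mult)
        then show ?thesis using e by (simp add: power_add power2_eq_square)
      qed
      finally show "(\<integral>h. R h \<partial>lborel) = (m (n + 2) + m (n + 4)) * (sqrt \<epsilon> ^ (CARD('d) + n) * \<epsilon>)"
        using e by (simp add: field_simps)
    qed
    define A1 where "A1 = (\<lambda>c h. G (c + (1/2) *\<^sub>R h, c - (1/2) *\<^sub>R h))"
    have midm: "midpoint (c + (1/2) *\<^sub>R h) (c - (1/2) *\<^sub>R h) = c" for c h :: "real^'d"
      by (rule euclidean_eqI) (simp add: midpoint_def inner_simps)
    have midd: "(c + (1/2) *\<^sub>R h) - (c - (1/2) *\<^sub>R h) = h" for c h :: "real^'d"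
      by (rule euclidean_eqI) (simp add: inner_simps)
    have diff: "\<bar>A1 c h - indicator ?U c * mi \<epsilon> c h\<bar> \<le> indicator ?U c * (C' * R h)" for c h
    proof (cases "c + (1/2) *\<^sub>R h \<in> ?U \<and> c - (1/2) *\<^sub>R h \<in> ?U")
      case True
      then have cU: "c \<in> ?U" using midpoint_mem[OF convex_ball, of "c + (1/2) *\<^sub>R h" u0 \<delta> "c - (1/2) *\<^sub>R h"] midm by metis
      have uv: "c + (1/2) *\<^sub>R h \<in> K" "c - (1/2) *\<^sub>R h \<in> K" using True UK by blast+
      have "\<bar>A1 c h - mi \<epsilon> c h\<bar> \<le> C * R h"
        using est1[OF e uv] True by (simp only: midm midd) (simp add: A1_def G_def R_def mult.assoc)
      also have "\<dots> \<le> C' * R h" using C'(2) R0 by (rule mult_right_mono)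
      finally show ?thesis using cU by simp
    next
      case False
      then have A10: "A1 c h = 0" by (auto simp: A1_def G_def indicator_def)
      show ?thesis
      proof (cases "c \<in> ?U")
        case True
        show ?thesis
        proof (cases "\<beta> c = 0")
          case True then show ?thesis using A10 R0 C'(1) by (simp add: model_integrand_def)
        next
          case nz: False
          then have "c \<in> ball u0 (\<delta>/2)" using supp True UK by blast
          then have c2: "dist u0 c < \<delta> / 2" by simp
          have hd: "norm h \<ge> \<delta>"
          proof (rule ccontr)
            assume "\<not> norm h \<ge> \<delta>"
            then have "norm ((1/2) *\<^sub>R h) < \<delta> / 2" by simp
            then have "dist u0 (c + (1/2) *\<^sub>R h) < \<delta>" "dist u0 (c - (1/2) *\<^sub>R h) < \<delta>"
              using c2 dist_triangle[of u0 "c + (1/2) *\<^sub>R h" c] dist_triangle[of u0 "c - (1/2) *\<^sub>R h" c]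
              by (auto simp: dist_norm)
            then show False using False by simp
          qed
          then have "\<delta>\<^sup>2 \<le> (norm h)\<^sup>2" using \<delta> by (intro power_mono) auto
          then have "1 \<le> (1 / \<delta>\<^sup>2) * (norm h)\<^sup>2" using \<delta> by (simp add: field_simps)
          then have "norm h ^ n * 1 \<le> norm h ^ n * ((1 / \<delta>\<^sup>2) * (norm h)\<^sup>2)" by (intro mult_left_mono) auto
          then have "norm h ^ n \<le> (1 / \<delta>\<^sup>2) * norm h ^ (n + 2)" by (simp add: power2_eq_square mult_ac)
          also have "\<dots> \<le> (1 / \<delta>\<^sup>2) * (norm h ^ (n + 2) + norm h ^ (n + 4) / \<epsilon>)"
            using e by (intro mult_left_mono) auto
          finally have hn: "norm h ^ n \<le> (1 / \<delta>\<^sup>2) * (norm h ^ (n + 2) + norm h ^ (n + 4) / \<epsilon>)" .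
          have "\<bar>mi \<epsilon> c h\<bar> \<le> C * norm h ^ n * exp (- b * (norm h)\<^sup>2 / \<epsilon>)"
            using est2[OF e] True UK by blast
          also have "\<dots> \<le> C * ((1 / \<delta>\<^sup>2) * (norm h ^ (n + 2) + norm h ^ (n + 4) / \<epsilon>)) * exp (- b * (norm h)\<^sup>2 / \<epsilon>)"
            using hn C by (intro mult_right_mono mult_left_mono) auto
          also have "\<dots> = C / \<delta>\<^sup>2 * R h" by (simp add: R_def)
          also have "\<dots> \<le> C' * R h" using C'(3) R0 by (rule mult_right_mono)
          finally show ?thesis using A10 True by simp
        qed
      next
        case False then show ?thesis using A10 by simp
      qed
    qed
    have modi: "integrable lborel (mi \<epsilon> c)" if "c \<in> K" for c
    proof (rule Bochner_Integration.integrable_bound)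
      show "integrable lborel (\<lambda>h. C * (norm (h::real^'d) ^ n * exp (- b * (norm h)\<^sup>2 / \<epsilon>)))"
        by (intro integrable_mult_right integral_power_exp_scaled(2) e b)
      have cV: "c \<in> V" using that K(3) by blast
      have "continuous_on UNIV (frechet_derivative \<phi> (at c))" "continuous_on UNIV (frechet_derivative F (at c))"
        using smooth_on_linear[OF sm(1) cV] smooth_on_linear[OF sm(2) cV] linear_continuous_on linear_conv_bounded_linear by blast+
      then have "continuous_on UNIV (mi \<epsilon> c)"
        unfolding model_integrand_def[abs_def] using e
        by (intro continuous_intros continuous_on_compose2[OF k]) auto
      then show "mi \<epsilon> c \<in> borel_measurable lborel" using borel_measurable_continuous_onI by simp
      show "AE h in lborel. norm (mi \<epsilon> c h) \<le> norm (C * (norm h ^ n * exp (- b * (norm h)\<^sup>2 / \<epsilon>)))"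
        using est2[OF e that] C by (intro AE_I2) (simp add: mult.assoc)
    qed
    define Z where "Z c = indicator ?U c * (\<integral>h. mi \<epsilon> c h \<partial>lborel)" for c
    have A1m: "A1 c \<in> borel_measurable lborel" for c
    proof -
      have "(\<lambda>h. (c + (1/2) *\<^sub>R h, c - (1/2) *\<^sub>R h)) \<in> borel \<rightarrow>\<^sub>M (lborel \<Otimes>\<^sub>M lborel)"
        by measurable
      from measurable_compose[OF this Gm'] show ?thesis by (simp add: A1_def)
    qed
    have mi: "integrable lborel (\<lambda>h. indicator ?U c * mi \<epsilon> c h)" for c
      using modi[of c] UK by (cases "c \<in> ?U") auto
    have A1i: "integrable lborel (A1 c)" for c
    proof (rule Bochner_Integration.integrable_bound)
      show "integrable lborel (\<lambda>h. \<bar>indicator ?U c * mi \<epsilon> c h\<bar> + C' * R h)"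
        by (intro Bochner_Integration.integrable_add integrable_abs mi integrable_mult_right Ri)
      have "\<bar>A1 c h\<bar> \<le> \<bar>indicator ?U c * mi \<epsilon> c h\<bar> + C' * R h" for h
      proof -
        have "indicator ?U c * (C' * R h) \<le> C' * R h" using C'(1) R0[of h] by (simp add: indicator_def)
        then show ?thesis using diff[of c h] by linarith
      qed
      then show "AE h in lborel. norm (A1 c h) \<le> norm (\<bar>indicator ?U c * mi \<epsilon> c h\<bar> + C' * R h)"
        by (intro AE_I2) (simp add: order_trans[OF _ abs_ge_self])
    qed (rule A1m)
    have dZ: "\<bar>(\<integral>h. A1 c h \<partial>lborel) - Z c\<bar> \<le> indicator ?U c * (C2 * (sqrt \<epsilon> ^ (CARD('d) + n) * \<epsilon>))" for c
    proof -
      have "(\<integral>h. A1 c h \<partial>lborel) - Z c = (\<integral>h. A1 c h - indicator ?U c * mi \<epsilon> c h \<partial>lborel)"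
        unfolding Z_def by (subst Bochner_Integration.integral_diff[OF A1i mi]) simp
      also have "\<bar>\<dots>\<bar> \<le> (\<integral>h. indicator ?U c * (C' * R h) \<partial>lborel)"
        using diff[of c]
        by (intro order_trans[OF integral_abs_bound] integral_mono integrable_abs Bochner_Integration.integrable_diff A1i mi integrable_mult_right Ri) auto
      also have "\<dots> = indicator ?U c * (C2 * (sqrt \<epsilon> ^ (CARD('d) + n) * \<epsilon>))" by (simp add: Ri(2) C2_def)
      finally show ?thesis .
    qed
    have Gi: "integrable (lborel \<Otimes>\<^sub>M lborel) G"
    proof (rule Bochner_Integration.integrable_bound)
      \<comment> \<open>A crude bound on a bounded region, depending on \<epsilon>; it serves only
        the integrability that Fubini requires.\<close>
      let ?B = "C * (2 * \<delta>) ^ n + C * ((2 * \<delta>) ^ (n + 2) + (2 * \<delta>) ^ (n + 4) / \<epsilon>)"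
      have fin: "emeasure (lborel \<Otimes>\<^sub>M lborel) (?U \<times> ?U) < \<infinity>"
        by (subst lborel.emeasure_pair_measure_Times) (use volU in \<open>auto simp: ennreal_mult_less_top\<close>)
      have meas: "?U \<times> ?U \<in> sets (lborel \<Otimes>\<^sub>M lborel)" by (intro pair_measureI) auto
      show "integrable (lborel \<Otimes>\<^sub>M lborel) (\<lambda>z. ?B * indicator (?U \<times> ?U) z)"
        using fin meas by (intro integrable_mult_right integrable_real_indicator)
      have "\<bar>ci \<epsilon> u v\<bar> \<le> ?B" if "u \<in> ?U" "v \<in> ?U" for u v
      proof -
        have uv: "u \<in> K" "v \<in> K" using that UK by blast+
        have "dist u v < \<delta> + \<delta>" using dist_triangle_less_add[of u u0 \<delta> v \<delta>] that by (auto simp: dist_commute)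
        then have t: "norm (u - v) \<le> 2 * \<delta>" by (simp add: dist_norm)
        have ex: "exp (- b * (norm (u - v))\<^sup>2 / \<epsilon>) \<le> 1" using b e by simp
        have pw: "norm (u - v) ^ j \<le> (2 * \<delta>) ^ j" for j using t by (intro power_mono) auto
        have "\<bar>mi \<epsilon> (midpoint u v) (u - v)\<bar> \<le> C * norm (u - v) ^ n * exp (- b * (norm (u - v))\<^sup>2 / \<epsilon>)"
          by (rule est2[OF e midpoint_mem[OF K(2) uv]])
        also have "\<dots> \<le> C * (2 * \<delta>) ^ n * 1"
          using C pw[of n] ex \<delta> by (intro mult_mono) auto
        finally have 1: "\<bar>mi \<epsilon> (midpoint u v) (u - v)\<bar> \<le> C * (2 * \<delta>) ^ n" by simp
        have "C * (norm (u - v) ^ (n + 2) + norm (u - v) ^ (n + 4) / \<epsilon>) * exp (- b * (norm (u - v))\<^sup>2 / \<epsilon>)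
          \<le> C * ((2 * \<delta>) ^ (n + 2) + (2 * \<delta>) ^ (n + 4) / \<epsilon>) * 1"
          using C pw[of "n+2"] pw[of "n+4"] ex \<delta> e
          by (intro mult_mono mult_left_mono add_mono divide_right_mono) (auto intro!: add_nonneg_nonneg)
        then show ?thesis using 1 est1[OF e uv] by linarith
      qed
      moreover have "0 \<le> ?B" using C \<delta> e by simp
      ultimately show "AE z in lborel \<Otimes>\<^sub>M lborel. norm (G z) \<le> norm (?B * indicator (?U \<times> ?U) z)"
        by (intro AE_I2) (auto simp: G_def indicator_def)
    qed (rule Gm')
    have I: "(\<integral>u. \<integral>v. G (u, v) \<partial>lborel \<partial>lborel) = (\<integral>c. \<integral>h. A1 c h \<partial>lborel \<partial>lborel)"
      unfolding A1_def by (rule integral_midpoint_diff(2)[OF Gi])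
    have Ii: "integrable lborel (\<lambda>c. \<integral>h. A1 c h \<partial>lborel)"
      using lborel_pair.integrable_fst'[OF integral_midpoint_diff(1)[OF Gi]] by (simp add: A1_def)
    have Ui: "integrable lborel (\<lambda>c. indicator ?U c * (C2 * (sqrt \<epsilon> ^ (CARD('d) + n) * \<epsilon>)) :: real)"
      using volU by (intro integrable_mult_left integrable_real_indicator) auto
    \<comment> \<open>The model integral inherits integrability from the transformed chart integral
      and the error just bounded.\<close>
    have Zi: "integrable lborel Z"
    proof (rule Bochner_Integration.integrable_bound)
      show "integrable lborel (\<lambda>c. \<bar>\<integral>h. A1 c h \<partial>lborel\<bar> + indicator ?U c * (C2 * (sqrt \<epsilon> ^ (CARD('d) + n) * \<epsilon>)))"
        by (intro Bochner_Integration.integrable_add integrable_abs Ii Ui)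
      show "Z \<in> borel_measurable lborel" unfolding Z_def using Zm[OF e] by simp
      have "\<bar>Z c\<bar> \<le> \<bar>\<integral>h. A1 c h \<partial>lborel\<bar> + indicator ?U c * (C2 * (sqrt \<epsilon> ^ (CARD('d) + n) * \<epsilon>))" for c
        using dZ[of c] by linarith
      then show "AE c in lborel. norm (Z c) \<le> norm (\<bar>\<integral>h. A1 c h \<partial>lborel\<bar> + indicator ?U c * (C2 * (sqrt \<epsilon> ^ (CARD('d) + n) * \<epsilon>)))"
        by (intro AE_I2) (simp add: order_trans[OF _ abs_ge_self])
    qed
    have "(\<integral>c. \<integral>h. A1 c h \<partial>lborel \<partial>lborel) - (\<integral>c. Z c \<partial>lborel) = (\<integral>c. (\<integral>h. A1 c h \<partial>lborel) - Z c \<partial>lborel)"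
      by (rule Bochner_Integration.integral_diff[OF Ii Zi, symmetric])
    also have "\<bar>\<dots>\<bar> \<le> (\<integral>c. indicator ?U c * (C2 * (sqrt \<epsilon> ^ (CARD('d) + n) * \<epsilon>)) \<partial>lborel)"
      using dZ by (intro order_trans[OF integral_abs_bound] integral_mono integrable_abs Bochner_Integration.integrable_diff Ii Zi Ui) auto
    also have "\<dots> = C2 * vol * (sqrt \<epsilon> ^ (CARD('d) + n) * \<epsilon>)" by (simp add: vol_def)
    finally show ?thesis using I Zi unfolding Z_def[abs_def] by (simp add: G_def)
  qed
  have le: "C2 * vol * (sqrt \<epsilon> ^ (CARD('d) + n) * \<epsilon>) \<le> (C2 * vol + 1) * sqrt \<epsilon> ^ (CARD('d) + n) * \<epsilon>" if "\<epsilon> > 0" for \<epsilon>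
    using that by (simp add: algebra_simps)
  have pos: "C2 * vol + 1 > 0" using C2 by (simp add: vol_def add_nonneg_pos)
  show ?thesis
    by (rule exI[of _ "C2 * vol + 1"], rule conjI[OF pos], intro allI impI conjI conjunct1[OF main]
          order_trans[OF conjunct2[OF main] le])
qed

end

section \<open>Kernel energies on the manifold\<close>

text \<open>Bounds are required in every parametrization, since cut-offs and powers of the density
  are later read in whatever chart is at hand. Continuity on \<open>M\<close> provides measurability
  and boundedness.\<close>

definition lip2_fun :: "'d::finite itself \<Rightarrow> 'a::euclidean_space set \<Rightarrow> ('a \<Rightarrow> real) \<Rightarrow> bool" where
  "lip2_fun _ M g \<longleftrightarrow> continuous_on M g \<and>
     (\<forall>(V :: (real^'d) set) \<phi> K. local_param M V \<phi> \<longrightarrow> compact K \<longrightarrow> convex K \<longrightarrow> K \<subseteq> V \<longrightarrow> lip2_on K (g \<circ> \<phi>))"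

text \<open>For pairs of points at a fixed distance; the right side has the form of the error terms
  in the chart estimates.\<close>

lemma exp_inverse_le_power:
  assumes "c > 0" "0 < \<epsilon>" "\<epsilon> \<le> (1::real)"
  shows "exp (- c / \<epsilon>) \<le> fact (N + 1) / c ^ (N + 1) * (sqrt \<epsilon> ^ N * \<epsilon>)"
proof -
  have "(1 / \<epsilon>) ^ (N + 1) * exp (- c * (1 / \<epsilon>)) \<le> fact (N + 1) / c ^ (N + 1)"
    by (rule power_times_exp_le) (use assms in auto)
  then have "exp (- c / \<epsilon>) \<le> fact (N + 1) / c ^ (N + 1) * \<epsilon> ^ (N + 1)"
    using assms by (simp add: power_divide field_simps)
  also have "\<dots> \<le> fact (N + 1) / c ^ (N + 1) * (sqrt \<epsilon> ^ N * \<epsilon>)"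
  proof (intro mult_left_mono)
    have "\<epsilon> \<le> sqrt \<epsilon>" using assms by (metis less_eq_real_def mult_left_le real_sqrt_ge_0_iff real_sqrt_le_1_iff real_sqrt_mult_self abs_of_pos)
    then have "\<epsilon> ^ N \<le> sqrt \<epsilon> ^ N" using assms by (intro power_mono) auto
    then show "\<epsilon> ^ (N + 1) \<le> sqrt \<epsilon> ^ N * \<epsilon>" using assms by simp
  qed (use assms in auto)
  finally show ?thesis .
qed

text \<open>\<open>q\<close> plays the part of a reciprocal bandwidth and \<open>\<tau>\<close> that
  of the weight of a point, sampling density included.\<close>

definition kernel_energy_integrand ::
  "(real \<Rightarrow> real) \<Rightarrow> ('a::real_normed_vector \<Rightarrow> real) \<Rightarrow> ('a \<Rightarrow> real) \<Rightarrow> ('a \<Rightarrow> real) \<Rightarrow> nat \<Rightarrow> real \<Rightarrow> 'a \<Rightarrow> 'a \<Rightarrow> real" where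
  "kernel_energy_integrand k q f \<tau> n \<epsilon> x y =
     k ((norm (x - y))\<^sup>2 * (q x * q y) / \<epsilon>) * (f x - f y) ^ n * (\<tau> x * \<tau> y)"

text \<open>The exponent \<open>d + n\<close> of \<open>q\<close> comes from the local length scale
  \<open>sqrt \<epsilon> / q\<close>: \<open>d\<close> from the volume of a neighbourhood,
  \<open>n\<close> from the increments of \<open>f\<close>.\<close>

definition limit_energy_density ::
  "'d::finite itself \<Rightarrow> 'a::euclidean_space set \<Rightarrow> ('a \<Rightarrow> real) \<Rightarrow> ('a \<Rightarrow> real) \<Rightarrow> ('a \<Rightarrow> real) \<Rightarrow> nat \<Rightarrow> 'a \<Rightarrow> real" where
  "limit_energy_density T M q f \<tau> n x = (\<tau> x)\<^sup>2 / q x ^ (CARD('d) + n) * norm (manifold_grad T M f x) ^ n"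

context
  fixes M :: "'a::euclidean_space set" and dV :: "'a measure" and f q \<tau> :: "'a \<Rightarrow> real" 
    and k :: "real \<Rightarrow> real" and A a q0 :: real and n :: nat
  assumes M: "compact M" "smooth_submanifold TYPE('d::finite) M"
    and vol: "riemannian_volume TYPE('d) M dV" and fin: "finite_measure dV"
    and f: "smooth_fun TYPE('d) M f" and qt: "lip2_fun TYPE('d) M q" "lip2_fun TYPE('d) M \<tau>"
    and q0: "q0 > 0" "\<And>x. x \<in> M \<Longrightarrow> q0 \<le> q x"
    and k: "continuous_on UNIV k" and a: "a > 0" 
    and kb: "\<And>s. s \<ge> 0 \<Longrightarrow> \<bar>k s\<bar> \<le> A * exp (- a * s)"
    and kl: "\<And>s t. s \<ge> 0 \<Longrightarrow> t \<ge> 0 \<Longrightarrow> \<bar>k s - k t\<bar> \<le> A * exp (- a * min s t) * \<bar>s - t\<bar>"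
    and n: "n > 0"
begin

private abbreviation "energy \<equiv> kernel_energy_integrand k q f \<tau> n"

lemma continuous_bounded_on_M:
  assumes "continuous_on M (g :: 'a \<Rightarrow> real)"
  shows "\<exists>B>0. \<forall>x\<in>M. \<bar>g x\<bar> \<le> B"
proof -
  have "bounded (g ` M)" by (rule compact_imp_bounded[OF compact_continuous_image[OF assms M(1)]])
  then obtain B where "\<forall>y\<in>g ` M. norm y \<le> B" unfolding bounded_iff by blast
  then have "\<forall>x\<in>M. \<bar>g x\<bar> \<le> max B 1" by fastforce
  then show ?thesis by (intro exI[of _ "max B 1"]) auto
qed

lemma continuous_f: "continuous_on M f" by (rule smooth_fun_continuous_on[OF M(2) f])

lemma continuous_qt: "continuous_on M q" "continuous_on M \<tau>" using qt by (auto simp: lip2_fun_def)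

lemma kernel_energy_integrand_measurable:
  "(\<lambda>z. energy \<epsilon> (fst z) (snd z)) \<in> borel_measurable (dV \<Otimes>\<^sub>M dV)"
proof -
  have [measurable]: "(\<lambda>x. x) \<in> borel_measurable dV" by (rule measurable_ident_volume[OF vol])
  have [measurable]: "f \<in> borel_measurable dV" "q \<in> borel_measurable dV" "\<tau> \<in> borel_measurable dV"
    using borel_measurable_volume_continuous_on[OF vol] continuous_f continuous_qt by blast+
  have [measurable]: "k \<in> borel_measurable borel" using k by (rule borel_measurable_continuous_onI)
  have [measurable]: "(\<lambda>z. fst z) \<in> borel_measurable (dV \<Otimes>\<^sub>M dV)" "(\<lambda>z. snd z) \<in> borel_measurable (dV \<Otimes>\<^sub>M dV)"
    using measurable_compose[OF measurable_fst measurable_ident_volume[OF vol]]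
      measurable_compose[OF measurable_snd measurable_ident_volume[OF vol]] by blast+
  have [measurable]: "fst \<in> dV \<Otimes>\<^sub>M dV \<rightarrow>\<^sub>M dV" "snd \<in> dV \<Otimes>\<^sub>M dV \<rightarrow>\<^sub>M dV" by measurable
  have [measurable]: "(\<lambda>z. f (fst z)) \<in> borel_measurable (dV \<Otimes>\<^sub>M dV)" "(\<lambda>z. f (snd z)) \<in> borel_measurable (dV \<Otimes>\<^sub>M dV)"
    "(\<lambda>z. q (fst z)) \<in> borel_measurable (dV \<Otimes>\<^sub>M dV)" "(\<lambda>z. q (snd z)) \<in> borel_measurable (dV \<Otimes>\<^sub>M dV)"
    "(\<lambda>z. \<tau> (fst z)) \<in> borel_measurable (dV \<Otimes>\<^sub>M dV)" "(\<lambda>z. \<tau> (snd z)) \<in> borel_measurable (dV \<Otimes>\<^sub>M dV)"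
    by (auto intro!: measurable_compose[OF measurable_fst] measurable_compose[OF measurable_snd])
  show ?thesis unfolding kernel_energy_integrand_def by measurable
qed

text \<open>The decay is kept in the bound, so that it serves both integrability and the smallness
  of pairs at a distance.\<close>

lemma kernel_energy_integrand_bounded:
  obtains B where "B > 0" "\<And>\<epsilon> x y. \<epsilon> > 0 \<Longrightarrow> x \<in> M \<Longrightarrow> y \<in> M \<Longrightarrow>
    \<bar>energy \<epsilon> x y\<bar> \<le> B * exp (- (a * q0\<^sup>2) * (norm (x - y))\<^sup>2 / \<epsilon>)"
proof -
  obtain Bf where Bf: "Bf > 0" "\<And>x. x \<in> M \<Longrightarrow> \<bar>f x\<bar> \<le> Bf" using continuous_bounded_on_M[OF continuous_f] by blast
  obtain Bt where Bt: "Bt > 0" "\<And>x. x \<in> M \<Longrightarrow> \<bar>\<tau> x\<bar> \<le> Bt" using continuous_bounded_on_M[OF continuous_qt(2)] by blast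
  have A0: "A \<ge> 0" using kb[of 0] by simp
  have "\<bar>energy \<epsilon> x y\<bar> \<le> ((A + 1) * (2 * Bf) ^ n * (Bt * Bt)) * exp (- (a * q0\<^sup>2) * (norm (x - y))\<^sup>2 / \<epsilon>)"
    if e: "\<epsilon> > 0" and xy: "x \<in> M" "y \<in> M" for \<epsilon> x y
  proof -
    have qq: "q0\<^sup>2 \<le> q x * q y" unfolding power2_eq_square using q0(1) q0(2)[OF xy(1)] q0(2)[OF xy(2)] by (intro mult_mono) auto
    then have le: "(norm (x - y))\<^sup>2 * q0\<^sup>2 / \<epsilon> \<le> (norm (x - y))\<^sup>2 * (q x * q y) / \<epsilon>"
      using e by (intro divide_right_mono mult_left_mono) auto
    have s0: "0 \<le> (norm (x - y))\<^sup>2 * (q x * q y) / \<epsilon>" using le e by (meson divide_nonneg_pos mult_nonneg_nonneg order_trans zero_le_power2)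
    have "\<bar>k ((norm (x - y))\<^sup>2 * (q x * q y) / \<epsilon>)\<bar> \<le> A * exp (- a * ((norm (x - y))\<^sup>2 * (q x * q y) / \<epsilon>))"
      by (rule kb[OF s0])
    also have "\<dots> \<le> (A + 1) * exp (- (a * q0\<^sup>2) * (norm (x - y))\<^sup>2 / \<epsilon>)"
    proof (intro mult_mono)
      have "a * ((norm (x - y))\<^sup>2 * q0\<^sup>2 / \<epsilon>) \<le> a * ((norm (x - y))\<^sup>2 * (q x * q y) / \<epsilon>)"
        using le a by (intro mult_left_mono) auto
      then show "exp (- a * ((norm (x - y))\<^sup>2 * (q x * q y) / \<epsilon>)) \<le> exp (- (a * q0\<^sup>2) * (norm (x - y))\<^sup>2 / \<epsilon>)"
        by (simp add: mult_ac)
    qed (use A0 in auto)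
    finally have k1: "\<bar>k ((norm (x - y))\<^sup>2 * (q x * q y) / \<epsilon>)\<bar> \<le> (A + 1) * exp (- (a * q0\<^sup>2) * (norm (x - y))\<^sup>2 / \<epsilon>)" .
    have f1: "\<bar>f x - f y\<bar> \<le> 2 * Bf" using Bf(2)[OF xy(1)] Bf(2)[OF xy(2)] unfolding abs_le_iff by argo
    have f2: "\<bar>f x - f y\<bar> ^ n \<le> (2 * Bf) ^ n" by (rule power_mono[OF f1 abs_ge_zero])
    have t1: "\<bar>\<tau> x\<bar> * \<bar>\<tau> y\<bar> \<le> Bt * Bt" 
      by (rule mult_mono[OF Bt(2)[OF xy(1)] Bt(2)[OF xy(2)] less_imp_le[OF Bt(1)] abs_ge_zero])
    have "\<bar>energy \<epsilon> x y\<bar> \<le> (A + 1) * exp (- (a * q0\<^sup>2) * (norm (x - y))\<^sup>2 / \<epsilon>) * (2 * Bf) ^ n * (Bt * Bt)"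
      unfolding kernel_energy_integrand_def abs_mult power_abs
      by (rule mult_mono[OF mult_mono[OF k1 f2] t1]) (use A0 Bf(1) in auto)
    then show ?thesis by (simp add: mult_ac)
  qed
  moreover have "(A + 1) * (2 * Bf) ^ n * (Bt * Bt) > 0" using A0 Bf(1) Bt(1) by simp
  ultimately show thesis using that by blast
qed

lemma finite_measure_pair: "finite_measure (dV \<Otimes>\<^sub>M dV)"
  using finite_measure_pair_measure[OF fin fin] .

lemma space_pair: "space (dV \<Otimes>\<^sub>M dV) = M \<times> M"
  by (simp add: space_pair_measure space_volume[OF vol])

lemma integrable_pair_bounded:
  fixes g :: "'a \<times> 'a \<Rightarrow> real"
  assumes "g \<in> borel_measurable (dV \<Otimes>\<^sub>M dV)" "\<And>x y. x \<in> M \<Longrightarrow> y \<in> M \<Longrightarrow> \<bar>g (x, y)\<bar> \<le> B"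
  shows "integrable (dV \<Otimes>\<^sub>M dV) g"
  by (rule finite_measure.integrable_const_bound[OF finite_measure_pair _ assms(1), of B])
     (use assms(2) in \<open>auto intro!: AE_I2 simp: space_pair\<close>)

lemma limit_energy_density_measurable: "limit_energy_density TYPE('d) M q f \<tau> n \<in> borel_measurable dV"
proof -
  have [measurable]: "q \<in> borel_measurable dV" "\<tau> \<in> borel_measurable dV"
    using borel_measurable_volume_continuous_on[OF vol] continuous_qt by blast+
  have [measurable]: "(\<lambda>x. norm (manifold_grad TYPE('d) M f x)) \<in> borel_measurable dV"
    by (rule measurable_norm_manifold_grad[OF M f vol])
  show ?thesis unfolding limit_energy_density_def[abs_def] by measurable
qed

lemma integrable_times_limit_energy_density:
  assumes "continuous_on M (g :: 'a \<Rightarrow> real)"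
  shows "integrable dV (\<lambda>x. g x * limit_energy_density TYPE('d) M q f \<tau> n x)"
proof -
  obtain Bg where Bg: "Bg > 0" "\<And>x. x \<in> M \<Longrightarrow> \<bar>g x\<bar> \<le> Bg" using continuous_bounded_on_M[OF assms] by blast
  obtain Bt where Bt: "Bt > 0" "\<And>x. x \<in> M \<Longrightarrow> \<bar>\<tau> x\<bar> \<le> Bt" using continuous_bounded_on_M[OF continuous_qt(2)] by blast
  obtain G where G: "\<And>x. x \<in> M \<Longrightarrow> norm (manifold_grad TYPE('d) M f x) \<le> G" using manifold_grad_bounded[OF M f] by blast
  have "\<bar>g x * limit_energy_density TYPE('d) M q f \<tau> n x\<bar> \<le> Bg * (Bt\<^sup>2 / q0 ^ (CARD('d) + n) * G ^ n)" if x: "x \<in> M" for x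
  proof -
    have t: "(\<tau> x)\<^sup>2 \<le> Bt\<^sup>2" using Bt(2)[OF x] Bt(1) by (simp add: power2_le_iff_abs_le)
    have "0 < q x ^ (CARD('d) + n)" using q0(1) q0(2)[OF x] by simp
    moreover have "q0 ^ (CARD('d) + n) \<le> q x ^ (CARD('d) + n)" using q0(1) q0(2)[OF x] by (intro power_mono) auto
    ultimately have r1: "(\<tau> x)\<^sup>2 / q x ^ (CARD('d) + n) \<le> Bt\<^sup>2 / q0 ^ (CARD('d) + n)"
      using t q0(1) by (intro frac_le) auto
    have r2: "norm (manifold_grad TYPE('d) M f x) ^ n \<le> G ^ n" using G[OF x] by (intro power_mono) auto
    have r3: "0 \<le> (\<tau> x)\<^sup>2 / q x ^ (CARD('d) + n)" using \<open>0 < q x ^ _\<close> by simp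
    have r4: "0 \<le> Bt\<^sup>2 / q0 ^ (CARD('d) + n)" using q0(1) by simp
    have "limit_energy_density TYPE('d) M q f \<tau> n x \<le> Bt\<^sup>2 / q0 ^ (CARD('d) + n) * G ^ n" "0 \<le> limit_energy_density TYPE('d) M q f \<tau> n x"
      unfolding limit_energy_density_def
      by (rule mult_mono[OF r1 r2 r4], simp, rule mult_nonneg_nonneg[OF r3], simp)
    then show ?thesis unfolding abs_mult using Bg(1) Bg(2)[OF x] by (intro mult_mono) auto
  qed
  moreover have "g \<in> borel_measurable dV" by (rule borel_measurable_volume_continuous_on[OF vol assms])
  ultimately show ?thesis using limit_energy_density_measurable
    by (intro finite_measure.integrable_const_bound[OF fin, of _ "Bg * (Bt\<^sup>2 / q0 ^ (CARD('d) + n) * G ^ n)"] AE_I2)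
       (auto simp: space_volume[OF vol])
qed

context
  fixes x0 :: 'a and V :: "(real^'d) set" and \<phi> u0 \<delta> l \<rho> and \<xi> :: "'a \<Rightarrow> real"
  assumes nc: "nice_chart M x0 V \<phi> u0 \<delta> l \<rho>"
    and \<xi>: "lip2_fun TYPE('d) M \<xi>" "\<And>y. y \<in> M \<Longrightarrow> y \<notin> ball x0 \<rho> \<Longrightarrow> \<xi> y = 0"
begin

private abbreviation "chart_int \<equiv> chart_integrand \<phi> (f \<circ> \<phi>) (q \<circ> \<phi>) (\<xi> \<circ> \<phi>) (\<lambda>u. \<tau> (\<phi> u) * sqrt_det_metric \<phi> u) k n"
private abbreviation "model_int \<equiv> model_integrand \<phi> (f \<circ> \<phi>) (q \<circ> \<phi>) (\<xi> \<circ> \<phi>) (\<lambda>u. \<tau> (\<phi> u) * sqrt_det_metric \<phi> u) k n"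

lemma model_integral_chart:
  assumes e: "\<epsilon> > 0" and c: "c \<in> V"
  shows "(\<integral>h. model_int \<epsilon> c h \<partial>lborel) = sqrt \<epsilon> ^ (CARD('d) + n) * radial_moment TYPE('d) k n *
     (sqrt_det_metric \<phi> c * (\<xi> (\<phi> c) * limit_energy_density TYPE('d) M q f \<tau> n (\<phi> c)))"
proof -
  note N = nice_chartD[OF nc]
  let ?T = "frechet_derivative \<phi> (at c)"
  note g = manifold_grad_local_param[OF f N(1) c]
  define v where "v = manifold_grad TYPE('d) M f (\<phi> c)"
  have vr: "v \<in> range ?T" and vd: "\<And>h. frechet_derivative (f \<circ> \<phi>) (at c) h = v \<bullet> ?T h"
    using g by (auto simp: v_def)
  have cM: "\<phi> c \<in> M" using local_paramD(5)[OF N(1)] c by blast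
  have qp: "q (\<phi> c) > 0" using q0(1) q0(2)[OF cM] by linarith
  define s where "s = sqrt \<epsilon> / q (\<phi> c)"
  have s: "s > 0" using qp e by (simp add: s_def)
  have [measurable]: "k \<in> borel_measurable borel" using k by (rule borel_measurable_continuous_onI)
  define J where "J = sqrt_det_metric \<phi> c"
  have J: "J > 0" using det_metric_matrix_pos[OF N(1) c] by (simp add: J_def sqrt_det_metric_def)
  have arg: "(norm (?T h))\<^sup>2 * (q (\<phi> c))\<^sup>2 / \<epsilon> = (norm (?T h))\<^sup>2 / s\<^sup>2" for h
    using e qp by (simp add: s_def power_divide)
  have "(\<integral>h. model_int \<epsilon> c h \<partial>lborel) = (\<integral>h. (\<xi> (\<phi> c) * (\<tau> (\<phi> c) * J)\<^sup>2) * (k ((norm (?T h))\<^sup>2 / s\<^sup>2) * (v \<bullet> ?T h) ^ n) \<partial>lborel)"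
  proof (rule Bochner_Integration.integral_cong[OF refl])
    fix h
    have "model_int \<epsilon> c h = \<xi> (\<phi> c) * k ((norm (?T h))\<^sup>2 / s\<^sup>2) * (v \<bullet> ?T h) ^ n * (\<tau> (\<phi> c) * J)\<^sup>2"
      by (simp only: model_integrand_def vd o_apply J_def arg)
    then show "model_int \<epsilon> c h = (\<xi> (\<phi> c) * (\<tau> (\<phi> c) * J)\<^sup>2) * (k ((norm (?T h))\<^sup>2 / s\<^sup>2) * (v \<bullet> ?T h) ^ n)"
      by (simp only: mult_ac)
  qed
  also have "\<dots> = (\<xi> (\<phi> c) * (\<tau> (\<phi> c) * J)\<^sup>2) * (\<integral>h. k ((norm (?T h))\<^sup>2 / s\<^sup>2) * (v \<bullet> ?T h) ^ n \<partial>lborel)" by simp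
  also have "(\<integral>h. k ((norm (?T h))\<^sup>2 / s\<^sup>2) * (v \<bullet> ?T h) ^ n \<partial>lborel) 
     = s ^ (CARD('d) + n) * norm v ^ n * radial_moment TYPE('d) k n / J"
    using integral_kernel_linear[OF _ a kb local_paramD(8)[OF N(1) c] local_paramD(3)[OF N(1) c] vr n s]
    by (simp add: J_def sqrt_det_metric_def metric_matrix_def)
  also have "(\<xi> (\<phi> c) * (\<tau> (\<phi> c) * J)\<^sup>2) * (s ^ (CARD('d) + n) * norm v ^ n * radial_moment TYPE('d) k n / J)
     = sqrt \<epsilon> ^ (CARD('d) + n) * radial_moment TYPE('d) k n * (J * (\<xi> (\<phi> c) * limit_energy_density TYPE('d) M q f \<tau> n (\<phi> c)))"
    using J by (simp add: s_def power_divide limit_energy_density_def v_def power2_eq_square mult_ac)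
  finally show ?thesis unfolding J_def .
qed

lemma ball_subset_chart: "ball u0 \<delta> \<subseteq> V"
  using nice_chartD(5)[OF nc] ball_subset_cball by blast

lemma near_image: "y \<in> M \<Longrightarrow> y \<in> ball x0 (2 * \<rho>) \<Longrightarrow> y \<in> \<phi> ` ball u0 (\<delta>/2)"
  using nice_chartD(10)[OF nc] by blast

text \<open>Injectivity of the parametrization: a point of the support has a preimage in the half
  ball and no other.\<close>

lemma xi_zero: "c \<in> V \<Longrightarrow> c \<notin> ball u0 (\<delta>/2) \<Longrightarrow> \<xi> (\<phi> c) = 0"
proof (rule ccontr)
  note N = nice_chartD[OF nc]
  assume c: "c \<in> V" "c \<notin> ball u0 (\<delta>/2)" and nz: "\<xi> (\<phi> c) \<noteq> 0"
  have cM: "\<phi> c \<in> M" using local_paramD(5)[OF N(1)] c(1) by blast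
  then have "\<phi> c \<in> ball x0 \<rho>" using \<xi>(2) nz by blast
  then have "\<phi> c \<in> ball x0 (2 * \<rho>)" using N(9) by simp
  then obtain c' where c': "c' \<in> ball u0 (\<delta>/2)" "\<phi> c = \<phi> c'" using near_image[OF cM] by blast
  moreover have "c' \<in> V" using c'(1) ball_subset_chart N(4) by (auto simp: subset_iff)
  ultimately have "c = c'" using local_paramD(7)[OF N(1)] c(1) by (meson inj_onD)
  then show False using c' c(2) by simp
qed

lemma chart_energy_estimate:
  "\<exists>C>0. \<forall>\<epsilon>>0. \<bar>(\<integral>u. \<integral>v. indicator (ball u0 \<delta>) u * indicator (ball u0 \<delta>) v * chart_int \<epsilon> u v \<partial>lborel \<partial>lborel)
       - sqrt \<epsilon> ^ (CARD('d) + n) * radial_moment TYPE('d) k n * (\<integral>x. \<xi> x * limit_energy_density TYPE('d) M q f \<tau> n x \<partial>dV)\<bar> \<le> C * sqrt \<epsilon> ^ (CARD('d) + n) * \<epsilon>"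
proof -
  note N = nice_chartD[OF nc]
  let ?U = "ball u0 \<delta>" and ?K = "cball u0 \<delta>"
  have x0: "x0 \<in> M" using local_paramD(5)[OF N(1)] N(2,3) by blast
  let ?\<phi> = "\<lambda>u. if u \<in> V then \<phi> u else x0"
  have \<phi>m[measurable]: "?\<phi> \<in> borel \<rightarrow>\<^sub>M dV" by (rule measurable_local_param_extended[OF vol N(1) x0])
  have [measurable]: "(\<lambda>u. indicator V u * sqrt_det_metric \<phi> u) \<in> borel_measurable borel"
    by (rule measurable_sqrt_det_metric[OF vol N(1)])
  have \<xi>m[measurable]: "\<xi> \<in> borel_measurable dV" 
    using borel_measurable_volume_continuous_on[OF vol] \<xi>(1) by (auto simp: lip2_fun_def)
  have lip: "lip2_on ?K (q \<circ> \<phi>)" "lip2_on ?K (\<xi> \<circ> \<phi>)" "lip2_on ?K (\<lambda>u. \<tau> (\<phi> u) * sqrt_det_metric \<phi> u)"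
    using qt \<xi>(1) N(1,5) lip2_on_mult[OF convex_cball _ lip2_on_sqrt_det_metric[OF N(1) compact_cball convex_cball N(5)]]
    unfolding lip2_fun_def o_def by auto
  have KM: "\<phi> u \<in> M" if "u \<in> ?K" for u using that N(5) local_paramD(5)[OF N(1)] by blast
  have mod: "indicator ?U c * (\<integral>h. model_int \<epsilon> c h \<partial>lborel) = (sqrt \<epsilon> ^ (CARD('d) + n) * radial_moment TYPE('d) k n) *
      (indicator V c * (sqrt_det_metric \<phi> c * (\<xi> (\<phi> c) * limit_energy_density TYPE('d) M q f \<tau> n (\<phi> c))))" if "\<epsilon> > 0" for \<epsilon> c
  proof (cases "c \<in> V")
    case True
    have "\<xi> (\<phi> c) = 0" if "c \<notin> ?U"
      using xi_zero[OF True] that N(4) by auto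
    then show ?thesis using model_integral_chart[OF \<open>\<epsilon> > 0\<close> True] True by (auto simp: indicator_def)
  next
    case False
    then have "c \<notin> ?U" using ball_subset_chart by blast
    then show ?thesis using False by simp
  qed
  have gm: "(\<lambda>x. \<xi> x * limit_energy_density TYPE('d) M q f \<tau> n x) \<in> borel_measurable dV"
    using limit_energy_density_measurable by measurable
  have "\<exists>C>0. \<forall>\<epsilon>>0. integrable lborel (\<lambda>c. indicator ?U c * (\<integral>h. model_int \<epsilon> c h \<partial>lborel)) \<and>
     \<bar>(\<integral>u. \<integral>v. indicator ?U u * indicator ?U v * chart_int \<epsilon> u v \<partial>lborel \<partial>lborel)
       - (\<integral>c. indicator ?U c * (\<integral>h. model_int \<epsilon> c h \<partial>lborel) \<partial>lborel)\<bar> \<le> C * sqrt \<epsilon> ^ (CARD('d) + n) * \<epsilon>"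
  proof (rule chart_integral_estimate[OF compact_cball convex_cball N(5) local_paramD(2)[OF N(1)] smooth_fun_smooth_on[OF f N(1)] N(6,7,8) lip q0(1) _ k a kb kl n refl N(4)])
    show "q0 \<le> (q \<circ> \<phi>) u" if "u \<in> ?K" for u using q0(2) KM[OF that] by simp
    show "(\<xi> \<circ> \<phi>) c = 0" if "c \<in> ?K" "c \<notin> ball u0 (\<delta>/2)" for c
      using xi_zero that N(5) by auto
    fix \<epsilon> :: real assume e: "\<epsilon> > 0"
    \<comment> \<open>Off \<open>V\<close> the coordinate expressions are uncontrolled, so
      measurability is shown for the extension \<open>?\<phi>\<close>; the indicator of
      \<open>V\<close> hides the difference.\<close>
    have "(\<lambda>c. (sqrt \<epsilon> ^ (CARD('d) + n) * radial_moment TYPE('d) k n) *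
      (indicator V c * sqrt_det_metric \<phi> c * (\<xi> (?\<phi> c) * limit_energy_density TYPE('d) M q f \<tau> n (?\<phi> c)))) \<in> borel_measurable borel"
      using measurable_compose[OF \<phi>m gm] by measurable
    moreover have "(\<lambda>c. (sqrt \<epsilon> ^ (CARD('d) + n) * radial_moment TYPE('d) k n) *
      (indicator V c * sqrt_det_metric \<phi> c * (\<xi> (?\<phi> c) * limit_energy_density TYPE('d) M q f \<tau> n (?\<phi> c)))) = (\<lambda>c. indicator ?U c * (\<integral>h. model_int \<epsilon> c h \<partial>lborel))"
      unfolding mod[OF e] by (auto simp: fun_eq_iff indicator_def)
    ultimately show "(\<lambda>c. indicator ?U c * (\<integral>h. model_int \<epsilon> c h \<partial>lborel)) \<in> borel_measurable lborel" by simp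
    have pm: "(\<lambda>z. (?\<phi> (fst z), ?\<phi> (snd z))) \<in> lborel \<Otimes>\<^sub>M lborel \<rightarrow>\<^sub>M dV \<Otimes>\<^sub>M dV" by measurable
    have e1: "(\<lambda>z. energy \<epsilon> (?\<phi> (fst z)) (?\<phi> (snd z))) \<in> borel_measurable (lborel \<Otimes>\<^sub>M lborel)"
      using measurable_compose[OF pm kernel_energy_integrand_measurable] by simp
    have x1: "(\<lambda>u. \<xi> (?\<phi> u)) \<in> borel_measurable lborel" using measurable_compose[OF \<phi>m \<xi>m] by simp
    have "(\<lambda>z. indicator ?U (fst z) * indicator ?U (snd z) * ((\<xi> (?\<phi> (fst z)) + \<xi> (?\<phi> (snd z))) / 2 
        * energy \<epsilon> (?\<phi> (fst z)) (?\<phi> (snd z)) * ((indicator V (fst z) * sqrt_det_metric \<phi> (fst z)) * (indicator V (snd z) * sqrt_det_metric \<phi> (snd z)))))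
       \<in> borel_measurable (lborel \<Otimes>\<^sub>M lborel)"
    proof -
      have L: "(\<lambda>z. g (fst z)) \<in> borel_measurable (lborel \<Otimes>\<^sub>M lborel)" "(\<lambda>z. g (snd z)) \<in> borel_measurable (lborel \<Otimes>\<^sub>M lborel)"
        if "g \<in> borel_measurable lborel" for g :: "real^'d \<Rightarrow> real"
        using measurable_compose[OF measurable_fst that] measurable_compose[OF measurable_snd that] by blast+
      have U: "(indicator ?U :: real^'d \<Rightarrow> real) \<in> borel_measurable lborel" 
        by (rule borel_measurable_indicator) simp
      have J: "(\<lambda>u. indicator V u * sqrt_det_metric \<phi> u) \<in> borel_measurable lborel" by simp
      show ?thesis
        by (intro borel_measurable_times borel_measurable_add borel_measurable_divide borel_measurable_const
            e1 L[OF U] L[OF J] L[OF x1])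
    qed
    also have "(\<lambda>z. indicator ?U (fst z) * indicator ?U (snd z) * ((\<xi> (?\<phi> (fst z)) + \<xi> (?\<phi> (snd z))) / 2 
        * energy \<epsilon> (?\<phi> (fst z)) (?\<phi> (snd z)) * ((indicator V (fst z) * sqrt_det_metric \<phi> (fst z)) * (indicator V (snd z) * sqrt_det_metric \<phi> (snd z)))))
      = (\<lambda>z. indicator ?U (fst z) * indicator ?U (snd z) * chart_int \<epsilon> (fst z) (snd z))"
    proof
      fix z :: "(real^'d) \<times> (real^'d)"
      show "indicator ?U (fst z) * indicator ?U (snd z) * ((\<xi> (?\<phi> (fst z)) + \<xi> (?\<phi> (snd z))) / 2 
        * energy \<epsilon> (?\<phi> (fst z)) (?\<phi> (snd z)) * ((indicator V (fst z) * sqrt_det_metric \<phi> (fst z)) * (indicator V (snd z) * sqrt_det_metric \<phi> (snd z))))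
        = indicator ?U (fst z) * indicator ?U (snd z) * chart_int \<epsilon> (fst z) (snd z)"
      proof (cases "fst z \<in> ?U \<and> snd z \<in> ?U")
        case True
        then have "fst z \<in> V" "snd z \<in> V" using ball_subset_chart by blast+
        then show ?thesis by (simp add: chart_integrand_def kernel_energy_integrand_def mult_ac)
      qed auto
    qed
    finally show "(\<lambda>z. indicator ?U (fst z) * indicator ?U (snd z) * chart_int \<epsilon> (fst z) (snd z)) \<in> borel_measurable (lborel \<Otimes>\<^sub>M lborel)" .
  qed
  moreover have "(\<integral>c. indicator ?U c * (\<integral>h. model_int \<epsilon> c h \<partial>lborel) \<partial>lborel) = sqrt \<epsilon> ^ (CARD('d) + n) * radial_moment TYPE('d) k n * (\<integral>x. \<xi> x * limit_energy_density TYPE('d) M q f \<tau> n x \<partial>dV)"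
    if e: "\<epsilon> > 0" for \<epsilon>
  proof -
    have "\<xi> x * limit_energy_density TYPE('d) M q f \<tau> n x = 0" if "x \<in> M - \<phi> ` V" for x
    proof -
      have "x \<notin> ball x0 \<rho>"
      proof
        assume "x \<in> ball x0 \<rho>"
        then have "x \<in> ball x0 (2 * \<rho>)" using N(9) by simp
        then have "x \<in> \<phi> ` ball u0 (\<delta>/2)" using near_image that by blast
        moreover have "ball u0 (\<delta>/2) \<subseteq> V" using ball_subset_chart N(4) by (auto simp: subset_iff)
        ultimately show False using that by blast
      qed
      then show ?thesis using \<xi>(2) that by simp
    qed
    then have "(\<integral>x. \<xi> x * limit_energy_density TYPE('d) M q f \<tau> n x \<partial>dV) = (\<integral>c. indicator V c * (sqrt_det_metric \<phi> c * (\<xi> (\<phi> c) * limit_energy_density TYPE('d) M q f \<tau> n (\<phi> c))) \<partial>lborel)"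
      by (rule integral_volume_local_param[OF vol N(1) gm])
    then show ?thesis unfolding mod[OF e] by simp
  qed
  ultimately show ?thesis by (elim ex_forward conj_forward) simp_all
qed

text \<open>Pairs inside the chart image \<open>W\<close> are covered by the chart estimate. If a
  pair is not in \<open>W \<times> W\<close> but one of its cut-off values is nonzero, its points
  are at distance at least \<rho> and the decay of the kernel makes the contribution
  negligible.\<close>

lemma chart_pair_estimate:
  "\<exists>C>0. \<forall>\<epsilon>. 0 < \<epsilon> \<and> \<epsilon> \<le> 1 \<longrightarrow> \<bar>(\<integral>z. (\<xi> (fst z) + \<xi> (snd z)) / 2 * energy \<epsilon> (fst z) (snd z) \<partial>(dV \<Otimes>\<^sub>M dV))
       - sqrt \<epsilon> ^ (CARD('d) + n) * radial_moment TYPE('d) k n * (\<integral>x. \<xi> x * limit_energy_density TYPE('d) M q f \<tau> n x \<partial>dV)\<bar> \<le> C * (sqrt \<epsilon> ^ (CARD('d) + n) * \<epsilon>)"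
proof -
  note N = nice_chartD[OF nc]
  let ?U = "ball u0 \<delta>"
  define W where "W = \<phi> ` ?U"
  interpret dV: finite_measure dV by (rule fin)
  interpret P: pair_sigma_finite dV dV ..
  interpret PP: finite_measure "dV \<Otimes>\<^sub>M dV" by (rule finite_measure_pair)
  have W[measurable]: "W \<in> sets dV" unfolding W_def
    by (rule openin_sets_volume[OF vol openin_local_param_image[OF N(1) open_ball ball_subset_chart]])
  have \<xi>m[measurable]: "\<xi> \<in> borel_measurable dV" 
    using borel_measurable_volume_continuous_on[OF vol] \<xi>(1) by (auto simp: lip2_fun_def)
  obtain Bx where Bx: "Bx > 0" "\<And>x. x \<in> M \<Longrightarrow> \<bar>\<xi> x\<bar> \<le> Bx"
    using continuous_bounded_on_M \<xi>(1) unfolding lip2_fun_def by blast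
  obtain B where B: "B > 0" "\<And>\<epsilon> x y. \<epsilon> > 0 \<Longrightarrow> x \<in> M \<Longrightarrow> y \<in> M \<Longrightarrow> \<bar>energy \<epsilon> x y\<bar> \<le> B * exp (- (a * q0\<^sup>2) * (norm (x - y))\<^sup>2 / \<epsilon>)"
    by (rule kernel_energy_integrand_bounded) (rule that)
  obtain C1 where C1: "C1 > 0" "\<And>\<epsilon>. \<epsilon> > 0 \<Longrightarrow> \<bar>(\<integral>u. \<integral>v. indicator ?U u * indicator ?U v * chart_int \<epsilon> u v \<partial>lborel \<partial>lborel)
       - sqrt \<epsilon> ^ (CARD('d) + n) * radial_moment TYPE('d) k n * (\<integral>x. \<xi> x * limit_energy_density TYPE('d) M q f \<tau> n x \<partial>dV)\<bar> \<le> C1 * sqrt \<epsilon> ^ (CARD('d) + n) * \<epsilon>"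
    using chart_energy_estimate by (elim exE conjE) (erule that, blast)
  have W2: "y \<in> W" if "y \<in> M" "dist x0 y < 2 * \<rho>" for y
  proof -
    have "y \<in> \<phi> ` ball u0 (\<delta>/2)" using near_image[OF that(1)] that(2) by simp
    moreover have "ball u0 (\<delta>/2) \<subseteq> ?U" using N(4) by (intro subset_ball) simp
    ultimately show ?thesis unfolding W_def by blast
  qed
  have far: "\<rho> \<le> norm (x - y)" if xy: "x \<in> M" "y \<in> M" "\<not> (x \<in> W \<and> y \<in> W)" "\<xi> x \<noteq> 0 \<or> \<xi> y \<noteq> 0" for x y
  proof -
    have *: "\<rho> \<le> dist x y" if "x \<in> M" "y \<in> M" "\<not> (x \<in> W \<and> y \<in> W)" "\<xi> x \<noteq> 0" for x y
    proof -
      have "x \<in> ball x0 \<rho>" using \<xi>(2)[OF that(1)] that(4) by blast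
      then have dx: "dist x0 x < \<rho>" by simp
      then have "x \<in> W" using W2[OF that(1)] N(9) by simp
      then have "\<not> dist x0 y < 2 * \<rho>" using W2[OF that(2)] that(3) by blast
      then show ?thesis using dx dist_triangle[of x0 y x] by linarith
    qed
    show ?thesis using *[OF xy(1,2,3)] *[OF xy(2,1)] xy(3,4) by (auto simp: dist_norm norm_minus_commute)
  qed
  define c where "c = a * q0\<^sup>2 * \<rho>\<^sup>2"
  have c: "c > 0" using a q0(1) N(9) by (simp add: c_def)
  define mP where "mP = measure (dV \<Otimes>\<^sub>M dV) (M \<times> M)"
  define N1 where "N1 = CARD('d) + n"
  define C2 where "C2 = Bx * B * (fact (N1 + 1) / c ^ (N1 + 1)) * mP"
  have C2: "C2 \<ge> 0" using Bx(1) B(1) c by (simp add: C2_def mP_def)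
  have main: "\<bar>(\<integral>z. (\<xi> (fst z) + \<xi> (snd z)) / 2 * energy \<epsilon> (fst z) (snd z) \<partial>(dV \<Otimes>\<^sub>M dV))
       - sqrt \<epsilon> ^ (CARD('d) + n) * radial_moment TYPE('d) k n * (\<integral>x. \<xi> x * limit_energy_density TYPE('d) M q f \<tau> n x \<partial>dV)\<bar> \<le> (C1 + C2) * (sqrt \<epsilon> ^ (CARD('d) + n) * \<epsilon>)"
    if e: "0 < \<epsilon>" "\<epsilon> \<le> 1" for \<epsilon>
  proof -
    define H where "H = (\<lambda>z. (\<xi> (fst z) + \<xi> (snd z)) / 2 * energy \<epsilon> (fst z) (snd z))"
    define nr where "nr = (\<lambda>z. indicator W (fst z) * indicator W (snd z) * H z)"
    have L: "(\<lambda>z. g (fst z)) \<in> borel_measurable (dV \<Otimes>\<^sub>M dV)" "(\<lambda>z. g (snd z)) \<in> borel_measurable (dV \<Otimes>\<^sub>M dV)"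
      if "g \<in> borel_measurable dV" for g :: "'a \<Rightarrow> real"
      using measurable_compose[OF measurable_fst that] measurable_compose[OF measurable_snd that] by blast+
    have Wi: "(indicator W :: 'a \<Rightarrow> real) \<in> borel_measurable dV" by (rule borel_measurable_indicator[OF W])
    have Hm: "H \<in> borel_measurable (dV \<Otimes>\<^sub>M dV)" unfolding H_def
      by (intro borel_measurable_times borel_measurable_add borel_measurable_divide borel_measurable_const
            kernel_energy_integrand_measurable L[OF \<xi>m])
    have nrm: "nr \<in> borel_measurable (dV \<Otimes>\<^sub>M dV)" unfolding nr_def
      by (intro borel_measurable_times L[OF Wi] Hm)
    have eb: "exp (- (a * q0\<^sup>2) * (norm (x - y))\<^sup>2 / \<epsilon>) \<le> 1" for x y :: 'a
      using a e by simp
    have xav: "\<bar>(\<xi> x + \<xi> y) / 2\<bar> \<le> Bx" if "x \<in> M" "y \<in> M" for x y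
      using Bx(2)[OF that(1)] Bx(2)[OF that(2)] unfolding abs_le_iff by argo
    have Hb: "\<bar>H (x, y)\<bar> \<le> Bx * (B * exp (- (a * q0\<^sup>2) * (norm (x - y))\<^sup>2 / \<epsilon>))" if "x \<in> M" "y \<in> M" for x y
      unfolding H_def abs_mult fst_conv snd_conv
      by (rule mult_mono[OF xav[OF that] B(2)[OF e(1) that] less_imp_le[OF Bx(1)] abs_ge_zero])
    have Hb1: "\<bar>H (x, y)\<bar> \<le> Bx * (B * 1)" if "x \<in> M" "y \<in> M" for x y
      using Hb[OF that] mult_left_mono[OF mult_left_mono[OF eb[of x y]], of B Bx] B(1) Bx(1) by linarith
    have Hi: "integrable (dV \<Otimes>\<^sub>M dV) H" by (rule integrable_pair_bounded[OF Hm Hb1])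
    have nri: "integrable (dV \<Otimes>\<^sub>M dV) nr"
    proof (rule integrable_pair_bounded[OF nrm])
      show "\<bar>nr (x, y)\<bar> \<le> Bx * (B * 1)" if "x \<in> M" "y \<in> M" for x y
        using Hb1[OF that] B(1) Bx(1) by (auto simp: nr_def indicator_def)
    qed
    have nr0: "nr (x, y) = 0" if "x \<notin> W \<or> y \<notin> W" for x y using that by (auto simp: nr_def)
    have WV: "W \<subseteq> \<phi> ` V" unfolding W_def by (rule image_mono[OF ball_subset_chart])
    have WU: "\<phi> u \<in> W \<longleftrightarrow> u \<in> ?U" if "u \<in> V" for u
      unfolding W_def by (rule inj_on_image_mem_iff[OF local_paramD(7)[OF N(1)] that ball_subset_chart])
    have inner: "(\<integral>y. nr (x, y) \<partial>dV) = (\<integral>v. indicator V v * (sqrt_det_metric \<phi> v * nr (x, \<phi> v)) \<partial>lborel)" if "x \<in> M" for x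
    proof (rule integral_volume_local_param[OF vol N(1)])
      show "(\<lambda>y. nr (x, y)) \<in> borel_measurable dV"
        using measurable_compose[OF measurable_Pair1' nrm, of x] that by (simp add: space_volume[OF vol])
    qed (use nr0 WV in auto)
    have gm: "(\<lambda>x. \<integral>y. nr (x, y) \<partial>dV) \<in> borel_measurable dV"
      using dV.borel_measurable_lebesgue_integral[of "\<lambda>x y. nr (x, y)" dV] nrm by simp
    \<comment> \<open>Fubini and one change of variables per point bring the near part into
      coordinates.\<close>
    have "(\<integral>z. nr z \<partial>(dV \<Otimes>\<^sub>M dV)) = (\<integral>x. \<integral>y. nr (x, y) \<partial>dV \<partial>dV)"
      using P.integral_fst'[OF nri] by simp
    also have "\<dots> = (\<integral>u. indicator V u * (sqrt_det_metric \<phi> u * (\<integral>y. nr (\<phi> u, y) \<partial>dV)) \<partial>lborel)"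
    proof (rule integral_volume_local_param[OF vol N(1) gm])
      fix x assume "x \<in> M - \<phi> ` V"
      then have "nr (x, y) = 0" for y using nr0 WV by blast
      then show "(\<integral>y. nr (x, y) \<partial>dV) = 0" by simp
    qed
    also have "\<dots> = (\<integral>u. \<integral>v. indicator ?U u * indicator ?U v * chart_int \<epsilon> u v \<partial>lborel \<partial>lborel)"
    proof (rule Bochner_Integration.integral_cong[OF refl])
      fix u :: "real^'d"
      show "indicator V u * (sqrt_det_metric \<phi> u * (\<integral>y. nr (\<phi> u, y) \<partial>dV)) = (\<integral>v. indicator ?U u * indicator ?U v * chart_int \<epsilon> u v \<partial>lborel)"
      proof (cases "u \<in> V")
        case False
        then have "u \<notin> ?U" using ball_subset_chart by blast
        then show ?thesis using False by simp
      next
        case True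
        then have uM: "\<phi> u \<in> M" using local_paramD(5)[OF N(1)] by blast
        have "indicator V u * (sqrt_det_metric \<phi> u * (\<integral>y. nr (\<phi> u, y) \<partial>dV))
          = (\<integral>v. sqrt_det_metric \<phi> u * (indicator V v * (sqrt_det_metric \<phi> v * nr (\<phi> u, \<phi> v))) \<partial>lborel)"
          using True by (simp add: inner[OF uM])
        also have "\<dots> = (\<integral>v. indicator ?U u * indicator ?U v * chart_int \<epsilon> u v \<partial>lborel)"
        proof (rule Bochner_Integration.integral_cong[OF refl])
          fix v :: "real^'d"
          show "sqrt_det_metric \<phi> u * (indicator V v * (sqrt_det_metric \<phi> v * nr (\<phi> u, \<phi> v))) = indicator ?U u * indicator ?U v * chart_int \<epsilon> u v"
          proof (cases "v \<in> V")
            case False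
            then have "v \<notin> ?U" using ball_subset_chart by blast
            then show ?thesis using False by simp
          next
            case vV: True
            show ?thesis using WU[OF True] WU[OF vV] vV
              by (simp add: nr_def H_def indicator_def chart_integrand_def kernel_energy_integrand_def mult_ac)
          qed
        qed
        finally show ?thesis .
      qed
    qed
    finally have near: "(\<integral>z. nr z \<partial>(dV \<Otimes>\<^sub>M dV)) = (\<integral>u. \<integral>v. indicator ?U u * indicator ?U v * chart_int \<epsilon> u v \<partial>lborel \<partial>lborel)" .
    have fb: "\<bar>H z - nr z\<bar> \<le> Bx * B * exp (- c / \<epsilon>)" if z: "z \<in> space (dV \<Otimes>\<^sub>M dV)" for z
    proof -
      obtain x y where zz: "z = (x, y)" and xy: "x \<in> M" "y \<in> M" using z by (auto simp: space_pair)
      have nn: "0 \<le> Bx * B * exp (- c / \<epsilon>)" using Bx(1) B(1) by simp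
      show ?thesis
      proof (cases "(x \<in> W \<and> y \<in> W) \<or> (\<xi> x = 0 \<and> \<xi> y = 0)")
        case True then show ?thesis using nn by (auto simp: zz nr_def H_def)
      next
        case False
        then have "\<rho> \<le> norm (x - y)" using far[OF xy] by blast
        then have "\<rho>\<^sup>2 \<le> (norm (x - y))\<^sup>2" using N(9) by (intro power_mono) auto
        then have "a * q0\<^sup>2 * \<rho>\<^sup>2 \<le> a * q0\<^sup>2 * (norm (x - y))\<^sup>2" using a by (intro mult_left_mono) auto
        then have "c / \<epsilon> \<le> a * q0\<^sup>2 * (norm (x - y))\<^sup>2 / \<epsilon>" unfolding c_def using e(1) by (intro divide_right_mono) auto
        then have "exp (- (a * q0\<^sup>2) * (norm (x - y))\<^sup>2 / \<epsilon>) \<le> exp (- c / \<epsilon>)" by simp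
        then have "Bx * (B * exp (- (a * q0\<^sup>2) * (norm (x - y))\<^sup>2 / \<epsilon>)) \<le> Bx * (B * exp (- c / \<epsilon>))"
          using Bx(1) B(1) by (intro mult_left_mono) auto
        moreover have "nr (x, y) = 0" using nr0 False by blast
        ultimately show ?thesis using Hb[OF xy] by (simp add: zz mult.assoc)
      qed
    qed
    have "(\<integral>z. H z \<partial>(dV \<Otimes>\<^sub>M dV)) - (\<integral>z. nr z \<partial>(dV \<Otimes>\<^sub>M dV)) = (\<integral>z. H z - nr z \<partial>(dV \<Otimes>\<^sub>M dV))"
      by (rule Bochner_Integration.integral_diff[OF Hi nri, symmetric])
    also have "\<bar>\<dots>\<bar> \<le> (\<integral>z. Bx * B * exp (- c / \<epsilon>) \<partial>(dV \<Otimes>\<^sub>M dV))"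
      using fb by (intro order_trans[OF integral_abs_bound] integral_mono integrable_abs Bochner_Integration.integrable_diff Hi nri) auto
    also have "\<dots> = Bx * B * exp (- c / \<epsilon>) * mP" by (simp add: mP_def space_pair)
    also have "\<dots> \<le> Bx * B * (fact (N1 + 1) / c ^ (N1 + 1) * (sqrt \<epsilon> ^ N1 * \<epsilon>)) * mP"
      using exp_inverse_le_power[OF c e, of N1] Bx(1) B(1)
      by (intro mult_right_mono mult_left_mono) (auto simp: mP_def)
    also have "\<dots> = C2 * (sqrt \<epsilon> ^ (CARD('d) + n) * \<epsilon>)" by (simp add: C2_def N1_def)
    finally have "\<bar>(\<integral>z. H z \<partial>(dV \<Otimes>\<^sub>M dV)) - (\<integral>z. nr z \<partial>(dV \<Otimes>\<^sub>M dV))\<bar> \<le> C2 * (sqrt \<epsilon> ^ (CARD('d) + n) * \<epsilon>)" .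
    moreover note C1(2)[OF e(1), folded near]
    ultimately have "\<bar>(\<integral>z. H z \<partial>(dV \<Otimes>\<^sub>M dV))
       - sqrt \<epsilon> ^ (CARD('d) + n) * radial_moment TYPE('d) k n * (\<integral>x. \<xi> x * limit_energy_density TYPE('d) M q f \<tau> n x \<partial>dV)\<bar>
       \<le> C2 * (sqrt \<epsilon> ^ (CARD('d) + n) * \<epsilon>) + C1 * sqrt \<epsilon> ^ (CARD('d) + n) * \<epsilon>" by linarith
    then show ?thesis unfolding H_def by (simp add: algebra_simps)
  qed
  have "C1 + C2 > 0" using C1(1) C2 by linarith
  then show ?thesis using main by (intro exI[of _ "C1 + C2"]) simp
qed

end

text \<open>The bumps are squared positive parts of \<open>\<rho>^2 - dist^2\<close>, divided by
  their sum, which is positive on \<open>M\<close> because the balls cover it.\<close>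

lemma lip2_partition_of_unity:
  obtains X V \<phi> u \<delta> l \<rho> \<xi> where "finite X" "X \<subseteq> M" 
    "\<And>x. x \<in> X \<Longrightarrow> nice_chart M x (V x :: (real^'d) set) (\<phi> x) (u x) (\<delta> x) (l x) (\<rho> x)"
    "\<And>x. x \<in> X \<Longrightarrow> lip2_fun TYPE('d) M (\<xi> x)" 
    "\<And>x y. x \<in> X \<Longrightarrow> y \<in> M \<Longrightarrow> y \<notin> ball x (\<rho> x) \<Longrightarrow> \<xi> x y = 0"
    "\<And>y. y \<in> M \<Longrightarrow> (\<Sum>x\<in>X. \<xi> x y) = (1::real)"
proof -
  obtain X V \<phi> u \<delta> l \<rho> where X: "finite X" "X \<subseteq> M" 
    and nc: "\<And>x. x \<in> X \<Longrightarrow> nice_chart M x (V x :: (real^'d) set) (\<phi> x) (u x) (\<delta> x) (l x) (\<rho> x)"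
    and cov: "M \<subseteq> (\<Union>x\<in>X. ball x (\<rho> x))"
    by (rule nice_chart_cover[OF M]) (rule that)
  have \<rho>: "\<rho> x > 0" if "x \<in> X" for x using nice_chartD(9)[OF nc[OF that]] .
  \<comment> \<open>Written with \<open>+ (-1) *\<close> and inner products so that the closure
    rules for sums, products and bilinear maps apply as they stand.\<close>
  define b where "b = (\<lambda>x y. (max 0 ((\<rho> x)\<^sup>2 + (-1) * ((y - x) \<bullet> (y - x))))\<^sup>2 :: real)"
  define B where "B = (\<lambda>y. \<Sum>x\<in>X. b x y)"
  define \<xi> where "\<xi> = (\<lambda>x y. b x y * B y powr (-1))"
  have sq: "(y - x) \<bullet> (y - x) = (dist x y)\<^sup>2" for x y :: 'a
    unfolding dist_norm norm_minus_commute[of x y] by (rule power2_norm_eq_inner[symmetric])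
  have b0: "b x y = 0" if "x \<in> X" "y \<notin> ball x (\<rho> x)" for x y
  proof -
    have "(\<rho> x)\<^sup>2 \<le> (dist x y)\<^sup>2" using that \<rho>[OF that(1)] by (intro power_mono) auto
    then show ?thesis by (simp add: b_def sq max_def)
  qed
  have bpos: "b x y > 0" if "x \<in> X" "y \<in> ball x (\<rho> x)" for x y
  proof -
    have "(dist x y)\<^sup>2 < (\<rho> x)\<^sup>2" using that \<rho>[OF that(1)] by (intro power_strict_mono) auto
    then show ?thesis by (simp add: b_def sq max_def)
  qed
  have Bpos: "B y > 0" if y: "y \<in> M" for y
  proof -
    obtain x where x: "x \<in> X" "y \<in> ball x (\<rho> x)" using cov y by blast
    show ?thesis unfolding B_def
      by (rule sum_pos2[OF X(1) x(1), of "\<lambda>x. b x y"]) (use bpos[OF x] in \<open>auto simp: b_def\<close>)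
  qed
  have bc: "continuous_on M (b x)" for x unfolding b_def by (intro continuous_intros)
  have Bc: "continuous_on M B" unfolding B_def by (intro continuous_intros bc)
  have blip: "lip2_on K (b x \<circ> \<psi>)" if "local_param M W \<psi>" "compact K" "convex K" "K \<subseteq> W" 
    for x K and W :: "(real^'d) set" and \<psi>
  proof -
    have "lip2_on K (\<lambda>u. \<psi> u + (- x))"
      by (intro lip2_on_add lip2_on_const smooth_on_lip2_on[OF that(2-4) local_paramD(2)[OF that(1)]])
    then have i: "lip2_on K (\<lambda>u. (\<psi> u - x) \<bullet> (\<psi> u - x))"
      using lip2_on_bilinear[OF bounded_bilinear_inner that(3), of "\<lambda>u. \<psi> u - x" "\<lambda>u. \<psi> u - x"] by simp
    have "lip2_on K (\<lambda>u. (\<rho> x)\<^sup>2 + (-1) * ((\<psi> u - x) \<bullet> (\<psi> u - x)))"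
      by (rule lip2_on_add[OF lip2_on_const lip2_on_mult[OF that(3) lip2_on_const i]])
    from lip2_on_pos_part_square[OF that(3) this] show ?thesis by (simp add: b_def o_def)
  qed
  have Blip: "lip2_on K (\<lambda>u. B (\<psi> u))" if "local_param M W \<psi>" "compact K" "convex K" "K \<subseteq> W" 
    for K and W :: "(real^'d) set" and \<psi>
    unfolding B_def using lip2_on_sum[of X K "\<lambda>x u. b x (\<psi> u)"] blip[OF that] by (simp add: o_def)
  have \<xi>lip: "lip2_fun TYPE('d) M (\<xi> x)" if x: "x \<in> X" for x
    unfolding lip2_fun_def
  proof (intro conjI allI impI)
    show "continuous_on M (\<xi> x)" unfolding \<xi>_def
    proof (intro continuous_on_mult bc continuous_on_powr' Bc continuous_on_const ballI)
      fix y assume "y \<in> M" then show "0 \<le> B y \<and> (B y = 0 \<longrightarrow> 0 < (-1::real))" using Bpos[of y] by simp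
    qed
    fix W :: "(real^'d) set" and \<psi> K assume as: "local_param M W \<psi>" "compact K" "convex K" "K \<subseteq> W"
    have "M \<noteq> {}" using x X(2) by blast
    then obtain y0 where y0: "y0 \<in> M" "\<And>y. y \<in> M \<Longrightarrow> B y0 \<le> B y"
      using continuous_attains_inf[OF M(1) _ Bc] by blast
    have "\<psi> u \<in> M" if "u \<in> K" for u using that as(4) local_paramD(5)[OF as(1)] by blast
    then have "lip2_on K (\<lambda>u. B (\<psi> u) powr (-1))"
      by (intro lip2_on_powr[OF as(3) Blip[OF as] Bpos[OF y0(1)]] y0(2))
    from lip2_on_mult[OF as(3) blip[OF as, of x] this] show "lip2_on K (\<xi> x \<circ> \<psi>)"
      by (simp add: \<xi>_def o_def)
  qed
  have "(\<Sum>x\<in>X. \<xi> x y) = 1" if y: "y \<in> M" for y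
  proof -
    have "(\<Sum>x\<in>X. \<xi> x y) = B y * B y powr (-1)" 
    proof -
      have "(\<Sum>x\<in>X. b x y * r) = B y * r" for r unfolding B_def by (rule sum_distrib_right[symmetric])
      then show ?thesis unfolding \<xi>_def .
    qed
    then show ?thesis using Bpos[OF y] by (simp add: powr_minus)
  qed
  note s = this
  have z: "\<xi> x y = 0" if "x \<in> X" "y \<in> M" "y \<notin> ball x (\<rho> x)" for x y
    using b0[OF that(1,3)] by (simp add: \<xi>_def)
  show thesis by (rule that[of X V \<phi> u \<delta> l \<rho> \<xi>, OF X nc \<xi>lip z s])
qed

text \<open>The averages of \<open>\<xi> x\<close> at the two points also sum to 1 over
  \<open>x\<close>, so a partition of unity on \<open>M\<close> splits the double integral and none
  on the product is required.\<close>

lemma kernel_energy_asymptotics: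
  "\<exists>C>0. \<forall>\<epsilon>. 0 < \<epsilon> \<and> \<epsilon> \<le> 1 \<longrightarrow> \<bar>(\<integral>z. energy \<epsilon> (fst z) (snd z) \<partial>(dV \<Otimes>\<^sub>M dV))
       - sqrt \<epsilon> ^ (CARD('d) + n) * radial_moment TYPE('d) k n * (\<integral>x. limit_energy_density TYPE('d) M q f \<tau> n x \<partial>dV)\<bar> \<le> C * (sqrt \<epsilon> ^ (CARD('d) + n) * \<epsilon>)"
proof -
  obtain X V \<phi> u \<delta> l \<rho> \<xi> where X: "finite X" "X \<subseteq> M" 
    and nc: "\<And>x. x \<in> X \<Longrightarrow> nice_chart M x (V x :: (real^'d) set) (\<phi> x) (u x) (\<delta> x) (l x) (\<rho> x)"
    and \<xi>: "\<And>x. x \<in> X \<Longrightarrow> lip2_fun TYPE('d) M (\<xi> x)" 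
    "\<And>x y. x \<in> X \<Longrightarrow> y \<in> M \<Longrightarrow> y \<notin> ball x (\<rho> x) \<Longrightarrow> \<xi> x y = 0"
    "\<And>y. y \<in> M \<Longrightarrow> (\<Sum>x\<in>X. \<xi> x y) = (1::real)"
    by (rule lip2_partition_of_unity) (rule that)
  let ?g = "limit_energy_density TYPE('d) M q f \<tau> n"
  let ?H = "\<lambda>x \<epsilon> z. (\<xi> x (fst z) + \<xi> x (snd z)) / 2 * energy \<epsilon> (fst z) (snd z)"
  have \<xi>c: "continuous_on M (\<xi> x)" if "x \<in> X" for x using \<xi>(1)[OF that] by (simp add: lip2_fun_def)
  have "\<forall>x. \<exists>C. x \<in> X \<longrightarrow> C > 0 \<and> (\<forall>\<epsilon>. 0 < \<epsilon> \<and> \<epsilon> \<le> 1 \<longrightarrow> \<bar>(\<integral>z. ?H x \<epsilon> z \<partial>(dV \<Otimes>\<^sub>M dV))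
       - sqrt \<epsilon> ^ (CARD('d) + n) * radial_moment TYPE('d) k n * (\<integral>y. \<xi> x y * ?g y \<partial>dV)\<bar> \<le> C * (sqrt \<epsilon> ^ (CARD('d) + n) * \<epsilon>))"
    using chart_pair_estimate[OF nc \<xi>(1,2)] by blast
  from choice[OF this] obtain C where C: "\<And>x. x \<in> X \<Longrightarrow> C x > 0" "\<And>x \<epsilon>. x \<in> X \<Longrightarrow> 0 < \<epsilon> \<Longrightarrow> \<epsilon> \<le> 1 \<Longrightarrow> \<bar>(\<integral>z. ?H x \<epsilon> z \<partial>(dV \<Otimes>\<^sub>M dV))
       - sqrt \<epsilon> ^ (CARD('d) + n) * radial_moment TYPE('d) k n * (\<integral>y. \<xi> x y * ?g y \<partial>dV)\<bar> \<le> C x * (sqrt \<epsilon> ^ (CARD('d) + n) * \<epsilon>)"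
    by blast
  obtain B where B: "B > 0" "\<And>\<epsilon> x y. \<epsilon> > 0 \<Longrightarrow> x \<in> M \<Longrightarrow> y \<in> M \<Longrightarrow> \<bar>energy \<epsilon> x y\<bar> \<le> B * exp (- (a * q0\<^sup>2) * (norm (x - y))\<^sup>2 / \<epsilon>)"
    by (rule kernel_energy_integrand_bounded) (rule that)
  define D where "D = (\<Sum>x\<in>X. C x) + 1"
  have D: "D > 0" unfolding D_def using C(1) by (intro add_nonneg_pos sum_nonneg) (auto intro: less_imp_le)
  have gsum: "(\<integral>y. ?g y \<partial>dV) = (\<Sum>x\<in>X. \<integral>y. \<xi> x y * ?g y \<partial>dV)"
  proof -
    have "(\<integral>y. ?g y \<partial>dV) = (\<integral>y. (\<Sum>x\<in>X. \<xi> x y * ?g y) \<partial>dV)"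
      by (rule Bochner_Integration.integral_cong[OF refl]) (simp add: space_volume[OF vol] \<xi>(3) flip: sum_distrib_right)
    also have "\<dots> = (\<Sum>x\<in>X. \<integral>y. \<xi> x y * ?g y \<partial>dV)"
      by (intro Bochner_Integration.integral_sum integrable_times_limit_energy_density \<xi>c)
    finally show ?thesis .
  qed
  have main: "\<bar>(\<integral>z. energy \<epsilon> (fst z) (snd z) \<partial>(dV \<Otimes>\<^sub>M dV))
       - sqrt \<epsilon> ^ (CARD('d) + n) * radial_moment TYPE('d) k n * (\<integral>x. ?g x \<partial>dV)\<bar> \<le> D * (sqrt \<epsilon> ^ (CARD('d) + n) * \<epsilon>)"
    if e: "0 < \<epsilon>" "\<epsilon> \<le> 1" for \<epsilon>
  proof -
    let ?S = "sqrt \<epsilon> ^ (CARD('d) + n) * radial_moment TYPE('d) k n"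
    have Hi: "integrable (dV \<Otimes>\<^sub>M dV) (?H x \<epsilon>)" if x: "x \<in> X" for x
    proof -
      obtain Bx where Bx: "Bx > 0" "\<And>y. y \<in> M \<Longrightarrow> \<bar>\<xi> x y\<bar> \<le> Bx" using continuous_bounded_on_M[OF \<xi>c[OF x]] by blast
      have \<xi>m: "\<xi> x \<in> borel_measurable dV" by (rule borel_measurable_volume_continuous_on[OF vol \<xi>c[OF x]])
      have m: "?H x \<epsilon> \<in> borel_measurable (dV \<Otimes>\<^sub>M dV)"
        by (intro borel_measurable_times borel_measurable_add borel_measurable_divide borel_measurable_const
            kernel_energy_integrand_measurable measurable_compose[OF measurable_fst \<xi>m] measurable_compose[OF measurable_snd \<xi>m])
      show ?thesis
      proof (rule integrable_pair_bounded[OF m])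
        fix y z assume yz: "y \<in> M" "z \<in> M"
        have 1: "\<bar>(\<xi> x y + \<xi> x z) / 2\<bar> \<le> Bx"
          using Bx(2)[OF yz(1)] Bx(2)[OF yz(2)] unfolding abs_le_iff by argo
        have "exp (- (a * q0\<^sup>2) * (norm (y - z))\<^sup>2 / \<epsilon>) \<le> 1" using a e by simp
        then have 2: "\<bar>energy \<epsilon> y z\<bar> \<le> B * 1" 
          using B(2)[OF e(1) yz] B(1) by (meson mult_left_mono less_imp_le order_trans)
        show "\<bar>?H x \<epsilon> (y, z)\<bar> \<le> Bx * (B * 1)"
          unfolding abs_mult fst_conv snd_conv by (rule mult_mono[OF 1 2]) (use Bx(1) in auto)
      qed
    qed
    have "(\<integral>z. energy \<epsilon> (fst z) (snd z) \<partial>(dV \<Otimes>\<^sub>M dV)) = (\<integral>z. (\<Sum>x\<in>X. ?H x \<epsilon> z) \<partial>(dV \<Otimes>\<^sub>M dV))"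
    proof (rule Bochner_Integration.integral_cong[OF refl])
      fix z assume "z \<in> space (dV \<Otimes>\<^sub>M dV)"
      then have z: "fst z \<in> M" "snd z \<in> M" by (auto simp: space_pair)
      have "(\<Sum>x\<in>X. ?H x \<epsilon> z) = (\<Sum>x\<in>X. (\<xi> x (fst z) + \<xi> x (snd z)) / 2) * energy \<epsilon> (fst z) (snd z)"
        by (rule sum_distrib_right[symmetric])
      also have "(\<Sum>x\<in>X. (\<xi> x (fst z) + \<xi> x (snd z)) / 2) = 1"
        using \<xi>(3)[OF z(1)] \<xi>(3)[OF z(2)] by (simp add: sum.distrib flip: sum_divide_distrib)
      finally show "energy \<epsilon> (fst z) (snd z) = (\<Sum>x\<in>X. ?H x \<epsilon> z)" by simp
    qed
    also have "\<dots> = (\<Sum>x\<in>X. \<integral>z. ?H x \<epsilon> z \<partial>(dV \<Otimes>\<^sub>M dV))" by (rule Bochner_Integration.integral_sum[OF Hi])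
    finally have tot: "(\<integral>z. energy \<epsilon> (fst z) (snd z) \<partial>(dV \<Otimes>\<^sub>M dV)) = (\<Sum>x\<in>X. \<integral>z. ?H x \<epsilon> z \<partial>(dV \<Otimes>\<^sub>M dV))" .
    define T where "T x = (\<integral>z. ?H x \<epsilon> z \<partial>(dV \<Otimes>\<^sub>M dV)) - ?S * (\<integral>y. \<xi> x y * ?g y \<partial>dV)" for x
    define R where "R = sqrt \<epsilon> ^ (CARD('d) + n) * \<epsilon>"
    have R: "R \<ge> 0" using e by (simp add: R_def)
    have eq: "(\<integral>z. energy \<epsilon> (fst z) (snd z) \<partial>(dV \<Otimes>\<^sub>M dV)) - ?S * (\<integral>x. ?g x \<partial>dV) = (\<Sum>x\<in>X. T x)"
      unfolding tot gsum T_def sum_subtractf sum_distrib_left ..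
    have T: "\<bar>T x\<bar> \<le> C x * R" if "x \<in> X" for x
      unfolding T_def R_def by (rule C(2)[OF that e])
    have "\<bar>\<Sum>x\<in>X. T x\<bar> \<le> (\<Sum>x\<in>X. \<bar>T x\<bar>)" by (rule sum_abs)
    also have "\<dots> \<le> (\<Sum>x\<in>X. C x * R)" by (rule sum_mono) (rule T)
    also have "\<dots> = (\<Sum>x\<in>X. C x) * R" by (simp add: sum_distrib_right)
    also have "\<dots> \<le> D * R" using R by (intro mult_right_mono) (auto simp: D_def)
    finally show ?thesis unfolding eq R_def .
  qed
  show ?thesis by (rule exI[of _ D], rule conjI[OF D], intro allI impI, elim conjE, rule main)
qed

end

section \<open>Consequences of kernel admissibility\<close>

text \<open>The derivative is controlled on the open half-line only. There the mean value theorem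
  gives a Lipschitz bound with the decay of the smaller argument; this bound and the one on values
  extend to 0 by continuity of \<open>k0\<close>.\<close>

lemma admissible_kernel_bounds:
  assumes "admissible_kernel k0"
  obtains A a where "A > 0" "a > 0" "\<And>s. s \<ge> 0 \<Longrightarrow> 0 \<le> k0 s" "\<And>s. s \<ge> 0 \<Longrightarrow> k0 s \<le> A * exp (- a * s)"
    "\<And>s t. s \<ge> 0 \<Longrightarrow> t \<ge> 0 \<Longrightarrow> \<bar>k0 s - k0 t\<bar> \<le> A * exp (- a * min s t) * \<bar>s - t\<bar>"
proof -
  have c: "continuous_on {0..} k0" and C4: "Ck_on 4 k0 {0<..}" and nn: "\<forall>s\<ge>0. k0 s \<ge> 0"
    using assms unfolding admissible_kernel_def by blast+
  obtain a b where a: "a > 0" and b: "\<forall>l\<le>4. b l > 0 \<and> (\<forall>s>0. \<bar>(deriv ^^ l) k0 s\<bar> \<le> b l * exp (- a * s))"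
    using assms unfolding admissible_kernel_def by blast
  have b0: "b 0 > 0" "\<And>s. s > 0 \<Longrightarrow> \<bar>k0 s\<bar> \<le> b 0 * exp (- a * s)" using b[rule_format, of 0] by auto
  have b1: "b 1 > 0" "\<And>s. s > 0 \<Longrightarrow> \<bar>deriv k0 s\<bar> \<le> b 1 * exp (- a * s)" using b[rule_format, of 1] by auto
  have diff: "(k0 has_real_derivative deriv k0 s) (at s)" if "s > 0" for s
  proof -
    have "k0 differentiable (at s)" using C4 that by (simp add: numeral_eq_Suc)
    then show ?thesis using DERIV_deriv_iff_real_differentiable by blast
  qed
  define A where "A = max (b 0) (b 1)"
  have A: "A > 0" "b 0 \<le> A" "b 1 \<le> A" using b0(1) by (auto simp: A_def)
  \<comment> \<open>Multiplied by \<open>exp (a * s)\<close>, the bound has a constant right side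
    and passes to the closure.\<close>
  have k1: "k0 s * exp (a * s) \<le> b 0" if s: "s \<ge> 0" for s
  proof (rule continuous_le_on_closure[where S = "{0<..}" and f = "\<lambda>s. k0 s * exp (a * s)"])
    show "continuous_on (closure {0<..}) (\<lambda>s. k0 s * exp (a * s))"
      by (simp, intro continuous_intros c)
    show "s \<in> closure {0<..}" using s by simp
    show "k0 s * exp (a * s) \<le> b 0" if "s \<in> {0<..}" for s
    proof -
      have "k0 s * exp (a * s) \<le> b 0 * exp (- a * s) * exp (a * s)" 
        using b0(2)[of s] that by (intro mult_right_mono) auto
      then show ?thesis by (simp add: mult.assoc flip: exp_add)
    qed
  qed
  have k2: "k0 s \<le> A * exp (- a * s)" if "s \<ge> 0" for s
  proof -
    have "k0 s = k0 s * exp (a * s) * exp (- a * s)" by (simp add: mult.assoc flip: exp_add)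
    also have "\<dots> \<le> A * exp (- a * s)" using k1[OF that] A(2) by (intro mult_right_mono) auto
    finally show ?thesis .
  qed
  have lip1: "\<bar>k0 s - k0 t\<bar> * exp (a * s) \<le> A * (t - s)" if st: "0 < s" "s < t" for s t
  proof -
    have "norm (k0 t - k0 s) \<le> (b 1 * exp (- a * s)) * norm (t - s)"
    proof (rule field_differentiable_bound[of "{s..t}" k0 "deriv k0"])
      show "(k0 has_field_derivative deriv k0 z) (at z within {s..t})" if "z \<in> {s..t}" for z
        using diff[of z] that st by (auto intro: has_field_derivative_at_within)
      show "norm (deriv k0 z) \<le> b 1 * exp (- a * s)" if "z \<in> {s..t}" for z
      proof -
        have "\<bar>deriv k0 z\<bar> \<le> b 1 * exp (- a * z)" using b1(2)[of z] that st by auto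
        also have "\<dots> \<le> b 1 * exp (- a * s)" using that a b1(1) by (intro mult_left_mono) auto
        finally show ?thesis by simp
      qed
    qed (use st in auto)
    then have "\<bar>k0 s - k0 t\<bar> * exp (a * s) \<le> (b 1 * exp (- a * s)) * (t - s) * exp (a * s)"
      using st by (intro mult_right_mono) (auto simp: abs_minus_commute)
    also have "\<dots> = b 1 * (t - s) * (exp (- a * s) * exp (a * s))" by (simp only: mult_ac)
    also have "exp (- a * s) * exp (a * s) = 1" by (simp flip: exp_add)
    also have "b 1 * (t - s) * 1 \<le> A * (t - s)" using A(3) st by (simp add: mult_right_mono)
    finally show ?thesis .
  qed
  have lip2: "\<bar>k0 s - k0 t\<bar> \<le> A * exp (- a * s) * \<bar>s - t\<bar>" if st: "0 \<le> s" "s < t" for s t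
  proof -
    \<comment> \<open>The larger argument \<open>t\<close> is kept fixed; only the smaller one may
      be 0.\<close>
    have "\<bar>k0 s - k0 t\<bar> * exp (a * s) - A * (t - s) \<le> 0"
    proof (rule continuous_le_on_closure[where S = "{0<..<t}" and f = "\<lambda>s. \<bar>k0 s - k0 t\<bar> * exp (a * s) - A * (t - s)"])
      have cl: "closure {0<..<t} = {0..t}" using st by (intro closure_greaterThanLessThan) auto
      show "continuous_on (closure {0<..<t}) (\<lambda>s. \<bar>k0 s - k0 t\<bar> * exp (a * s) - A * (t - s))"
        unfolding cl by (intro continuous_intros continuous_on_subset[OF c]) auto
      show "s \<in> closure {0<..<t}" unfolding cl using st by simp
      show "\<bar>k0 s - k0 t\<bar> * exp (a * s) - A * (t - s) \<le> 0" if "s \<in> {0<..<t}" for s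
        using lip1[of s t] that by simp
    qed
    then have "\<bar>k0 s - k0 t\<bar> * exp (a * s) * exp (- a * s) \<le> A * (t - s) * exp (- a * s)" by (intro mult_right_mono) auto
    moreover have "\<bar>k0 s - k0 t\<bar> * exp (a * s) * exp (- a * s) = \<bar>k0 s - k0 t\<bar>" by (simp add: mult.assoc flip: exp_add)
    ultimately have "\<bar>k0 s - k0 t\<bar> \<le> A * (t - s) * exp (- a * s)" by linarith
    moreover have "\<bar>s - t\<bar> = t - s" using st by simp
    ultimately show ?thesis by (simp only: mult_ac)
  qed
  have lip: "\<bar>k0 s - k0 t\<bar> \<le> A * exp (- a * min s t) * \<bar>s - t\<bar>" if st: "s \<ge> 0" "t \<ge> 0" for s t
  proof -
    consider "s < t" | "t < s" | "s = t" by linarith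
    then show ?thesis
    proof cases
      case 1 then show ?thesis using lip2[OF st(1) 1] by (simp add: min_def)
    next
      case 2 then show ?thesis using lip2[OF st(2) 2] by (simp add: min_def abs_minus_commute)
    next
      case 3 then show ?thesis by simp
    qed
  qed
  show thesis by (rule that[OF A(1) a _ k2 lip]) (use nn in auto)
qed

text \<open>Lets the exponential comparison kernel pass through the same asymptotics as
  \<open>k0\<close>.\<close>

lemma exp_kernel_bounds:
  assumes "\<beta> > (0::real)" "s \<ge> 0" "t \<ge> 0"
  shows "\<bar>exp (- \<beta> * s) - exp (- \<beta> * t)\<bar> \<le> (1 + \<beta>) * exp (- \<beta> * min s t) * \<bar>s - t\<bar>"
proof -
  have *: "\<bar>exp (- \<beta> * s) - exp (- \<beta> * t)\<bar> \<le> (1 + \<beta>) * exp (- \<beta> * s) * (t - s)" if "s \<le> t" for s t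
  proof -
    have "exp (- \<beta> * t) = exp (- \<beta> * s) * exp (- \<beta> * (t - s))" by (simp add: algebra_simps flip: exp_add)
    then have eq: "exp (- \<beta> * s) - exp (- \<beta> * t) = exp (- \<beta> * s) * (1 - exp (- \<beta> * (t - s)))" by (simp add: algebra_simps)
    have "0 \<le> \<beta> * (t - s)" using that assms(1) by simp
    then have "0 \<le> 1 - exp (- \<beta> * (t - s))" by simp
    moreover have "1 - exp (- \<beta> * (t - s)) \<le> \<beta> * (t - s)" using exp_ge_add_one_self[of "- \<beta> * (t - s)"] by linarith
    moreover have "\<beta> * (t - s) \<le> (1 + \<beta>) * (t - s)" using that by (intro mult_right_mono) auto
    ultimately have 1: "\<bar>1 - exp (- \<beta> * (t - s))\<bar> \<le> (1 + \<beta>) * (t - s)" by linarith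
    have "exp (- \<beta> * s) * \<bar>1 - exp (- \<beta> * (t - s))\<bar> \<le> exp (- \<beta> * s) * ((1 + \<beta>) * (t - s))" using 1 by (rule mult_left_mono) simp
    then show ?thesis unfolding eq abs_mult by (simp add: mult_ac)
  qed
  show ?thesis
  proof (cases "s \<le> t")
    case True then show ?thesis using *[OF True] by (simp add: min_def)
  next
    case False
    then have "t \<le> s" by simp
    from *[OF this] show ?thesis using False by (simp add: min_def abs_minus_commute)
  qed
qed

text \<open>A positive supremum gives a point where \<open>k0\<close> is positive; continuity
  spreads this to an open set of vectors, on which the integrand vanishes at most at the
  origin.\<close>

lemma kernel_m2_pos:
  assumes "admissible_kernel k0" shows "kernel_m2 TYPE('d::finite) k0 > 0"
proof -
  obtain A a where A: "A > 0" "a > 0" "\<And>s. s \<ge> 0 \<Longrightarrow> 0 \<le> k0 s" "\<And>s. s \<ge> 0 \<Longrightarrow> k0 s \<le> A * exp (- a * s)"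
    by (rule admissible_kernel_bounds[OF assms]) (rule that)
  have c: "continuous_on {0..} k0" and S: "(SUP s\<in>{0..}. \<bar>k0 s\<bar>) > 0"
    using assms unfolding admissible_kernel_def by blast+
  have "\<exists>s\<ge>0. k0 s > 0"
  proof (rule ccontr)
    assume "\<not> (\<exists>s\<ge>0. k0 s > 0)"
    then have "\<bar>k0 s\<bar> = 0" if "s \<ge> 0" for s using A(3)[OF that] that by force
    then have "(\<lambda>s. \<bar>k0 s\<bar>) ` {0..} = (\<lambda>s. 0) ` {0::real..}" by (intro image_cong[OF refl]) (simp only: atLeast_iff)
    then have "(SUP s\<in>{0..}. \<bar>k0 s\<bar>) = (SUP s\<in>{0::real..}. 0::real)" by (simp only:)
    then show False using S by simp
  qed
  then obtain s0 where s0: "s0 \<ge> 0" "k0 s0 > 0" by blast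
  define g where "g = (\<lambda>u::real^'d. (norm u)\<^sup>2 * k0 ((norm u)\<^sup>2))"
  have gc: "continuous_on UNIV g" unfolding g_def
    by (intro continuous_intros continuous_on_compose2[OF c]) auto
  have kc: "continuous_on UNIV (\<lambda>u::real^'d. k0 ((norm u)\<^sup>2))"
    by (intro continuous_intros continuous_on_compose2[OF c]) auto
  have g0: "g u \<ge> 0" for u using A(3) by (simp add: g_def)
  have gi: "integrable lborel g"
  proof (rule Bochner_Integration.integrable_bound)
    show "integrable lborel (\<lambda>u::real^'d. A * (norm u ^ 2 * exp (- a * (norm u)\<^sup>2)))"
      by (intro integrable_mult_right integrable_power_exp_norm_square A(2))
    show "g \<in> borel_measurable lborel" using gc borel_measurable_continuous_onI by simp
    have "g u \<le> A * (norm u ^ 2 * exp (- a * (norm u)\<^sup>2))" for u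
      using mult_left_mono[OF A(4)[of "(norm u)\<^sup>2"], of "(norm u)\<^sup>2"] by (simp add: g_def mult_ac)
    then show "AE u in lborel. norm (g u) \<le> norm (A * (norm u ^ 2 * exp (- a * (norm u)\<^sup>2)))"
      using g0 A(1) by (intro AE_I2) (simp add: abs_mult)
  qed
  define O1 where "O1 = {u::real^'d. 0 < k0 ((norm u)\<^sup>2)}"
  have O1: "open O1" unfolding O1_def using kc by (intro open_Collect_less) auto
  define u1 where "u1 = (sqrt s0 *\<^sub>R axis undefined 1 :: real^'d)"
  have u1: "u1 \<in> O1" using s0 by (simp add: O1_def u1_def norm_axis_1)
  \<comment> \<open>If \<open>s0 = 0\<close>, the witness \<open>u1\<close> is the origin itself; an
    open set does not consist of that point alone.\<close>
  have ne: "O1 - {0} \<noteq> {}"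
  proof
    assume "O1 - {0} = {}"
    then have "O1 = {0}" using u1 by blast
    then show False using O1 not_open_singleton[of "0::real^'d"] by simp
  qed
  have op: "open (O1 - {0})" using O1 by (intro open_Diff) auto
  have "(\<integral>u. g u \<partial>lborel) \<noteq> 0"
  proof
    assume "(\<integral>u. g u \<partial>lborel) = 0"
    then have "AE u in lborel. g u = 0" using integral_nonneg_eq_0_iff_AE[OF gi] g0 by auto
    then have "AE u in lborel. u \<notin> O1 - {0}" by eventually_elim (auto simp: g_def O1_def)
    then have "O1 - {0} \<in> null_sets lborel" using op by (subst (asm) AE_iff_null_sets[symmetric]) auto
    then have "negligible (O1 - {0})" by (simp add: negligible_iff_null_sets null_sets_completionI)
    then show False using open_not_negligible[OF op ne] by blast
  qed
  moreover have "(\<integral>u. g u \<partial>lborel) \<ge> 0" using g0 by (intro Bochner_Integration.integral_nonneg) auto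
  ultimately show ?thesis unfolding kernel_m2_def g_def by simp
qed

section \<open>Regularity and perturbation of bandwidths\<close>

text \<open>A ball about \<open>x'\<close> lies in the ball about \<open>x\<close> enlarged by
  \<open>norm (x - x')\<close>, so a radius admissible at \<open>x'\<close> becomes admissible at
  \<open>x\<close> after adding this distance. The bound \<open>k \<le> Ny\<close> keeps the set of
  admissible radii nonempty. The resulting continuity makes the bandwidth measurable.\<close>

lemma knn_radius_lipschitz:
  assumes k: "1 \<le> k" "k \<le> Ny"
  shows "\<bar>knn_radius Ny y k x - knn_radius Ny y k x'\<bar> \<le> norm (x - x')"
proof -
  let ?S = "\<lambda>x. {r. r > 0 \<and> k \<le> card {j. j < Ny \<and> norm (y j - x) < r}}"
  have ne: "?S x \<noteq> {}" for x
  proof -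
    define r where "r = (\<Sum>j<Ny. norm (y j - x)) + 1"
    have "norm (y j - x) < r" if "j < Ny" for j
    proof -
      have "norm (y j - x) \<le> (\<Sum>j<Ny. norm (y j - x))" using that by (intro member_le_sum) auto
      then show ?thesis by (simp add: r_def)
    qed
    then have "{j. j < Ny \<and> norm (y j - x) < r} = {..<Ny}" by auto
    moreover have "r > 0" by (simp add: r_def add_nonneg_pos sum_nonneg)
    ultimately have "r \<in> ?S x" using k by simp
    then show ?thesis by blast
  qed
  have bdd: "bdd_below (?S x)" for x by (rule bdd_belowI[of _ 0]) auto
  have "knn_radius Ny y k x \<le> knn_radius Ny y k x' + norm (x - x')" for x x'
  proof -
    have "knn_radius Ny y k x - norm (x - x') \<le> Inf (?S x')"
    proof (rule cInf_greatest[OF ne])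
      fix r assume r: "r \<in> ?S x'"
      have "{j. j < Ny \<and> norm (y j - x') < r} \<subseteq> {j. j < Ny \<and> norm (y j - x) < r + norm (x - x')}"
      proof (intro subsetI, elim CollectE conjE, intro CollectI conjI)
        fix j assume "norm (y j - x') < r"
        then show "norm (y j - x) < r + norm (x - x')"
          using norm_triangle_ineq[of "y j - x'" "x' - x"] by (simp add: norm_minus_commute)
      qed
      then have "card {j. j < Ny \<and> norm (y j - x') < r} \<le> card {j. j < Ny \<and> norm (y j - x) < r + norm (x - x')}"
        by (intro card_mono) auto
      then have "r + norm (x - x') \<in> ?S x" using r by (auto simp: add_pos_nonneg)
      then have "knn_radius Ny y k x \<le> r + norm (x - x')" unfolding knn_radius_def by (rule cInf_lower[OF _ bdd])
      then show "knn_radius Ny y k x - norm (x - x') \<le> r" by linarith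
    qed
    then show ?thesis unfolding knn_radius_def by linarith
  qed
  from this[of x x'] this[of x' x] show ?thesis by (simp add: norm_minus_commute abs_le_iff)
qed

lemma continuous_on_knn_bandwidth:
  assumes "1 \<le> k" "k \<le> Ny" shows "continuous_on S (knn_bandwidth T Ny y k)"
proof -
  have "1-lipschitz_on S (knn_radius Ny y k)"
    using knn_radius_lipschitz[OF assms] by (auto simp: lipschitz_on_def dist_norm)
  then have "continuous_on S (knn_radius Ny y k)" by (rule lipschitz_on_continuous_on)
  then show ?thesis unfolding knn_bandwidth_def by (intro continuous_intros)
qed

lemma lip2_fun_powr:
  fixes M :: "'a::euclidean_space set"
  assumes M: "smooth_submanifold TYPE('d::finite) M" and p: "smooth_fun TYPE('d) M p"
    and lo: "lo > 0" "\<And>x. x \<in> M \<Longrightarrow> lo \<le> p x"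
  shows "lip2_fun TYPE('d) M (\<lambda>x. p x powr r)"
  unfolding lip2_fun_def
proof (intro conjI allI impI)
  have "p x \<noteq> 0" if "x \<in> M" for x using lo that by fastforce
  then show "continuous_on M (\<lambda>x. p x powr r)"
    by (intro continuous_on_powr smooth_fun_continuous_on[OF M p] continuous_on_const) auto
  fix V :: "(real^'d) set" and \<phi> K assume as: "local_param M V \<phi>" "compact K" "convex K" "K \<subseteq> V"
  have "\<phi> u \<in> M" if "u \<in> K" for u using that as(4) local_paramD(5)[OF as(1)] by blast
  then have "lip2_on K (\<lambda>u. (p \<circ> \<phi>) u powr r)"
    by (intro lip2_on_powr[OF as(3) smooth_on_lip2_on[OF as(2-4) smooth_fun_smooth_on[OF p as(1)]] lo(1)]) (auto intro: lo(2))
  then show "lip2_on K ((\<lambda>x. p x powr r) \<circ> \<phi>)" by (simp add: o_def)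
qed

text \<open>\<open>t\<close> will be the ratio of the estimated to the exact product of two
  bandwidths. Relative errors up to \<eta> \<le> 1/10 give
  \<open>2 * \<eta> + \<eta>^2 \<le> (21/10) * \<eta>\<close>, and division by \<open>8/10\<close>
  bounds the logarithm by \<open>3 * \<eta>\<close>. As this is at most 1, the exponential factor is
  at most \<open>exp \<bar>\<alpha>\<bar>\<close>.\<close>

lemma abs_powr_minus_one_le:
  fixes t \<alpha> \<eta> :: real
  assumes t: "t > 0" "\<bar>t - 1\<bar> \<le> (21/10) * \<eta>" and \<eta>: "0 \<le> \<eta>" "\<eta> \<le> 1/10" and t8: "t \<ge> 8/10"
  shows "\<bar>t powr \<alpha> - 1\<bar> \<le> (3 * \<bar>\<alpha>\<bar> * exp \<bar>\<alpha>\<bar>) * \<eta>"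
proof -
  have "\<bar>ln t\<bar> \<le> 3 * \<eta>"
  proof (cases "t \<ge> 1")
    case True
    then have "\<bar>ln t\<bar> = ln t" by simp
    also have "\<dots> \<le> t - 1" using t(1) ln_le_minus_one by blast
    finally show ?thesis using t(2) \<eta>(1) by linarith
  next
    case False
    have "- ln t = ln (1 / t)" using t(1) by (simp add: ln_div)
    also have "\<dots> \<le> 1 / t - 1" using t(1) by (intro ln_le_minus_one) simp
    also have "\<dots> = (1 - t) / t" using t(1) by (simp add: field_simps)
    also have "\<dots> \<le> ((21/10) * \<eta>) / (8/10)" using False t t8 by (intro frac_le) auto
    finally show ?thesis using False t(1) \<eta>(1) by simp
  qed
  then have x: "\<bar>\<alpha> * ln t\<bar> \<le> \<bar>\<alpha>\<bar> * (3 * \<eta>)" unfolding abs_mult by (rule mult_left_mono) simp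
  have "\<bar>exp x - 1\<bar> \<le> \<bar>x\<bar> * exp \<bar>x\<bar>" for x :: real
  proof (cases "x \<ge> 0")
    case True
    have "exp x * (1 - x) \<le> exp x * exp (- x)" using exp_ge_add_one_self[of "-x"] by (intro mult_left_mono) auto
    then have "exp x - 1 \<le> x * exp x" by (simp add: algebra_simps flip: exp_add)
    then show ?thesis using True by simp
  next
    case False
    have "1 - exp x \<le> - x" using exp_ge_add_one_self[of x] by linarith
    moreover have "- x * 1 \<le> - x * exp (- x)" using False by (intro mult_left_mono) auto
    moreover have "\<bar>exp x - 1\<bar> = 1 - exp x" "\<bar>x\<bar> = - x" using False by auto
    ultimately show ?thesis by simp
  qed
  from this[of "\<alpha> * ln t"] have "\<bar>t powr \<alpha> - 1\<bar> \<le> \<bar>\<alpha> * ln t\<bar> * exp \<bar>\<alpha> * ln t\<bar>" using t(1) by (simp add: powr_def)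
  also have "\<dots> \<le> (\<bar>\<alpha>\<bar> * (3 * \<eta>)) * exp \<bar>\<alpha>\<bar>"
  proof (intro mult_mono)
    have "\<bar>\<alpha>\<bar> * (3 * \<eta>) \<le> \<bar>\<alpha>\<bar> * 1" using \<eta> by (intro mult_left_mono) auto
    then show "exp \<bar>\<alpha> * ln t\<bar> \<le> exp \<bar>\<alpha>\<bar>" using x by simp
  qed (use x \<eta> in auto)
  finally show ?thesis by (simp add: mult_ac)
qed

section \<open>Concentration of V-statistics\<close>

text \<open>There is no lower bound on \<open>x\<close>, which suits the lower tail of nonnegative
  summands. For \<open>x = - y < 0\<close> the claim follows from
  \<open>(1 - y + y^2) * (1 + y + y^2 / 2) \<ge> 1\<close>.\<close>

lemma exp_le_quadratic:
  assumes "x \<le> (1::real)" shows "exp x \<le> 1 + x + x\<^sup>2"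
proof (cases "x \<ge> 0")
  case True then show ?thesis using exp_bound assms by blast
next
  case False
  define y where "y = - x"
  have y: "y > 0" using False by (simp add: y_def)
  have e: "1 + y + y\<^sup>2 / 2 \<le> exp y" using exp_lower_Taylor_quadratic y by simp
  have p: "0 < 1 - y + y\<^sup>2"
  proof -
    have "1 - y + y\<^sup>2 = (y - 1/2)\<^sup>2 + 3/4" by (simp add: power2_eq_square algebra_simps)
    then show ?thesis by (metis add_nonneg_pos zero_le_power2 zero_less_divide_iff zero_less_numeral)
  qed
  have "1 \<le> (1 - y + y\<^sup>2) * (1 + y + y\<^sup>2 / 2)"
  proof -
    have "(1 - y + y\<^sup>2) * (1 + y + y\<^sup>2 / 2) = 1 + (y\<^sup>2 / 2 + y ^ 3 / 2 + y ^ 4 / 2)"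
      by (simp add: field_simps power2_eq_square power3_eq_cube power4_eq_xxxx)
    then show ?thesis using y by simp
  qed
  also have "\<dots> \<le> (1 - y + y\<^sup>2) * exp y" using e p by (intro mult_left_mono) auto
  finally have "exp (- y) \<le> 1 - y + y\<^sup>2" using p by (simp add: exp_minus field_simps)
  then show ?thesis by (simp add: y_def)
qed

text \<open>Markov's inequality for the exponential: each factor
  \<open>exp (c * (Z i - \<mu>))\<close> has expectation at most \<open>exp (c^2 * \<nu>)\<close>,
  with \<nu> bounding the second moment rather than the variance. The sign of \<open>c\<close> is
  free, so both tails are instances.\<close>

lemma (in prob_space) one_sided_tail:
  fixes Z :: "'i \<Rightarrow> 'a \<Rightarrow> real"
  assumes I: "finite I" and ind: "indep_vars (\<lambda>_. borel) Z I"
    and le: "\<And>i \<omega>. i \<in> I \<Longrightarrow> \<omega> \<in> space M \<Longrightarrow> c * Z i \<omega> \<le> 1" 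
    and b: "\<And>i \<omega>. i \<in> I \<Longrightarrow> \<omega> \<in> space M \<Longrightarrow> \<bar>Z i \<omega>\<bar> \<le> L"
    and mu: "\<And>i. i \<in> I \<Longrightarrow> expectation (Z i) = \<mu>" and nu: "\<And>i. i \<in> I \<Longrightarrow> expectation (\<lambda>\<omega>. (Z i \<omega>)\<^sup>2) \<le> \<nu>"
  shows "prob {\<omega>\<in>space M. c * (\<Sum>i\<in>I. Z i \<omega>) - c * (real (card I) * \<mu>) \<ge> t} \<le> exp (- t + real (card I) * c\<^sup>2 * \<nu>)"
proof -
  have Zm: "Z i \<in> borel_measurable M" if "i \<in> I" for i using ind that unfolding indep_vars_def2 by simp
  have Zi: "integrable M (Z i)" if "i \<in> I" for i
    by (rule integrable_const_bound[of _ L]) (use b that Zm in auto)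
  have Z2i: "integrable M (\<lambda>\<omega>. (Z i \<omega>)\<^sup>2)" if "i \<in> I" for i
  proof (rule integrable_const_bound[of _ "L\<^sup>2"])
    have "(Z i \<omega>)\<^sup>2 \<le> L\<^sup>2" if "\<omega> \<in> space M" for \<omega>
      using b[OF \<open>i \<in> I\<close> that] power_mono[of "\<bar>Z i \<omega>\<bar>" L 2] by simp
    then show "AE \<omega> in M. norm ((Z i \<omega>)\<^sup>2) \<le> L\<^sup>2" by (intro AE_I2) simp
  qed (use Zm that in measurable)
  define E where "E = (\<lambda>i \<omega>. exp (c * (Z i \<omega> - \<mu>)))"
  have Em: "E i \<in> borel_measurable M" if "i \<in> I" for i unfolding E_def using Zm[OF that] by measurable
  have Ei: "integrable M (E i)" if i: "i \<in> I" for i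
  proof (rule integrable_const_bound[of _ "exp (1 - c * \<mu>)"])
    show "AE \<omega> in M. norm (E i \<omega>) \<le> exp (1 - c * \<mu>)"
      using le[OF i] by (intro AE_I2) (simp add: E_def right_diff_distrib)
  qed (rule Em[OF i])
  have indE: "indep_vars (\<lambda>_. borel) E I"
    unfolding E_def by (rule indep_vars_compose2[OF ind, of "\<lambda>_ z. exp (c * (z - \<mu>))"]) simp
  have EE: "0 \<le> expectation (E i) \<and> expectation (E i) \<le> exp (c\<^sup>2 * \<nu>)" if i: "i \<in> I" for i
  proof
    show "0 \<le> expectation (E i)" by (intro Bochner_Integration.integral_nonneg) (simp add: E_def)
    have "expectation (E i) = exp (- c * \<mu>) * expectation (\<lambda>\<omega>. exp (c * Z i \<omega>))"
      unfolding E_def by (subst integral_mult_right_zero[symmetric]) (simp add: algebra_simps flip: exp_add)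
    also have "\<dots> \<le> exp (- c * \<mu>) * expectation (\<lambda>\<omega>. 1 + c * Z i \<omega> + c\<^sup>2 * (Z i \<omega>)\<^sup>2)"
    proof (rule mult_left_mono[OF integral_mono])
      show "integrable M (\<lambda>\<omega>. exp (c * Z i \<omega>))"
        by (rule integrable_const_bound[of _ "exp 1"]) (use le[OF i] Zm[OF i] in \<open>auto intro!: AE_I2\<close>)
      show "integrable M (\<lambda>\<omega>. 1 + c * Z i \<omega> + c\<^sup>2 * (Z i \<omega>)\<^sup>2)" using Zi[OF i] Z2i[OF i] by simp
      show "exp (c * Z i \<omega>) \<le> 1 + c * Z i \<omega> + c\<^sup>2 * (Z i \<omega>)\<^sup>2" if "\<omega> \<in> space M" for \<omega>
        using exp_le_quadratic[OF le[OF i that]] by (simp add: power_mult_distrib)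
    qed simp
    also have "expectation (\<lambda>\<omega>. 1 + c * Z i \<omega> + c\<^sup>2 * (Z i \<omega>)\<^sup>2) = 1 + c * \<mu> + c\<^sup>2 * expectation (\<lambda>\<omega>. (Z i \<omega>)\<^sup>2)"
      using Zi[OF i] Z2i[OF i] mu[OF i] by (simp add: prob_space)
    also have "exp (- c * \<mu>) * (1 + c * \<mu> + c\<^sup>2 * expectation (\<lambda>\<omega>. (Z i \<omega>)\<^sup>2)) \<le> exp (- c * \<mu>) * exp (c * \<mu> + c\<^sup>2 * \<nu>)"
    proof (rule mult_left_mono)
      have "c\<^sup>2 * expectation (\<lambda>\<omega>. (Z i \<omega>)\<^sup>2) \<le> c\<^sup>2 * \<nu>" using nu[OF i] by (rule mult_left_mono) simp
      then show "1 + c * \<mu> + c\<^sup>2 * expectation (\<lambda>\<omega>. (Z i \<omega>)\<^sup>2) \<le> exp (c * \<mu> + c\<^sup>2 * \<nu>)"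
        using exp_ge_add_one_self[of "c * \<mu> + c\<^sup>2 * \<nu>"] by linarith
    qed simp
    also have "\<dots> = exp (c\<^sup>2 * \<nu>)" by (simp flip: exp_add)
    finally show "expectation (E i) \<le> exp (c\<^sup>2 * \<nu>)" .
  qed
  have prodE: "(\<Prod>i\<in>I. E i \<omega>) = exp (c * (\<Sum>i\<in>I. Z i \<omega>) - c * (real (card I) * \<mu>))" for \<omega>
    unfolding E_def by (simp add: exp_sum[OF I, symmetric] sum_subtractf right_diff_distrib sum_distrib_left)
  have "prob {\<omega>\<in>space M. c * (\<Sum>i\<in>I. Z i \<omega>) - c * (real (card I) * \<mu>) \<ge> t} = prob {\<omega>\<in>space M. (\<Prod>i\<in>I. E i \<omega>) \<ge> exp t}"
    by (simp add: prodE)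
  also have "\<dots> \<le> expectation (\<lambda>\<omega>. \<Prod>i\<in>I. E i \<omega>) / exp t"
    by (rule integral_Markov_inequality_measure[OF indep_vars_integrable[OF I indE Ei], of "{}"])
       (auto intro!: AE_I2 prod_nonneg simp: E_def)
  also have "expectation (\<lambda>\<omega>. \<Prod>i\<in>I. E i \<omega>) = (\<Prod>i\<in>I. expectation (E i))" by (rule indep_vars_lebesgue_integral[OF I indE Ei])
  also have "(\<Prod>i\<in>I. expectation (E i)) / exp t \<le> (\<Prod>i\<in>I. exp (c\<^sup>2 * \<nu>)) / exp t"
    using EE by (intro divide_right_mono prod_mono) auto
  also have "\<dots> = exp (real (card I) * (c\<^sup>2 * \<nu>) - t)" by (simp add: exp_of_nat_mult exp_diff)
  also have "\<dots> = exp (- t + real (card I) * c\<^sup>2 * \<nu>)" by (simp add: algebra_simps)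
  finally show ?thesis .
qed

text \<open>The lower tail uses the parameter \<open>- c\<close>; nonnegativity of the summands
  makes the requirement \<open>(- c) * Z i \<omega> \<le> 1\<close> automatic.\<close>

lemma (in prob_space) two_sided_tail:
  fixes Z :: "'i \<Rightarrow> 'a \<Rightarrow> real"
  assumes I: "finite I" and ind: "indep_vars (\<lambda>_. borel) Z I"
    and b: "\<And>i \<omega>. i \<in> I \<Longrightarrow> \<omega> \<in> space M \<Longrightarrow> 0 \<le> Z i \<omega>" "\<And>i \<omega>. i \<in> I \<Longrightarrow> \<omega> \<in> space M \<Longrightarrow> Z i \<omega> \<le> L"
    and mu: "\<And>i. i \<in> I \<Longrightarrow> expectation (Z i) = \<mu>" and nu: "\<And>i. i \<in> I \<Longrightarrow> expectation (\<lambda>\<omega>. (Z i \<omega>)\<^sup>2) \<le> \<nu>"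
    and c: "c > 0" "c * L \<le> 1"
  shows "prob {\<omega>\<in>space M. \<bar>(\<Sum>i\<in>I. Z i \<omega>) - real (card I) * \<mu>\<bar> \<ge> t} \<le> 2 * exp (- (c * t) + real (card I) * c\<^sup>2 * \<nu>)"
proof -
  have Zm[measurable]: "Z i \<in> borel_measurable M" if "i \<in> I" for i using ind that unfolding indep_vars_def2 by simp
  let ?S = "\<lambda>\<omega>. \<Sum>i\<in>I. Z i \<omega>" and ?m = "real (card I) * \<mu>"
  have Sm[measurable]: "?S \<in> borel_measurable M" by measurable
  have abs: "\<bar>Z i \<omega>\<bar> \<le> L" if "i \<in> I" "\<omega> \<in> space M" for i \<omega> using b that by fastforce
  have le1: "c * Z i \<omega> \<le> 1" if "i \<in> I" "\<omega> \<in> space M" for i \<omega>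
    using mult_left_mono[OF b(2)[OF that], of c] c by linarith
  have le2: "(- c) * Z i \<omega> \<le> 1" if "i \<in> I" "\<omega> \<in> space M" for i \<omega>
  proof -
    have "0 \<le> c * Z i \<omega>" using b(1)[OF that] c(1) by (intro mult_nonneg_nonneg) auto
    then show ?thesis unfolding mult_minus_left by linarith
  qed
  have "{\<omega>\<in>space M. \<bar>?S \<omega> - ?m\<bar> \<ge> t} \<subseteq> {\<omega>\<in>space M. c * ?S \<omega> - c * ?m \<ge> c * t} \<union> {\<omega>\<in>space M. (- c) * ?S \<omega> - (- c) * ?m \<ge> c * t}"
  proof
    fix \<omega> assume w: "\<omega> \<in> {\<omega>\<in>space M. \<bar>?S \<omega> - ?m\<bar> \<ge> t}"
    then consider "t \<le> ?S \<omega> - ?m" | "t \<le> - (?S \<omega> - ?m)" by (auto simp: abs_if split: if_splits)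
    then show "\<omega> \<in> {\<omega>\<in>space M. c * ?S \<omega> - c * ?m \<ge> c * t} \<union> {\<omega>\<in>space M. (- c) * ?S \<omega> - (- c) * ?m \<ge> c * t}"
    proof cases
      case 1
      then have "c * t \<le> c * (?S \<omega> - ?m)" using c(1) by (intro mult_left_mono) auto
      then show ?thesis using w by (simp add: right_diff_distrib)
    next
      case 2
      then have "c * t \<le> c * (- (?S \<omega> - ?m))" using c(1) by (intro mult_left_mono) auto
      then show ?thesis using w by (simp add: algebra_simps)
    qed
  qed
  then have "prob {\<omega>\<in>space M. \<bar>?S \<omega> - ?m\<bar> \<ge> t} \<le> prob ({\<omega>\<in>space M. c * ?S \<omega> - c * ?m \<ge> c * t} \<union> {\<omega>\<in>space M. (- c) * ?S \<omega> - (- c) * ?m \<ge> c * t})"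
    by (intro finite_measure_mono) measurable
  also have "\<dots> \<le> prob {\<omega>\<in>space M. c * ?S \<omega> - c * ?m \<ge> c * t} + prob {\<omega>\<in>space M. (- c) * ?S \<omega> - (- c) * ?m \<ge> c * t}"
    by (intro measure_Un_le) measurable
  also have "\<dots> \<le> exp (- (c * t) + real (card I) * c\<^sup>2 * \<nu>) + exp (- (c * t) + real (card I) * (- c)\<^sup>2 * \<nu>)"
    by (intro add_mono one_sided_tail[OF I ind _ abs mu nu] le1 le2)
  finally show ?thesis by simp
qed

text \<open>The ordered pairs of distinct indices split into the classes \<open>i + j \<equiv> s (mod N)\<close>; within a class
  the unordered pairs are disjoint, hence the corresponding kernel values independent.\<close>

definition partner :: "nat \<Rightarrow> nat \<Rightarrow> nat \<Rightarrow> nat" where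
  "partner N s i = (if i \<le> s then s - i else s + N - i)"

definition pair_reps :: "nat \<Rightarrow> nat \<Rightarrow> nat set" where
  "pair_reps N s = {i. i < N \<and> i < partner N s i}"

lemma partner_less: "s < N \<Longrightarrow> i < N \<Longrightarrow> partner N s i < N"
  by (auto simp: partner_def)

lemma partner_partner: "s < N \<Longrightarrow> i < N \<Longrightarrow> partner N s (partner N s i) = i"
  by (auto simp: partner_def)

text \<open>For fixed \<open>i\<close> the classes run through every partner index once; the inverse
  is addition modulo \<open>N\<close>.\<close>

lemma bij_betw_partner: "i < N \<Longrightarrow> bij_betw (\<lambda>s. partner N s i) {..<N} {..<N}"
  by (rule bij_betwI[where g = "\<lambda>j. if i + j < N then i + j else i + j - N"]) (auto simp: partner_def)

lemma finite_pair_reps: "finite (pair_reps N s)" by (simp add: pair_reps_def)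

text \<open>\<open>partner N s\<close> is an involution on the indices. Its fixed points carry the
  diagonal value 0, and by symmetry of \<open>g\<close> the indices below and above their partners
  have equal sums.\<close>

lemma sum_partner:
  fixes g :: "nat \<Rightarrow> nat \<Rightarrow> real"
  assumes s: "s < N" and sym: "\<And>i j. i < N \<Longrightarrow> j < N \<Longrightarrow> g i j = g j i" and diag: "\<And>i. i < N \<Longrightarrow> g i i = 0"
  shows "(\<Sum>i<N. g i (partner N s i)) = 2 * (\<Sum>i\<in>pair_reps N s. g i (partner N s i))"
proof -
  let ?p = "partner N s" and ?I = "pair_reps N s"
  let ?F = "{i. i < N \<and> i = ?p i}" and ?J = "{i. i < N \<and> ?p i < i}"
  have un: "{..<N} = ?I \<union> (?J \<union> ?F)" by (auto simp: pair_reps_def)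
  have dis: "?I \<inter> (?J \<union> ?F) = {}" "?J \<inter> ?F = {}" by (auto simp: pair_reps_def)
  have "bij_betw ?p ?I ?J"
    by (rule bij_betwI[where g = ?p]) (use s in \<open>auto simp: pair_reps_def partner_less partner_partner\<close>)
  then have "(\<Sum>j\<in>?J. g j (?p j)) = (\<Sum>i\<in>?I. g (?p i) (?p (?p i)))"
    using sum.reindex_bij_betw[of ?p ?I ?J "\<lambda>j. g j (?p j)"] by simp
  also have "\<dots> = (\<Sum>i\<in>?I. g i (?p i))"
    by (rule sum.cong[OF refl]) (use s sym in \<open>auto simp: pair_reps_def partner_less partner_partner\<close>)
  finally have J: "(\<Sum>j\<in>?J. g j (?p j)) = (\<Sum>i\<in>?I. g i (?p i))" .
  have "(\<Sum>i\<in>?F. g i (?p i)) = (\<Sum>i\<in>?F. 0)" by (rule sum.cong[OF refl]) (use diag in auto)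
  then have F: "(\<Sum>i\<in>?F. g i (?p i)) = 0" by simp
  have "(\<Sum>i<N. g i (?p i)) = (\<Sum>i\<in>?I. g i (?p i)) + ((\<Sum>i\<in>?J. g i (?p i)) + (\<Sum>i\<in>?F. g i (?p i)))"
    unfolding un by (subst sum.union_disjoint[OF finite_pair_reps _ dis(1)], simp, subst sum.union_disjoint[OF _ _ dis(2)], simp_all)
  then show ?thesis using J F by simp
qed

lemma sum_pairs_partner:
  fixes g :: "nat \<Rightarrow> nat \<Rightarrow> real"
  shows "(\<Sum>i<N. \<Sum>j<N. g i j) = (\<Sum>s<N. \<Sum>i<N. g i (partner N s i))"
proof -
  have "(\<Sum>i<N. \<Sum>j<N. g i j) = (\<Sum>i<N. \<Sum>s<N. g i (partner N s i))"
    by (rule sum.cong[OF refl], rule sum.reindex_bij_betw[symmetric, OF bij_betw_partner]) simp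
  also have "\<dots> = (\<Sum>s<N. \<Sum>i<N. g i (partner N s i))" by (rule sum.swap)
  finally show ?thesis .
qed

text \<open>Counting is \<open>sum_partner\<close> for the indicator of distinct indices.\<close>

lemma card_pair_reps: "s < N \<Longrightarrow> 2 * real (card (pair_reps N s)) = (\<Sum>i<N. of_bool (i \<noteq> partner N s i))"
proof -
  assume s: "s < N"
  have "(\<Sum>i<N. of_bool (i \<noteq> partner N s i)) = 2 * (\<Sum>i\<in>pair_reps N s. of_bool (i \<noteq> partner N s i) :: real)"
    by (rule sum_partner[OF s, of "\<lambda>i j. of_bool (i \<noteq> j)"]) auto
  also have "(\<Sum>i\<in>pair_reps N s. of_bool (i \<noteq> partner N s i) :: real) = (\<Sum>i\<in>pair_reps N s. 1)"
    by (rule sum.cong[OF refl]) (auto simp: pair_reps_def)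
  finally show ?thesis by simp
qed

lemma card_pair_reps_le: "s < N \<Longrightarrow> 2 * real (card (pair_reps N s)) \<le> real N"
proof -
  assume "s < N"
  have "(\<Sum>i<N. of_bool (i \<noteq> partner N s i)) \<le> (\<Sum>i<N. (1::real))" by (rule sum_mono) simp
  then show ?thesis using card_pair_reps[OF \<open>s < N\<close>] by simp
qed

lemma sum_card_pair_reps: "(\<Sum>s<N. 2 * real (card (pair_reps N s))) = real N * (real N - 1)"
proof -
  have "(\<Sum>s<N. 2 * real (card (pair_reps N s))) = (\<Sum>s<N. \<Sum>i<N. of_bool (i \<noteq> partner N s i))"
    by (rule sum.cong[OF refl]) (simp add: card_pair_reps)
  also have "\<dots> = (\<Sum>i<N. \<Sum>j<N. of_bool (i \<noteq> j))" by (rule sum_pairs_partner[symmetric])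
  also have "\<dots> = (\<Sum>i<N. real N - 1)"
  proof (rule sum.cong[OF refl])
    fix i assume "i \<in> {..<N}"
    have "(\<Sum>j<N. of_bool (i \<noteq> j) :: real) = (\<Sum>j<N. 1 - of_bool (i = j))" by (rule sum.cong) auto
    also have "\<dots> = real N - (\<Sum>j<N. of_bool (i = j))" by (simp add: sum_subtractf)
    also have "(\<Sum>j<N. of_bool (i = j) :: real) = 1" using \<open>i \<in> {..<N}\<close> by (simp add: of_bool_def)
    finally show "(\<Sum>j<N. of_bool (i \<noteq> j) :: real) = real N - 1" .
  qed
  finally show ?thesis by simp
qed

lemma (in prob_space) distr_pair_of_indep_vars:
  assumes ind: "indep_vars (\<lambda>_. \<mu>) X {..<N}" and d: "\<And>i. i < N \<Longrightarrow> distr M \<mu> (X i) = \<mu>"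
    and ij: "i < N" "j < N" "i \<noteq> j"
  shows "distr M (\<mu> \<Otimes>\<^sub>M \<mu>) (\<lambda>\<omega>. (X i \<omega>, X j \<omega>)) = \<mu> \<Otimes>\<^sub>M \<mu>"
proof -
  let ?k = "case_bool i j"
  have "indep_vars (\<lambda>b. Pi\<^sub>M {?k b} (\<lambda>_. \<mu>)) (\<lambda>b \<omega>. restrict (\<lambda>k. X k \<omega>) {?k b}) UNIV"
    by (rule indep_vars_restrict[OF ind]) (use ij in \<open>auto simp: disjoint_family_on_def split: bool.splits\<close>)
  then have "indep_vars (\<lambda>b. \<mu>) (\<lambda>b \<omega>. restrict (\<lambda>k. X k \<omega>) {?k b} (?k b)) UNIV"
    by (rule indep_vars_compose2) (rule measurable_component_singleton, simp)
  then have "indep_vars (\<lambda>b. \<mu>) (\<lambda>b \<omega>. X (?k b) \<omega>) UNIV" by simp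
  moreover have "(\<lambda>b. \<mu>) = case_bool \<mu> \<mu>" "(\<lambda>b \<omega>. X (?k b) \<omega>) = case_bool (X i) (X j)"
    by (auto simp: fun_eq_iff split: bool.splits)
  ultimately have "indep_var \<mu> (X i) \<mu> (X j)" unfolding indep_var_def by simp
  then show ?thesis using d[OF ij(1)] d[OF ij(2)] unfolding indep_var_distribution_eq by simp
qed

text \<open>Each residue class is a sum of at most \<open>N / 2\<close> independent terms, and the
  union bound over \<open>N\<close> classes costs one power of \<open>N\<close>. The condition on
  \<open>L\<close> is the range in which the variance governs Bernstein's inequality: it admits the
  parameter \<open>c\<close> that balances the deviation against the variance.\<close>

theorem (in prob_space) v_statistic_concentration:
  fixes v :: "'b \<Rightarrow> 'b \<Rightarrow> real"
  assumes ind: "indep_vars (\<lambda>_. \<mu>) X {..<N}" and d: "\<And>i. i < N \<Longrightarrow> distr M \<mu> (X i) = \<mu>"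
    and vm: "(\<lambda>z. v (fst z) (snd z)) \<in> borel_measurable (\<mu> \<Otimes>\<^sub>M \<mu>)"
    and v0: "\<And>x y. x \<in> space \<mu> \<Longrightarrow> y \<in> space \<mu> \<Longrightarrow> 0 \<le> v x y" 
    and vL: "\<And>x y. x \<in> space \<mu> \<Longrightarrow> y \<in> space \<mu> \<Longrightarrow> v x y \<le> L"
    and sym: "\<And>x y. x \<in> space \<mu> \<Longrightarrow> y \<in> space \<mu> \<Longrightarrow> v x y = v y x"
    and diag: "\<And>x. x \<in> space \<mu> \<Longrightarrow> v x x = 0"
    and nu: "(\<integral>z. (v (fst z) (snd z))\<^sup>2 \<partial>(\<mu> \<Otimes>\<^sub>M \<mu>)) \<le> \<nu>" "\<nu> > 0"
    and N: "N \<ge> 3" and L: "L\<^sup>2 * ln (real N) \<le> real N * \<nu>"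
  defines "m \<equiv> (\<integral>z. v (fst z) (snd z) \<partial>(\<mu> \<Otimes>\<^sub>M \<mu>))"
  shows "1 - 2 / real N ^ 11 \<le> prob {\<omega>\<in>space M. \<bar>(\<Sum>i<N. \<Sum>j<N. v (X i \<omega>) (X j \<omega>)) / (real N)\<^sup>2 - m\<bar> \<le> 27 * sqrt (\<nu> * ln (real N) / real N)}"
    and "(\<lambda>\<omega>. \<Sum>i<N. \<Sum>j<N. v (X i \<omega>) (X j \<omega>)) \<in> borel_measurable M"
proof -
  have Xm: "X i \<in> M \<rightarrow>\<^sub>M \<mu>" if "i < N" for i using ind that unfolding indep_vars_def2 by simp
  have XS: "X i \<omega> \<in> space \<mu>" if "i < N" "\<omega> \<in> space M" for i \<omega> using measurable_space[OF Xm[OF that(1)] that(2)] .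
  have vX: "(\<lambda>\<omega>. v (X i \<omega>) (X j \<omega>)) \<in> borel_measurable M" if "i < N" "j < N" for i j
    using measurable_compose[OF measurable_Pair[OF Xm[OF that(1)] Xm[OF that(2)]] vm] by simp
  show Vm: "(\<lambda>\<omega>. \<Sum>i<N. \<Sum>j<N. v (X i \<omega>) (X j \<omega>)) \<in> borel_measurable M"
    by (intro borel_measurable_sum vX) auto
  have E1: "expectation (\<lambda>\<omega>. v (X i \<omega>) (X j \<omega>)) = m" if "i < N" "j < N" "i \<noteq> j" for i j
  proof -
    have "m = (\<integral>z. v (fst z) (snd z) \<partial>distr M (\<mu> \<Otimes>\<^sub>M \<mu>) (\<lambda>\<omega>. (X i \<omega>, X j \<omega>)))"
      by (simp add: m_def distr_pair_of_indep_vars[OF ind d that])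
    also have "\<dots> = expectation (\<lambda>\<omega>. v (X i \<omega>) (X j \<omega>))"
      by (subst integral_distr[OF measurable_Pair[OF Xm[OF that(1)] Xm[OF that(2)]] vm]) simp
    finally show ?thesis by simp
  qed
  have E2: "expectation (\<lambda>\<omega>. (v (X i \<omega>) (X j \<omega>))\<^sup>2) \<le> \<nu>" if "i < N" "j < N" "i \<noteq> j" for i j
  proof -
    have "(\<integral>z. (v (fst z) (snd z))\<^sup>2 \<partial>(\<mu> \<Otimes>\<^sub>M \<mu>)) = (\<integral>z. (v (fst z) (snd z))\<^sup>2 \<partial>distr M (\<mu> \<Otimes>\<^sub>M \<mu>) (\<lambda>\<omega>. (X i \<omega>, X j \<omega>)))"
      by (simp add: distr_pair_of_indep_vars[OF ind d that])
    also have "\<dots> = expectation (\<lambda>\<omega>. (v (X i \<omega>) (X j \<omega>))\<^sup>2)"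
      by (subst integral_distr[OF measurable_Pair[OF Xm[OF that(1)] Xm[OF that(2)]]]) (use vm in simp_all)
    finally show ?thesis using nu(1) by simp
  qed
  obtain \<omega>0 where "\<omega>0 \<in> space M" using not_empty by blast
  then have "X 0 \<omega>0 \<in> space \<mu>" using XS N by simp
  then have L0: "L \<ge> 0" using v0[of "X 0 \<omega>0" "X 0 \<omega>0"] vL[of "X 0 \<omega>0" "X 0 \<omega>0"] by linarith
  define lN where "lN = ln (real N)"
  \<comment> \<open>\<open>N \<ge> 3\<close> enters through \<open>exp 1 \<le> 3\<close>.\<close>
  have lN: "lN \<ge> 1"
  proof -
    have "(3::real) \<le> real N" using N by simp
    then have "exp 1 \<le> real N" using exp_le by linarith
    then show ?thesis unfolding lN_def using N by (subst ln_ge_iff) auto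
  qed
  have Np: "real N > 0" using N by simp
  \<comment> \<open>Of the order that optimizes the exponent for deviations proportional to
    \<open>sqrt (lN * real N * \<nu>)\<close>; the condition on \<open>L\<close> turns into
    \<open>c * L \<le> 1\<close>.\<close>
  define c where "c = sqrt (lN / (real N * \<nu>))"
  have c: "c > 0" "c\<^sup>2 = lN / (real N * \<nu>)" using lN Np nu(2) by (auto simp: c_def)
  have cL: "c * L \<le> 1"
  proof -
    have "(c * L)\<^sup>2 = L\<^sup>2 * lN / (real N * \<nu>)" by (simp add: power_mult_distrib c(2))
    also have "\<dots> \<le> 1" using L Np nu(2) by (simp add: lN_def)
    finally have "(c * L)\<^sup>2 \<le> 1\<^sup>2" by simp
    then show ?thesis by (rule power2_le_imp_le) simp
  qed
  \<comment> \<open>With 13 the exponent is \<open>- 13 * lN\<close> plus a variance term of at most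
    \<open>lN / 2\<close>, hence at most \<open>- 12 * lN\<close>. Of the twelve powers of
    \<open>N\<close>, one pays for the union bound and one will make the final inequality
    strict.\<close>
  define t where "t = 13 * sqrt (lN * real N * \<nu>)"
  have ct: "c * t = 13 * lN"
  proof -
    have "c * sqrt (lN * real N * \<nu>) = sqrt (lN / (real N * \<nu>) * (lN * real N * \<nu>))" unfolding c_def by (rule real_sqrt_mult[symmetric])
    also have "lN / (real N * \<nu>) * (lN * real N * \<nu>) = lN\<^sup>2" using Np nu(2) by (simp add: power2_eq_square)
    finally show ?thesis using lN by (simp add: t_def)
  qed
  let ?p = "partner N"
  let ?S = "\<lambda>s \<omega>. \<Sum>i\<in>pair_reps N s. v (X i \<omega>) (X (?p s i) \<omega>)"
  define bad where "bad s = {\<omega>\<in>space M. \<bar>?S s \<omega> - real (card (pair_reps N s)) * m\<bar> \<ge> t}" for s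
  have tail: "prob (bad s) \<le> 2 / real N ^ 12" if s: "s < N" for s
  proof -
    let ?I = "pair_reps N s"
    have I: "i < N" "?p s i < N" "i \<noteq> ?p s i" if "i \<in> ?I" for i
      using that s partner_less by (auto simp: pair_reps_def)
    let ?K = "\<lambda>i. {i, ?p s i}"
    have dj: "disjoint_family_on ?K ?I"
      unfolding disjoint_family_on_def
    proof (intro ballI impI)
      fix i j assume ij: "i \<in> ?I" "j \<in> ?I" "i \<noteq> j"
      have "?p s i \<noteq> ?p s j" using partner_partner[OF s I(1)[OF ij(1)]] partner_partner[OF s I(1)[OF ij(2)]] ij(3) by metis
      moreover have "i \<noteq> ?p s j" "?p s i \<noteq> j"
        using ij partner_partner[OF s I(1)[OF ij(1)]] partner_partner[OF s I(1)[OF ij(2)]] by (auto simp: pair_reps_def)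
      ultimately show "?K i \<inter> ?K j = {}" using ij(3) by auto
    qed
    have r: "indep_vars (\<lambda>i. Pi\<^sub>M (?K i) (\<lambda>_. \<mu>)) (\<lambda>i \<omega>. restrict (\<lambda>k. X k \<omega>) (?K i)) ?I"
      by (rule indep_vars_restrict[OF ind _ dj]) (use I in auto)
    have "indep_vars (\<lambda>_. borel) (\<lambda>i \<omega>. v (restrict (\<lambda>k. X k \<omega>) (?K i) i) (restrict (\<lambda>k. X k \<omega>) (?K i) (?p s i))) ?I"
    proof (rule indep_vars_compose2[OF r])
      fix i
      have "(\<lambda>x. (x i, x (?p s i))) \<in> Pi\<^sub>M (?K i) (\<lambda>_. \<mu>) \<rightarrow>\<^sub>M \<mu> \<Otimes>\<^sub>M \<mu>"
        by (intro measurable_Pair measurable_component_singleton) auto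
      from measurable_compose[OF this vm] show "(\<lambda>x. v (x i) (x (?p s i))) \<in> borel_measurable (Pi\<^sub>M (?K i) (\<lambda>_. \<mu>))" by simp
    qed
    then have ind': "indep_vars (\<lambda>_. borel) (\<lambda>i \<omega>. v (X i \<omega>) (X (?p s i) \<omega>)) ?I" by simp
    have "prob (bad s) \<le> 2 * exp (- (c * t) + real (card ?I) * c\<^sup>2 * \<nu>)"
      unfolding bad_def
      by (rule two_sided_tail[OF finite_pair_reps ind' _ _ _ _ c(1) cL]) (use I XS v0 vL E1 E2 in auto)
    also have "\<dots> \<le> 2 * exp (- 12 * lN)"
    proof -
      have "real (card ?I) * c\<^sup>2 * \<nu> \<le> (real N / 2) * c\<^sup>2 * \<nu>"
        using card_pair_reps_le[OF s] nu(2) by (intro mult_right_mono) auto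
      also have "\<dots> = lN / 2" using Np nu(2) by (simp add: c(2))
      finally show ?thesis using ct lN by simp
    qed
    also have "exp (- 12 * lN) = 1 / real N ^ 12"
    proof -
      have "exp (12 * lN) = exp lN ^ 12" using exp_of_nat_mult[of 12 lN] by simp
      also have "\<dots> = real N ^ 12" using Np by (simp add: lN_def)
      finally show ?thesis by (simp add: exp_minus field_simps)
    qed
    finally show ?thesis by simp
  qed
  have badm: "bad s \<in> events" if s: "s < N" for s
  proof -
    have "?S s \<in> borel_measurable M"
      by (rule borel_measurable_sum, rule vX) (use s partner_less in \<open>auto simp: pair_reps_def\<close>)
    then show ?thesis unfolding bad_def by measurable
  qed
  have "prob (\<Union>s<N. bad s) \<le> (\<Sum>s<N. prob (bad s))"
    using badm by (intro measure_UNION_le) auto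
  also have "\<dots> \<le> (\<Sum>s<N. 2 / real N ^ 12)" by (intro sum_mono tail) simp
  also have "\<dots> = 2 / real N ^ 11" using Np by (simp add: field_simps eval_nat_numeral)
  finally have pb: "prob (\<Union>s<N. bad s) \<le> 2 / real N ^ 11" .
  have BM: "(\<Union>s<N. bad s) \<in> events" using badm by auto
  define good where "good = {\<omega>\<in>space M. \<bar>(\<Sum>i<N. \<Sum>j<N. v (X i \<omega>) (X j \<omega>)) / (real N)\<^sup>2 - m\<bar> \<le> 27 * sqrt (\<nu> * ln (real N) / real N)}"
  have goodm: "good \<in> events" unfolding good_def using Vm by measurable
  \<comment> \<open>The classes miss the diagonal, so the V-statistic has mean
    \<open>(1 - 1 / N) * m\<close>. To absorb the correction \<open>m / N\<close>, \<open>m\<close>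
    is compared with the square root of \<nu>.\<close>
  have m2: "m\<^sup>2 \<le> \<nu>" "0 \<le> m"
  proof -
    have i: "0 < N" "1 < N" "(0::nat) \<noteq> 1" using N by auto
    have b: "AE \<omega> in M. norm (v (X 0 \<omega>) (X 1 \<omega>)) \<le> L" using v0 vL XS[OF i(1)] XS[OF i(2)] by (intro AE_I2) simp
    have vi: "integrable M (\<lambda>\<omega>. v (X 0 \<omega>) (X 1 \<omega>))" by (rule integrable_const_bound[OF b vX[OF i(1,2)]])
    have b2: "AE \<omega> in M. norm ((v (X 0 \<omega>) (X 1 \<omega>))\<^sup>2) \<le> L\<^sup>2" 
      using v0 vL XS[OF i(1)] XS[OF i(2)] by (intro AE_I2) (simp add: power_mono)
    have vi2: "integrable M (\<lambda>\<omega>. (v (X 0 \<omega>) (X 1 \<omega>))\<^sup>2)"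
      by (rule integrable_const_bound[OF b2]) (use vX[OF i(1,2)] in measurable)
    have "0 \<le> variance (\<lambda>\<omega>. v (X 0 \<omega>) (X 1 \<omega>))" by (rule variance_positive)
    also have "\<dots> = expectation (\<lambda>\<omega>. (v (X 0 \<omega>) (X 1 \<omega>))\<^sup>2) - m\<^sup>2"
      using variance_eq[OF vi vi2] E1[OF i] by simp
    finally show "m\<^sup>2 \<le> \<nu>" using E2[OF i] by simp
    have "0 \<le> expectation (\<lambda>\<omega>. v (X 0 \<omega>) (X 1 \<omega>))"
      by (rule integral_nonneg_AE, rule AE_I2) (use v0 XS[OF i(1)] XS[OF i(2)] in auto)
    then show "0 \<le> m" using E1[OF i] by simp
  qed
  have "space M - (\<Union>s<N. bad s) \<subseteq> good"
  proof
    fix \<omega> assume w: "\<omega> \<in> space M - (\<Union>s<N. bad s)"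
    then have wS: "\<omega> \<in> space M" by simp
    let ?V = "\<Sum>i<N. \<Sum>j<N. v (X i \<omega>) (X j \<omega>)"
    have st: "\<bar>?S s \<omega> - real (card (pair_reps N s)) * m\<bar> \<le> t" if "s < N" for s
      using w that by (force simp: bad_def)
    have "?V = (\<Sum>s<N. \<Sum>i<N. v (X i \<omega>) (X (?p s i) \<omega>))"
      by (rule sum_pairs_partner[of "\<lambda>i j. v (X i \<omega>) (X j \<omega>)"])
    also have "\<dots> = (\<Sum>s<N. 2 * ?S s \<omega>)"
      by (rule sum.cong[OF refl], rule sum_partner) (use sym diag XS wS in auto)
    finally have "?V - real N * (real N - 1) * m = (\<Sum>s<N. 2 * (?S s \<omega> - real (card (pair_reps N s)) * m))"
      unfolding sum_card_pair_reps[symmetric] by (simp add: sum_subtractf sum_distrib_right algebra_simps) (simp add: sum_distrib_left)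
    also have "\<bar>\<dots>\<bar> \<le> (\<Sum>s<N. \<bar>2 * (?S s \<omega> - real (card (pair_reps N s)) * m)\<bar>)" by (rule sum_abs)
    also have "\<dots> \<le> (\<Sum>s<N. 2 * t)" 
    proof (rule sum_mono)
      fix s assume "s \<in> {..<N}"
      then have "2 * \<bar>?S s \<omega> - real (card (pair_reps N s)) * m\<bar> \<le> 2 * t" using st[of s] by simp
      then show "\<bar>2 * (?S s \<omega> - real (card (pair_reps N s)) * m)\<bar> \<le> 2 * t"
        unfolding abs_mult abs_numeral .
    qed
    also have "\<dots> = real N * (2 * t)" by simp
    finally have V: "\<bar>?V - real N * (real N - 1) * m\<bar> \<le> real N * (2 * t)" .
    define r where "r = sqrt (\<nu> * lN / real N)"
    have tr: "t = 13 * real N * r"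
    proof -
      have "real N * r = sqrt ((real N)\<^sup>2) * sqrt (\<nu> * lN / real N)" by (simp add: r_def)
      also have "\<dots> = sqrt ((real N)\<^sup>2 * (\<nu> * lN / real N))" by (rule real_sqrt_mult[symmetric])
      also have "(real N)\<^sup>2 * (\<nu> * lN / real N) = lN * real N * \<nu>" using Np by (simp add: power2_eq_square)
      finally show ?thesis by (simp add: t_def)
    qed
    have mr: "m / real N \<le> r"
    proof -
      have "(m / real N)\<^sup>2 \<le> \<nu> / (real N)\<^sup>2" using m2(1) by (simp add: power_divide divide_right_mono)
      also have "\<dots> \<le> \<nu> * lN / real N"
      proof -
        have "\<nu> * 1 \<le> \<nu> * lN" using lN nu(2) by (intro mult_left_mono) auto
        moreover have "real N \<le> (real N)\<^sup>2" using N by (simp add: power2_eq_square)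
        ultimately show ?thesis using Np nu(2) by (intro frac_le) auto
      qed
      finally show ?thesis unfolding r_def by (rule real_le_rsqrt)
    qed
    have "?V / (real N)\<^sup>2 - m = (?V - real N * (real N - 1) * m) / (real N)\<^sup>2 - m / real N"
      using Np by (simp add: field_simps power2_eq_square)
    then have "\<bar>?V / (real N)\<^sup>2 - m\<bar> \<le> \<bar>(?V - real N * (real N - 1) * m) / (real N)\<^sup>2\<bar> + \<bar>m / real N\<bar>" by (simp only: abs_triangle_ineq4)
    also have "\<dots> \<le> real N * (2 * t) / (real N)\<^sup>2 + r"
      using V mr m2(2) Np by (intro add_mono) (auto simp: abs_divide divide_right_mono)
    \<comment> \<open>\<open>2 * 13\<close> from the classes and 1 from the diagonal
      correction.\<close>
    also have "\<dots> = 27 * r" using Np by (simp add: tr power2_eq_square)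
    finally show "\<omega> \<in> good" using wS by (simp add: good_def r_def lN_def)
  qed
  then have "prob (space M - (\<Union>s<N. bad s)) \<le> prob good" by (rule finite_measure_mono[OF _ goodm])
  moreover have "prob (space M - (\<Union>s<N. bad s)) = 1 - prob (\<Union>s<N. bad s)" by (rule prob_compl[OF BM])
  ultimately show "1 - 2 / real N ^ 11 \<le> prob {\<omega>\<in>space M. \<bar>(\<Sum>i<N. \<Sum>j<N. v (X i \<omega>) (X j \<omega>)) / (real N)\<^sup>2 - m\<bar> \<le> 27 * sqrt (\<nu> * ln (real N) / real N)}"
    using pb by (simp add: good_def)
qed

section \<open>Replacing the estimated bandwidth\<close>

text \<open>One summand of the graph form with its normalization by \<epsilon> and \<open>m2\<close>
  included; the factors \<open>1 / \<epsilon>\<close> and \<open>\<epsilon> powr (- d / 2)\<close>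
  are merged into an integer power of \<open>sqrt \<epsilon>\<close>, which suits the scaling
  arguments.\<close>

definition graph_kernel ::
  "nat \<Rightarrow> (real \<Rightarrow> real) \<Rightarrow> real \<Rightarrow> real \<Rightarrow> real \<Rightarrow> ('a::real_normed_vector \<Rightarrow> real) \<Rightarrow> ('a \<Rightarrow> real) \<Rightarrow> 'a \<Rightarrow> 'a \<Rightarrow> real" where
  "graph_kernel d k m2 \<alpha> \<epsilon> \<rho> f x y = 1 / (sqrt \<epsilon> ^ (d + 2) * m2) *
     (k ((norm (x - y))\<^sup>2 / (\<epsilon> * \<rho> x * \<rho> y)) * (1 / (\<rho> x powr \<alpha> * \<rho> y powr \<alpha>))) * (f x - f y)\<^sup>2"

lemma powr_half_card: "\<epsilon> > 0 \<Longrightarrow> \<epsilon> powr (real d / 2) = sqrt \<epsilon> ^ d"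
  by (simp add: powr_half_sqrt[symmetric] powr_realpow[symmetric] powr_powr)

text \<open>Nonnegative bandwidths give nonnegative arguments, at which the extension of the kernel
  by \<open>max 0\<close> changes nothing.\<close>

lemma graph_dirichlet_form_eq:
  assumes e: "\<epsilon> > 0" and \<rho>: "\<And>i. i < N \<Longrightarrow> 0 \<le> \<rho> (x i)"
  shows "graph_dirichlet_form TYPE('d::finite) k0 \<alpha> \<epsilon> \<rho> N x f =
    (\<Sum>i<N. \<Sum>j<N. graph_kernel CARD('d) (\<lambda>s. k0 (max 0 s)) (kernel_m2 TYPE('d) k0) \<alpha> \<epsilon> \<rho> f (x i) (x j)) / (real N)\<^sup>2"
proof -
  have c: "1 / (\<epsilon> * m) * r * (\<epsilon> powr (- real CARD('d) / 2) * w * g) = 1 / (sqrt \<epsilon> ^ (CARD('d) + 2) * m) * w * g * r" for m r w g :: real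
  proof -
    have f1: "\<epsilon> powr (- real CARD('d) / 2) = 1 / sqrt \<epsilon> ^ CARD('d)"
      using powr_half_card[OF e, of "CARD('d)"] by (simp add: powr_minus_divide)
    have f2: "sqrt \<epsilon> ^ (CARD('d) + 2) = sqrt \<epsilon> ^ CARD('d) * \<epsilon>" using e by (simp add: power_add)
    show ?thesis unfolding f1 f2 by (simp add: mult_ac)
  qed
  have "max 0 ((norm (x i - x j))\<^sup>2 / (\<epsilon> * \<rho> (x i) * \<rho> (x j))) = (norm (x i - x j))\<^sup>2 / (\<epsilon> * \<rho> (x i) * \<rho> (x j))" if "i < N" "j < N" for i j
    using \<rho>[OF that(1)] \<rho>[OF that(2)] e by (simp add: max_def)
  then have "1 / (\<epsilon> * kernel_m2 TYPE('d) k0) * (1 / (real N)\<^sup>2) * (\<epsilon> powr (- real CARD('d) / 2) * graph_weight k0 \<alpha> \<epsilon> \<rho> (x i) (x j) * (f (x i) - f (x j))\<^sup>2)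
    = graph_kernel CARD('d) (\<lambda>s. k0 (max 0 s)) (kernel_m2 TYPE('d) k0) \<alpha> \<epsilon> \<rho> f (x i) (x j) * (1 / (real N)\<^sup>2)" if "i < N" "j < N" for i j
    unfolding c graph_kernel_def graph_weight_def using that by simp
  then show ?thesis
    unfolding graph_dirichlet_form_def sum_distrib_left sum_divide_distrib by (intro sum.cong refl) simp
qed

text \<open>With \<open>t\<close> the ratio of the bandwidth products, \<open>s = s' / t\<close> is
  at least \<open>(8/10) * s'\<close>, so a good part of the decay is retained in terms of
  \<open>s'\<close>. The error is thereby \<eta> times a kernel in the exact bandwidths, and can
  again be measured by an energy.\<close>

lemma weight_comparison:
  fixes A a b1 b2 r1 r2 \<eta> \<alpha> w :: real
  assumes k: "\<And>s. s \<ge> 0 \<Longrightarrow> 0 \<le> k s" "\<And>s. s \<ge> 0 \<Longrightarrow> k s \<le> A * exp (- a * s)"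
      "\<And>s t. s \<ge> 0 \<Longrightarrow> t \<ge> 0 \<Longrightarrow> \<bar>k s - k t\<bar> \<le> A * exp (- a * min s t) * \<bar>s - t\<bar>"
    and Aa: "A > 0" "a > 0" and b: "b1 > 0" "b2 > 0" and \<eta>: "0 \<le> \<eta>" "\<eta> \<le> 1/10"
    and r: "\<bar>r1 - b1\<bar> \<le> \<eta> * b1" "\<bar>r2 - b2\<bar> \<le> \<eta> * b2" and w: "w \<ge> 0"
  defines "s \<equiv> w / (r1 * r2)" and "s' \<equiv> w / (b1 * b2)" and "Ca \<equiv> 3 * \<bar>\<alpha>\<bar> * exp \<bar>\<alpha>\<bar>"
  shows "\<bar>k s * (1 / (r1 powr \<alpha> * r2 powr \<alpha>)) - k s' * (1 / (b1 powr \<alpha> * b2 powr \<alpha>))\<bar>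
      \<le> A * (Ca + 10 / a) * \<eta> * (exp (- (a / 2) * s') * (1 / (b1 powr \<alpha> * b2 powr \<alpha>)))"
    and "0 \<le> k s * (1 / (r1 powr \<alpha> * r2 powr \<alpha>))"
    and "k s * (1 / (r1 powr \<alpha> * r2 powr \<alpha>)) \<le> A * (1 + Ca * \<eta>) * (exp (- (a / 2) * s') * (1 / (b1 powr \<alpha> * b2 powr \<alpha>)))"
proof -
  define t where "t = (r1 * r2) / (b1 * b2)"
  define u1 u2 where "u1 = r1 / b1 - 1" and "u2 = r2 / b2 - 1"
  have u: "\<bar>u1\<bar> \<le> \<eta>" "\<bar>u2\<bar> \<le> \<eta>"
  proof -
    have "u1 = (r1 - b1) / b1" "u2 = (r2 - b2) / b2" using b by (auto simp: u1_def u2_def field_simps)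
    then show "\<bar>u1\<bar> \<le> \<eta>" "\<bar>u2\<bar> \<le> \<eta>" using r b by (auto simp: abs_divide divide_le_eq)
  qed
  have uu: "\<bar>u1 * u2\<bar> \<le> (1/10) * \<eta>"
    unfolding abs_mult using mult_mono[OF order_trans[OF u(1) \<eta>(2)] u(2)] by simp
  have t1: "t - 1 = u1 + u2 + u1 * u2"
    using b by (simp add: t_def u1_def u2_def field_simps)
  then have tb: "\<bar>t - 1\<bar> \<le> (21/10) * \<eta>" using u uu by linarith
  then have t8: "t \<ge> 79/100" "t \<le> 121/100" using \<eta> by linarith+
  have t81: "t \<ge> 8/10"
  proof -
    have "(9/10) * (9/10) \<le> (1 + u1) * (1 + u2)" using u \<eta> by (intro mult_mono) linarith+
    moreover have "(1 + u1) * (1 + u2) = t" using t1 by (simp add: algebra_simps)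
    ultimately show ?thesis by simp
  qed
  have tpos: "t > 0" using t81 by linarith
  have rp: "r1 > 0" "r2 > 0"
  proof -
    have "\<eta> * b1 \<le> (1/10) * b1" "\<eta> * b2 \<le> (1/10) * b2" using \<eta> b by (auto intro!: mult_right_mono)
    then show "r1 > 0" "r2 > 0" using r b by linarith+
  qed
  have s't: "s = s' / t" using b rp by (simp add: s_def s'_def t_def)
  have s'0: "s' \<ge> 0" using w b by (simp add: s'_def)
  have s0: "s \<ge> 0" using s't s'0 tpos by simp
  have ge: "s \<ge> (8/10) * s'"
  proof -
    have "(8/10) * s' * t \<le> (8/10) * s' * (125/100)" using t8(2) s'0 by (intro mult_left_mono) auto
    then have "(8/10) * s' * t \<le> s'" by simp
    then show ?thesis unfolding s't using tpos by (simp add: pos_le_divide_eq)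
  qed
  define B where "B = 1 / (b1 powr \<alpha> * b2 powr \<alpha>)"
  have B: "B > 0" using b by (simp add: B_def)
  have rB: "1 / (r1 powr \<alpha> * r2 powr \<alpha>) = t powr (- \<alpha>) * B"
  proof -
    have "t powr \<alpha> = (r1 powr \<alpha> * r2 powr \<alpha>) / (b1 powr \<alpha> * b2 powr \<alpha>)"
      unfolding t_def using b rp by (simp add: powr_divide powr_mult)
    then show ?thesis unfolding B_def powr_minus using b rp by simp
  qed
  define e where "e = exp (- (a / 2) * s')"
  have e0: "e > 0" by (simp add: e_def)
  have Ca0: "Ca \<ge> 0" by (simp add: Ca_def)
  have t\<alpha>: "\<bar>t powr (- \<alpha>) - 1\<bar> \<le> Ca * \<eta>"
    using abs_powr_minus_one_le[OF tpos tb \<eta> t81, of "- \<alpha>"] by (simp add: Ca_def)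
  have ks: "k s \<le> A * e"
  proof -
    have "(a / 2) * s' \<le> a * s"
    proof -
      have "(a / 2) * s' \<le> a * ((8/10) * s')" using Aa s'0 by simp
      also have "\<dots> \<le> a * s" using ge Aa by (intro mult_left_mono) auto
      finally show ?thesis .
    qed
    then have "A * exp (- a * s) \<le> A * e" using Aa by (simp add: e_def)
    then show ?thesis using k(2)[OF s0] by linarith
  qed
  have kd: "\<bar>k s - k s'\<bar> \<le> A * e * ((10 / a) * \<eta>)"
  proof -
    have d: "\<bar>s - s'\<bar> \<le> 3 * \<eta> * s'"
    proof -
      have "s - s' = s' * ((1 - t) / t)" using tpos by (simp add: s't field_simps)
      then have "\<bar>s - s'\<bar> = s' * (\<bar>t - 1\<bar> / t)" using s'0 tpos by (simp add: abs_mult abs_divide abs_minus_commute)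
      also have "\<dots> \<le> s' * (((21/10) * \<eta>) / (8/10))" using s'0 tb t81 \<eta> by (intro mult_left_mono frac_le) auto
      also have "\<dots> \<le> 3 * \<eta> * s'" using s'0 \<eta> by (simp add: mult_right_mono)
      finally show ?thesis .
    qed
    have m: "(8/10) * s' \<le> min s s'" using ge s'0 by simp
    \<comment> \<open>\<open>8/10 = 3/10 + 1/2\<close>: the second part is the comparison kernel,
      the first is spent on the factor \<open>s'\<close> in
      \<open>\<bar>s - s'\<bar> \<le> 3 * \<eta> * s'\<close>.\<close>
    have "exp (- a * min s s') \<le> exp (- (3/10 * a) * s') * e"
    proof -
      have "a * ((8/10) * s') \<le> a * min s s'" using m Aa by (intro mult_left_mono) auto
      then have "- a * min s s' \<le> - (3/10 * a) * s' + - (a / 2) * s'" by (simp add: algebra_simps)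
      then show ?thesis unfolding e_def exp_add[symmetric] by simp
    qed
    then have "A * exp (- a * min s s') * \<bar>s - s'\<bar> \<le> A * (exp (- (3/10 * a) * s') * e) * (3 * \<eta> * s')"
      using d Aa e0 by (intro mult_mono) auto
    also have "\<dots> = A * e * (3 * \<eta>) * (s' ^ 1 * exp (- (3/10 * a) * s'))" by simp
    \<comment> \<open>Dividing 3 by \<open>3/10 * a\<close> is the origin of the constant
      \<open>10 / a\<close>.\<close>
    also have "\<dots> \<le> A * e * (3 * \<eta>) * (fact 1 / (3/10 * a) ^ 1)"
      using Aa e0 \<eta> s'0 by (intro mult_left_mono power_times_exp_le) auto
    also have "\<dots> = A * e * ((10 / a) * \<eta>)" using Aa by simp
    finally show ?thesis using k(3)[OF s0 s'0] by linarith
  qed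
  have Ae\<eta>: "0 \<le> A * e" using Aa e0 by simp
  have "k s * t powr (- \<alpha>) - k s' = k s * (t powr (- \<alpha>) - 1) + (k s - k s')" by (simp add: algebra_simps)
  then have "\<bar>k s * t powr (- \<alpha>) - k s'\<bar> \<le> \<bar>k s\<bar> * \<bar>t powr (- \<alpha>) - 1\<bar> + \<bar>k s - k s'\<bar>"
    by (metis abs_mult abs_triangle_ineq)
  also have "\<dots> \<le> (A * e) * (Ca * \<eta>) + A * e * ((10 / a) * \<eta>)"
    using ks k(1)[OF s0] t\<alpha> kd Ae\<eta> by (intro add_mono mult_mono) auto
  also have "\<dots> = A * (Ca + 10 / a) * \<eta> * e" by (simp add: algebra_simps)
  finally have m1: "\<bar>k s * t powr (- \<alpha>) - k s'\<bar> \<le> A * (Ca + 10 / a) * \<eta> * e" .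
  have "\<bar>k s * (t powr (- \<alpha>) * B) - k s' * B\<bar> = \<bar>k s * t powr (- \<alpha>) - k s'\<bar> * B"
    using B by (simp add: abs_mult flip: mult.assoc left_diff_distrib)
  also have "\<dots> \<le> (A * (Ca + 10 / a) * \<eta> * e) * B" using m1 B by (intro mult_right_mono) auto
  finally show "\<bar>k s * (1 / (r1 powr \<alpha> * r2 powr \<alpha>)) - k s' * (1 / (b1 powr \<alpha> * b2 powr \<alpha>))\<bar>
      \<le> A * (Ca + 10 / a) * \<eta> * (exp (- (a / 2) * s') * (1 / (b1 powr \<alpha> * b2 powr \<alpha>)))"
    unfolding rB B_def[symmetric] e_def by (simp only: mult.assoc)
  show "0 \<le> k s * (1 / (r1 powr \<alpha> * r2 powr \<alpha>))" using k(1)[OF s0] by simp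
  have "k s * (t powr (- \<alpha>) * B) \<le> (A * e) * ((1 + Ca * \<eta>) * B)"
    using ks t\<alpha> B Ae\<eta> k(1)[OF s0] by (intro mult_mono) auto
  then show "k s * (1 / (r1 powr \<alpha> * r2 powr \<alpha>)) \<le> A * (1 + Ca * \<eta>) * (exp (- (a / 2) * s') * (1 / (b1 powr \<alpha> * b2 powr \<alpha>)))"
    unfolding rB B_def[symmetric] e_def by (simp only: mult_ac)
qed

text \<open>All that the estimates know of the bandwidth: continuity and relative error. Constants
  obtained under this predicate are uniform over all datasets.\<close>

definition bandwidth_approx :: "'a::topological_space set \<Rightarrow> ('a \<Rightarrow> real) \<Rightarrow> real \<Rightarrow> real \<Rightarrow> ('a \<Rightarrow> real) \<Rightarrow> bool" where
  "bandwidth_approx M b \<epsilon> \<eta> \<rho> \<longleftrightarrow> 0 < \<epsilon> \<and> \<epsilon> \<le> 1 \<and> 0 \<le> \<eta> \<and> \<eta> \<le> 1/10 \<and> continuous_on M \<rho> \<and> (\<forall>x\<in>M. \<bar>\<rho> x - b x\<bar> \<le> \<eta> * b x)"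

lemma bandwidth_approxD:
  assumes "bandwidth_approx M b \<epsilon> \<eta> \<rho>"
  shows "0 < \<epsilon>" "\<epsilon> \<le> 1" "0 \<le> \<eta>" "\<eta> \<le> 1/10" "continuous_on M \<rho>" "\<And>x. x \<in> M \<Longrightarrow> \<bar>\<rho> x - b x\<bar> \<le> \<eta> * b x"
  using assms by (auto simp: bandwidth_approx_def)

text \<open>Replaces the existence of remainders, an event whose measurability is not evident, by
  one inequality. For the converse a deviation is distributed over the remainders in proportion to
  their bounds.\<close>

lemma error_split:
  fixes x E R1 R2 R3 :: real
  assumes "E \<ge> 0" "R1 \<ge> 0" "R2 \<ge> 0" "R3 \<ge> 0"
  shows "(\<exists>r1 r2 r3. \<bar>r1\<bar> \<le> R1 \<and> \<bar>r2\<bar> \<le> R2 \<and> \<bar>r3\<bar> \<le> R3 \<and> x = E * (1 + r1) + r2 + r3) \<longleftrightarrow> \<bar>x - E\<bar> \<le> R1 * E + R2 + R3"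
proof
  assume "\<exists>r1 r2 r3. \<bar>r1\<bar> \<le> R1 \<and> \<bar>r2\<bar> \<le> R2 \<and> \<bar>r3\<bar> \<le> R3 \<and> x = E * (1 + r1) + r2 + r3"
  then obtain r1 r2 r3 where r: "\<bar>r1\<bar> \<le> R1" "\<bar>r2\<bar> \<le> R2" "\<bar>r3\<bar> \<le> R3" "x = E * (1 + r1) + r2 + r3" by blast
  have "\<bar>r1 * E\<bar> \<le> R1 * E" using r(1) assms by (simp add: abs_mult mult_right_mono)
  moreover have "x - E = r1 * E + r2 + r3" using r(4) by (simp add: algebra_simps)
  ultimately show "\<bar>x - E\<bar> \<le> R1 * E + R2 + R3" using r(2,3) by linarith
next
  assume le: "\<bar>x - E\<bar> \<le> R1 * E + R2 + R3"
  define T where "T = R1 * E + R2 + R3"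
  \<comment> \<open>If \<open>T = 0\<close>, division by zero gives \<open>t = 0\<close>, which is
    then the right proportion.\<close>
  define t where "t = (x - E) / T"
  have T0: "T \<ge> 0" using assms by (simp add: T_def)
  have t: "\<bar>t\<bar> \<le> 1" using le T0 by (cases "T = 0") (auto simp: t_def abs_divide T_def[symmetric])
  have tT: "x - E = t * T" using le T0 by (cases "T = 0") (auto simp: t_def T_def[symmetric])
  have "\<bar>t * R\<bar> \<le> R" if "R \<ge> 0" for R using that t by (simp add: abs_mult mult_left_le_one_le)
  moreover have "x = E * (1 + t * R1) + t * R2 + t * R3" using tT by (simp add: T_def algebra_simps)
  ultimately show "\<exists>r1 r2 r3. \<bar>r1\<bar> \<le> R1 \<and> \<bar>r2\<bar> \<le> R2 \<and> \<bar>r3\<bar> \<le> R3 \<and> x = E * (1 + r1) + r2 + r3"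
    using assms by blast
qed

text \<open>Here \<open>S\<close> is a power of \<open>sqrt \<epsilon>\<close>, \<open>J\<close> the
  Dirichlet form, \<open>I1\<close> and \<open>I2\<close> the energies of \<open>k0\<close> and of
  the comparison kernel, \<open>M1\<close> the moment of the latter. Replacing \<open>I2\<close> by
  its limit makes the bandwidth error proportional to \<open>J\<close>;
  \<open>\<eta> \<le> 1\<close> sends the rest to the \<epsilon> term.\<close>

lemma bias_bound:
  fixes S m :: real
  assumes S: "S > 0" and m: "m > 0" and c: "c \<ge> 0" and \<eta>: "0 \<le> \<eta>" "\<eta> \<le> 1" and e: "\<epsilon> > 0" and C2: "C2 \<ge> 0"
    and h: "\<bar>X - 1 / (S * m) * I1\<bar> \<le> c * \<eta> * (1 / (S * m)) * I2" "\<bar>I1 - S * m * J\<bar> \<le> C1 * (S * \<epsilon>)"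
      "\<bar>I2 - S * M1 * J\<bar> \<le> C2 * (S * \<epsilon>)"
  shows "\<bar>X - J\<bar> \<le> c * M1 / m * \<eta> * J + (C1 + c * C2) / m * \<epsilon>"
proof -
  have "\<bar>1 / (S * m) * I1 - J\<bar> = \<bar>I1 - S * m * J\<bar> / (S * m)"
  proof -
    have "1 / (S * m) * I1 - J = (I1 - S * m * J) / (S * m)" using S m by (simp add: field_simps)
    then show ?thesis using S m by (simp add: abs_divide abs_mult)
  qed
  also have "\<dots> \<le> C1 * (S * \<epsilon>) / (S * m)" using h(2) S m by (intro divide_right_mono) auto
  also have "\<dots> = C1 / m * \<epsilon>" using S m by simp
  finally have 1: "\<bar>1 / (S * m) * I1 - J\<bar> \<le> C1 / m * \<epsilon>" .
  have "I2 \<le> S * M1 * J + C2 * (S * \<epsilon>)" using h(3) unfolding abs_le_iff by argo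
  then have "c * \<eta> * (1 / (S * m)) * I2 \<le> c * \<eta> * (1 / (S * m)) * (S * M1 * J + C2 * (S * \<epsilon>))"
    using c \<eta> S m by (intro mult_left_mono) auto
  also have "\<dots> = c * M1 / m * \<eta> * J + \<eta> * (c * C2 / m * \<epsilon>)" using S m by (simp add: field_simps)
  also have "\<eta> * (c * C2 / m * \<epsilon>) \<le> 1 * (c * C2 / m * \<epsilon>)" using \<eta> c C2 m e by (intro mult_right_mono) auto
  finally have 2: "c * \<eta> * (1 / (S * m)) * I2 \<le> c * M1 / m * \<eta> * J + c * C2 / m * \<epsilon>" by simp
  have 3: "(C1 + c * C2) / m * \<epsilon> = C1 / m * \<epsilon> + c * C2 / m * \<epsilon>" by (simp add: field_simps add_divide_distrib)
  show ?thesis using h(1) 1 2 3 unfolding abs_le_iff by argo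
qed

section \<open>Mean, second moment and size of the graph kernel\<close>

context
  fixes M :: "'a::euclidean_space set" and dV :: "'a measure" and k0 :: "real \<Rightarrow> real" and A a pmin pmax :: real
    and p f :: "'a \<Rightarrow> real"
  assumes M: "compact M" "smooth_submanifold TYPE('d::finite) M"
    and vol: "riemannian_volume TYPE('d) M dV"
    and adm: "admissible_kernel k0"
    and Aa: "A > 0" "a > 0" and kb: "\<And>s. s \<ge> 0 \<Longrightarrow> 0 \<le> k0 s" "\<And>s. s \<ge> 0 \<Longrightarrow> k0 s \<le> A * exp (- a * s)"
      "\<And>s t. s \<ge> 0 \<Longrightarrow> t \<ge> 0 \<Longrightarrow> \<bar>k0 s - k0 t\<bar> \<le> A * exp (- a * min s t) * \<bar>s - t\<bar>"
    and p: "smooth_fun TYPE('d) M p" "0 < pmin" "\<And>x. x \<in> M \<Longrightarrow> pmin \<le> p x" "\<And>x. x \<in> M \<Longrightarrow> p x \<le> pmax"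
    and p1: "(\<integral>x. p x \<partial>dV) = 1"
    and f: "smooth_fun TYPE('d) M f"
begin

lemma density_pos: "x \<in> M \<Longrightarrow> 0 < p x" using p(2,3) by fastforce

lemma density_measurable: "p \<in> borel_measurable dV"
  by (rule borel_measurable_volume_continuous_on[OF vol smooth_fun_continuous_on[OF M(2) p(1)]])

text \<open>The integral of \<open>p\<close> is 1 rather than the default 0 of a non-integrable
  function, so \<open>p\<close> is integrable; the lower bound \<open>pmin\<close> transfers this to
  constants.\<close>

lemma finite_volume: "finite_measure dV"
proof (rule finite_measureI)
  have "integrable dV p" using p1 not_integrable_integral_eq[of dV p] by fastforce
  then have "(\<integral>\<^sup>+x. ennreal (p x) \<partial>dV) < \<infinity>"
    using density_pos by (subst nn_integral_eq_integral) (auto intro!: AE_I2 simp: space_volume[OF vol] less_imp_le)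
  moreover have "ennreal pmin * emeasure dV (space dV) \<le> (\<integral>\<^sup>+x. ennreal (p x) \<partial>dV)"
  proof -
    have "ennreal pmin * emeasure dV (space dV) = (\<integral>\<^sup>+x. ennreal pmin \<partial>dV)" by simp
    also have "\<dots> \<le> (\<integral>\<^sup>+x. ennreal (p x) \<partial>dV)"
      by (rule nn_integral_mono) (use p(3) in \<open>auto simp: space_volume[OF vol] intro!: ennreal_leI\<close>)
    finally show ?thesis .
  qed
  ultimately have "ennreal pmin * emeasure dV (space dV) < \<infinity>" by (rule le_less_trans[rotated])
  then show "emeasure dV (space dV) \<noteq> \<infinity>" using p(2) by (auto simp: ennreal_mult_eq_top_iff)
qed

lemma sets_pair_density: "sets (density dV (\<lambda>x. ennreal (p x)) \<Otimes>\<^sub>M density dV (\<lambda>x. ennreal (p x))) = sets (dV \<Otimes>\<^sub>M dV)"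
  by (rule sets_pair_measure_cong) simp_all

lemma integral_pair_density:
  assumes g: "g \<in> borel_measurable (dV \<Otimes>\<^sub>M dV)"
  shows "(\<integral>z. g z \<partial>(density dV (\<lambda>x. ennreal (p x)) \<Otimes>\<^sub>M density dV (\<lambda>x. ennreal (p x)))) = (\<integral>z. p (fst z) * p (snd z) * g z \<partial>(dV \<Otimes>\<^sub>M dV))"
proof -
  interpret finite_measure dV by (rule finite_volume)
  have sf: "sigma_finite_measure (density dV (\<lambda>x. ennreal (p x)))"
    using sigma_finite_measure_axioms density_measurable by (subst sigma_finite_iff_density_finite) auto
  have L: "(\<lambda>z. p (fst z) * p (snd z)) \<in> borel_measurable (dV \<Otimes>\<^sub>M dV)"
    by (intro borel_measurable_times measurable_compose[OF measurable_fst density_measurable] measurable_compose[OF measurable_snd density_measurable])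
  have "density dV (\<lambda>x. ennreal (p x)) \<Otimes>\<^sub>M density dV (\<lambda>x. ennreal (p x)) = density (dV \<Otimes>\<^sub>M dV) (\<lambda>(x,y). ennreal (p x) * ennreal (p y))"
    by (rule pair_measure_density) (use density_measurable sigma_finite_measure_axioms sf in auto)
  also have "\<dots> = density (dV \<Otimes>\<^sub>M dV) (\<lambda>z. ennreal (p (fst z) * p (snd z)))"
  proof (rule density_cong)
    show "AE z in dV \<Otimes>\<^sub>M dV. (case z of (x, y) \<Rightarrow> ennreal (p x) * ennreal (p y)) = ennreal (p (fst z) * p (snd z))"
      using density_pos by (intro AE_I2) (auto simp: space_pair_measure space_volume[OF vol] ennreal_mult less_imp_le)
  qed (use density_measurable L in \<open>auto intro!: measurable_compose[OF _ measurable_ennreal]\<close>)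
  finally have eq: "density dV (\<lambda>x. ennreal (p x)) \<Otimes>\<^sub>M density dV (\<lambda>x. ennreal (p x)) = density (dV \<Otimes>\<^sub>M dV) (\<lambda>z. ennreal (p (fst z) * p (snd z)))" .
  have AE: "AE z in dV \<Otimes>\<^sub>M dV. 0 \<le> p (fst z) * p (snd z)"
    using density_pos by (intro AE_I2) (auto simp: space_pair_measure space_volume[OF vol] less_imp_le)
  show ?thesis unfolding eq using integral_density[OF g L AE] by simp
qed


lemma density_powr_lip2: "lip2_fun TYPE('d) M (\<lambda>x. p x powr r)"
  by (rule lip2_fun_powr[OF M(2) p(1,2,3)])

lemma energy_facts:
  fixes \<kappa> :: "real \<Rightarrow> real"
  assumes \<kappa>: "continuous_on UNIV \<kappa>" "a' > 0" "\<And>s. s \<ge> 0 \<Longrightarrow> \<bar>\<kappa> s\<bar> \<le> A' * exp (- a' * s)"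
    "\<And>s t. s \<ge> 0 \<Longrightarrow> t \<ge> 0 \<Longrightarrow> \<bar>\<kappa> s - \<kappa> t\<bar> \<le> A' * exp (- a' * min s t) * \<bar>s - t\<bar>" and n: "n > 0"
  shows "\<forall>\<epsilon>>0. integrable (dV \<Otimes>\<^sub>M dV) (\<lambda>z. kernel_energy_integrand \<kappa> (\<lambda>x. p x powr (1 / real CARD('d))) f (\<lambda>x. p x powr r) n \<epsilon> (fst z) (snd z))"
    and "\<exists>C>0. \<forall>\<epsilon>. 0 < \<epsilon> \<and> \<epsilon> \<le> 1 \<longrightarrow> \<bar>(\<integral>z. kernel_energy_integrand \<kappa> (\<lambda>x. p x powr (1 / real CARD('d))) f (\<lambda>x. p x powr r) n \<epsilon> (fst z) (snd z) \<partial>(dV \<Otimes>\<^sub>M dV))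
       - sqrt \<epsilon> ^ (CARD('d) + n) * radial_moment TYPE('d) \<kappa> n * (\<integral>x. limit_energy_density TYPE('d) M (\<lambda>x. p x powr (1 / real CARD('d))) f (\<lambda>x. p x powr r) n x \<partial>dV)\<bar> \<le> C * (sqrt \<epsilon> ^ (CARD('d) + n) * \<epsilon>)"
proof -
  have q0: "pmin powr (1 / real CARD('d)) > 0" "\<And>x. x \<in> M \<Longrightarrow> pmin powr (1 / real CARD('d)) \<le> p x powr (1 / real CARD('d))"
    using p(2,3) by (auto intro!: powr_mono2)
  note pr = M vol finite_volume f density_powr_lip2[of "1 / real CARD('d)"] density_powr_lip2[of r] q0 \<kappa> n
  show "\<exists>C>0. \<forall>\<epsilon>. 0 < \<epsilon> \<and> \<epsilon> \<le> 1 \<longrightarrow> \<bar>(\<integral>z. kernel_energy_integrand \<kappa> (\<lambda>x. p x powr (1 / real CARD('d))) f (\<lambda>x. p x powr r) n \<epsilon> (fst z) (snd z) \<partial>(dV \<Otimes>\<^sub>M dV))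
       - sqrt \<epsilon> ^ (CARD('d) + n) * radial_moment TYPE('d) \<kappa> n * (\<integral>x. limit_energy_density TYPE('d) M (\<lambda>x. p x powr (1 / real CARD('d))) f (\<lambda>x. p x powr r) n x \<partial>dV)\<bar> \<le> C * (sqrt \<epsilon> ^ (CARD('d) + n) * \<epsilon>)"
    by (rule kernel_energy_asymptotics[OF pr])
  obtain B where B: "B > 0" "\<And>\<epsilon> x y. \<epsilon> > 0 \<Longrightarrow> x \<in> M \<Longrightarrow> y \<in> M \<Longrightarrow>
    \<bar>kernel_energy_integrand \<kappa> (\<lambda>x. p x powr (1 / real CARD('d))) f (\<lambda>x. p x powr r) n \<epsilon> x y\<bar> \<le> B * exp (- (a' * (pmin powr (1 / real CARD('d)))\<^sup>2) * (norm (x - y))\<^sup>2 / \<epsilon>)"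
    by (rule kernel_energy_integrand_bounded[OF pr]) (assumption | rule that)+
  show "\<forall>\<epsilon>>0. integrable (dV \<Otimes>\<^sub>M dV) (\<lambda>z. kernel_energy_integrand \<kappa> (\<lambda>x. p x powr (1 / real CARD('d))) f (\<lambda>x. p x powr r) n \<epsilon> (fst z) (snd z))"
  proof (intro allI impI)
    fix \<epsilon> :: real assume e: "\<epsilon> > 0"
    show "integrable (dV \<Otimes>\<^sub>M dV) (\<lambda>z. kernel_energy_integrand \<kappa> (\<lambda>x. p x powr (1 / real CARD('d))) f (\<lambda>x. p x powr r) n \<epsilon> (fst z) (snd z))"
    proof (rule integrable_pair_bounded[OF pr kernel_energy_integrand_measurable[OF pr]])
      fix x y assume xy: "x \<in> M" "y \<in> M"
      have "exp (- (a' * (pmin powr (1 / real CARD('d)))\<^sup>2) * (norm (x - y))\<^sup>2 / \<epsilon>) \<le> 1" using \<kappa>(2) e by simp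
      from mult_left_mono[OF this less_imp_le[OF B(1)]] B(2)[OF e xy]
      show "\<bar>kernel_energy_integrand \<kappa> (\<lambda>x. p x powr (1 / real CARD('d))) f (\<lambda>x. p x powr r) n \<epsilon> (fst (x, y)) (snd (x, y))\<bar> \<le> B" by simp
    qed
  qed
qed

lemma limit_energy_density_powr:
  assumes x: "x \<in> M"
  shows "limit_energy_density TYPE('d) M (\<lambda>x. p x powr (1 / real CARD('d))) f (\<lambda>x. p x powr r) n x
    = p x powr (2 * r - (real CARD('d) + real n) / real CARD('d)) * norm (manifold_grad TYPE('d) M f x) ^ n"
proof -
  have px: "p x > 0" by (rule density_pos[OF x])
  have pw: "(p x powr c) ^ j = p x powr (c * real j)" for c j
    using px by (simp add: powr_realpow[symmetric] powr_powr)
  have "(p x powr r)\<^sup>2 / (p x powr (1 / real CARD('d))) ^ (CARD('d) + n) = p x powr (2 * r - (real CARD('d) + real n) / real CARD('d))"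
    unfolding pw powr_diff[symmetric] by (simp add: mult.commute add_divide_distrib)
  then show ?thesis by (simp add: limit_energy_density_def)
qed

text \<open>\<open>k0\<close> is controlled on the closed half-line only; its constant extension is
  continuous on the whole line and keeps every value that occurs.\<close>

lemma kernel_K:
  "continuous_on UNIV (\<lambda>s. k0 (max 0 s))" "\<And>s. s \<ge> 0 \<Longrightarrow> \<bar>k0 (max 0 s)\<bar> \<le> A * exp (- a * s)" 
  "\<And>s t. s \<ge> 0 \<Longrightarrow> t \<ge> 0 \<Longrightarrow> \<bar>k0 (max 0 s) - k0 (max 0 t)\<bar> \<le> A * exp (- a * min s t) * \<bar>s - t\<bar>"
proof -
  have "continuous_on {0..} k0" using adm by (simp add: admissible_kernel_def)
  then show "continuous_on UNIV (\<lambda>s. k0 (max 0 s))" by (rule continuous_on_compose2) (auto intro!: continuous_intros)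
  show "\<bar>k0 (max 0 s)\<bar> \<le> A * exp (- a * s)" if "s \<ge> 0" for s using kb(1,2)[OF that] that by simp
  show "\<bar>k0 (max 0 s) - k0 (max 0 t)\<bar> \<le> A * exp (- a * min s t) * \<bar>s - t\<bar>" if "s \<ge> 0" "t \<ge> 0" for s t using kb(3)[OF that] that by simp
qed

text \<open>The rate \<open>a / 2\<close> is the one left over by \<open>weight_comparison\<close>;
  the factor \<open>1 + a / 2\<close> serves the values and the Lipschitz bound alike.\<close>

lemma kernel_EK:
  "continuous_on UNIV (\<lambda>s. exp (- (a / 2) * max 0 s))" "\<And>s. s \<ge> 0 \<Longrightarrow> \<bar>exp (- (a / 2) * max 0 s)\<bar> \<le> (1 + a / 2) * exp (- (a / 2) * s)" 
  "\<And>s t. s \<ge> 0 \<Longrightarrow> t \<ge> 0 \<Longrightarrow> \<bar>exp (- (a / 2) * max 0 s) - exp (- (a / 2) * max 0 t)\<bar> \<le> (1 + a / 2) * exp (- (a / 2) * min s t) * \<bar>s - t\<bar>"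
proof -
  show "continuous_on UNIV (\<lambda>s. exp (- (a / 2) * max 0 s))" by (intro continuous_intros)
  show "\<bar>exp (- (a / 2) * max 0 s)\<bar> \<le> (1 + a / 2) * exp (- (a / 2) * s)" if "s \<ge> 0" for s
  proof -
    have "1 * exp (- (a / 2) * s) \<le> (1 + a / 2) * exp (- (a / 2) * s)" using Aa by (intro mult_right_mono) auto
    then show ?thesis using that by (simp add: max_def)
  qed
  show "\<bar>exp (- (a / 2) * max 0 s) - exp (- (a / 2) * max 0 t)\<bar> \<le> (1 + a / 2) * exp (- (a / 2) * min s t) * \<bar>s - t\<bar>" if "s \<ge> 0" "t \<ge> 0" for s t
    using exp_kernel_bounds[of "a / 2" s t] that Aa by (simp add: max_absorb2)
qed

text \<open>The second moment sees the kernel at nonnegative arguments only, so the extension has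
  the very moment by which the graph form is normalized.\<close>

lemma radial_moment_K: "radial_moment TYPE('d) (\<lambda>s. k0 (max 0 s)) 2 = kernel_m2 TYPE('d) k0"
proof -
  have "(\<lambda>s. k0 (max 0 s)) \<in> borel_measurable borel" by (rule borel_measurable_continuous_onI[OF kernel_K(1)])
  from kernel_m2_eq_radial_moment[OF this Aa(2) kernel_K(2), where 'd = 'd]
  have "kernel_m2 TYPE('d) (\<lambda>s. k0 (max 0 s)) = radial_moment TYPE('d) (\<lambda>s. k0 (max 0 s)) 2" .
  moreover have "kernel_m2 TYPE('d) (\<lambda>s. k0 (max 0 s)) = kernel_m2 TYPE('d) k0" by (simp add: kernel_m2_def)
  ultimately show ?thesis by simp
qed

lemma radial_moment_EK_nonneg: "even j \<Longrightarrow> 0 \<le> radial_moment TYPE('d) (\<lambda>s. exp (- (a / 2) * max 0 s)) j"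
  unfolding radial_moment_def by (intro Bochner_Integration.integral_nonneg) (auto simp: zero_le_even_power)

context
  fixes \<alpha> \<epsilon> \<eta> :: real and \<rho> :: "'a \<Rightarrow> real"
  assumes R: "bandwidth_approx M (\<lambda>x. p x powr (- 1 / real CARD('d))) \<epsilon> \<eta> \<rho>"
begin

text \<open>The bandwidth weights and the sampling density combine to
  \<open>p powr (1 + \<alpha> / d)\<close> at each point. Squaring the kernel doubles the share of
  \<alpha> but not that of the density, hence \<open>1 + 2 * \<alpha> / d\<close> in the last
  bound.\<close>

lemma graph_kernel_pointwise:
  assumes x: "x \<in> M" "y \<in> M"
  shows "\<bar>p x * p y * graph_kernel CARD('d) (\<lambda>s. k0 (max 0 s)) (kernel_m2 TYPE('d) k0) \<alpha> \<epsilon> \<rho> f x y - (1 / (sqrt \<epsilon> ^ (CARD('d) + 2) * kernel_m2 TYPE('d) k0)) * kernel_energy_integrand (\<lambda>s. k0 (max 0 s)) (\<lambda>x. p x powr (1 / real CARD('d))) f (\<lambda>x. p x powr (1 + \<alpha> / real CARD('d))) 2 \<epsilon> x y\<bar>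
      \<le> (A * ((3 * \<bar>\<alpha>\<bar> * exp \<bar>\<alpha>\<bar>) + 10 / a) * \<eta> * (1 / (sqrt \<epsilon> ^ (CARD('d) + 2) * kernel_m2 TYPE('d) k0))) * kernel_energy_integrand (\<lambda>s. exp (- (a / 2) * max 0 s)) (\<lambda>x. p x powr (1 / real CARD('d))) f (\<lambda>x. p x powr (1 + \<alpha> / real CARD('d))) 2 \<epsilon> x y"
    and "0 \<le> graph_kernel CARD('d) (\<lambda>s. k0 (max 0 s)) (kernel_m2 TYPE('d) k0) \<alpha> \<epsilon> \<rho> f x y"
    and "graph_kernel CARD('d) (\<lambda>s. k0 (max 0 s)) (kernel_m2 TYPE('d) k0) \<alpha> \<epsilon> \<rho> f x y \<le> (A * (1 + (3 * \<bar>\<alpha>\<bar> * exp \<bar>\<alpha>\<bar>) * \<eta>)) * (1 / (sqrt \<epsilon> ^ (CARD('d) + 2) * kernel_m2 TYPE('d) k0)) * (exp (- (a / 2) * ((norm (x - y))\<^sup>2 * (p x powr (1 / real CARD('d)) * p y powr (1 / real CARD('d))) / \<epsilon>)) * (p x powr (\<alpha> / real CARD('d)) * p y powr (\<alpha> / real CARD('d))) * (f x - f y)\<^sup>2)"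
    and "p x * p y * (graph_kernel CARD('d) (\<lambda>s. k0 (max 0 s)) (kernel_m2 TYPE('d) k0) \<alpha> \<epsilon> \<rho> f x y)\<^sup>2 \<le> (A * (1 + (3 * \<bar>\<alpha>\<bar> * exp \<bar>\<alpha>\<bar>) * \<eta>) * (1 / (sqrt \<epsilon> ^ (CARD('d) + 2) * kernel_m2 TYPE('d) k0)))\<^sup>2 * kernel_energy_integrand (\<lambda>s. exp (- (a / 2) * max 0 s)) (\<lambda>x. p x powr (1 / real CARD('d))) f (\<lambda>x. p x powr (1 + 2 * \<alpha> / real CARD('d))) 4 \<epsilon> x y"
proof -
  let ?d = "real CARD('d)"
  note e = bandwidth_approxD(1,2)[OF R] and \<eta> = bandwidth_approxD(3,4)[OF R] and \<rho> = bandwidth_approxD(6)[OF R]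
  have px: "p x > 0" "p y > 0" using density_pos x by auto
  define b1 b2 where "b1 = p x powr (-1 / ?d)" and "b2 = p y powr (-1 / ?d)"
  have b: "b1 > 0" "b2 > 0" using px by (auto simp: b1_def b2_def)
  define w where "w = (norm (x - y))\<^sup>2 / \<epsilon>"
  have w: "w \<ge> 0" using e by (simp add: w_def)
  have K0: "0 \<le> k0 (max 0 s)" "k0 (max 0 s) \<le> A * exp (- a * s)" if "s \<ge> 0" for s using kb(1,2)[OF that] that by simp_all
  define Wb where "Wb = 1 / (b1 powr \<alpha> * b2 powr \<alpha>)"
  define s' where "s' = w / (b1 * b2)"
  note wc = weight_comparison[OF K0 kernel_K(3) Aa b \<eta> \<rho>[OF x(1), folded b1_def] \<rho>[OF x(2), folded b2_def] w, of \<alpha>, folded Wb_def s'_def]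
  define W where "W = (\<lambda>s. k0 (max 0 s)) (w / (\<rho> x * \<rho> y)) * (1 / (\<rho> x powr \<alpha> * \<rho> y powr \<alpha>))"
  note wc = wc[folded W_def]
  have Wpos: "Wb > 0" using b by (simp add: Wb_def)
  have m2: "kernel_m2 TYPE('d) k0 > 0" by (rule kernel_m2_pos[OF adm])
  define G where "G = (1 / (sqrt \<epsilon> ^ (CARD('d) + 2) * kernel_m2 TYPE('d) k0))"
  have G: "G > 0" using m2 e by (simp add: G_def)
  define D where "D = (f x - f y)\<^sup>2"
  have D: "D \<ge> 0" by (simp add: D_def)
  have V: "graph_kernel CARD('d) (\<lambda>s. k0 (max 0 s)) (kernel_m2 TYPE('d) k0) \<alpha> \<epsilon> \<rho> f x y = G * W * D"
    by (simp add: graph_kernel_def W_def w_def G_def D_def mult.assoc)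
  have s's: "s' = (norm (x - y))\<^sup>2 * (p x powr (1 / real CARD('d)) * p y powr (1 / real CARD('d))) / \<epsilon>"
    by (simp add: s'_def w_def b1_def b2_def powr_minus_divide)
  have s'0: "s' \<ge> 0" using w b by (simp add: s'_def)
  have Wbp: "Wb = p x powr (\<alpha> / ?d) * p y powr (\<alpha> / ?d)"
  proof -
    have h: "(p z powr (-1 / ?d)) powr \<alpha> = 1 / p z powr (\<alpha> / ?d)" for z
    proof -
      have "-1 / ?d * \<alpha> = - (\<alpha> / ?d)" by simp
      then show ?thesis by (simp only: powr_powr powr_minus_divide)
    qed
    show ?thesis unfolding Wb_def b1_def b2_def h by simp
  qed
  have t1: "Wb * (p x * p y) = p x powr (1 + \<alpha> / real CARD('d)) * p y powr (1 + \<alpha> / real CARD('d))"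
    using px by (simp add: Wbp powr_add)
  have t2: "Wb\<^sup>2 * (p x * p y) = p x powr (1 + 2 * \<alpha> / real CARD('d)) * p y powr (1 + 2 * \<alpha> / real CARD('d))"
  proof -
    have h: "(p z powr (\<alpha> / ?d))\<^sup>2 = p z powr (2 * \<alpha> / ?d)" for z by (simp add: power2_eq_square flip: powr_add)
    show ?thesis using px unfolding Wbp power_mult_distrib h by (simp add: powr_add)
  qed
  have EKs: "(\<lambda>s. exp (- (a / 2) * max 0 s)) s' = exp (- (a / 2) * s')" using s'0 by (simp add: max_absorb2)
  have eK: "kernel_energy_integrand (\<lambda>s. k0 (max 0 s)) (\<lambda>x. p x powr (1 / real CARD('d))) f (\<lambda>x. p x powr (1 + \<alpha> / real CARD('d))) 2 \<epsilon> x y = (\<lambda>s. k0 (max 0 s)) s' * D * (Wb * (p x * p y))"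
    unfolding kernel_energy_integrand_def s's[symmetric] t1 D_def ..
  have eE: "kernel_energy_integrand (\<lambda>s. exp (- (a / 2) * max 0 s)) (\<lambda>x. p x powr (1 / real CARD('d))) f (\<lambda>x. p x powr (1 + \<alpha> / real CARD('d))) 2 \<epsilon> x y = exp (- (a / 2) * s') * D * (Wb * (p x * p y))"
    unfolding kernel_energy_integrand_def s's[symmetric] t1 D_def EKs ..
  have "(f x - f y) ^ 4 = D\<^sup>2" unfolding D_def by (simp flip: power_mult)
  then have eE4: "kernel_energy_integrand (\<lambda>s. exp (- (a / 2) * max 0 s)) (\<lambda>x. p x powr (1 / real CARD('d))) f (\<lambda>x. p x powr (1 + 2 * \<alpha> / real CARD('d))) 4 \<epsilon> x y = exp (- (a / 2) * s') * D\<^sup>2 * (Wb\<^sup>2 * (p x * p y))"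
    unfolding kernel_energy_integrand_def s's[symmetric] t2 EKs by simp
  have "\<bar>p x * p y * graph_kernel CARD('d) (\<lambda>s. k0 (max 0 s)) (kernel_m2 TYPE('d) k0) \<alpha> \<epsilon> \<rho> f x y - G * kernel_energy_integrand (\<lambda>s. k0 (max 0 s)) (\<lambda>x. p x powr (1 / real CARD('d))) f (\<lambda>x. p x powr (1 + \<alpha> / real CARD('d))) 2 \<epsilon> x y\<bar> = (p x * p y * G * D) * \<bar>W - (\<lambda>s. k0 (max 0 s)) s' * Wb\<bar>"
  proof -
    have "p x * p y * graph_kernel CARD('d) (\<lambda>s. k0 (max 0 s)) (kernel_m2 TYPE('d) k0) \<alpha> \<epsilon> \<rho> f x y - G * kernel_energy_integrand (\<lambda>s. k0 (max 0 s)) (\<lambda>x. p x powr (1 / real CARD('d))) f (\<lambda>x. p x powr (1 + \<alpha> / real CARD('d))) 2 \<epsilon> x y = (p x * p y * G * D) * (W - (\<lambda>s. k0 (max 0 s)) s' * Wb)"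
      unfolding V eK by (simp add: algebra_simps)
    moreover have "0 \<le> p x * p y * G * D" using px G D by simp
    ultimately show ?thesis by (simp only: abs_mult[of "p x * p y * G * D"] abs_of_nonneg)
  qed
  also have "\<dots> \<le> (p x * p y * G * D) * (A * ((3 * \<bar>\<alpha>\<bar> * exp \<bar>\<alpha>\<bar>) + 10 / a) * \<eta> * (exp (- (a / 2) * s') * Wb))"
    using wc(1) px G D by (intro mult_left_mono) auto
  also have "\<dots> = (A * ((3 * \<bar>\<alpha>\<bar> * exp \<bar>\<alpha>\<bar>) + 10 / a) * \<eta> * G) * kernel_energy_integrand (\<lambda>s. exp (- (a / 2) * max 0 s)) (\<lambda>x. p x powr (1 / real CARD('d))) f (\<lambda>x. p x powr (1 + \<alpha> / real CARD('d))) 2 \<epsilon> x y"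
    unfolding eE by (simp only: mult_ac)
  finally show "\<bar>p x * p y * graph_kernel CARD('d) (\<lambda>s. k0 (max 0 s)) (kernel_m2 TYPE('d) k0) \<alpha> \<epsilon> \<rho> f x y - (1 / (sqrt \<epsilon> ^ (CARD('d) + 2) * kernel_m2 TYPE('d) k0)) * kernel_energy_integrand (\<lambda>s. k0 (max 0 s)) (\<lambda>x. p x powr (1 / real CARD('d))) f (\<lambda>x. p x powr (1 + \<alpha> / real CARD('d))) 2 \<epsilon> x y\<bar>
      \<le> (A * ((3 * \<bar>\<alpha>\<bar> * exp \<bar>\<alpha>\<bar>) + 10 / a) * \<eta> * (1 / (sqrt \<epsilon> ^ (CARD('d) + 2) * kernel_m2 TYPE('d) k0))) * kernel_energy_integrand (\<lambda>s. exp (- (a / 2) * max 0 s)) (\<lambda>x. p x powr (1 / real CARD('d))) f (\<lambda>x. p x powr (1 + \<alpha> / real CARD('d))) 2 \<epsilon> x y" unfolding G_def .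
  show V0: "0 \<le> graph_kernel CARD('d) (\<lambda>s. k0 (max 0 s)) (kernel_m2 TYPE('d) k0) \<alpha> \<epsilon> \<rho> f x y" unfolding V using wc(2) G D by simp
  have "G * W * D \<le> G * (A * (1 + (3 * \<bar>\<alpha>\<bar> * exp \<bar>\<alpha>\<bar>) * \<eta>) * (exp (- (a / 2) * s') * Wb)) * D"
    using wc(3) G D by (intro mult_right_mono mult_left_mono) auto
  then have Vle: "graph_kernel CARD('d) (\<lambda>s. k0 (max 0 s)) (kernel_m2 TYPE('d) k0) \<alpha> \<epsilon> \<rho> f x y \<le> (A * (1 + (3 * \<bar>\<alpha>\<bar> * exp \<bar>\<alpha>\<bar>) * \<eta>)) * G * (exp (- (a / 2) * s') * Wb * D)" unfolding V by (simp only: mult_ac)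
  then show "graph_kernel CARD('d) (\<lambda>s. k0 (max 0 s)) (kernel_m2 TYPE('d) k0) \<alpha> \<epsilon> \<rho> f x y \<le> (A * (1 + (3 * \<bar>\<alpha>\<bar> * exp \<bar>\<alpha>\<bar>) * \<eta>)) * (1 / (sqrt \<epsilon> ^ (CARD('d) + 2) * kernel_m2 TYPE('d) k0)) * (exp (- (a / 2) * ((norm (x - y))\<^sup>2 * (p x powr (1 / real CARD('d)) * p y powr (1 / real CARD('d))) / \<epsilon>)) * (p x powr (\<alpha> / real CARD('d)) * p y powr (\<alpha> / real CARD('d))) * (f x - f y)\<^sup>2)"
    unfolding G_def s's Wbp D_def .
  have "(graph_kernel CARD('d) (\<lambda>s. k0 (max 0 s)) (kernel_m2 TYPE('d) k0) \<alpha> \<epsilon> \<rho> f x y)\<^sup>2 \<le> ((A * (1 + (3 * \<bar>\<alpha>\<bar> * exp \<bar>\<alpha>\<bar>) * \<eta>)) * G * (exp (- (a / 2) * s') * Wb * D))\<^sup>2"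
    by (rule power_mono[OF Vle V0])
  also have "\<dots> = (A * (1 + (3 * \<bar>\<alpha>\<bar> * exp \<bar>\<alpha>\<bar>) * \<eta>) * G)\<^sup>2 * ((exp (- (a / 2) * s'))\<^sup>2 * Wb\<^sup>2 * D\<^sup>2)" by (simp add: power_mult_distrib)
  \<comment> \<open>The squared exponential is bounded by the exponential, so that one comparison
    kernel serves \<open>n = 2\<close> and \<open>n = 4\<close>.\<close>
  also have "\<dots> \<le> (A * (1 + (3 * \<bar>\<alpha>\<bar> * exp \<bar>\<alpha>\<bar>) * \<eta>) * G)\<^sup>2 * (exp (- (a / 2) * s') * Wb\<^sup>2 * D\<^sup>2)"
  proof (intro mult_left_mono mult_right_mono)
    have "exp (- (a / 2) * s') \<le> 1" using Aa s'0 by simp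
    then show "(exp (- (a / 2) * s'))\<^sup>2 \<le> exp (- (a / 2) * s')" by (simp add: power2_eq_square mult_left_le)
  qed auto
  finally have "p x * p y * (graph_kernel CARD('d) (\<lambda>s. k0 (max 0 s)) (kernel_m2 TYPE('d) k0) \<alpha> \<epsilon> \<rho> f x y)\<^sup>2 \<le> p x * p y * ((A * (1 + (3 * \<bar>\<alpha>\<bar> * exp \<bar>\<alpha>\<bar>) * \<eta>) * G)\<^sup>2 * (exp (- (a / 2) * s') * Wb\<^sup>2 * D\<^sup>2))"
    using px by (intro mult_left_mono) auto
  also have "\<dots> = (A * (1 + (3 * \<bar>\<alpha>\<bar> * exp \<bar>\<alpha>\<bar>) * \<eta>) * G)\<^sup>2 * kernel_energy_integrand (\<lambda>s. exp (- (a / 2) * max 0 s)) (\<lambda>x. p x powr (1 / real CARD('d))) f (\<lambda>x. p x powr (1 + 2 * \<alpha> / real CARD('d))) 4 \<epsilon> x y"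
    unfolding eE4 by (simp only: mult_ac)
  finally show "p x * p y * (graph_kernel CARD('d) (\<lambda>s. k0 (max 0 s)) (kernel_m2 TYPE('d) k0) \<alpha> \<epsilon> \<rho> f x y)\<^sup>2 \<le> (A * (1 + (3 * \<bar>\<alpha>\<bar> * exp \<bar>\<alpha>\<bar>) * \<eta>) * (1 / (sqrt \<epsilon> ^ (CARD('d) + 2) * kernel_m2 TYPE('d) k0)))\<^sup>2 * kernel_energy_integrand (\<lambda>s. exp (- (a / 2) * max 0 s)) (\<lambda>x. p x powr (1 / real CARD('d))) f (\<lambda>x. p x powr (1 + 2 * \<alpha> / real CARD('d))) 4 \<epsilon> x y" unfolding G_def .
qed

lemma graph_kernel_symmetric: "graph_kernel CARD('d) (\<lambda>s. k0 (max 0 s)) (kernel_m2 TYPE('d) k0) \<alpha> \<epsilon> \<rho> f x y = graph_kernel CARD('d) (\<lambda>s. k0 (max 0 s)) (kernel_m2 TYPE('d) k0) \<alpha> \<epsilon> \<rho> f y x" "graph_kernel CARD('d) (\<lambda>s. k0 (max 0 s)) (kernel_m2 TYPE('d) k0) \<alpha> \<epsilon> \<rho> f x x = 0"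
  by (simp_all add: graph_kernel_def norm_minus_commute mult.commute mult.left_commute power2_commute)

lemma graph_kernel_measurable: "(\<lambda>z. graph_kernel CARD('d) (\<lambda>s. k0 (max 0 s)) (kernel_m2 TYPE('d) k0) \<alpha> \<epsilon> \<rho> f (fst z) (snd z)) \<in> borel_measurable (dV \<Otimes>\<^sub>M dV)"
proof -
  have L: "(\<lambda>z. g (fst z)) \<in> borel_measurable (dV \<Otimes>\<^sub>M dV)" "(\<lambda>z. g (snd z)) \<in> borel_measurable (dV \<Otimes>\<^sub>M dV)"
    if "g \<in> borel_measurable dV" for g :: "'a \<Rightarrow> real"
    using measurable_compose[OF measurable_fst that] measurable_compose[OF measurable_snd that] by blast+
  have [measurable]: "(\<lambda>z. fst z) \<in> borel_measurable (dV \<Otimes>\<^sub>M dV)" "(\<lambda>z. snd z) \<in> borel_measurable (dV \<Otimes>\<^sub>M dV)"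
    using measurable_compose[OF measurable_fst measurable_ident_volume[OF vol]]
      measurable_compose[OF measurable_snd measurable_ident_volume[OF vol]] by blast+
  have \<rho>m: "\<rho> \<in> borel_measurable dV" by (rule borel_measurable_volume_continuous_on[OF vol bandwidth_approxD(5)[OF R]])
  have fm: "f \<in> borel_measurable dV" by (rule borel_measurable_volume_continuous_on[OF vol smooth_fun_continuous_on[OF M(2) f]])
  note [measurable] = L[OF \<rho>m] L[OF fm]
  have [measurable]: "(\<lambda>s. k0 (max 0 s)) \<in> borel_measurable borel" by (rule borel_measurable_continuous_onI[OF kernel_K(1)])
  have arg: "(\<lambda>z. (norm (fst z - snd z))\<^sup>2 / (\<epsilon> * \<rho> (fst z) * \<rho> (snd z))) \<in> borel_measurable (dV \<Otimes>\<^sub>M dV)" by measurable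
  have [measurable]: "(\<lambda>z. (\<lambda>s. k0 (max 0 s)) ((norm (fst z - snd z))\<^sup>2 / (\<epsilon> * \<rho> (fst z) * \<rho> (snd z)))) \<in> borel_measurable (dV \<Otimes>\<^sub>M dV)"
    by (rule measurable_compose[OF arg]) measurable
  show ?thesis unfolding graph_kernel_def by measurable
qed

end

text \<open>The exponent \<open>c\<close> is a parameter of its own, so that each use can present it
  in the form of its target integral.\<close>

lemma energy_limit:
  fixes \<kappa> :: "real \<Rightarrow> real"
  assumes \<kappa>: "continuous_on UNIV \<kappa>" "a' > 0" "\<And>s. s \<ge> 0 \<Longrightarrow> \<bar>\<kappa> s\<bar> \<le> A' * exp (- a' * s)"
    "\<And>s t. s \<ge> 0 \<Longrightarrow> t \<ge> 0 \<Longrightarrow> \<bar>\<kappa> s - \<kappa> t\<bar> \<le> A' * exp (- a' * min s t) * \<bar>s - t\<bar>" and n: "n > 0"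
    and c: "2 * r - (real CARD('d) + real n) / real CARD('d) = c"
  shows "\<exists>C>0. \<forall>\<epsilon>. 0 < \<epsilon> \<and> \<epsilon> \<le> 1 \<longrightarrow> \<bar>(\<integral>z. kernel_energy_integrand \<kappa> (\<lambda>x. p x powr (1 / real CARD('d))) f (\<lambda>x. p x powr r) n \<epsilon> (fst z) (snd z) \<partial>(dV \<Otimes>\<^sub>M dV))
       - sqrt \<epsilon> ^ (CARD('d) + n) * radial_moment TYPE('d) \<kappa> n * (\<integral>x. p x powr c * norm (manifold_grad TYPE('d) M f x) ^ n \<partial>dV)\<bar> \<le> C * (sqrt \<epsilon> ^ (CARD('d) + n) * \<epsilon>)"
proof -
  have "(\<integral>x. limit_energy_density TYPE('d) M (\<lambda>x. p x powr (1 / real CARD('d))) f (\<lambda>x. p x powr r) n x \<partial>dV) = (\<integral>x. p x powr c * norm (manifold_grad TYPE('d) M f x) ^ n \<partial>dV)"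
    by (rule Bochner_Integration.integral_cong[OF refl]) (simp add: space_volume[OF vol] limit_energy_density_powr c)
  moreover have "\<exists>C>0. \<forall>\<epsilon>. 0 < \<epsilon> \<and> \<epsilon> \<le> 1 \<longrightarrow> \<bar>(\<integral>z. kernel_energy_integrand \<kappa> (\<lambda>x. p x powr (1 / real CARD('d))) f (\<lambda>x. p x powr r) n \<epsilon> (fst z) (snd z) \<partial>(dV \<Otimes>\<^sub>M dV))
       - sqrt \<epsilon> ^ (CARD('d) + n) * radial_moment TYPE('d) \<kappa> n * (\<integral>x. limit_energy_density TYPE('d) M (\<lambda>x. p x powr (1 / real CARD('d))) f (\<lambda>x. p x powr r) n x \<partial>dV)\<bar> \<le> C * (sqrt \<epsilon> ^ (CARD('d) + n) * \<epsilon>)"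
    by (rule energy_facts(2)[OF \<kappa> n])
  ultimately show ?thesis by simp
qed

lemma integrable_energy_K:
  "n > 0 \<Longrightarrow> \<epsilon> > 0 \<Longrightarrow> integrable (dV \<Otimes>\<^sub>M dV) (\<lambda>z. kernel_energy_integrand (\<lambda>s. k0 (max 0 s)) (\<lambda>x. p x powr (1 / real CARD('d))) f (\<lambda>x. p x powr r) n \<epsilon> (fst z) (snd z))"
  by (rule energy_facts(1)[OF kernel_K(1) Aa(2) kernel_K(2,3), rule_format])

lemma integrable_energy_EK:
  assumes "n > 0" "\<epsilon> > 0"
  shows "integrable (dV \<Otimes>\<^sub>M dV) (\<lambda>z. kernel_energy_integrand (\<lambda>s. exp (- (a / 2) * max 0 s)) (\<lambda>x. p x powr (1 / real CARD('d))) f (\<lambda>x. p x powr r) n \<epsilon> (fst z) (snd z))"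
proof -
  have a2: "a / 2 > 0" using Aa by simp
  have "\<forall>\<epsilon>>0. integrable (dV \<Otimes>\<^sub>M dV) (\<lambda>z. kernel_energy_integrand (\<lambda>s. exp (- (a / 2) * max 0 s)) (\<lambda>x. p x powr (1 / real CARD('d))) f (\<lambda>x. p x powr r) n \<epsilon> (fst z) (snd z))"
    by (rule energy_facts(1)[OF kernel_EK(1) a2 kernel_EK(2,3) assms(1)])
  then show ?thesis using assms by blast
qed

lemma space_pair_volume: "z \<in> space (dV \<Otimes>\<^sub>M dV) \<Longrightarrow> fst z \<in> M \<and> snd z \<in> M"
  by (auto simp: space_pair_measure space_volume[OF vol])

lemma density_pair_measurable: "(\<lambda>z. p (fst z) * p (snd z)) \<in> borel_measurable (dV \<Otimes>\<^sub>M dV)"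
  by (intro borel_measurable_times measurable_compose[OF measurable_fst density_measurable] measurable_compose[OF measurable_snd density_measurable])

text \<open>The two weights contribute \<open>2 * (1 + \<alpha> / d)\<close> and the local scale
  takes away \<open>(d + 2) / d\<close>, which leaves the exponent
  \<open>1 + 2 * (\<alpha> - 1) / d\<close>. The factor of \<eta> involves \<alpha>, the kernel and
  the dimension only; all other dependence on \<open>f\<close> and \<open>p\<close> sits in
  \<open>C\<close>.\<close>

lemma expectation_bias:
  "\<exists>C>0. \<forall>\<epsilon> \<eta> \<rho>. bandwidth_approx M (\<lambda>x. p x powr (- 1 / real CARD('d))) \<epsilon> \<eta> \<rho> \<longrightarrow> \<bar>(\<integral>z. graph_kernel CARD('d) (\<lambda>s. k0 (max 0 s)) (kernel_m2 TYPE('d) k0) \<alpha> \<epsilon> \<rho> f (fst z) (snd z) \<partial>(density dV (\<lambda>x. ennreal (p x)) \<Otimes>\<^sub>M density dV (\<lambda>x. ennreal (p x)))) - dirichlet_form TYPE('d) M dV (\<lambda>x. p x powr (1 + 2 * (\<alpha> - 1) / real CARD('d))) f\<bar>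
     \<le> (A * ((3 * \<bar>\<alpha>\<bar> * exp \<bar>\<alpha>\<bar>) + 10 / a)) * radial_moment TYPE('d) (\<lambda>s. exp (- (a / 2) * max 0 s)) 2 / kernel_m2 TYPE('d) k0 * \<eta> * dirichlet_form TYPE('d) M dV (\<lambda>x. p x powr (1 + 2 * (\<alpha> - 1) / real CARD('d))) f + C * \<epsilon>"
proof -
  have a2: "a / 2 > 0" using Aa by simp
  have ex: "2 * (1 + \<alpha> / real CARD('d)) - (real CARD('d) + real 2) / real CARD('d) = 1 + 2 * (\<alpha> - 1) / real CARD('d)"
    by (simp add: field_simps)
  have EEq: "dirichlet_form TYPE('d) M dV (\<lambda>x. p x powr (1 + 2 * (\<alpha> - 1) / real CARD('d))) f = (\<integral>x. p x powr (1 + 2 * (\<alpha> - 1) / real CARD('d)) * norm (manifold_grad TYPE('d) M f x) ^ 2 \<partial>dV)"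
    by (simp add: dirichlet_form_def)
  have e1: "\<exists>C>0. \<forall>\<epsilon>. 0 < \<epsilon> \<and> \<epsilon> \<le> 1 \<longrightarrow> \<bar>(\<integral>z. kernel_energy_integrand (\<lambda>s. k0 (max 0 s)) (\<lambda>x. p x powr (1 / real CARD('d))) f (\<lambda>x. p x powr (1 + \<alpha> / real CARD('d))) 2 \<epsilon> (fst z) (snd z) \<partial>(dV \<Otimes>\<^sub>M dV))
       - sqrt \<epsilon> ^ (CARD('d) + 2) * radial_moment TYPE('d) (\<lambda>s. k0 (max 0 s)) 2 * dirichlet_form TYPE('d) M dV (\<lambda>x. p x powr (1 + 2 * (\<alpha> - 1) / real CARD('d))) f\<bar> \<le> C * (sqrt \<epsilon> ^ (CARD('d) + 2) * \<epsilon>)"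
    unfolding EEq by (rule energy_limit[OF kernel_K(1) Aa(2) kernel_K(2,3) _ ex]) simp_all
  have e2: "\<exists>C>0. \<forall>\<epsilon>. 0 < \<epsilon> \<and> \<epsilon> \<le> 1 \<longrightarrow> \<bar>(\<integral>z. kernel_energy_integrand (\<lambda>s. exp (- (a / 2) * max 0 s)) (\<lambda>x. p x powr (1 / real CARD('d))) f (\<lambda>x. p x powr (1 + \<alpha> / real CARD('d))) 2 \<epsilon> (fst z) (snd z) \<partial>(dV \<Otimes>\<^sub>M dV))
       - sqrt \<epsilon> ^ (CARD('d) + 2) * radial_moment TYPE('d) (\<lambda>s. exp (- (a / 2) * max 0 s)) 2 * dirichlet_form TYPE('d) M dV (\<lambda>x. p x powr (1 + 2 * (\<alpha> - 1) / real CARD('d))) f\<bar> \<le> C * (sqrt \<epsilon> ^ (CARD('d) + 2) * \<epsilon>)"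
    unfolding EEq by (rule energy_limit[OF kernel_EK(1) a2 kernel_EK(2,3) _ ex]) simp_all
  obtain C1 where C1: "C1 > 0" "\<And>\<epsilon>. 0 < \<epsilon> \<and> \<epsilon> \<le> 1 \<Longrightarrow> \<bar>(\<integral>z. kernel_energy_integrand (\<lambda>s. k0 (max 0 s)) (\<lambda>x. p x powr (1 / real CARD('d))) f (\<lambda>x. p x powr (1 + \<alpha> / real CARD('d))) 2 \<epsilon> (fst z) (snd z) \<partial>(dV \<Otimes>\<^sub>M dV))
       - sqrt \<epsilon> ^ (CARD('d) + 2) * radial_moment TYPE('d) (\<lambda>s. k0 (max 0 s)) 2 * dirichlet_form TYPE('d) M dV (\<lambda>x. p x powr (1 + 2 * (\<alpha> - 1) / real CARD('d))) f\<bar> \<le> C1 * (sqrt \<epsilon> ^ (CARD('d) + 2) * \<epsilon>)"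
    using e1 by blast
  obtain C2 where C2: "C2 > 0" "\<And>\<epsilon>. 0 < \<epsilon> \<and> \<epsilon> \<le> 1 \<Longrightarrow> \<bar>(\<integral>z. kernel_energy_integrand (\<lambda>s. exp (- (a / 2) * max 0 s)) (\<lambda>x. p x powr (1 / real CARD('d))) f (\<lambda>x. p x powr (1 + \<alpha> / real CARD('d))) 2 \<epsilon> (fst z) (snd z) \<partial>(dV \<Otimes>\<^sub>M dV))
       - sqrt \<epsilon> ^ (CARD('d) + 2) * radial_moment TYPE('d) (\<lambda>s. exp (- (a / 2) * max 0 s)) 2 * dirichlet_form TYPE('d) M dV (\<lambda>x. p x powr (1 + 2 * (\<alpha> - 1) / real CARD('d))) f\<bar> \<le> C2 * (sqrt \<epsilon> ^ (CARD('d) + 2) * \<epsilon>)"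
    using e2 by blast
  have m: "kernel_m2 TYPE('d) k0 > 0" by (rule kernel_m2_pos[OF adm])
  have c0: "0 < A * ((3 * \<bar>\<alpha>\<bar> * exp \<bar>\<alpha>\<bar>) + 10 / a)" using Aa by (intro mult_pos_pos add_nonneg_pos) auto
  have Cpos: "(C1 + A * ((3 * \<bar>\<alpha>\<bar> * exp \<bar>\<alpha>\<bar>) + 10 / a) * C2) / kernel_m2 TYPE('d) k0 > 0"
    by (rule divide_pos_pos[OF add_pos_pos[OF C1(1) mult_pos_pos[OF c0 C2(1)]] m])
  have main: "\<bar>(\<integral>z. graph_kernel CARD('d) (\<lambda>s. k0 (max 0 s)) (kernel_m2 TYPE('d) k0) \<alpha> \<epsilon> \<rho> f (fst z) (snd z) \<partial>(density dV (\<lambda>x. ennreal (p x)) \<Otimes>\<^sub>M density dV (\<lambda>x. ennreal (p x)))) - dirichlet_form TYPE('d) M dV (\<lambda>x. p x powr (1 + 2 * (\<alpha> - 1) / real CARD('d))) f\<bar>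
     \<le> (A * ((3 * \<bar>\<alpha>\<bar> * exp \<bar>\<alpha>\<bar>) + 10 / a)) * radial_moment TYPE('d) (\<lambda>s. exp (- (a / 2) * max 0 s)) 2 / kernel_m2 TYPE('d) k0 * \<eta> * dirichlet_form TYPE('d) M dV (\<lambda>x. p x powr (1 + 2 * (\<alpha> - 1) / real CARD('d))) f + (C1 + A * ((3 * \<bar>\<alpha>\<bar> * exp \<bar>\<alpha>\<bar>) + 10 / a) * C2) / kernel_m2 TYPE('d) k0 * \<epsilon>"
    if R: "bandwidth_approx M (\<lambda>x. p x powr (- 1 / real CARD('d))) \<epsilon> \<eta> \<rho>" for \<epsilon> \<eta> \<rho>
  proof -
    note e = bandwidth_approxD(1,2)[OF R] and \<eta> = bandwidth_approxD(3,4)[OF R]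
    define KI where "KI = (\<lambda>z. kernel_energy_integrand (\<lambda>s. k0 (max 0 s)) (\<lambda>x. p x powr (1 / real CARD('d))) f (\<lambda>x. p x powr (1 + \<alpha> / real CARD('d))) 2 \<epsilon> (fst z) (snd z))"
    define EI where "EI = (\<lambda>z. kernel_energy_integrand (\<lambda>s. exp (- (a / 2) * max 0 s)) (\<lambda>x. p x powr (1 / real CARD('d))) f (\<lambda>x. p x powr (1 + \<alpha> / real CARD('d))) 2 \<epsilon> (fst z) (snd z))"
    define V where "V = (\<lambda>z. p (fst z) * p (snd z) * graph_kernel CARD('d) (\<lambda>s. k0 (max 0 s)) (kernel_m2 TYPE('d) k0) \<alpha> \<epsilon> \<rho> f (fst z) (snd z))"
    define cc where "cc = A * ((3 * \<bar>\<alpha>\<bar> * exp \<bar>\<alpha>\<bar>) + 10 / a) * \<eta> * (1 / (sqrt \<epsilon> ^ (CARD('d) + 2) * kernel_m2 TYPE('d) k0))"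
    have KIi: "integrable (dV \<Otimes>\<^sub>M dV) (\<lambda>z. (1 / (sqrt \<epsilon> ^ (CARD('d) + 2) * kernel_m2 TYPE('d) k0)) * KI z)" unfolding KI_def by (intro integrable_mult_right integrable_energy_K e) simp
    have EIi: "integrable (dV \<Otimes>\<^sub>M dV) (\<lambda>z. cc * EI z)" unfolding EI_def by (intro integrable_mult_right integrable_energy_EK e) simp
    have Vm: "V \<in> borel_measurable (dV \<Otimes>\<^sub>M dV)"
      unfolding V_def by (intro borel_measurable_times[OF density_pair_measurable graph_kernel_measurable[OF R]])
    have pt: "\<bar>V z - (1 / (sqrt \<epsilon> ^ (CARD('d) + 2) * kernel_m2 TYPE('d) k0)) * KI z\<bar> \<le> cc * EI z" if "z \<in> space (dV \<Otimes>\<^sub>M dV)" for z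
      unfolding V_def KI_def EI_def cc_def by (rule graph_kernel_pointwise(1)[OF R]) (use space_pair_volume[OF that] in auto)
    have Dm: "(\<lambda>z. V z - (1 / (sqrt \<epsilon> ^ (CARD('d) + 2) * kernel_m2 TYPE('d) k0)) * KI z) \<in> borel_measurable (dV \<Otimes>\<^sub>M dV)"
      by (intro borel_measurable_diff Vm borel_measurable_integrable[OF KIi])
    \<comment> \<open>Integrability of \<open>V\<close> comes from its distance to an integrable
      energy.\<close>
    have Di: "integrable (dV \<Otimes>\<^sub>M dV) (\<lambda>z. V z - (1 / (sqrt \<epsilon> ^ (CARD('d) + 2) * kernel_m2 TYPE('d) k0)) * KI z)"
      by (rule Bochner_Integration.integrable_bound[OF EIi Dm]) (rule AE_I2, use pt in \<open>fastforce\<close>)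
    have Vi: "integrable (dV \<Otimes>\<^sub>M dV) V" using Bochner_Integration.integrable_add[OF Di KIi] by simp
    have "\<bar>(\<integral>z. V z - (1 / (sqrt \<epsilon> ^ (CARD('d) + 2) * kernel_m2 TYPE('d) k0)) * KI z \<partial>(dV \<Otimes>\<^sub>M dV))\<bar> \<le> (\<integral>z. cc * EI z \<partial>(dV \<Otimes>\<^sub>M dV))"
      by (rule order_trans[OF integral_abs_bound integral_mono[OF integrable_abs[OF Di] EIi pt]])
    then have h: "\<bar>(\<integral>z. V z \<partial>(dV \<Otimes>\<^sub>M dV)) - (1 / (sqrt \<epsilon> ^ (CARD('d) + 2) * kernel_m2 TYPE('d) k0)) * (\<integral>z. KI z \<partial>(dV \<Otimes>\<^sub>M dV))\<bar> \<le> A * ((3 * \<bar>\<alpha>\<bar> * exp \<bar>\<alpha>\<bar>) + 10 / a) * \<eta> * (1 / (sqrt \<epsilon> ^ (CARD('d) + 2) * kernel_m2 TYPE('d) k0)) * (\<integral>z. EI z \<partial>(dV \<Otimes>\<^sub>M dV))"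
      unfolding Bochner_Integration.integral_diff[OF Vi KIi] Bochner_Integration.integral_mult_right_zero cc_def .
    have eq: "(\<integral>z. graph_kernel CARD('d) (\<lambda>s. k0 (max 0 s)) (kernel_m2 TYPE('d) k0) \<alpha> \<epsilon> \<rho> f (fst z) (snd z) \<partial>(density dV (\<lambda>x. ennreal (p x)) \<Otimes>\<^sub>M density dV (\<lambda>x. ennreal (p x)))) = (\<integral>z. V z \<partial>(dV \<Otimes>\<^sub>M dV))"
      unfolding V_def by (rule integral_pair_density[OF graph_kernel_measurable[OF R]])
    have h1: "\<bar>(\<integral>z. KI z \<partial>(dV \<Otimes>\<^sub>M dV)) - sqrt \<epsilon> ^ (CARD('d) + 2) * kernel_m2 TYPE('d) k0 * dirichlet_form TYPE('d) M dV (\<lambda>x. p x powr (1 + 2 * (\<alpha> - 1) / real CARD('d))) f\<bar> \<le> C1 * (sqrt \<epsilon> ^ (CARD('d) + 2) * \<epsilon>)"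
      using C1(2)[of \<epsilon>] e unfolding KI_def radial_moment_K by blast
    have h2: "\<bar>(\<integral>z. EI z \<partial>(dV \<Otimes>\<^sub>M dV)) - sqrt \<epsilon> ^ (CARD('d) + 2) * radial_moment TYPE('d) (\<lambda>s. exp (- (a / 2) * max 0 s)) 2 * dirichlet_form TYPE('d) M dV (\<lambda>x. p x powr (1 + 2 * (\<alpha> - 1) / real CARD('d))) f\<bar> \<le> C2 * (sqrt \<epsilon> ^ (CARD('d) + 2) * \<epsilon>)"
      using C2(2)[of \<epsilon>] e unfolding EI_def by blast
    have S: "sqrt \<epsilon> ^ (CARD('d) + 2) > 0" using e by simp
    have \<eta>1: "\<eta> \<le> 1" using \<eta> by simp
    show ?thesis unfolding eq
      by (rule bias_bound[OF S m less_imp_le[OF c0] \<eta>(1) \<eta>1 e(1) less_imp_le[OF C2(1)] h h1 h2])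
  qed
  show ?thesis
    by (rule exI[of _ "(C1 + A * ((3 * \<bar>\<alpha>\<bar> * exp \<bar>\<alpha>\<bar>) + 10 / a) * C2) / kernel_m2 TYPE('d) k0"], rule conjI[OF Cpos], intro allI impI, rule main)
qed

text \<open>The exponent of \<open>p\<close> is
  \<open>2 * (1 + 2 * \<alpha> / d) - (d + 4) / d\<close>. The energy with \<open>n = 4\<close> is
  of order \<open>sqrt \<epsilon> ^ (d + 4)\<close>, and the squared normalization divides by
  \<open>sqrt \<epsilon> ^ (2 * d + 4)\<close>; the quotient is of order
  \<open>\<epsilon> powr (- d / 2)\<close>.\<close>

lemma second_moment_bound:
  "\<exists>C>0. \<forall>\<epsilon> \<eta> \<rho>. bandwidth_approx M (\<lambda>x. p x powr (- 1 / real CARD('d))) \<epsilon> \<eta> \<rho> \<longrightarrow> (\<integral>z. (graph_kernel CARD('d) (\<lambda>s. k0 (max 0 s)) (kernel_m2 TYPE('d) k0) \<alpha> \<epsilon> \<rho> f (fst z) (snd z))\<^sup>2 \<partial>(density dV (\<lambda>x. ennreal (p x)) \<Otimes>\<^sub>M density dV (\<lambda>x. ennreal (p x))))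
     \<le> (A * (1 + (3 * \<bar>\<alpha>\<bar> * exp \<bar>\<alpha>\<bar>) * \<eta>) / kernel_m2 TYPE('d) k0)\<^sup>2 * (radial_moment TYPE('d) (\<lambda>s. exp (- (a / 2) * max 0 s)) 4 * (\<integral>x. norm (manifold_grad TYPE('d) M f x) ^ 4 * p x powr (1 + 4 * (\<alpha> - 1) / real CARD('d)) \<partial>dV) + C * \<epsilon>) / sqrt \<epsilon> ^ CARD('d)"
proof -
  have a2: "a / 2 > 0" using Aa by simp
  have ex: "2 * (1 + 2 * \<alpha> / real CARD('d)) - (real CARD('d) + real 4) / real CARD('d) = 1 + 4 * (\<alpha> - 1) / real CARD('d)"
    by (simp add: field_simps)
  have V4q: "(\<integral>x. norm (manifold_grad TYPE('d) M f x) ^ 4 * p x powr (1 + 4 * (\<alpha> - 1) / real CARD('d)) \<partial>dV) = (\<integral>x. p x powr (1 + 4 * (\<alpha> - 1) / real CARD('d)) * norm (manifold_grad TYPE('d) M f x) ^ 4 \<partial>dV)"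
    by (simp add: mult.commute)
  have e2: "\<exists>C>0. \<forall>\<epsilon>. 0 < \<epsilon> \<and> \<epsilon> \<le> 1 \<longrightarrow> \<bar>(\<integral>z. kernel_energy_integrand (\<lambda>s. exp (- (a / 2) * max 0 s)) (\<lambda>x. p x powr (1 / real CARD('d))) f (\<lambda>x. p x powr (1 + 2 * \<alpha> / real CARD('d))) 4 \<epsilon> (fst z) (snd z) \<partial>(dV \<Otimes>\<^sub>M dV))
       - sqrt \<epsilon> ^ (CARD('d) + 4) * radial_moment TYPE('d) (\<lambda>s. exp (- (a / 2) * max 0 s)) 4 * (\<integral>x. norm (manifold_grad TYPE('d) M f x) ^ 4 * p x powr (1 + 4 * (\<alpha> - 1) / real CARD('d)) \<partial>dV)\<bar> \<le> C * (sqrt \<epsilon> ^ (CARD('d) + 4) * \<epsilon>)"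
    unfolding V4q by (rule energy_limit[OF kernel_EK(1) a2 kernel_EK(2,3) _ ex]) simp_all
  obtain C where C: "C > 0" "\<And>\<epsilon>. 0 < \<epsilon> \<and> \<epsilon> \<le> 1 \<Longrightarrow> \<bar>(\<integral>z. kernel_energy_integrand (\<lambda>s. exp (- (a / 2) * max 0 s)) (\<lambda>x. p x powr (1 / real CARD('d))) f (\<lambda>x. p x powr (1 + 2 * \<alpha> / real CARD('d))) 4 \<epsilon> (fst z) (snd z) \<partial>(dV \<Otimes>\<^sub>M dV))
       - sqrt \<epsilon> ^ (CARD('d) + 4) * radial_moment TYPE('d) (\<lambda>s. exp (- (a / 2) * max 0 s)) 4 * (\<integral>x. norm (manifold_grad TYPE('d) M f x) ^ 4 * p x powr (1 + 4 * (\<alpha> - 1) / real CARD('d)) \<partial>dV)\<bar> \<le> C * (sqrt \<epsilon> ^ (CARD('d) + 4) * \<epsilon>)"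
    using e2 by blast
  have m: "kernel_m2 TYPE('d) k0 > 0" by (rule kernel_m2_pos[OF adm])
  have main: "(\<integral>z. (graph_kernel CARD('d) (\<lambda>s. k0 (max 0 s)) (kernel_m2 TYPE('d) k0) \<alpha> \<epsilon> \<rho> f (fst z) (snd z))\<^sup>2 \<partial>(density dV (\<lambda>x. ennreal (p x)) \<Otimes>\<^sub>M density dV (\<lambda>x. ennreal (p x))))
     \<le> (A * (1 + (3 * \<bar>\<alpha>\<bar> * exp \<bar>\<alpha>\<bar>) * \<eta>) / kernel_m2 TYPE('d) k0)\<^sup>2 * (radial_moment TYPE('d) (\<lambda>s. exp (- (a / 2) * max 0 s)) 4 * (\<integral>x. norm (manifold_grad TYPE('d) M f x) ^ 4 * p x powr (1 + 4 * (\<alpha> - 1) / real CARD('d)) \<partial>dV) + C * \<epsilon>) / sqrt \<epsilon> ^ CARD('d)"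
    if R: "bandwidth_approx M (\<lambda>x. p x powr (- 1 / real CARD('d))) \<epsilon> \<eta> \<rho>" for \<epsilon> \<eta> \<rho>
  proof -
    note e = bandwidth_approxD(1,2)[OF R]
    define EI where "EI = (\<lambda>z. kernel_energy_integrand (\<lambda>s. exp (- (a / 2) * max 0 s)) (\<lambda>x. p x powr (1 / real CARD('d))) f (\<lambda>x. p x powr (1 + 2 * \<alpha> / real CARD('d))) 4 \<epsilon> (fst z) (snd z))"
    define V where "V = (\<lambda>z. p (fst z) * p (snd z) * (graph_kernel CARD('d) (\<lambda>s. k0 (max 0 s)) (kernel_m2 TYPE('d) k0) \<alpha> \<epsilon> \<rho> f (fst z) (snd z))\<^sup>2)"
    define cc where "cc = (A * (1 + (3 * \<bar>\<alpha>\<bar> * exp \<bar>\<alpha>\<bar>) * \<eta>) * (1 / (sqrt \<epsilon> ^ (CARD('d) + 2) * kernel_m2 TYPE('d) k0)))\<^sup>2"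
    have EIi: "integrable (dV \<Otimes>\<^sub>M dV) (\<lambda>z. cc * EI z)" unfolding EI_def by (intro integrable_mult_right integrable_energy_EK e) simp
    have Wm: "(\<lambda>z. (graph_kernel CARD('d) (\<lambda>s. k0 (max 0 s)) (kernel_m2 TYPE('d) k0) \<alpha> \<epsilon> \<rho> f (fst z) (snd z))\<^sup>2) \<in> borel_measurable (dV \<Otimes>\<^sub>M dV)"
      by (intro borel_measurable_power graph_kernel_measurable[OF R])
    have Vm: "V \<in> borel_measurable (dV \<Otimes>\<^sub>M dV)"
      unfolding V_def by (intro borel_measurable_times[OF density_pair_measurable Wm])
    have pt: "V z \<le> cc * EI z" if "z \<in> space (dV \<Otimes>\<^sub>M dV)" for z
      unfolding V_def EI_def cc_def by (rule graph_kernel_pointwise(4)[OF R]) (use space_pair_volume[OF that] in auto)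
    have V0: "0 \<le> V z" if "z \<in> space (dV \<Otimes>\<^sub>M dV)" for z
      unfolding V_def using space_pair_volume[OF that] density_pos by (intro mult_nonneg_nonneg) (auto intro: less_imp_le)
    have Vi: "integrable (dV \<Otimes>\<^sub>M dV) V"
      by (rule Bochner_Integration.integrable_bound[OF EIi Vm]) (rule AE_I2, use pt V0 in \<open>fastforce\<close>)
    have "(\<integral>z. (graph_kernel CARD('d) (\<lambda>s. k0 (max 0 s)) (kernel_m2 TYPE('d) k0) \<alpha> \<epsilon> \<rho> f (fst z) (snd z))\<^sup>2 \<partial>(density dV (\<lambda>x. ennreal (p x)) \<Otimes>\<^sub>M density dV (\<lambda>x. ennreal (p x)))) = (\<integral>z. V z \<partial>(dV \<Otimes>\<^sub>M dV))"
      unfolding V_def by (rule integral_pair_density[OF Wm])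
    also have "\<dots> \<le> (\<integral>z. cc * EI z \<partial>(dV \<Otimes>\<^sub>M dV))" by (rule integral_mono[OF Vi EIi pt])
    also have "\<dots> = cc * (\<integral>z. EI z \<partial>(dV \<Otimes>\<^sub>M dV))" by simp
    also have "\<dots> \<le> cc * (sqrt \<epsilon> ^ (CARD('d) + 4) * radial_moment TYPE('d) (\<lambda>s. exp (- (a / 2) * max 0 s)) 4 * (\<integral>x. norm (manifold_grad TYPE('d) M f x) ^ 4 * p x powr (1 + 4 * (\<alpha> - 1) / real CARD('d)) \<partial>dV) + C * (sqrt \<epsilon> ^ (CARD('d) + 4) * \<epsilon>))"
    proof (rule mult_left_mono)
      have "\<bar>(\<integral>z. EI z \<partial>(dV \<Otimes>\<^sub>M dV)) - sqrt \<epsilon> ^ (CARD('d) + 4) * radial_moment TYPE('d) (\<lambda>s. exp (- (a / 2) * max 0 s)) 4 * (\<integral>x. norm (manifold_grad TYPE('d) M f x) ^ 4 * p x powr (1 + 4 * (\<alpha> - 1) / real CARD('d)) \<partial>dV)\<bar> \<le> C * (sqrt \<epsilon> ^ (CARD('d) + 4) * \<epsilon>)"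
        using C(2)[of \<epsilon>] e unfolding EI_def by blast
      then show "(\<integral>z. EI z \<partial>(dV \<Otimes>\<^sub>M dV)) \<le> sqrt \<epsilon> ^ (CARD('d) + 4) * radial_moment TYPE('d) (\<lambda>s. exp (- (a / 2) * max 0 s)) 4 * (\<integral>x. norm (manifold_grad TYPE('d) M f x) ^ 4 * p x powr (1 + 4 * (\<alpha> - 1) / real CARD('d)) \<partial>dV) + C * (sqrt \<epsilon> ^ (CARD('d) + 4) * \<epsilon>)"
        unfolding abs_le_iff by argo
    qed (simp add: cc_def)
    also have "\<dots> = cc * sqrt \<epsilon> ^ (CARD('d) + 4) * (radial_moment TYPE('d) (\<lambda>s. exp (- (a / 2) * max 0 s)) 4 * (\<integral>x. norm (manifold_grad TYPE('d) M f x) ^ 4 * p x powr (1 + 4 * (\<alpha> - 1) / real CARD('d)) \<partial>dV) + C * \<epsilon>)" by (simp add: algebra_simps)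
    also have "cc * sqrt \<epsilon> ^ (CARD('d) + 4) = (A * (1 + (3 * \<bar>\<alpha>\<bar> * exp \<bar>\<alpha>\<bar>) * \<eta>) / kernel_m2 TYPE('d) k0)\<^sup>2 / sqrt \<epsilon> ^ CARD('d)"
    proof -
      have s: "sqrt \<epsilon> > 0" using e by simp
      have "cc = (A * (1 + (3 * \<bar>\<alpha>\<bar> * exp \<bar>\<alpha>\<bar>) * \<eta>) / kernel_m2 TYPE('d) k0)\<^sup>2 * (1 / (sqrt \<epsilon> ^ (CARD('d) + 2))\<^sup>2)"
        unfolding cc_def by (simp add: power_mult_distrib power_divide)
      moreover have "(sqrt \<epsilon> ^ (CARD('d) + 2))\<^sup>2 = sqrt \<epsilon> ^ CARD('d) * sqrt \<epsilon> ^ (CARD('d) + 4)"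
        unfolding power_mult[symmetric] power_add[symmetric] by (rule arg_cong[where f = "(^) (sqrt \<epsilon>)"]) simp
      ultimately show ?thesis using s by simp
    qed
    finally show ?thesis by simp
  qed
  show ?thesis by (rule exI[of _ C], rule conjI[OF C(1)], intro allI impI, rule main)
qed

text \<open>The normalization alone is of order \<open>\<epsilon> powr (- d / 2 - 1)\<close>. The
  Lipschitz bound regains one power of \<epsilon>, since \<open>(f x - f y)^2\<close> is at most a
  multiple of \<open>\<epsilon> * s\<close> and \<open>s * exp (- (a / 2) * s)\<close> is bounded.
  For locally constant \<open>f\<close> only pairs at a fixed distance contribute, and there the
  exponential beats every power of \<epsilon>.\<close>

lemma graph_kernel_le:
  "\<exists>L>0. \<forall>\<epsilon> \<eta> \<rho>. bandwidth_approx M (\<lambda>x. p x powr (- 1 / real CARD('d))) \<epsilon> \<eta> \<rho> \<longrightarrow> (\<forall>x\<in>M. \<forall>y\<in>M. graph_kernel CARD('d) (\<lambda>s. k0 (max 0 s)) (kernel_m2 TYPE('d) k0) \<alpha> \<epsilon> \<rho> f x y \<le> L / sqrt \<epsilon> ^ CARD('d))"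
  and graph_kernel_locally_constant:
  "r0 > 0 \<Longrightarrow> (\<And>x y. x \<in> M \<Longrightarrow> y \<in> M \<Longrightarrow> norm (x - y) < r0 \<Longrightarrow> f x = f y) \<Longrightarrow>
   \<exists>C>0. \<forall>\<epsilon> \<eta> \<rho>. bandwidth_approx M (\<lambda>x. p x powr (- 1 / real CARD('d))) \<epsilon> \<eta> \<rho> \<longrightarrow> (\<forall>x\<in>M. \<forall>y\<in>M. graph_kernel CARD('d) (\<lambda>s. k0 (max 0 s)) (kernel_m2 TYPE('d) k0) \<alpha> \<epsilon> \<rho> f x y \<le> C * \<epsilon>)"
proof -
  let ?P = "\<lambda>x. p x powr (\<alpha> / real CARD('d))"
  have bdd: "\<exists>B>0. \<forall>x\<in>M. \<bar>g x\<bar> \<le> B" if "continuous_on M g" for g :: "'a \<Rightarrow> real"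
    using compact_imp_bounded[OF compact_continuous_image[OF that M(1)]] unfolding bounded_pos by auto
  have "continuous_on M ?P" using density_powr_lip2[of "\<alpha> / real CARD('d)"] by (simp add: lip2_fun_def)
  from bdd[OF this] obtain B where B: "B > 0" "\<And>x. x \<in> M \<Longrightarrow> ?P x \<le> B" by auto
  from bdd[OF smooth_fun_continuous_on[OF M(2) f]] obtain F where F: "F > 0" "\<And>x. x \<in> M \<Longrightarrow> \<bar>f x\<bar> \<le> F" by auto
  from smooth_fun_lipschitz[OF M f] obtain Lf where Lf: "Lf > 0" "\<And>x y. x \<in> M \<Longrightarrow> y \<in> M \<Longrightarrow> \<bar>f x - f y\<bar> \<le> Lf * norm (x - y)" by blast
  define q0 where "q0 = pmin powr (1 / real CARD('d))"
  have q0: "q0 > 0" "\<And>x. x \<in> M \<Longrightarrow> q0 \<le> p x powr (1 / real CARD('d))"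
    using p(2,3) unfolding q0_def by (auto intro!: powr_mono2)
  have m: "kernel_m2 TYPE('d) k0 > 0" by (rule kernel_m2_pos[OF adm])
  \<comment> \<open>Uniform in \<eta>: the factor \<open>1 + (3 * \<bar>\<alpha>\<bar> * exp
    \<bar>\<alpha>\<bar>) * \<eta>\<close> is replaced by its value at 1.\<close>
  define H where "H = A * (1 + (3 * \<bar>\<alpha>\<bar> * exp \<bar>\<alpha>\<bar>)) * (B * B) / kernel_m2 TYPE('d) k0"
  have H: "H > 0" using Aa B(1) m unfolding H_def by (intro divide_pos_pos mult_pos_pos add_pos_nonneg) auto
  have V: "graph_kernel CARD('d) (\<lambda>s. k0 (max 0 s)) (kernel_m2 TYPE('d) k0) \<alpha> \<epsilon> \<rho> f x y \<le> H * (1 / sqrt \<epsilon> ^ (CARD('d) + 2)) * (exp (- (a / 2) * s) * (f x - f y)\<^sup>2)"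
      and s0: "s \<ge> 0" and sge: "(norm (x - y))\<^sup>2 * q0\<^sup>2 / \<epsilon> \<le> s"
    if R: "bandwidth_approx M (\<lambda>x. p x powr (- 1 / real CARD('d))) \<epsilon> \<eta> \<rho>" and xy: "x \<in> M" "y \<in> M" and s: "s = (norm (x - y))\<^sup>2 * (p x powr (1 / real CARD('d)) * p y powr (1 / real CARD('d))) / \<epsilon>" for \<epsilon> \<eta> \<rho> x y s
  proof -
    note e = bandwidth_approxD(1,2)[OF R] and \<eta> = bandwidth_approxD(3,4)[OF R]
    have "q0\<^sup>2 \<le> p x powr (1 / real CARD('d)) * p y powr (1 / real CARD('d))" unfolding power2_eq_square using q0(1) q0(2)[OF xy(1)] q0(2)[OF xy(2)] by (intro mult_mono) auto
    then show sge: "(norm (x - y))\<^sup>2 * q0\<^sup>2 / \<epsilon> \<le> s"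
      unfolding s using e by (intro divide_right_mono mult_left_mono) auto
    have "0 \<le> (norm (x - y))\<^sup>2 * q0\<^sup>2 / \<epsilon>" using e by simp
    with sge show "s \<ge> 0" by linarith
    define P where "P = ?P x * ?P y"
    have "A * (1 + (3 * \<bar>\<alpha>\<bar> * exp \<bar>\<alpha>\<bar>) * \<eta>) \<le> A * (1 + (3 * \<bar>\<alpha>\<bar> * exp \<bar>\<alpha>\<bar>))"
      using Aa \<eta> by (intro mult_left_mono add_left_mono mult_left_le) auto
    moreover have "P \<le> B * B" unfolding P_def using B xy by (intro mult_mono) auto
    moreover have "0 \<le> P" by (simp add: P_def)
    ultimately have "(A * (1 + (3 * \<bar>\<alpha>\<bar> * exp \<bar>\<alpha>\<bar>) * \<eta>)) * (1 / (sqrt \<epsilon> ^ (CARD('d) + 2) * kernel_m2 TYPE('d) k0)) * (exp (- (a / 2) * s) * P) * (f x - f y)\<^sup>2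
      \<le> (A * (1 + (3 * \<bar>\<alpha>\<bar> * exp \<bar>\<alpha>\<bar>))) * (1 / (sqrt \<epsilon> ^ (CARD('d) + 2) * kernel_m2 TYPE('d) k0)) * (exp (- (a / 2) * s) * (B * B)) * (f x - f y)\<^sup>2"
      using Aa \<eta> B(1) m e by (intro mult_mono mult_left_mono) auto
    also have "\<dots> = H * (1 / sqrt \<epsilon> ^ (CARD('d) + 2)) * (exp (- (a / 2) * s) * (f x - f y)\<^sup>2)"
      unfolding H_def by (simp add: mult_ac)
    finally have le: "(A * (1 + (3 * \<bar>\<alpha>\<bar> * exp \<bar>\<alpha>\<bar>) * \<eta>)) * (1 / (sqrt \<epsilon> ^ (CARD('d) + 2) * kernel_m2 TYPE('d) k0)) * (exp (- (a / 2) * s) * P) * (f x - f y)\<^sup>2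
      \<le> H * (1 / sqrt \<epsilon> ^ (CARD('d) + 2)) * (exp (- (a / 2) * s) * (f x - f y)\<^sup>2)" .
    have "graph_kernel CARD('d) (\<lambda>s. k0 (max 0 s)) (kernel_m2 TYPE('d) k0) \<alpha> \<epsilon> \<rho> f x y \<le> (A * (1 + (3 * \<bar>\<alpha>\<bar> * exp \<bar>\<alpha>\<bar>) * \<eta>)) * (1 / (sqrt \<epsilon> ^ (CARD('d) + 2) * kernel_m2 TYPE('d) k0)) * (exp (- (a / 2) * s) * P) * (f x - f y)\<^sup>2"
      using graph_kernel_pointwise(3)[OF R xy, of \<alpha>] unfolding s[symmetric] P_def[symmetric] by (simp only: mult.assoc)
    from order_trans[OF this le]
    show "graph_kernel CARD('d) (\<lambda>s. k0 (max 0 s)) (kernel_m2 TYPE('d) k0) \<alpha> \<epsilon> \<rho> f x y \<le> H * (1 / sqrt \<epsilon> ^ (CARD('d) + 2)) * (exp (- (a / 2) * s) * (f x - f y)\<^sup>2)" .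
  qed
  show "\<exists>L>0. \<forall>\<epsilon> \<eta> \<rho>. bandwidth_approx M (\<lambda>x. p x powr (- 1 / real CARD('d))) \<epsilon> \<eta> \<rho> \<longrightarrow> (\<forall>x\<in>M. \<forall>y\<in>M. graph_kernel CARD('d) (\<lambda>s. k0 (max 0 s)) (kernel_m2 TYPE('d) k0) \<alpha> \<epsilon> \<rho> f x y \<le> L / sqrt \<epsilon> ^ CARD('d))"
  proof (rule exI[of _ "H * (Lf\<^sup>2 / q0\<^sup>2 * (2 / a))"], rule conjI, use H Lf(1) q0(1) Aa in simp, intro allI impI ballI)
    fix \<epsilon> \<eta> \<rho> x y assume R: "bandwidth_approx M (\<lambda>x. p x powr (- 1 / real CARD('d))) \<epsilon> \<eta> \<rho>" and xy: "x \<in> M" "y \<in> M"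
    note e = bandwidth_approxD(1,2)[OF R]
    define s where "s = (norm (x - y))\<^sup>2 * (p x powr (1 / real CARD('d)) * p y powr (1 / real CARD('d))) / \<epsilon>"
    note V' = V[OF R xy s_def] and s' = s0[OF R xy s_def] and sg = sge[OF R xy s_def]
    have "(f x - f y)\<^sup>2 \<le> (Lf * norm (x - y))\<^sup>2"
      using Lf(2)[OF xy] by (subst power2_abs[symmetric]) (rule power_mono, auto)
    also have "\<dots> = Lf\<^sup>2 / q0\<^sup>2 * \<epsilon> * ((norm (x - y))\<^sup>2 * q0\<^sup>2 / \<epsilon>)" using e q0 by (simp add: power_mult_distrib)
    also have "\<dots> \<le> Lf\<^sup>2 / q0\<^sup>2 * \<epsilon> * s" using sg e by (intro mult_left_mono) auto
    finally have "exp (- (a / 2) * s) * (f x - f y)\<^sup>2 \<le> exp (- (a / 2) * s) * (Lf\<^sup>2 / q0\<^sup>2 * \<epsilon> * s)" by (intro mult_left_mono) auto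
    also have "\<dots> = Lf\<^sup>2 / q0\<^sup>2 * \<epsilon> * (s ^ 1 * exp (- (a / 2) * s))" by simp
    also have "\<dots> \<le> Lf\<^sup>2 / q0\<^sup>2 * \<epsilon> * (fact 1 / (a / 2) ^ 1)"
      using Aa s' e by (intro mult_left_mono power_times_exp_le) auto
    finally have "H * (1 / sqrt \<epsilon> ^ (CARD('d) + 2)) * (exp (- (a / 2) * s) * (f x - f y)\<^sup>2) \<le> H * (1 / sqrt \<epsilon> ^ (CARD('d) + 2)) * (Lf\<^sup>2 / q0\<^sup>2 * \<epsilon> * (2 / a))"
      using H e by (intro mult_left_mono) auto
    also have "\<dots> = H * (Lf\<^sup>2 / q0\<^sup>2 * (2 / a)) / sqrt \<epsilon> ^ CARD('d)"
    proof -
      have "sqrt \<epsilon> ^ (CARD('d) + 2) = sqrt \<epsilon> ^ CARD('d) * \<epsilon>" using e by (simp add: power_add)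
      show ?thesis unfolding \<open>sqrt \<epsilon> ^ (CARD('d) + 2) = sqrt \<epsilon> ^ CARD('d) * \<epsilon>\<close> using e by simp
    qed
    finally show "graph_kernel CARD('d) (\<lambda>s. k0 (max 0 s)) (kernel_m2 TYPE('d) k0) \<alpha> \<epsilon> \<rho> f x y \<le> H * (Lf\<^sup>2 / q0\<^sup>2 * (2 / a)) / sqrt \<epsilon> ^ CARD('d)" using V' by linarith
  qed
  assume r0: "r0 > 0" and lc: "\<And>x y. x \<in> M \<Longrightarrow> y \<in> M \<Longrightarrow> norm (x - y) < r0 \<Longrightarrow> f x = f y"
  define c where "c = (a / 2) * (r0\<^sup>2 * q0\<^sup>2)"
  have c: "c > 0" using Aa r0 q0(1) by (simp add: c_def)
  \<comment> \<open>The exponent \<open>d + 2\<close> in \<open>exp_inverse_le_power\<close> cancels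
    the normalization and leaves one factor \<epsilon>.\<close>
  define C where "C = H * ((2 * F)\<^sup>2 * (fact (CARD('d) + 2 + 1) / c ^ (CARD('d) + 2 + 1)))"
  have C: "C > 0" using H F(1) c unfolding C_def by (intro mult_pos_pos divide_pos_pos zero_less_power) auto
  show "\<exists>C>0. \<forall>\<epsilon> \<eta> \<rho>. bandwidth_approx M (\<lambda>x. p x powr (- 1 / real CARD('d))) \<epsilon> \<eta> \<rho> \<longrightarrow> (\<forall>x\<in>M. \<forall>y\<in>M. graph_kernel CARD('d) (\<lambda>s. k0 (max 0 s)) (kernel_m2 TYPE('d) k0) \<alpha> \<epsilon> \<rho> f x y \<le> C * \<epsilon>)"
  proof (rule exI[of _ C], rule conjI[OF C], intro allI impI ballI)
    fix \<epsilon> \<eta> \<rho> x y assume R: "bandwidth_approx M (\<lambda>x. p x powr (- 1 / real CARD('d))) \<epsilon> \<eta> \<rho>" and xy: "x \<in> M" "y \<in> M"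
    note e = bandwidth_approxD(1,2)[OF R]
    show "graph_kernel CARD('d) (\<lambda>s. k0 (max 0 s)) (kernel_m2 TYPE('d) k0) \<alpha> \<epsilon> \<rho> f x y \<le> C * \<epsilon>"
    proof (cases "norm (x - y) < r0")
      case True
      then have "graph_kernel CARD('d) (\<lambda>s. k0 (max 0 s)) (kernel_m2 TYPE('d) k0) \<alpha> \<epsilon> \<rho> f x y = 0" using lc[OF xy] by (simp add: graph_kernel_def)
      then show ?thesis using C e by simp
    next
      case False
      define s where "s = (norm (x - y))\<^sup>2 * (p x powr (1 / real CARD('d)) * p y powr (1 / real CARD('d))) / \<epsilon>"
      note V' = V[OF R xy s_def] and sg = sge[OF R xy s_def]
      have "r0\<^sup>2 \<le> (norm (x - y))\<^sup>2" using False r0 by (intro power_mono) auto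
      then have "r0\<^sup>2 * q0\<^sup>2 / \<epsilon> \<le> (norm (x - y))\<^sup>2 * q0\<^sup>2 / \<epsilon>" using e by (intro divide_right_mono mult_right_mono) auto
      with sg have "r0\<^sup>2 * q0\<^sup>2 / \<epsilon> \<le> s" by linarith
      then have "(a / 2) * (r0\<^sup>2 * q0\<^sup>2 / \<epsilon>) \<le> (a / 2) * s" using Aa by (intro mult_left_mono) auto
      then have "exp (- (a / 2) * s) \<le> exp (- c / \<epsilon>)" by (simp add: c_def)
      also have "\<dots> \<le> fact (CARD('d) + 2 + 1) / c ^ (CARD('d) + 2 + 1) * (sqrt \<epsilon> ^ (CARD('d) + 2) * \<epsilon>)"
        by (rule exp_inverse_le_power[OF c e])
      finally have E: "exp (- (a / 2) * s) \<le> fact (CARD('d) + 2 + 1) / c ^ (CARD('d) + 2 + 1) * (sqrt \<epsilon> ^ (CARD('d) + 2) * \<epsilon>)" .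
      have "\<bar>f x - f y\<bar> \<le> 2 * F" using F(2)[OF xy(1)] F(2)[OF xy(2)] by linarith
      then have "(f x - f y)\<^sup>2 \<le> (2 * F)\<^sup>2" by (subst power2_abs[symmetric]) (rule power_mono, auto)
      then have "exp (- (a / 2) * s) * (f x - f y)\<^sup>2 \<le> (fact (CARD('d) + 2 + 1) / c ^ (CARD('d) + 2 + 1) * (sqrt \<epsilon> ^ (CARD('d) + 2) * \<epsilon>)) * (2 * F)\<^sup>2"
        using E c e by (intro mult_mono) auto
      then have "H * (1 / sqrt \<epsilon> ^ (CARD('d) + 2)) * (exp (- (a / 2) * s) * (f x - f y)\<^sup>2)
         \<le> H * (1 / sqrt \<epsilon> ^ (CARD('d) + 2)) * ((fact (CARD('d) + 2 + 1) / c ^ (CARD('d) + 2 + 1) * (sqrt \<epsilon> ^ (CARD('d) + 2) * \<epsilon>)) * (2 * F)\<^sup>2)"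
        using H e by (intro mult_left_mono) auto
      also have "\<dots> = C * \<epsilon>"
      proof -
        have "sqrt \<epsilon> ^ (CARD('d) + 2) \<noteq> 0" using e by simp
        then show ?thesis unfolding C_def by (simp del: power_add)
      qed
      finally show ?thesis using V' by linarith
    qed
  qed
qed

section \<open>Deviation of the graph form\<close>

lemma volume_nonempty: "M \<noteq> {}"
proof
  assume "M = {}"
  then have "(\<integral>x. p x \<partial>dV) = (\<integral>x. 0 \<partial>dV)"
    by (intro Bochner_Integration.integral_cong refl) (simp add: space_volume[OF vol])
  then show False using p1 by simp
qed

text \<open>Translates the extended-real supremum into pointwise bounds; a point of \<open>M\<close>
  shows that the error bound is positive.\<close>

lemma bandwidth_regimeD:
  assumes reg: "bandwidth_regime TYPE('d) M p \<epsilon> \<eta> Ny k y" and N: "N > 0" "\<epsilon> N \<le> 1"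
  shows "bandwidth_approx M (\<lambda>x. p x powr (- 1 / real CARD('d))) (\<epsilon> N) (\<eta> N) (knn_bandwidth TYPE('d) (Ny N) (y N) (k N))"
proof -
  let ?r = "knn_bandwidth TYPE('d) (Ny N) (y N) (k N)" and ?b = "\<lambda>x. p x powr (- 1 / real CARD('d))"
  have h: "\<epsilon> N > 0" "1 \<le> k N" "k N \<le> Ny N" "\<eta> N < 0.1"
    "(SUP x\<in>M. ereal (\<bar>?r x - ?b x\<bar> / \<bar>?b x\<bar>)) < ereal (\<eta> N)"
    using reg N(1) unfolding bandwidth_regime_def Let_def by blast+
  have lt: "\<bar>?r x - ?b x\<bar> / \<bar>?b x\<bar> < \<eta> N" if "x \<in> M" for x
    using le_less_trans[OF SUP_upper[OF that] h(5)] by simp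
  obtain x where x: "x \<in> M" using volume_nonempty by blast
  have "0 \<le> \<bar>?r x - ?b x\<bar> / \<bar>?b x\<bar>" by simp
  with lt[OF x] have "\<eta> N > 0" by linarith
  moreover have "\<bar>?r x - ?b x\<bar> \<le> \<eta> N * ?b x" if "x \<in> M" for x
  proof -
    have "?b x > 0" using density_pos[OF that] by simp
    then show ?thesis using lt[OF that] by (simp add: pos_divide_less_eq)
  qed
  moreover have "continuous_on M ?r" by (rule continuous_on_knn_bandwidth[OF h(2,3)])
  ultimately show ?thesis using h N(2) unfolding bandwidth_approx_def by simp
qed

text \<open>A relative error below 1 keeps the bandwidth nonnegative at the data.\<close>

lemma graph_dirichlet_form_V_statistic:
  assumes R: "bandwidth_approx M (\<lambda>x. p x powr (- 1 / real CARD('d))) \<epsilon> \<eta> \<rho>" and x: "\<And>i. i < N \<Longrightarrow> x i \<in> M"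
  shows "graph_dirichlet_form TYPE('d) k0 \<alpha> \<epsilon> \<rho> N x f = (\<Sum>i<N. \<Sum>j<N. graph_kernel CARD('d) (\<lambda>s. k0 (max 0 s)) (kernel_m2 TYPE('d) k0) \<alpha> \<epsilon> \<rho> f (x i) (x j)) / (real N)\<^sup>2"
proof (rule graph_dirichlet_form_eq[OF bandwidth_approxD(1)[OF R]])
  fix i assume "i < N"
  then have b: "p (x i) powr (- 1 / real CARD('d)) > 0" using density_pos[OF x[OF \<open>i < N\<close>]] by simp
  have "\<eta> * p (x i) powr (- 1 / real CARD('d)) \<le> 1 * p (x i) powr (- 1 / real CARD('d))"
    using bandwidth_approxD(4)[OF R] b by (intro mult_right_mono) auto
  then show "0 \<le> \<rho> (x i)" using bandwidth_approxD(6)[OF R x[OF \<open>i < N\<close>]] by linarith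
qed

text \<open>As \<open>p\<close> is positive, a vanishing integral makes the gradient 0 almost
  everywhere, and openness of the set of nonzero gradients removes the exceptional set. This is the
  case in which the fluctuation term offers no room.\<close>

lemma fourth_moment_pos_or_locally_constant:
  assumes "(\<integral>x. norm (manifold_grad TYPE('d) M f x) ^ 4 * p x powr (1 + 4 * (\<alpha> - 1) / real CARD('d)) \<partial>dV) = 0"
  shows "dirichlet_form TYPE('d) M dV (\<lambda>x. p x powr (1 + 2 * (\<alpha> - 1) / real CARD('d))) f = 0" "\<exists>r>0. \<forall>x\<in>M. \<forall>y\<in>M. norm (x - y) < r \<longrightarrow> f x = f y"
proof -
  let ?c = "1 + 4 * (\<alpha> - 1) / real CARD('d)"
  let ?g = "\<lambda>x. norm (manifold_grad TYPE('d) M f x) ^ 4 * p x powr ?c"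
  have pc: "continuous_on M (\<lambda>x. p x powr ?c)" using density_powr_lip2[of ?c] by (simp add: lip2_fun_def)
  from compact_imp_bounded[OF compact_continuous_image[OF pc M(1)]]
  obtain B where B: "B > 0" "\<And>x. x \<in> M \<Longrightarrow> p x powr ?c \<le> B" unfolding bounded_pos by auto
  obtain G where G: "\<And>x. x \<in> M \<Longrightarrow> norm (manifold_grad TYPE('d) M f x) \<le> G"
    using manifold_grad_bounded[OF M f] by blast
  have gm: "?g \<in> borel_measurable dV"
    by (intro borel_measurable_times borel_measurable_power measurable_norm_manifold_grad[OF M f vol]
        borel_measurable_volume_continuous_on[OF vol pc])
  have gi: "integrable dV ?g"
  proof (rule finite_measure.integrable_const_bound[OF finite_volume _ gm, of "G ^ 4 * B"], rule AE_I2)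
    fix x assume "x \<in> space dV"
    then have x: "x \<in> M" by (simp add: space_volume[OF vol])
    have "0 \<le> G" using order_trans[OF norm_ge_zero G[OF x]] .
    then have "?g x \<le> G ^ 4 * B" using G[OF x] B(2)[OF x] by (intro mult_mono power_mono) auto
    then show "norm (?g x) \<le> G ^ 4 * B" by simp
  qed
  have "AE x in dV. ?g x = 0"
    using integral_nonneg_eq_0_iff_AE[OF gi] assms by simp
  moreover have "AE x in dV. 0 < p x" using density_pos by (intro AE_I2) (simp add: space_volume[OF vol])
  ultimately have "AE x in dV. manifold_grad TYPE('d) M f x = 0" by eventually_elim simp
  then have z: "manifold_grad TYPE('d) M f x = 0" if "x \<in> M" for x
    by (rule manifold_grad_zero_of_AE[OF M f vol]) (rule that)
  then show "\<exists>r>0. \<forall>x\<in>M. \<forall>y\<in>M. norm (x - y) < r \<longrightarrow> f x = f y"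
    by (rule locally_constant_of_manifold_grad_zero[OF M f])
  have "dirichlet_form TYPE('d) M dV (\<lambda>x. p x powr (1 + 2 * (\<alpha> - 1) / real CARD('d))) f = (\<integral>x. 0 \<partial>dV)"
    unfolding dirichlet_form_def by (intro Bochner_Integration.integral_cong refl) (simp add: space_volume[OF vol] z)
  then show "dirichlet_form TYPE('d) M dV (\<lambda>x. p x powr (1 + 2 * (\<alpha> - 1) / real CARD('d))) f = 0" by simp
qed

lemma iid_sample_in_M:
  assumes "iid_sample \<Omega> (density dV (\<lambda>x. ennreal (p x))) N X" "i < N" "\<omega> \<in> space \<Omega>"
  shows "X i \<omega> \<in> M"
proof -
  interpret prob_space \<Omega> using assms(1) by (simp add: iid_sample_def)
  have "indep_vars (\<lambda>_. (density dV (\<lambda>x. ennreal (p x)))) X {..<N}" using assms(1) by (simp add: iid_sample_def)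
  then have "X i \<in> \<Omega> \<rightarrow>\<^sub>M (density dV (\<lambda>x. ennreal (p x)))" using assms(2) unfolding indep_vars_def2 by simp
  from measurable_space[OF this assms(3)] show ?thesis by (simp add: space_volume[OF vol])
qed

text \<open>Turns the event into a sublevel set of a measurable function, for which monotonicity of
  the measure can be used.\<close>

lemma deviation_event_eq:
  assumes R: "bandwidth_approx M (\<lambda>x. p x powr (- 1 / real CARD('d))) \<epsilon> \<eta> \<rho>" and iid: "iid_sample \<Omega> (density dV (\<lambda>x. ennreal (p x))) N X" and R123: "R1 \<ge> 0" "R2 \<ge> 0" "R3 \<ge> 0"
  shows "{\<omega> \<in> space \<Omega>. \<exists>r1 r2 r3. \<bar>r1\<bar> \<le> R1 \<and> \<bar>r2\<bar> \<le> R2 \<and> \<bar>r3\<bar> \<le> R3 \<and>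
      graph_dirichlet_form TYPE('d) k0 \<alpha> \<epsilon> \<rho> N (\<lambda>i. X i \<omega>) f = dirichlet_form TYPE('d) M dV (\<lambda>x. p x powr (1 + 2 * (\<alpha> - 1) / real CARD('d))) f * (1 + r1) + r2 + r3}
    = {\<omega> \<in> space \<Omega>. \<bar>(\<Sum>i<N. \<Sum>j<N. graph_kernel CARD('d) (\<lambda>s. k0 (max 0 s)) (kernel_m2 TYPE('d) k0) \<alpha> \<epsilon> \<rho> f (X i \<omega>) (X j \<omega>)) / (real N)\<^sup>2 - dirichlet_form TYPE('d) M dV (\<lambda>x. p x powr (1 + 2 * (\<alpha> - 1) / real CARD('d))) f\<bar> \<le> R1 * dirichlet_form TYPE('d) M dV (\<lambda>x. p x powr (1 + 2 * (\<alpha> - 1) / real CARD('d))) f + R2 + R3}"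
proof (intro Collect_cong conj_cong refl)
  fix \<omega> assume w: "\<omega> \<in> space \<Omega>"
  have EE0: "0 \<le> dirichlet_form TYPE('d) M dV (\<lambda>x. p x powr (1 + 2 * (\<alpha> - 1) / real CARD('d))) f" unfolding dirichlet_form_def by (intro Bochner_Integration.integral_nonneg) simp
  have eq: "graph_dirichlet_form TYPE('d) k0 \<alpha> \<epsilon> \<rho> N (\<lambda>i. X i \<omega>) f = (\<Sum>i<N. \<Sum>j<N. graph_kernel CARD('d) (\<lambda>s. k0 (max 0 s)) (kernel_m2 TYPE('d) k0) \<alpha> \<epsilon> \<rho> f (X i \<omega>) (X j \<omega>)) / (real N)\<^sup>2"
    by (rule graph_dirichlet_form_V_statistic[OF R]) (rule iid_sample_in_M[OF iid _ w])
  show "(\<exists>r1 r2 r3. \<bar>r1\<bar> \<le> R1 \<and> \<bar>r2\<bar> \<le> R2 \<and> \<bar>r3\<bar> \<le> R3 \<and>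
      graph_dirichlet_form TYPE('d) k0 \<alpha> \<epsilon> \<rho> N (\<lambda>i. X i \<omega>) f = dirichlet_form TYPE('d) M dV (\<lambda>x. p x powr (1 + 2 * (\<alpha> - 1) / real CARD('d))) f * (1 + r1) + r2 + r3)
    \<longleftrightarrow> \<bar>(\<Sum>i<N. \<Sum>j<N. graph_kernel CARD('d) (\<lambda>s. k0 (max 0 s)) (kernel_m2 TYPE('d) k0) \<alpha> \<epsilon> \<rho> f (X i \<omega>) (X j \<omega>)) / (real N)\<^sup>2 - dirichlet_form TYPE('d) M dV (\<lambda>x. p x powr (1 + 2 * (\<alpha> - 1) / real CARD('d))) f\<bar> \<le> R1 * dirichlet_form TYPE('d) M dV (\<lambda>x. p x powr (1 + 2 * (\<alpha> - 1) / real CARD('d))) f + R2 + R3"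
    unfolding eq by (rule error_split[OF EE0 R123])
qed

text \<open>The \<epsilon> remainder takes its constant from the bias or, when the fourth-moment
  integral is 0, from the uniform bound on the kernel. The fluctuation constant stays free of
  \<alpha>, \<open>f\<close> and \<open>p\<close> because \<open>N\<close> is taken large depending
  on them.\<close>

theorem graph_dirichlet_form_concentration:
  assumes Ca: "(A * ((3 * \<bar>\<alpha>\<bar> * exp \<bar>\<alpha>\<bar>) + 10 / a)) * radial_moment TYPE('d) (\<lambda>s. exp (- (a / 2) * max 0 s)) 2 / kernel_m2 TYPE('d) k0 \<le> C\<alpha>" "C\<alpha> > 0"
  shows "\<exists>Cfp>0. \<forall>\<epsilon> e\<rho> Ny k y. bandwidth_regime TYPE('d) M p \<epsilon> e\<rho> Ny k y \<longrightarrow>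
      (\<forall>\<^sub>F N in sequentially. \<forall>(\<Omega> :: 'w measure) X. iid_sample \<Omega> (density dV (\<lambda>x. ennreal (p x))) N X \<longrightarrow>
        measure \<Omega> {\<omega> \<in> space \<Omega>. \<exists>r\<^sub>\<rho> r\<^sub>\<epsilon> r\<^sub>N. \<bar>r\<^sub>\<rho>\<bar> \<le> C\<alpha> * e\<rho> N \<and> \<bar>r\<^sub>\<epsilon>\<bar> \<le> Cfp * \<epsilon> N \<and>
            \<bar>r\<^sub>N\<bar> \<le> (27 * sqrt (2 * A\<^sup>2 * (radial_moment TYPE('d) (\<lambda>s. exp (- (a / 2) * max 0 s)) 4 + 1) / (kernel_m2 TYPE('d) k0)\<^sup>2)) * sqrt (ln (real N) / (real N * \<epsilon> N powr (real CARD('d) / 2)) * (\<integral>x. norm (manifold_grad TYPE('d) M f x) ^ 4 * p x powr (1 + 4 * (\<alpha> - 1) / real CARD('d)) \<partial>dV)) \<and>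
            graph_dirichlet_form TYPE('d) k0 \<alpha> (\<epsilon> N) (knn_bandwidth TYPE('d) (Ny N) (y N) (k N)) N (\<lambda>i. X i \<omega>) f = dirichlet_form TYPE('d) M dV (\<lambda>x. p x powr (1 + 2 * (\<alpha> - 1) / real CARD('d))) f * (1 + r\<^sub>\<rho>) + r\<^sub>\<epsilon> + r\<^sub>N}
          > 1 - 2 / real N ^ 10)"
proof -
  \<comment> \<open>For large \<open>N\<close> the factor 2 bounds the square of the
    \<alpha>-dependent factor, and the 1 next to the moment covers the
    \<epsilon>-correction.\<close>
  let ?Cn = "2 * A\<^sup>2 * (radial_moment TYPE('d) (\<lambda>s. exp (- (a / 2) * max 0 s)) 4 + 1) / (kernel_m2 TYPE('d) k0)\<^sup>2"
  have m: "kernel_m2 TYPE('d) k0 > 0" by (rule kernel_m2_pos[OF adm])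
  have M4: "0 \<le> radial_moment TYPE('d) (\<lambda>s. exp (- (a / 2) * max 0 s)) 4" by (rule radial_moment_EK_nonneg) simp
  have Cn: "?Cn > 0" using Aa(1) m M4 by (intro divide_pos_pos mult_pos_pos) auto
  have V40: "0 \<le> (\<integral>x. norm (manifold_grad TYPE('d) M f x) ^ 4 * p x powr (1 + 4 * (\<alpha> - 1) / real CARD('d)) \<partial>dV)" by (intro Bochner_Integration.integral_nonneg) simp
  have EE0: "0 \<le> dirichlet_form TYPE('d) M dV (\<lambda>x. p x powr (1 + 2 * (\<alpha> - 1) / real CARD('d))) f" unfolding dirichlet_form_def by (intro Bochner_Integration.integral_nonneg) simp
  have rate0: "0 \<le> (27 * sqrt (2 * A\<^sup>2 * (radial_moment TYPE('d) (\<lambda>s. exp (- (a / 2) * max 0 s)) 4 + 1) / (kernel_m2 TYPE('d) k0)\<^sup>2)) * sqrt (ln (real N) / (real N * \<epsilon> N powr (real CARD('d) / 2)) * (\<integral>x. norm (manifold_grad TYPE('d) M f x) ^ 4 * p x powr (1 + 4 * (\<alpha> - 1) / real CARD('d)) \<partial>dV))" if "N \<ge> 3" for N :: nat and \<epsilon>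
  proof (rule mult_nonneg_nonneg)
    show "0 \<le> (27 * sqrt (2 * A\<^sup>2 * (radial_moment TYPE('d) (\<lambda>s. exp (- (a / 2) * max 0 s)) 4 + 1) / (kernel_m2 TYPE('d) k0)\<^sup>2))" by (rule mult_nonneg_nonneg[OF _ real_sqrt_ge_zero[OF less_imp_le[OF Cn]]]) simp
    show "0 \<le> sqrt (ln (real N) / (real N * \<epsilon> N powr (real CARD('d) / 2)) * (\<integral>x. norm (manifold_grad TYPE('d) M f x) ^ 4 * p x powr (1 + 4 * (\<alpha> - 1) / real CARD('d)) \<partial>dV))"
      using that by (intro real_sqrt_ge_zero mult_nonneg_nonneg[OF _ V40] divide_nonneg_nonneg) auto
  qed
  show ?thesis
  proof (cases "(\<integral>x. norm (manifold_grad TYPE('d) M f x) ^ 4 * p x powr (1 + 4 * (\<alpha> - 1) / real CARD('d)) \<partial>dV) = 0")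
    \<comment> \<open>The Dirichlet form is 0 as well, and the whole graph form counts as the
      \<epsilon> remainder, with certainty.\<close>
    case True
    note z = fourth_moment_pos_or_locally_constant[OF True]
    obtain r0 where r0: "r0 > 0" "\<And>x y. x \<in> M \<Longrightarrow> y \<in> M \<Longrightarrow> norm (x - y) < r0 \<Longrightarrow> f x = f y" using z(2) by blast
    obtain C where C: "C > 0" "\<And>\<epsilon> \<eta> \<rho> x y. bandwidth_approx M (\<lambda>x. p x powr (- 1 / real CARD('d))) \<epsilon> \<eta> \<rho> \<Longrightarrow> x \<in> M \<Longrightarrow> y \<in> M \<Longrightarrow> graph_kernel CARD('d) (\<lambda>s. k0 (max 0 s)) (kernel_m2 TYPE('d) k0) \<alpha> \<epsilon> \<rho> f x y \<le> C * \<epsilon>"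
      using graph_kernel_locally_constant[OF r0] by blast
    show ?thesis
    proof (rule exI[of _ C], rule conjI[OF C(1)], intro allI impI)
      fix \<epsilon> e\<rho> Ny k y assume reg: "bandwidth_regime TYPE('d) M p \<epsilon> e\<rho> Ny k y"
      have "\<epsilon> \<longlonglongrightarrow> 0" using reg by (simp add: bandwidth_regime_def)
      from order_tendstoD(2)[OF this, of 1] have "\<forall>\<^sub>F N in sequentially. \<epsilon> N < 1" by simp
      moreover have "\<forall>\<^sub>F N::nat in sequentially. N \<ge> 3" by (rule eventually_ge_at_top)
      ultimately show "\<forall>\<^sub>F N in sequentially. \<forall>(\<Omega> :: 'w measure) X. iid_sample \<Omega> (density dV (\<lambda>x. ennreal (p x))) N X \<longrightarrow>
        measure \<Omega> {\<omega> \<in> space \<Omega>. \<exists>r\<^sub>\<rho> r\<^sub>\<epsilon> r\<^sub>N. \<bar>r\<^sub>\<rho>\<bar> \<le> C\<alpha> * e\<rho> N \<and> \<bar>r\<^sub>\<epsilon>\<bar> \<le> C * \<epsilon> N \<and>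
            \<bar>r\<^sub>N\<bar> \<le> (27 * sqrt (2 * A\<^sup>2 * (radial_moment TYPE('d) (\<lambda>s. exp (- (a / 2) * max 0 s)) 4 + 1) / (kernel_m2 TYPE('d) k0)\<^sup>2)) * sqrt (ln (real N) / (real N * \<epsilon> N powr (real CARD('d) / 2)) * (\<integral>x. norm (manifold_grad TYPE('d) M f x) ^ 4 * p x powr (1 + 4 * (\<alpha> - 1) / real CARD('d)) \<partial>dV)) \<and>
            graph_dirichlet_form TYPE('d) k0 \<alpha> (\<epsilon> N) (knn_bandwidth TYPE('d) (Ny N) (y N) (k N)) N (\<lambda>i. X i \<omega>) f = dirichlet_form TYPE('d) M dV (\<lambda>x. p x powr (1 + 2 * (\<alpha> - 1) / real CARD('d))) f * (1 + r\<^sub>\<rho>) + r\<^sub>\<epsilon> + r\<^sub>N}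
          > 1 - 2 / real N ^ 10"
      proof (rule eventually_elim2, intro allI impI)
        fix N and \<Omega> :: "'w measure" and X assume N: "\<epsilon> N < 1" "N \<ge> 3" and iid: "iid_sample \<Omega> (density dV (\<lambda>x. ennreal (p x))) N X"
        interpret prob_space \<Omega> using iid by (simp add: iid_sample_def)
        have N0: "N > 0" using N(2) by simp
        note R = bandwidth_regimeD[OF reg N0 less_imp_le[OF N(1)]]
        note e = bandwidth_approxD(1,2)[OF R] and \<eta> = bandwidth_approxD(3,4)[OF R]
        have R1: "0 \<le> C\<alpha> * e\<rho> N" using Ca(2) \<eta> by simp
        have R2: "0 \<le> C * \<epsilon> N" using C(1) e by simp
        have "{\<omega> \<in> space \<Omega>. \<bar>(\<Sum>i<N. \<Sum>j<N. graph_kernel CARD('d) (\<lambda>s. k0 (max 0 s)) (kernel_m2 TYPE('d) k0) \<alpha> (\<epsilon> N) (knn_bandwidth TYPE('d) (Ny N) (y N) (k N)) f (X i \<omega>) (X j \<omega>)) / (real N)\<^sup>2 - dirichlet_form TYPE('d) M dV (\<lambda>x. p x powr (1 + 2 * (\<alpha> - 1) / real CARD('d))) f\<bar>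
          \<le> C\<alpha> * e\<rho> N * dirichlet_form TYPE('d) M dV (\<lambda>x. p x powr (1 + 2 * (\<alpha> - 1) / real CARD('d))) f + C * \<epsilon> N + (27 * sqrt (2 * A\<^sup>2 * (radial_moment TYPE('d) (\<lambda>s. exp (- (a / 2) * max 0 s)) 4 + 1) / (kernel_m2 TYPE('d) k0)\<^sup>2)) * sqrt (ln (real N) / (real N * \<epsilon> N powr (real CARD('d) / 2)) * (\<integral>x. norm (manifold_grad TYPE('d) M f x) ^ 4 * p x powr (1 + 4 * (\<alpha> - 1) / real CARD('d)) \<partial>dV))} = space \<Omega>"
        proof (intro equalityI subsetI CollectI conjI)
          fix \<omega> assume w: "\<omega> \<in> space \<Omega>"
          let ?v = "\<lambda>i j. graph_kernel CARD('d) (\<lambda>s. k0 (max 0 s)) (kernel_m2 TYPE('d) k0) \<alpha> (\<epsilon> N) (knn_bandwidth TYPE('d) (Ny N) (y N) (k N)) f (X i \<omega>) (X j \<omega>)"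
          have v: "0 \<le> ?v i j" "?v i j \<le> C * \<epsilon> N" if "i < N" "j < N" for i j
            using graph_kernel_pointwise(2)[OF R] C(2)[OF R] iid_sample_in_M[OF iid _ w] that by blast+
          have S0: "0 \<le> (\<Sum>i<N. \<Sum>j<N. ?v i j)" by (intro sum_nonneg) (simp add: v)
          have "(\<Sum>i<N. \<Sum>j<N. ?v i j) \<le> (\<Sum>i<N. \<Sum>j<N. C * \<epsilon> N)" by (intro sum_mono) (simp add: v)
          also have "\<dots> = C * \<epsilon> N * (real N)\<^sup>2" by (simp add: power2_eq_square)
          finally have "(\<Sum>i<N. \<Sum>j<N. ?v i j) / (real N)\<^sup>2 \<le> C * \<epsilon> N" using N0 by (simp add: pos_divide_le_eq)
          moreover have "0 \<le> (\<Sum>i<N. \<Sum>j<N. ?v i j) / (real N)\<^sup>2" using S0 by simp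
          ultimately show "\<bar>(\<Sum>i<N. \<Sum>j<N. ?v i j) / (real N)\<^sup>2 - dirichlet_form TYPE('d) M dV (\<lambda>x. p x powr (1 + 2 * (\<alpha> - 1) / real CARD('d))) f\<bar>
            \<le> C\<alpha> * e\<rho> N * dirichlet_form TYPE('d) M dV (\<lambda>x. p x powr (1 + 2 * (\<alpha> - 1) / real CARD('d))) f + C * \<epsilon> N + (27 * sqrt (2 * A\<^sup>2 * (radial_moment TYPE('d) (\<lambda>s. exp (- (a / 2) * max 0 s)) 4 + 1) / (kernel_m2 TYPE('d) k0)\<^sup>2)) * sqrt (ln (real N) / (real N * \<epsilon> N powr (real CARD('d) / 2)) * (\<integral>x. norm (manifold_grad TYPE('d) M f x) ^ 4 * p x powr (1 + 4 * (\<alpha> - 1) / real CARD('d)) \<partial>dV))"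
            using rate0[OF N(2), of \<epsilon>] unfolding z(1) by simp
        qed auto
        then show "1 - 2 / real N ^ 10 < measure \<Omega> {\<omega> \<in> space \<Omega>. \<exists>r\<^sub>\<rho> r\<^sub>\<epsilon> r\<^sub>N. \<bar>r\<^sub>\<rho>\<bar> \<le> C\<alpha> * e\<rho> N \<and> \<bar>r\<^sub>\<epsilon>\<bar> \<le> C * \<epsilon> N \<and>
            \<bar>r\<^sub>N\<bar> \<le> (27 * sqrt (2 * A\<^sup>2 * (radial_moment TYPE('d) (\<lambda>s. exp (- (a / 2) * max 0 s)) 4 + 1) / (kernel_m2 TYPE('d) k0)\<^sup>2)) * sqrt (ln (real N) / (real N * \<epsilon> N powr (real CARD('d) / 2)) * (\<integral>x. norm (manifold_grad TYPE('d) M f x) ^ 4 * p x powr (1 + 4 * (\<alpha> - 1) / real CARD('d)) \<partial>dV)) \<and>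
            graph_dirichlet_form TYPE('d) k0 \<alpha> (\<epsilon> N) (knn_bandwidth TYPE('d) (Ny N) (y N) (k N)) N (\<lambda>i. X i \<omega>) f = dirichlet_form TYPE('d) M dV (\<lambda>x. p x powr (1 + 2 * (\<alpha> - 1) / real CARD('d))) f * (1 + r\<^sub>\<rho>) + r\<^sub>\<epsilon> + r\<^sub>N}"
          unfolding deviation_event_eq[OF R iid R1 R2 rate0[OF N(2)]] using N0 by (simp add: prob_space)
      qed
    qed
  next
    case False
    have Vp: "(\<integral>x. norm (manifold_grad TYPE('d) M f x) ^ 4 * p x powr (1 + 4 * (\<alpha> - 1) / real CARD('d)) \<partial>dV) > 0" by (rule order.not_eq_order_implies_strict[OF not_sym[OF False] V40])
    obtain Cb where Cb: "Cb > 0" "\<And>\<epsilon> \<eta> \<rho>. bandwidth_approx M (\<lambda>x. p x powr (- 1 / real CARD('d))) \<epsilon> \<eta> \<rho> \<Longrightarrow> \<bar>(\<integral>z. graph_kernel CARD('d) (\<lambda>s. k0 (max 0 s)) (kernel_m2 TYPE('d) k0) \<alpha> \<epsilon> \<rho> f (fst z) (snd z) \<partial>(density dV (\<lambda>x. ennreal (p x)) \<Otimes>\<^sub>M density dV (\<lambda>x. ennreal (p x)))) - dirichlet_form TYPE('d) M dV (\<lambda>x. p x powr (1 + 2 * (\<alpha> - 1) / real CARD('d))) f\<bar>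
     \<le> (A * ((3 * \<bar>\<alpha>\<bar> * exp \<bar>\<alpha>\<bar>) + 10 / a)) * radial_moment TYPE('d) (\<lambda>s. exp (- (a / 2) * max 0 s)) 2 / kernel_m2 TYPE('d) k0 * \<eta> * dirichlet_form TYPE('d) M dV (\<lambda>x. p x powr (1 + 2 * (\<alpha> - 1) / real CARD('d))) f + Cb * \<epsilon>" using expectation_bias[of \<alpha>] by blast
    obtain Cs where Cs: "Cs > 0" "\<And>\<epsilon> \<eta> \<rho>. bandwidth_approx M (\<lambda>x. p x powr (- 1 / real CARD('d))) \<epsilon> \<eta> \<rho> \<Longrightarrow> (\<integral>z. (graph_kernel CARD('d) (\<lambda>s. k0 (max 0 s)) (kernel_m2 TYPE('d) k0) \<alpha> \<epsilon> \<rho> f (fst z) (snd z))\<^sup>2 \<partial>(density dV (\<lambda>x. ennreal (p x)) \<Otimes>\<^sub>M density dV (\<lambda>x. ennreal (p x))))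
     \<le> (A * (1 + (3 * \<bar>\<alpha>\<bar> * exp \<bar>\<alpha>\<bar>) * \<eta>) / kernel_m2 TYPE('d) k0)\<^sup>2 * (radial_moment TYPE('d) (\<lambda>s. exp (- (a / 2) * max 0 s)) 4 * (\<integral>x. norm (manifold_grad TYPE('d) M f x) ^ 4 * p x powr (1 + 4 * (\<alpha> - 1) / real CARD('d)) \<partial>dV) + Cs * \<epsilon>) / sqrt \<epsilon> ^ CARD('d)"
      using second_moment_bound[of \<alpha>] by blast
    obtain L where L: "L > 0" "\<And>\<epsilon> \<eta> \<rho> x y. bandwidth_approx M (\<lambda>x. p x powr (- 1 / real CARD('d))) \<epsilon> \<eta> \<rho> \<Longrightarrow> x \<in> M \<Longrightarrow> y \<in> M \<Longrightarrow> graph_kernel CARD('d) (\<lambda>s. k0 (max 0 s)) (kernel_m2 TYPE('d) k0) \<alpha> \<epsilon> \<rho> f x y \<le> L / sqrt \<epsilon> ^ CARD('d)"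
      using graph_kernel_le[of \<alpha>] by blast
    show ?thesis
    proof (rule exI[of _ Cb], rule conjI[OF Cb(1)], intro allI impI)
      fix \<epsilon> e\<rho> Ny k y assume reg: "bandwidth_regime TYPE('d) M p \<epsilon> e\<rho> Ny k y"
      have lim: "\<epsilon> \<longlonglongrightarrow> 0" "e\<rho> \<longlonglongrightarrow> 0" "filterlim (\<lambda>N. \<epsilon> N powr (real CARD('d) / 2) * real N / ln (real N)) at_top sequentially"
        using reg by (simp_all add: bandwidth_regime_def)
      \<comment> \<open>Below this threshold \<open>1 + (3 * \<bar>\<alpha>\<bar> * exp
        \<bar>\<alpha>\<bar>) * e\<rho> N\<close> is at most \<open>4/3\<close>, whose square is
        below 2. The added 1 keeps the denominator positive when
        \<open>\<alpha> = 0\<close>.\<close>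
      have c3: "0 < 1 / (3 * ((3 * \<bar>\<alpha>\<bar> * exp \<bar>\<alpha>\<bar>) + 1))" by (intro divide_pos_pos mult_pos_pos add_nonneg_pos) auto
      \<comment> \<open>Positivity of the fourth-moment integral enters here: it gives a threshold
        for \<epsilon>, and it is a divisor in the condition that will bound the kernel against
        \<nu>.\<close>
      have ev: "\<forall>\<^sub>F N in sequentially. (\<epsilon> N < 1 \<and> \<epsilon> N < (\<integral>x. norm (manifold_grad TYPE('d) M f x) ^ 4 * p x powr (1 + 4 * (\<alpha> - 1) / real CARD('d)) \<partial>dV) / Cs) \<and> e\<rho> N < 1 / (3 * ((3 * \<bar>\<alpha>\<bar> * exp \<bar>\<alpha>\<bar>) + 1)) \<and>
          L\<^sup>2 / (?Cn * (\<integral>x. norm (manifold_grad TYPE('d) M f x) ^ 4 * p x powr (1 + 4 * (\<alpha> - 1) / real CARD('d)) \<partial>dV)) \<le> \<epsilon> N powr (real CARD('d) / 2) * real N / ln (real N) \<and> N \<ge> 3"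
        by (intro eventually_conj order_tendstoD(2)[OF lim(1) zero_less_one] order_tendstoD(2)[OF lim(1) divide_pos_pos[OF Vp Cs(1)]]
            order_tendstoD(2)[OF lim(2) c3] filterlim_at_top[THEN iffD1, OF lim(3), rule_format] eventually_ge_at_top)
      then show "\<forall>\<^sub>F N in sequentially. \<forall>(\<Omega> :: 'w measure) X. iid_sample \<Omega> (density dV (\<lambda>x. ennreal (p x))) N X \<longrightarrow>
        measure \<Omega> {\<omega> \<in> space \<Omega>. \<exists>r\<^sub>\<rho> r\<^sub>\<epsilon> r\<^sub>N. \<bar>r\<^sub>\<rho>\<bar> \<le> C\<alpha> * e\<rho> N \<and> \<bar>r\<^sub>\<epsilon>\<bar> \<le> Cb * \<epsilon> N \<and>
            \<bar>r\<^sub>N\<bar> \<le> (27 * sqrt (2 * A\<^sup>2 * (radial_moment TYPE('d) (\<lambda>s. exp (- (a / 2) * max 0 s)) 4 + 1) / (kernel_m2 TYPE('d) k0)\<^sup>2)) * sqrt (ln (real N) / (real N * \<epsilon> N powr (real CARD('d) / 2)) * (\<integral>x. norm (manifold_grad TYPE('d) M f x) ^ 4 * p x powr (1 + 4 * (\<alpha> - 1) / real CARD('d)) \<partial>dV)) \<and>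
            graph_dirichlet_form TYPE('d) k0 \<alpha> (\<epsilon> N) (knn_bandwidth TYPE('d) (Ny N) (y N) (k N)) N (\<lambda>i. X i \<omega>) f = dirichlet_form TYPE('d) M dV (\<lambda>x. p x powr (1 + 2 * (\<alpha> - 1) / real CARD('d))) f * (1 + r\<^sub>\<rho>) + r\<^sub>\<epsilon> + r\<^sub>N}
          > 1 - 2 / real N ^ 10"
      proof (rule eventually_mono, intro allI impI, elim conjE)
        fix N and \<Omega> :: "'w measure" and X
        assume N1: "\<epsilon> N < 1" and NV: "\<epsilon> N < (\<integral>x. norm (manifold_grad TYPE('d) M f x) ^ 4 * p x powr (1 + 4 * (\<alpha> - 1) / real CARD('d)) \<partial>dV) / Cs" and N\<eta>: "e\<rho> N < 1 / (3 * ((3 * \<bar>\<alpha>\<bar> * exp \<bar>\<alpha>\<bar>) + 1))"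
          and NL: "L\<^sup>2 / (?Cn * (\<integral>x. norm (manifold_grad TYPE('d) M f x) ^ 4 * p x powr (1 + 4 * (\<alpha> - 1) / real CARD('d)) \<partial>dV)) \<le> \<epsilon> N powr (real CARD('d) / 2) * real N / ln (real N)" and N3: "N \<ge> 3"
          and iid: "iid_sample \<Omega> (density dV (\<lambda>x. ennreal (p x))) N X"
        interpret prob_space \<Omega> using iid by (simp add: iid_sample_def)
        have N0: "N > 0" using N3 by simp
        define \<rho> where "\<rho> = knn_bandwidth TYPE('d) (Ny N) (y N) (k N)"
        note R = bandwidth_regimeD[OF reg N0 less_imp_le[OF N1], folded \<rho>_def]
        note e = bandwidth_approxD(1,2)[OF R] and \<eta> = bandwidth_approxD(3,4)[OF R]
        have R1: "0 \<le> C\<alpha> * e\<rho> N" using Ca(2) \<eta> by simp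
        have R2: "0 \<le> Cb * \<epsilon> N" using Cb(1) e by simp
        let ?s = "sqrt (\<epsilon> N) ^ CARD('d)"
        have s: "?s > 0" using e by simp
        have pw: "\<epsilon> N powr (real CARD('d) / 2) = ?s" by (rule powr_half_card[OF e(1)])
        define v where "v = graph_kernel CARD('d) (\<lambda>s. k0 (max 0 s)) (kernel_m2 TYPE('d) k0) \<alpha> (\<epsilon> N) \<rho> f"
        define m where "m = (\<integral>z. v (fst z) (snd z) \<partial>(density dV (\<lambda>x. ennreal (p x)) \<Otimes>\<^sub>M density dV (\<lambda>x. ennreal (p x))))"
        define \<nu> where "\<nu> = ?Cn * (\<integral>x. norm (manifold_grad TYPE('d) M f x) ^ 4 * p x powr (1 + 4 * (\<alpha> - 1) / real CARD('d)) \<partial>dV) / ?s"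
        have \<nu>: "\<nu> > 0" unfolding \<nu>_def by (rule divide_pos_pos[OF mult_pos_pos[OF Cn Vp] s])
        have lnN: "ln (real N) > 0" using N3 by simp
        have sp: "space (density dV (\<lambda>x. ennreal (p x))) = M" by (simp add: space_volume[OF vol])
        have ind: "indep_vars (\<lambda>_. (density dV (\<lambda>x. ennreal (p x)))) X {..<N}" and ds: "\<And>i. i < N \<Longrightarrow> distr \<Omega> (density dV (\<lambda>x. ennreal (p x))) (X i) = (density dV (\<lambda>x. ennreal (p x)))"
          using iid by (simp_all add: iid_sample_def)
        have vm: "(\<lambda>z. v (fst z) (snd z)) \<in> borel_measurable (density dV (\<lambda>x. ennreal (p x)) \<Otimes>\<^sub>M density dV (\<lambda>x. ennreal (p x)))"
          using graph_kernel_measurable[OF R] unfolding measurable_cong_sets[OF sets_pair_density refl] v_def .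
        have v0: "0 \<le> v x y" and vL: "v x y \<le> L / ?s" if "x \<in> space (density dV (\<lambda>x. ennreal (p x)))" "y \<in> space (density dV (\<lambda>x. ennreal (p x)))" for x y
          using graph_kernel_pointwise(2)[OF R] L(2)[OF R] that unfolding sp v_def by blast+
        have vs: "v x y = v y x" "v x x = 0" for x y unfolding v_def by (rule graph_kernel_symmetric[OF R])+
        have v2: "(\<integral>z. (v (fst z) (snd z))\<^sup>2 \<partial>(density dV (\<lambda>x. ennreal (p x)) \<Otimes>\<^sub>M density dV (\<lambda>x. ennreal (p x)))) \<le> \<nu>"
        proof -
          have CA1: "((3 * \<bar>\<alpha>\<bar> * exp \<bar>\<alpha>\<bar>) + 1) > 0" by (intro add_nonneg_pos) auto
          have "e\<rho> N * (3 * ((3 * \<bar>\<alpha>\<bar> * exp \<bar>\<alpha>\<bar>) + 1)) < 1" using N\<eta> CA1 by (simp add: pos_less_divide_eq)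
          moreover have "e\<rho> N * (3 * ((3 * \<bar>\<alpha>\<bar> * exp \<bar>\<alpha>\<bar>) + 1)) = 3 * ((3 * \<bar>\<alpha>\<bar> * exp \<bar>\<alpha>\<bar>) * e\<rho> N) + 3 * e\<rho> N" by (simp add: algebra_simps)
          ultimately have c: "(3 * \<bar>\<alpha>\<bar> * exp \<bar>\<alpha>\<bar>) * e\<rho> N \<le> 1/3" using \<eta> by linarith
          have c0: "0 \<le> (3 * \<bar>\<alpha>\<bar> * exp \<bar>\<alpha>\<bar>) * e\<rho> N" using \<eta> by simp
          have "(1 + (3 * \<bar>\<alpha>\<bar> * exp \<bar>\<alpha>\<bar>) * e\<rho> N)\<^sup>2 \<le> (4/3)\<^sup>2" using c c0 by (intro power_mono) linarith+
          also have "\<dots> \<le> (2::real)" by (simp add: power2_eq_square)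
          finally have c2: "(1 + (3 * \<bar>\<alpha>\<bar> * exp \<bar>\<alpha>\<bar>) * e\<rho> N)\<^sup>2 \<le> 2" .
          have cs: "Cs * \<epsilon> N \<le> (\<integral>x. norm (manifold_grad TYPE('d) M f x) ^ 4 * p x powr (1 + 4 * (\<alpha> - 1) / real CARD('d)) \<partial>dV)" using NV Cs(1) by (simp add: pos_less_divide_eq mult.commute)
          have "(\<integral>z. (v (fst z) (snd z))\<^sup>2 \<partial>(density dV (\<lambda>x. ennreal (p x)) \<Otimes>\<^sub>M density dV (\<lambda>x. ennreal (p x)))) \<le> (A * (1 + (3 * \<bar>\<alpha>\<bar> * exp \<bar>\<alpha>\<bar>) * e\<rho> N) / kernel_m2 TYPE('d) k0)\<^sup>2 * (radial_moment TYPE('d) (\<lambda>s. exp (- (a / 2) * max 0 s)) 4 * (\<integral>x. norm (manifold_grad TYPE('d) M f x) ^ 4 * p x powr (1 + 4 * (\<alpha> - 1) / real CARD('d)) \<partial>dV) + Cs * \<epsilon> N) / ?s"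
            unfolding v_def by (rule Cs(2)[OF R])
          also have "(A * (1 + (3 * \<bar>\<alpha>\<bar> * exp \<bar>\<alpha>\<bar>) * e\<rho> N) / kernel_m2 TYPE('d) k0)\<^sup>2 = A\<^sup>2 / (kernel_m2 TYPE('d) k0)\<^sup>2 * (1 + (3 * \<bar>\<alpha>\<bar> * exp \<bar>\<alpha>\<bar>) * e\<rho> N)\<^sup>2" by (simp add: power_mult_distrib power_divide)
          also have "A\<^sup>2 / (kernel_m2 TYPE('d) k0)\<^sup>2 * (1 + (3 * \<bar>\<alpha>\<bar> * exp \<bar>\<alpha>\<bar>) * e\<rho> N)\<^sup>2 * (radial_moment TYPE('d) (\<lambda>s. exp (- (a / 2) * max 0 s)) 4 * (\<integral>x. norm (manifold_grad TYPE('d) M f x) ^ 4 * p x powr (1 + 4 * (\<alpha> - 1) / real CARD('d)) \<partial>dV) + Cs * \<epsilon> N) / ?s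
            \<le> A\<^sup>2 / (kernel_m2 TYPE('d) k0)\<^sup>2 * 2 * (radial_moment TYPE('d) (\<lambda>s. exp (- (a / 2) * max 0 s)) 4 * (\<integral>x. norm (manifold_grad TYPE('d) M f x) ^ 4 * p x powr (1 + 4 * (\<alpha> - 1) / real CARD('d)) \<partial>dV) + (\<integral>x. norm (manifold_grad TYPE('d) M f x) ^ 4 * p x powr (1 + 4 * (\<alpha> - 1) / real CARD('d)) \<partial>dV)) / ?s"
          proof (rule divide_right_mono[OF mult_mono])
            show "A\<^sup>2 / (kernel_m2 TYPE('d) k0)\<^sup>2 * (1 + (3 * \<bar>\<alpha>\<bar> * exp \<bar>\<alpha>\<bar>) * e\<rho> N)\<^sup>2 \<le> A\<^sup>2 / (kernel_m2 TYPE('d) k0)\<^sup>2 * 2" by (rule mult_left_mono[OF c2]) simp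
            have "0 \<le> radial_moment TYPE('d) (\<lambda>s. exp (- (a / 2) * max 0 s)) 4 * (\<integral>x. norm (manifold_grad TYPE('d) M f x) ^ 4 * p x powr (1 + 4 * (\<alpha> - 1) / real CARD('d)) \<partial>dV)" by (rule mult_nonneg_nonneg[OF M4 V40])
            then show "0 \<le> radial_moment TYPE('d) (\<lambda>s. exp (- (a / 2) * max 0 s)) 4 * (\<integral>x. norm (manifold_grad TYPE('d) M f x) ^ 4 * p x powr (1 + 4 * (\<alpha> - 1) / real CARD('d)) \<partial>dV) + Cs * \<epsilon> N" using Cs(1) e by simp
          qed (use cs s in auto)
          also have "\<dots> = \<nu>"
          proof -
            have "c / m' * 2 * (r * w + w) / t = 2 * c * (r + 1) / m' * w / t" for c m' r w t :: real
              by (simp add: algebra_simps)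
            then show ?thesis unfolding \<nu>_def .
          qed
          finally show ?thesis .
        qed
        \<comment> \<open>The unbounded growth of
          \<open>\<epsilon> N powr (d / 2) * N / ln N\<close> is what places the kernel in the
          Bernstein range.\<close>
        have LL: "(L / ?s)\<^sup>2 * ln (real N) \<le> real N * \<nu>"
        proof -
          define Z where "Z = ?Cn * (\<integral>x. norm (manifold_grad TYPE('d) M f x) ^ 4 * p x powr (1 + 4 * (\<alpha> - 1) / real CARD('d)) \<partial>dV)"
          have Z: "Z > 0" unfolding Z_def by (rule mult_pos_pos[OF Cn Vp])
          have "L\<^sup>2 / Z \<le> ?s * real N / ln (real N)" using NL unfolding pw Z_def .
          then have "L\<^sup>2 \<le> ?s * real N / ln (real N) * Z" unfolding pos_divide_le_eq[OF Z] .
          then have "L\<^sup>2 * ln (real N) \<le> ?s * real N / ln (real N) * Z * ln (real N)"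
            using lnN by (intro mult_right_mono) auto
          also have "\<dots> = ?s * real N * Z" using lnN by simp
          finally have "L\<^sup>2 * ln (real N) / ?s\<^sup>2 \<le> ?s * real N * Z / ?s\<^sup>2"
            by (rule divide_right_mono) simp
          also have "\<dots> = real N * \<nu>" unfolding \<nu>_def Z_def[symmetric] using s by (simp add: power2_eq_square)
          finally show ?thesis by (simp add: power_divide)
        qed
        note conc = v_statistic_concentration[OF ind ds vm v0 vL vs(1) vs(2) v2 \<nu> N3 LL, folded m_def]
        let ?S = "\<lambda>\<omega>. (\<Sum>i<N. \<Sum>j<N. v (X i \<omega>) (X j \<omega>)) / (real N)\<^sup>2"
        let ?R3 = "(27 * sqrt (2 * A\<^sup>2 * (radial_moment TYPE('d) (\<lambda>s. exp (- (a / 2) * max 0 s)) 4 + 1) / (kernel_m2 TYPE('d) k0)\<^sup>2)) * sqrt (ln (real N) / (real N * \<epsilon> N powr (real CARD('d) / 2)) * (\<integral>x. norm (manifold_grad TYPE('d) M f x) ^ 4 * p x powr (1 + 4 * (\<alpha> - 1) / real CARD('d)) \<partial>dV))"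
        have R3: "27 * sqrt (\<nu> * ln (real N) / real N) = ?R3"
        proof -
          have "\<nu> * ln (real N) / real N = ?Cn * (ln (real N) / (real N * \<epsilon> N powr (real CARD('d) / 2)) * (\<integral>x. norm (manifold_grad TYPE('d) M f x) ^ 4 * p x powr (1 + 4 * (\<alpha> - 1) / real CARD('d)) \<partial>dV))"
          proof -
            have "c * w / t * l / n = c * (l / (n * t) * w)" for c w t l n :: real by (simp add: mult_ac)
            then show ?thesis unfolding pw \<nu>_def .
          qed
          then have "27 * sqrt (\<nu> * ln (real N) / real N) = 27 * sqrt (?Cn * (ln (real N) / (real N * \<epsilon> N powr (real CARD('d) / 2)) * (\<integral>x. norm (manifold_grad TYPE('d) M f x) ^ 4 * p x powr (1 + 4 * (\<alpha> - 1) / real CARD('d)) \<partial>dV)))"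
            by (simp only:)
          also have "\<dots> = ?R3" by (subst real_sqrt_mult) (rule mult.assoc[symmetric])
          finally show ?thesis .
        qed
        have mE: "\<bar>m - dirichlet_form TYPE('d) M dV (\<lambda>x. p x powr (1 + 2 * (\<alpha> - 1) / real CARD('d))) f\<bar> \<le> C\<alpha> * e\<rho> N * dirichlet_form TYPE('d) M dV (\<lambda>x. p x powr (1 + 2 * (\<alpha> - 1) / real CARD('d))) f + Cb * \<epsilon> N"
        proof -
          have "\<bar>m - dirichlet_form TYPE('d) M dV (\<lambda>x. p x powr (1 + 2 * (\<alpha> - 1) / real CARD('d))) f\<bar> \<le> (A * ((3 * \<bar>\<alpha>\<bar> * exp \<bar>\<alpha>\<bar>) + 10 / a)) * radial_moment TYPE('d) (\<lambda>s. exp (- (a / 2) * max 0 s)) 2 / kernel_m2 TYPE('d) k0 * e\<rho> N * dirichlet_form TYPE('d) M dV (\<lambda>x. p x powr (1 + 2 * (\<alpha> - 1) / real CARD('d))) f + Cb * \<epsilon> N"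
            unfolding m_def v_def by (rule Cb(2)[OF R])
          moreover have "(A * ((3 * \<bar>\<alpha>\<bar> * exp \<bar>\<alpha>\<bar>) + 10 / a)) * radial_moment TYPE('d) (\<lambda>s. exp (- (a / 2) * max 0 s)) 2 / kernel_m2 TYPE('d) k0 * e\<rho> N * dirichlet_form TYPE('d) M dV (\<lambda>x. p x powr (1 + 2 * (\<alpha> - 1) / real CARD('d))) f \<le> C\<alpha> * e\<rho> N * dirichlet_form TYPE('d) M dV (\<lambda>x. p x powr (1 + 2 * (\<alpha> - 1) / real CARD('d))) f"
            by (intro mult_right_mono Ca(1) \<eta>(1) EE0)
          ultimately show ?thesis by linarith
        qed
        have Sm: "?S \<in> borel_measurable \<Omega>"
          by (intro borel_measurable_divide borel_measurable_const) (rule conc(2))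
        \<comment> \<open>The spare power of \<open>N\<close> in the concentration bound makes the
          inequality strict.\<close>
        have "1 - 2 / real N ^ 10 < 1 - 2 / real N ^ 11"
        proof -
          have "real N ^ 10 < real N ^ 11" using N3 by (intro power_strict_increasing) auto
          then have "2 / real N ^ 11 < 2 / real N ^ 10" using N0 by (intro divide_strict_left_mono) auto
          then show ?thesis by simp
        qed
        also have "1 - 2 / real N ^ 11 \<le> prob {\<omega> \<in> space \<Omega>. \<bar>?S \<omega> - m\<bar> \<le> ?R3}"
          unfolding R3[symmetric] by (rule conc(1))
        also have "\<dots> \<le> prob {\<omega> \<in> space \<Omega>. \<bar>?S \<omega> - dirichlet_form TYPE('d) M dV (\<lambda>x. p x powr (1 + 2 * (\<alpha> - 1) / real CARD('d))) f\<bar> \<le> C\<alpha> * e\<rho> N * dirichlet_form TYPE('d) M dV (\<lambda>x. p x powr (1 + 2 * (\<alpha> - 1) / real CARD('d))) f + Cb * \<epsilon> N + ?R3}"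
        proof (rule finite_measure_mono)
          show "{\<omega> \<in> space \<Omega>. \<bar>?S \<omega> - m\<bar> \<le> ?R3} \<subseteq> {\<omega> \<in> space \<Omega>. \<bar>?S \<omega> - dirichlet_form TYPE('d) M dV (\<lambda>x. p x powr (1 + 2 * (\<alpha> - 1) / real CARD('d))) f\<bar> \<le> C\<alpha> * e\<rho> N * dirichlet_form TYPE('d) M dV (\<lambda>x. p x powr (1 + 2 * (\<alpha> - 1) / real CARD('d))) f + Cb * \<epsilon> N + ?R3}"
          proof (intro subsetI CollectI conjI; elim CollectE conjE)
            fix \<omega> assume "\<bar>?S \<omega> - m\<bar> \<le> ?R3"
            then show "\<bar>?S \<omega> - dirichlet_form TYPE('d) M dV (\<lambda>x. p x powr (1 + 2 * (\<alpha> - 1) / real CARD('d))) f\<bar> \<le> C\<alpha> * e\<rho> N * dirichlet_form TYPE('d) M dV (\<lambda>x. p x powr (1 + 2 * (\<alpha> - 1) / real CARD('d))) f + Cb * \<epsilon> N + ?R3" using mE by linarith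
          qed
          have "(\<lambda>\<omega>. \<bar>?S \<omega> - dirichlet_form TYPE('d) M dV (\<lambda>x. p x powr (1 + 2 * (\<alpha> - 1) / real CARD('d))) f\<bar>) \<in> borel_measurable \<Omega>" by (intro borel_measurable_abs borel_measurable_diff Sm borel_measurable_const)
          then show "{\<omega> \<in> space \<Omega>. \<bar>?S \<omega> - dirichlet_form TYPE('d) M dV (\<lambda>x. p x powr (1 + 2 * (\<alpha> - 1) / real CARD('d))) f\<bar> \<le> C\<alpha> * e\<rho> N * dirichlet_form TYPE('d) M dV (\<lambda>x. p x powr (1 + 2 * (\<alpha> - 1) / real CARD('d))) f + Cb * \<epsilon> N + ?R3} \<in> events"
            by (rule borel_measurable_iff_le[THEN iffD1, rule_format])
        qed
        finally show "1 - 2 / real N ^ 10 < measure \<Omega> {\<omega> \<in> space \<Omega>. \<exists>r\<^sub>\<rho> r\<^sub>\<epsilon> r\<^sub>N. \<bar>r\<^sub>\<rho>\<bar> \<le> C\<alpha> * e\<rho> N \<and> \<bar>r\<^sub>\<epsilon>\<bar> \<le> Cb * \<epsilon> N \<and>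
            \<bar>r\<^sub>N\<bar> \<le> ?R3 \<and>
            graph_dirichlet_form TYPE('d) k0 \<alpha> (\<epsilon> N) (knn_bandwidth TYPE('d) (Ny N) (y N) (k N)) N (\<lambda>i. X i \<omega>) f = dirichlet_form TYPE('d) M dV (\<lambda>x. p x powr (1 + 2 * (\<alpha> - 1) / real CARD('d))) f * (1 + r\<^sub>\<rho>) + r\<^sub>\<epsilon> + r\<^sub>N}"
          unfolding deviation_event_eq[OF R[unfolded \<rho>_def] iid R1 R2 rate0[OF N3]] v_def \<rho>_def .
      qed
    qed
  qed
qed

end

section \<open>Choice of the constants\<close>

theorem theorem3p3:
  fixes M :: "(real ^ 'n) set" and dV :: "(real ^ 'n) measure" and k0 :: "real \<Rightarrow> real"
  assumes "compact M" and "smooth_submanifold TYPE('d::finite) M"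
    and "riemannian_volume TYPE('d) M dV"
    and "admissible_kernel k0"
  shows "\<exists>C1>0. \<forall>\<alpha>::real. \<exists>C\<alpha>>0. \<forall>p f.
    smooth_density TYPE('d) M dV p \<and> smooth_fun TYPE('d) M f \<longrightarrow>
    (\<exists>Cfp>0. \<forall>\<epsilon> e\<rho> Ny k y. bandwidth_regime TYPE('d) M p \<epsilon> e\<rho> Ny k y \<longrightarrow>
      (\<forall>\<^sub>F N in sequentially. \<forall>(\<Omega> :: 'w measure) X.
        iid_sample \<Omega> (density dV (\<lambda>x. ennreal (p x))) N X \<longrightarrow>
        measure \<Omega> {\<omega> \<in> space \<Omega>. \<exists>r\<^sub>\<rho> r\<^sub>\<epsilon> r\<^sub>N.
            \<bar>r\<^sub>\<rho>\<bar> \<le> C\<alpha> * e\<rho> N \<and>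
            \<bar>r\<^sub>\<epsilon>\<bar> \<le> Cfp * \<epsilon> N \<and>
            \<bar>r\<^sub>N\<bar> \<le> C1 * sqrt (ln (real N) / (real N * \<epsilon> N powr (real CARD('d) / 2)) *
              (\<integral>x. norm (manifold_grad TYPE('d) M f x) ^ 4 *
                   p x powr (1 + 4 * (\<alpha> - 1) / real CARD('d)) \<partial>dV)) \<and>
            graph_dirichlet_form TYPE('d) k0 \<alpha> (\<epsilon> N)
                (knn_bandwidth TYPE('d) (Ny N) (y N) (k N)) N (\<lambda>i. X i \<omega>) f =
              dirichlet_form TYPE('d) M dV (\<lambda>x. p x powr (1 + 2 * (\<alpha> - 1) / real CARD('d))) f
                * (1 + r\<^sub>\<rho>) + r\<^sub>\<epsilon> + r\<^sub>N}
          > 1 - 2 / real N ^ 10))"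
proof -
  obtain A a where A: "A > 0" "a > 0" "\<And>s. s \<ge> 0 \<Longrightarrow> 0 \<le> k0 s" "\<And>s. s \<ge> 0 \<Longrightarrow> k0 s \<le> A * exp (- a * s)"
    "\<And>s t. s \<ge> 0 \<Longrightarrow> t \<ge> 0 \<Longrightarrow> \<bar>k0 s - k0 t\<bar> \<le> A * exp (- a * min s t) * \<bar>s - t\<bar>"
    by (rule admissible_kernel_bounds[OF assms(4)]) (rule that)
  let ?E = "\<lambda>s. exp (- (a / 2) * max 0 s)"
  \<comment> \<open>Built from the kernel and the dimension only, hence available before
    \<alpha>.\<close>
  let ?C1 = "27 * sqrt (2 * A\<^sup>2 * (radial_moment TYPE('d) ?E 4 + 1) / (kernel_m2 TYPE('d) k0)\<^sup>2)"
  \<comment> \<open>The coefficient of \<eta> in \<open>expectation_bias\<close>; absolute value and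
    the added 1 secure positivity without inspecting the moment.\<close>
  let ?Ca = "\<lambda>\<alpha>. \<bar>A * (3 * \<bar>\<alpha>\<bar> * exp \<bar>\<alpha>\<bar> + 10 / a) * radial_moment TYPE('d) ?E 2 / kernel_m2 TYPE('d) k0\<bar> + 1"
  have "0 \<le> radial_moment TYPE('d) ?E 4"
    unfolding radial_moment_def by (intro Bochner_Integration.integral_nonneg) (auto simp: zero_le_even_power)
  moreover have "kernel_m2 TYPE('d) k0 > 0" by (rule kernel_m2_pos[OF assms(4)])
  ultimately have "0 < 2 * A\<^sup>2 * (radial_moment TYPE('d) ?E 4 + 1) / (kernel_m2 TYPE('d) k0)\<^sup>2"
    using A(1) by (intro divide_pos_pos mult_pos_pos add_nonneg_pos zero_less_power) simp_all
  then have C1: "?C1 > 0" by (intro mult_pos_pos real_sqrt_gt_zero) simp_all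
  have Ca1: "A * (3 * \<bar>\<alpha>\<bar> * exp \<bar>\<alpha>\<bar> + 10 / a) * radial_moment TYPE('d) ?E 2 / kernel_m2 TYPE('d) k0 \<le> ?Ca \<alpha>" for \<alpha>
    by (rule order_trans[OF abs_ge_self]) simp
  have Ca2: "?Ca \<alpha> > 0" for \<alpha> by (rule add_nonneg_pos) simp_all
  show ?thesis
  proof (rule exI[of _ ?C1], rule conjI[OF C1], rule allI, rule exI, rule conjI[OF Ca2], intro allI impI, elim conjE)
    fix \<alpha> p f
    assume sd: "smooth_density TYPE('d) M dV p" and f: "smooth_fun TYPE('d) M f"
    have p: "smooth_fun TYPE('d) M p" and p1: "(\<integral>x. p x \<partial>dV) = 1"
      and ex: "\<exists>pmin pmax. 0 < pmin \<and> (\<forall>x\<in>M. pmin \<le> p x \<and> p x \<le> pmax)"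
      using sd[unfolded smooth_density_def] by - (elim conjE, assumption)+
    from ex obtain pmin pmax where pm: "0 < pmin" "\<forall>x\<in>M. pmin \<le> p x \<and> p x \<le> pmax"
      by (elim exE conjE) (rule that)
    have pb: "pmin \<le> p x" "p x \<le> pmax" if "x \<in> M" for x using pm(2) that by simp_all
    note conc = graph_dirichlet_form_concentration[OF assms A p pm(1) pb p1 f Ca1 Ca2]
    show "\<exists>Cfp>0. \<forall>\<epsilon> e\<rho> Ny k y. bandwidth_regime TYPE('d) M p \<epsilon> e\<rho> Ny k y \<longrightarrow>
      (\<forall>\<^sub>F N in sequentially. \<forall>(\<Omega> :: 'w measure) X.
        iid_sample \<Omega> (density dV (\<lambda>x. ennreal (p x))) N X \<longrightarrow>
        measure \<Omega> {\<omega> \<in> space \<Omega>. \<exists>r\<^sub>\<rho> r\<^sub>\<epsilon> r\<^sub>N.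
            \<bar>r\<^sub>\<rho>\<bar> \<le> ?Ca \<alpha> * e\<rho> N \<and>
            \<bar>r\<^sub>\<epsilon>\<bar> \<le> Cfp * \<epsilon> N \<and>
            \<bar>r\<^sub>N\<bar> \<le> ?C1 * sqrt (ln (real N) / (real N * \<epsilon> N powr (real CARD('d) / 2)) *
              (\<integral>x. norm (manifold_grad TYPE('d) M f x) ^ 4 *
                   p x powr (1 + 4 * (\<alpha> - 1) / real CARD('d)) \<partial>dV)) \<and>
            graph_dirichlet_form TYPE('d) k0 \<alpha> (\<epsilon> N)
                (knn_bandwidth TYPE('d) (Ny N) (y N) (k N)) N (\<lambda>i. X i \<omega>) f =
              dirichlet_form TYPE('d) M dV (\<lambda>x. p x powr (1 + 2 * (\<alpha> - 1) / real CARD('d))) f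
                * (1 + r\<^sub>\<rho>) + r\<^sub>\<epsilon> + r\<^sub>N}
          > 1 - 2 / real N ^ 10)"
      by (rule conc)
  qed
qed

end
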